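(* Let $(M,g)$ be a connected homogeneous Riemannian manifold with $\lambda_g(M)=\infty$, let $\delta,t>0$, and let $G$ be the random graph of the threshold model on $(M,g)$ with density $\delta$ and threshold $t$, with vertices the atoms of the Poisson process $\nu$. Let $E_1,E_2,\dots$ be Borel subsets of $M$ with $\lambda_g(E_n)<\infty$ for all $n$ and $E_n\uparrow M$. Write $$\widehat C_n:=\frac{1}{\nu(E_n)}\sum_{x\in v(G)\cap E_n}C(x)$$ on the event $\{\nu(E_n)>0\}$, and $\widehat C_n:=0$ otherwise, where $C(x)$ is the local clustering coefficient of $x$ in $G$. Then $$\widehat C_n\;\overset{\mathbb{P}}{\longrightarrow}\;\bigl(1-e^{-\delta V_t}(1+\delta V_t)\bigr)\,p_t\qquad(n\to\infty).$$ If, in addition, $\sum_{n=1}^\infty\frac{1}{\lambda_g(E_n)}<\infty$, then this convergence holds almost surely.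
   Context: $d_g$ and $\lambda_g$ are the Riemannian distance and Riemannian volume measure. $(M,g)$ is homogeneous if its isometry group acts transitively (this implies geodesic completeness). $V_t:=\lambda_g(B_t(x_0))$ is the volume of the closed ball $B_t(x_0)$ of radius $t$. The clustering tendency $p_t$ is the probability that two independent random points with law $\lambda_g(B_t(x_0))^{-1}\lambda_g|_{B_t(x_0)}$ are at distance $d_g$ at most $t$ from each other. By homogeneity neither $V_t$ nor $p_t$ depends on $x_0\in M$. $E_n\uparrow M$ means $E_1\subseteq E_2\subseteq\cdots$ and $\bigcup_n E_n=M$. The threshold model with density $\delta$ and threshold $t$: the vertex set $v(G)$ is the set of atoms of a Poisson process $\nu$ on $M$ with intensity measure $\delta\lambda_g$, and $e(G)$ consists of all $\{x,y\}$ with $x,y\in v(G)$, $x\ne y$ and $d_g(x,y)\le t$. With $\deg(x)$ the number of neighbours of $x$ in $G$ and $\tau(x)$ the number of triangles in $G$ containing $x$, the local clustering coefficient is $C(x):=\frac{2\tau(x)}{\deg(x)(\deg(x)-1)}$, with $C(x):=0$ if $\deg(x)\le1$. *)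

theory Defs
  imports "HOL-Probability.Probability"
begin

section \<open>Smooth manifolds\<close>

text \<open>
  Class \<open>C\<^sup>k\<close> on an open subset of a finite-dimensional space, by means of iterated directional
  derivatives.
\<close>

primrec Ck_on :: "nat \<Rightarrow> 'e::euclidean_space set \<Rightarrow> ('e \<Rightarrow> 'f::real_normed_vector) \<Rightarrow> bool" where
  "Ck_on 0 S f \<longleftrightarrow> continuous_on S f"
| "Ck_on (Suc k) S f \<longleftrightarrow>
     (\<forall>x\<in>S. f differentiable (at x)) \<and> (\<forall>v. Ck_on k S (\<lambda>x. frechet_derivative f (at x) v))"

definition smooth_on :: "'e::euclidean_space set \<Rightarrow> ('e \<Rightarrow> 'f::real_normed_vector) \<Rightarrow> bool" where
  "smooth_on S f \<longleftrightarrow> (\<forall>k. Ck_on k S f)"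

text \<open>
  The manifold is a whole type \<open>'a\<close>, a second countable Hausdorff space. A chart is a pair
  \<open>(U, \<phi>)\<close>; the values of \<open>\<phi>\<close> outside \<open>U\<close> are irrelevant.
  The dimension is \<open>CARD('n) \<ge> 1\<close>; a connected manifold of dimension 0 is a single point. Requiring
  \<open>'n\<close> to be a well-ordered finite type, as the library does for the change of variables formula,
  does not restrict the dimension: the index type can be taken to be \<open>{1..n}\<close>.
\<close>

type_synonym ('a, 'n) chart = "'a set \<times> ('a \<Rightarrow> real ^ 'n)"

abbreviation chart_inv :: "('a, 'n) chart \<Rightarrow> real ^ 'n \<Rightarrow> 'a" where
  "chart_inv c \<equiv> inv_into (fst c) (snd c)"

definition is_chart :: "('a::topological_space, 'n::finite) chart \<Rightarrow> bool" where
  "is_chart c \<longleftrightarrow> open (fst c) \<and> open (snd c ` fst c) \<and>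
     homeomorphism (fst c) (snd c ` fst c) (snd c) (chart_inv c)"

definition coord_rep ::
  "('a, 'n) chart \<Rightarrow> ('a, 'n) chart \<Rightarrow> ('a \<Rightarrow> 'a) \<Rightarrow> real ^ 'n \<Rightarrow> real ^ 'n" where
  "coord_rep c c' f = snd c' \<circ> f \<circ> chart_inv c"

definition smooth_map ::
  "('a::topological_space, 'n::finite) chart set \<Rightarrow> ('a \<Rightarrow> 'a) \<Rightarrow> bool" where
  "smooth_map A f \<longleftrightarrow> continuous_on UNIV f \<and>
     (\<forall>c\<in>A. \<forall>c'\<in>A. smooth_on (snd c ` (fst c \<inter> f -` fst c')) (coord_rep c c' f))"

text \<open>Smoothness of the identity says precisely that all transition maps are smooth.\<close>

definition smooth_atlas :: "('a::topological_space, 'n::finite) chart set \<Rightarrow> bool" where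
  "smooth_atlas A \<longleftrightarrow> (\<forall>c\<in>A. is_chart c) \<and> (\<Union>c\<in>A. fst c) = UNIV \<and> smooth_map A id"


section \<open>Riemannian metrics\<close>

text \<open>
  A metric tensor is given by its local representatives: \<open>g c p u v\<close> is \<open>g\<^sub>p\<close> evaluated at the two
  tangent vectors at \<open>p\<close> with coordinates \<open>u\<close> and \<open>v\<close> in the chart \<open>c\<close>.
\<close>

type_synonym ('a, 'n) metric_tensor =
  "('a, 'n) chart \<Rightarrow> 'a \<Rightarrow> real ^ 'n \<Rightarrow> real ^ 'n \<Rightarrow> real"

definition preserves_metric ::
  "('a, 'n::finite) chart set \<Rightarrow> ('a, 'n) metric_tensor \<Rightarrow> ('a \<Rightarrow> 'a) \<Rightarrow> bool" where
  "preserves_metric A g f \<longleftrightarrow>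
     (\<forall>c\<in>A. \<forall>c'\<in>A. \<forall>p \<in> fst c \<inter> f -` fst c'. \<forall>u v.
        g c p u v = (let D = frechet_derivative (coord_rep c c' f) (at (snd c p))
                     in g c' (f p) (D u) (D v)))"

text \<open>
  For the identity, \<^const>\<open>preserves_metric\<close> is the transformation law of a covariant 2-tensor
  under change of charts.
\<close>

definition riemannian_metric ::
  "('a::topological_space, 'n::finite) chart set \<Rightarrow> ('a, 'n) metric_tensor \<Rightarrow> bool" where
  "riemannian_metric A g \<longleftrightarrow>
     (\<forall>c\<in>A. \<forall>p\<in>fst c. bilinear (g c p) \<and> (\<forall>u v. g c p u v = g c p v u) \<and>
                        (\<forall>u. u \<noteq> 0 \<longrightarrow> g c p u u > 0)) \<and>
     (\<forall>c\<in>A. \<forall>u v. smooth_on (snd c ` fst c) (\<lambda>x. g c (chart_inv c x) u v)) \<and>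
     preserves_metric A g id"

definition riemannian_manifold ::
  "('a::{t2_space,second_countable_topology}, 'n::finite) chart set \<Rightarrow>
   ('a, 'n) metric_tensor \<Rightarrow> bool" where
  "riemannian_manifold A g \<longleftrightarrow> smooth_atlas A \<and> riemannian_metric A g"

definition riemannian_isometry ::
  "('a::topological_space, 'n::finite) chart set \<Rightarrow> ('a, 'n) metric_tensor \<Rightarrow> ('a \<Rightarrow> 'a) \<Rightarrow> bool" where
  "riemannian_isometry A g f \<longleftrightarrow>
     bij f \<and> smooth_map A f \<and> smooth_map A (inv f) \<and> preserves_metric A g f"

definition homogeneous ::
  "('a::topological_space, 'n::finite) chart set \<Rightarrow> ('a, 'n) metric_tensor \<Rightarrow> bool" where
  "homogeneous A g \<longleftrightarrow> (\<forall>x y. \<exists>f. riemannian_isometry A g f \<and> f x = y)"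


subsection \<open>Riemannian distance\<close>

definition C1_curve_on ::
  "('a, 'n::finite) chart set \<Rightarrow> real \<Rightarrow> real \<Rightarrow> (real \<Rightarrow> 'a) \<Rightarrow> bool" where
  "C1_curve_on A a b \<gamma> \<longleftrightarrow>
     (\<forall>c\<in>A. \<exists>D. continuous_on ({a..b} \<inter> \<gamma> -` fst c) D \<and>
        (\<forall>s \<in> {a..b} \<inter> \<gamma> -` fst c.
           (snd c \<circ> \<gamma> has_vector_derivative D s) (at s within {a..b})))"

definition piecewise_C1_curve ::
  "('a::topological_space, 'n::finite) chart set \<Rightarrow> (real \<Rightarrow> 'a) \<Rightarrow> bool" where
  "piecewise_C1_curve A \<gamma> \<longleftrightarrow> continuous_on {0..1} \<gamma> \<and>
     (\<exists>S. finite S \<and>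
        (\<forall>a b. 0 \<le> a \<and> a < b \<and> b \<le> 1 \<and> {a<..<b} \<inter> S = {} \<longrightarrow> C1_curve_on A a b \<gamma>))"

text \<open>
  By the transformation law of \<open>g\<close>, the speed does not depend on the chart chosen. At the finitely
  many break points of a piecewise \<open>C\<^sup>1\<close> curve it is an arbitrary value, which does not affect the
  length.
\<close>

definition curve_speed ::
  "('a, 'n::finite) chart set \<Rightarrow> ('a, 'n) metric_tensor \<Rightarrow> (real \<Rightarrow> 'a) \<Rightarrow> real \<Rightarrow> real" where
  "curve_speed A g \<gamma> s =
     (let c = (SOME c. c \<in> A \<and> \<gamma> s \<in> fst c);
          v = vector_derivative (snd c \<circ> \<gamma>) (at s)
      in sqrt (g c (\<gamma> s) v v))"

definition curve_length ::
  "('a, 'n::finite) chart set \<Rightarrow> ('a, 'n) metric_tensor \<Rightarrow> (real \<Rightarrow> 'a) \<Rightarrow> real" where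
  "curve_length A g \<gamma> = integral {0..1} (curve_speed A g \<gamma>)"

definition riemannian_dist ::
  "('a::topological_space, 'n::finite) chart set \<Rightarrow> ('a, 'n) metric_tensor \<Rightarrow> 'a \<Rightarrow> 'a \<Rightarrow> real" where
  "riemannian_dist A g x y =
     Inf {curve_length A g \<gamma> |\<gamma>. piecewise_C1_curve A \<gamma> \<and> \<gamma> 0 = x \<and> \<gamma> 1 = y}"

definition riemannian_cball ::
  "('a::topological_space, 'n::finite) chart set \<Rightarrow> ('a, 'n) metric_tensor \<Rightarrow> 'a \<Rightarrow> real \<Rightarrow> 'a set" where
  "riemannian_cball A g x r = {y. riemannian_dist A g x y \<le> r}"


subsection \<open>Riemannian volume\<close>

definition gram_matrix ::
  "('a, 'n::finite) metric_tensor \<Rightarrow> ('a, 'n) chart \<Rightarrow> 'a \<Rightarrow> real ^ 'n ^ 'n" where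
  "gram_matrix g c p = (\<chi> i j. g c p (axis i 1) (axis j 1))"

text \<open>
  On a Riemannian manifold there is exactly one Borel measure that has density \<open>\<surd>(det g\<^sub>i\<^sub>j)\<close> with
  respect to Lebesgue measure in every chart of the atlas: local volumes agree on overlaps by the
  change of variables formula, and countably many charts cover the manifold.
\<close>

definition is_riemannian_volume ::
  "('a::topological_space, 'n::finite) chart set \<Rightarrow> ('a, 'n) metric_tensor \<Rightarrow> 'a measure \<Rightarrow> bool" where
  "is_riemannian_volume A g \<mu> \<longleftrightarrow> sets \<mu> = sets borel \<and>
     (\<forall>c\<in>A. \<forall>B\<in>sets borel. B \<subseteq> fst c \<longrightarrow>
        emeasure \<mu> B =
          (\<integral>\<^sup>+ x\<in>snd c ` B. ennreal (sqrt (det (gram_matrix g c (chart_inv c x)))) \<partial>lborel))"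

definition riemannian_volume ::
  "('a::topological_space, 'n::finite) chart set \<Rightarrow> ('a, 'n) metric_tensor \<Rightarrow> 'a measure" where
  "riemannian_volume A g = (THE \<mu>. is_riemannian_volume A g \<mu>)"

definition ball_volume ::
  "('a::topological_space, 'n::finite) chart set \<Rightarrow> ('a, 'n) metric_tensor \<Rightarrow> 'a \<Rightarrow> real \<Rightarrow> real" where
  "ball_volume A g x\<^sub>0 t = measure (riemannian_volume A g) (riemannian_cball A g x\<^sub>0 t)"

definition clustering_tendency ::
  "('a::topological_space, 'n::finite) chart set \<Rightarrow> ('a, 'n) metric_tensor \<Rightarrow> 'a \<Rightarrow> real \<Rightarrow> real" where
  "clustering_tendency A g x\<^sub>0 t =
     (let U = uniform_measure (riemannian_volume A g) (riemannian_cball A g x\<^sub>0 t)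
      in measure (U \<Otimes>\<^sub>M U) {z. riemannian_dist A g (fst z) (snd z) \<le> t})"


section \<open>Poisson processes and convergence in probability\<close>

text \<open>
  A point process is a random locally finite measure with values in \<open>{0, 1, 2, \<dots>, \<infinity>}\<close>.
\<close>

definition point_process :: "'w measure \<Rightarrow> ('w \<Rightarrow> 'a::topological_space measure) \<Rightarrow> bool" where
  "point_process \<Omega> \<nu> \<longleftrightarrow>
     (\<forall>\<omega>\<in>space \<Omega>. sets (\<nu> \<omega>) = sets borel \<and>
        (\<forall>B\<in>sets borel. emeasure (\<nu> \<omega>) B \<in> range ennreal_of_enat) \<and>
        (\<forall>K. compact K \<longrightarrow> emeasure (\<nu> \<omega>) K < \<infinity>)) \<and>
     (\<forall>B\<in>sets borel. (\<lambda>\<omega>. emeasure (\<nu> \<omega>) B) \<in> borel_measurable \<Omega>)"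

definition poisson_process ::
  "'w measure \<Rightarrow> 'a::topological_space measure \<Rightarrow> ('w \<Rightarrow> 'a measure) \<Rightarrow> bool" where
  "poisson_process \<Omega> \<mu> \<nu> \<longleftrightarrow> point_process \<Omega> \<nu> \<and>
     (\<forall>B\<in>sets borel. emeasure \<mu> B < \<infinity> \<longrightarrow>
        (\<forall>k::nat. measure \<Omega> {\<omega>\<in>space \<Omega>. emeasure (\<nu> \<omega>) B = of_nat k} =
                  exp (- measure \<mu> B) * measure \<mu> B ^ k / fact k)) \<and>
     (\<forall>(I::nat set) B. finite I \<and> (\<forall>i\<in>I. B i \<in> sets borel) \<and> disjoint_family_on B I \<longrightarrow>
        prob_space.indep_vars \<Omega> (\<lambda>_. borel) (\<lambda>i \<omega>. emeasure (\<nu> \<omega>) (B i)) I)"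

definition converges_in_probability :: "'w measure \<Rightarrow> (nat \<Rightarrow> 'w \<Rightarrow> real) \<Rightarrow> real \<Rightarrow> bool" where
  "converges_in_probability \<Omega> X l \<longleftrightarrow> (\<forall>n. X n \<in> borel_measurable \<Omega>) \<and>
     (\<forall>\<epsilon>>0. (\<lambda>n. measure \<Omega> {\<omega>\<in>space \<Omega>. \<bar>X n \<omega> - l\<bar> > \<epsilon>}) \<longlonglongrightarrow> 0)"


section \<open>The threshold graph and its clustering coefficients\<close>

definition atoms :: "'a measure \<Rightarrow> 'a set" where
  "atoms N = {x. emeasure N {x} > 0}"

definition threshold_edges :: "('a \<Rightarrow> 'a \<Rightarrow> real) \<Rightarrow> real \<Rightarrow> 'a set \<Rightarrow> 'a set set" where
  "threshold_edges d t V = {{x, y} |x y. x \<in> V \<and> y \<in> V \<and> x \<noteq> y \<and> d x y \<le> t}"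

definition degree :: "'a set set \<Rightarrow> 'a \<Rightarrow> nat" where
  "degree E x = card {y. {x, y} \<in> E}"

definition triangle_count :: "'a set set \<Rightarrow> 'a \<Rightarrow> nat" where
  "triangle_count E x =
     card {T. x \<in> T \<and> card T = 3 \<and> (\<forall>y\<in>T. \<forall>z\<in>T. y \<noteq> z \<longrightarrow> {y, z} \<in> E)}"

definition local_clustering :: "'a set set \<Rightarrow> 'a \<Rightarrow> real" where
  "local_clustering E x =
     (if degree E x \<le> 1 then 0
      else 2 * real (triangle_count E x) / (real (degree E x) * (real (degree E x) - 1)))"

text \<open>
  The average over a window \<open>W\<close> of the local clustering coefficients of the threshold graph on the
  atoms of \<open>N\<close>. The graph is not restricted to \<open>W\<close>. If \<open>N W = \<infinity>\<close>, the value is \<open>0\<close>.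
\<close>

definition average_clustering ::
  "('a \<Rightarrow> 'a \<Rightarrow> real) \<Rightarrow> real \<Rightarrow> 'a measure \<Rightarrow> 'a set \<Rightarrow> real" where
  "average_clustering d t N W =
     (if emeasure N W > 0
      then (\<Sum>x\<in>atoms N \<inter> W. local_clustering (threshold_edges d t (atoms N)) x) / measure N W
      else 0)"

end

theory Submission
  imports Defs
begin

text \<open>
  Write \<open>S\<^sub>n\<close> for the sum of the local clustering coefficients of the vertices in \<open>E n\<close>, \<open>N\<^sub>n\<close> for
  the number of these vertices, and \<open>a\<^sub>n = \<delta> \<lambda>(E n)\<close> for its expectation. Both \<open>S\<^sub>n\<close> and \<open>N\<^sub>n\<close> are
  sums over the points of the process of a functional with values in \<open>[0, 1]\<close> that depends only
  on the points in a neighbourhood \<open>B x\<close> of the point \<open>x\<close>, namely the ball of radius \<open>t\<close>,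
  respectively nothing. For such a sum the Mecke equation (theorem \<open>mecke\<close>) gives the expectation
  as the integral over \<open>x\<close> of the expected value of the functional at an additional point \<open>x\<close>. By
  homogeneity this value is a constant \<open>l\<close>, so the expectation is \<open>l a\<^sub>n\<close>.

  The variance grows at most linearly in \<open>a\<^sub>n\<close> (lemma \<open>second_moment\<close>). Functionals at two points
  \<open>x\<close> and \<open>y\<close> are independent except if one point is a neighbour of the other or the process has
  a point in \<open>B x \<inter> B y\<close> (lemma \<open>local_covariance\<close>). Integrated over \<open>y\<close>, the expected number of
  such points is the square of \<open>\<delta> V\<^sub>t\<close>. So Chebyshev's inequality gives \<open>S\<^sub>n / a\<^sub>n \<longlongrightarrow> l\<close> and
  \<open>N\<^sub>n / a\<^sub>n \<longlongrightarrow> 1\<close> in probability, and if the series of the \<open>1 / a\<^sub>n\<close> converges, then the sum of the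
  squared errors has finite expectation, which gives almost sure convergence. The quotient has
  the same limit \<open>l\<close>.

  For the value of \<open>l\<close>, the clustering coefficient is written as a sum over ordered pairs of
  neighbours with weight \<open>1 / (k (k - 1))\<close>, where \<open>k\<close> is the degree. The Mecke equation for pairs
  of points splits its expectation into the measure of the linked pairs in the ball and the
  expected weight. The same computation for the complete graph, where the coefficient is the
  indicator of \<open>k \<ge> 2\<close>, shows that \<open>(\<delta> V\<^sub>t)\<^sup>2\<close> times the expected weight is the probability that a
  Poisson variable with mean \<open>\<delta> V\<^sub>t\<close> is finite and at least \<open>2\<close> (lemma \<open>linked_fraction_mean\<close>).
  This covers balls of infinite volume: the expected weight is then \<open>0\<close>, in accordance with
  \<open>ball_volume\<close> being the real number \<open>0\<close> in that case.

  Two things are to be shown about the manifold. Isometries preserve the distance, and the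
  distance is jointly measurable (\<open>riemannian_dist_isometry\<close>, \<open>measurable_riemannian_dist_le\<close>).
  There is exactly one Riemannian volume measure, it is therefore invariant under isometries, and
  points have volume \<open>0\<close> (\<open>ex1_riemannian_volume\<close>, \<open>riemannian_volume_isometry\<close>,
  \<open>riemannian_volume_singleton\<close>). About the process, one has to pass from a random measure to a
  random set of points: masses are integers, so the measure is carried by atoms, and almost
  surely all atoms have mass \<open>1\<close> since the intensity measure is diffuse (\<open>exists_atom\<close>,
  \<open>AE_simple\<close>).
\<close>


section \<open>Smooth maps, charts and curves\<close>

lemma smooth_on_has_derivative:
  assumes "smooth_on S F" "x \<in> S"
  shows "(F has_derivative frechet_derivative F (at x)) (at x)"
proof -
  have "Ck_on (Suc 0) S F" using assms unfolding smooth_on_def by blast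
  then show ?thesis using assms(2) frechet_derivative_works by auto
qed

lemma smooth_on_continuous_on: "smooth_on S F \<Longrightarrow> continuous_on S F"
  unfolding smooth_on_def using Ck_on.simps(1) by blast

text \<open>
  A derivative is linear in the direction, so joint continuity in point and direction reduces to
  continuity of the finitely many derivatives along basis vectors.
\<close>

lemma smooth_on_continuous_derivative:
  fixes F :: "'e::euclidean_space \<Rightarrow> 'f::real_normed_vector"
  assumes "smooth_on S F" "continuous_on T p" "p ` T \<subseteq> S" "continuous_on T v"
  shows "continuous_on T (\<lambda>s. frechet_derivative F (at (p s)) (v s))"
proof -
  have "Ck_on (Suc 0) S F" using assms unfolding smooth_on_def by blast
  then have c: "continuous_on S (\<lambda>x. frechet_derivative F (at x) b)" for b by simp
  have "frechet_derivative F (at (p s)) (v s) =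
      (\<Sum>b\<in>Basis. (v s \<bullet> b) *\<^sub>R frechet_derivative F (at (p s)) b)"
    if "s \<in> T" for s
  proof -
    have "linear (frechet_derivative F (at (p s)))"
      using smooth_on_has_derivative[OF assms(1), of "p s"] assms(3) that has_derivative_linear
          by blast
    then have "frechet_derivative F (at (p s)) (\<Sum>b\<in>Basis. (v s \<bullet> b) *\<^sub>R b)
       = (\<Sum>b\<in>Basis. (v s \<bullet> b) *\<^sub>R frechet_derivative F (at (p s)) b)"
      by (simp add: linear_sum linear_scale)
    then show ?thesis by (simp add: euclidean_representation)
  qed
  moreover have "continuous_on T (\<lambda>s. \<Sum>b\<in>Basis. (v s \<bullet> b) *\<^sub>R frechet_derivative F (at (p s)) b)"
    by (intro continuous_intros continuous_on_compose2[OF c assms(2,3)] assms(4))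
  ultimately show ?thesis by (simp cong: continuous_on_cong)
qed

locale riemannian =
  fixes A :: "('a::{t2_space,second_countable_topology}, 'n::{finite,wellorder}) chart set"
    and g :: "('a, 'n) metric_tensor"
  assumes manifold: "riemannian_manifold A g"
begin

lemma atlas: "smooth_atlas A" and metric: "riemannian_metric A g"
  using manifold unfolding riemannian_manifold_def by auto

lemma chart: "c \<in> A \<Longrightarrow> is_chart c"
  using atlas unfolding smooth_atlas_def by blast

lemma chart_cover: "\<exists>c\<in>A. p \<in> fst c"
  using atlas unfolding smooth_atlas_def by blast

lemma smooth_id: "smooth_map A id"
  using atlas unfolding smooth_atlas_def by blast

lemma preserves_id: "preserves_metric A g id"
  using metric unfolding riemannian_metric_def by blast

lemma chart_facts:
  assumes "c \<in> A"
  shows "open (fst c)" "open (snd c ` fst c)" "continuous_on (fst c) (snd c)"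
    "continuous_on (snd c ` fst c) (chart_inv c)" "inj_on (snd c) (fst c)"
    "\<And>p. p \<in> fst c \<Longrightarrow> chart_inv c (snd c p) = p"
    "\<And>x. x \<in> snd c ` fst c \<Longrightarrow> chart_inv c x \<in> fst c"
    "\<And>x. x \<in> snd c ` fst c \<Longrightarrow> snd c (chart_inv c x) = x"
proof -
  have h: "homeomorphism (fst c) (snd c ` fst c) (snd c) (chart_inv c)"
    using chart[OF assms] unfolding is_chart_def by auto
  show "open (fst c)" "open (snd c ` fst c)"
    using chart[OF assms] unfolding is_chart_def by auto
  show "continuous_on (fst c) (snd c)" "continuous_on (snd c ` fst c) (chart_inv c)"
    using h homeomorphism_cont1 homeomorphism_cont2 by blast+
  show *: "\<And>p. p \<in> fst c \<Longrightarrow> chart_inv c (snd c p) = p"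
    using h homeomorphism_apply1 by fastforce
  then show "inj_on (snd c) (fst c)" by (metis inj_onI)
  show "\<And>x. x \<in> snd c ` fst c \<Longrightarrow> chart_inv c x \<in> fst c"
    "\<And>x. x \<in> snd c ` fst c \<Longrightarrow> snd c (chart_inv c x) = x"
    using * by auto
qed

lemma metric_at:
  assumes "c \<in> A" "p \<in> fst c"
  shows "bilinear (g c p)" "g c p u v = g c p v u" "u \<noteq> 0 \<Longrightarrow> g c p u u > 0" "g c p u u \<ge> 0"
proof -
  show b: "bilinear (g c p)" and "g c p u v = g c p v u" and pos: "u \<noteq> 0 \<Longrightarrow> g c p u u > 0"
    using metric assms unfolding riemannian_metric_def by auto
  show "g c p u u \<ge> 0"
    using pos bilinear_lzero[OF b] by (cases "u = 0") (auto intro: less_imp_le)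
qed

lemma metric_continuous_coeff:
  assumes "c \<in> A"
  shows "continuous_on (fst c) (\<lambda>p. g c p u v)"
proof -
  have "continuous_on (snd c ` fst c) (\<lambda>x. g c (chart_inv c x) u v)"
    using metric assms unfolding riemannian_metric_def by (blast intro: smooth_on_continuous_on)
  then have "continuous_on (fst c) (\<lambda>p. g c (chart_inv c (snd c p)) u v)"
    using chart_facts(3)[OF assms] continuous_on_compose2 by blast
  then show ?thesis using chart_facts(6)[OF assms] by (simp cong: continuous_on_cong)
qed

lemma metric_expand:
  assumes "c \<in> A" "p \<in> fst c"
  shows "g c p u v = (\<Sum>i\<in>Basis. \<Sum>j\<in>Basis. (u \<bullet> i) * (v \<bullet> j) * g c p i j)"
proof -
  have b: "bilinear (g c p)" by (rule metric_at(1)[OF assms])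
  have "g c p (\<Sum>i\<in>Basis. (u \<bullet> i) *\<^sub>R i) (\<Sum>j\<in>Basis. (v \<bullet> j) *\<^sub>R j)
      = (\<Sum>(i,j)\<in>Basis \<times> Basis. g c p ((u \<bullet> i) *\<^sub>R i) ((v \<bullet> j) *\<^sub>R j))"
    by (rule bilinear_sum[OF b])
  then show ?thesis
    by (simp add: euclidean_representation bilinear_lmul[OF b] bilinear_rmul[OF b]
        sum.cartesian_product ac_simps)
qed

lemma metric_continuous:
  assumes "c \<in> A" "continuous_on T \<gamma>" "\<gamma> ` T \<subseteq> fst c" "continuous_on T v"
  shows "continuous_on T (\<lambda>s. g c (\<gamma> s) (v s) (v s))"
proof -
  have "continuous_on T (\<lambda>s. \<Sum>i\<in>Basis. \<Sum>j\<in>Basis. (v s \<bullet> i) * (v s \<bullet> j) * g c (\<gamma> s) i j)"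
    by (intro continuous_intros continuous_on_compose2[OF metric_continuous_coeff[OF assms(1)]
        assms(2,3)] assms(4))
  then show ?thesis
    by (rule continuous_on_eq) (use assms(3) in
        \<open>auto simp: image_subset_iff intro!: metric_expand[OF assms(1), symmetric]\<close>)
qed

lemma coord_rep_has_derivative:
  assumes "smooth_map A f" "c \<in> A" "c' \<in> A" "p \<in> fst c" "f p \<in> fst c'"
  shows "(coord_rep c c' f has_derivative frechet_derivative (coord_rep c c' f) (at (snd c p)))
      (at (snd c p))"
  using assms unfolding smooth_map_def by (intro smooth_on_has_derivative) auto

text \<open>
  The chain rule in charts. With \<open>f = id\<close> it changes the chart along a curve, with an isometry it
  describes the image curve. The derivative is taken within \<open>T\<close> because at a break point a piecewise
  \<open>C\<^sup>1\<close> curve has only one-sided derivatives.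
\<close>

lemma curve_transfer_derivative:
  assumes f: "smooth_map A f" and c: "c \<in> A" "c' \<in> A"
    and \<gamma>: "continuous (at s within T) \<gamma>" "s \<in> T" "\<gamma> s \<in> fst c" "f (\<gamma> s) \<in> fst c'"
    and v: "((snd c \<circ> \<gamma>) has_vector_derivative v) (at s within T)"
  shows "((snd c' \<circ> (f \<circ> \<gamma>)) has_vector_derivative
           frechet_derivative (coord_rep c c' f) (at (snd c (\<gamma> s))) v) (at s within T)"
proof -
  let ?F = "coord_rep c c' f"
  have "(?F has_derivative frechet_derivative ?F (at (snd c (\<gamma> s))))
      (at ((snd c \<circ> \<gamma>) s) within (snd c \<circ> \<gamma>) ` T)"
    using coord_rep_has_derivative[OF f c \<gamma>(3,4)] has_derivative_at_withinI by force
  from vector_derivative_diff_chain_within[OF v this]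
  have 1: "(?F \<circ> (snd c \<circ> \<gamma>) has_vector_derivative frechet_derivative ?F (at (snd c (\<gamma> s))) v)
      (at s within T)" .
  have "open (fst c \<inter> f -` fst c')"
    using f chart_facts(1)[OF c(1)] chart_facts(1)[OF c(2)] unfolding smooth_map_def
    by (intro open_Int open_vimage) (auto)
  then have "\<forall>\<^sub>F s' in at s within T. \<gamma> s' \<in> fst c \<inter> f -` fst c'"
    using topological_tendstoD[OF \<gamma>(1)[unfolded continuous_within], of "fst c \<inter> f -` fst c'"] \<gamma>(3,4)
        by simp
  then have "\<forall>\<^sub>F s' in at s within T. (?F \<circ> (snd c \<circ> \<gamma>)) s' = (snd c' \<circ> (f \<circ> \<gamma>)) s'"
    by eventually_elim (auto simp: coord_rep_def chart_facts(6)[OF c(1)])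
  moreover have "(?F \<circ> (snd c \<circ> \<gamma>)) s = (snd c' \<circ> (f \<circ> \<gamma>)) s"
    using \<gamma>(3) by (auto simp: coord_rep_def chart_facts(6)[OF c(1)])
  ultimately show ?thesis
    using 1 unfolding has_vector_derivative_def
    by (auto intro: has_derivative_transform_eventually simp: \<gamma>(2))
qed

text \<open>
  The definition of the speed selects some chart at the point. Since \<open>f\<close> preserves the metric, the
  speed of the image curve can be computed in any chart at the original point; for \<open>f = id\<close> this is
  independence of the chart.
\<close>

lemma curve_speed_transfer:
  assumes f: "smooth_map A f" "preserves_metric A g f" and c: "c \<in> A"
    and \<gamma>: "isCont \<gamma> s" "\<gamma> s \<in> fst c"
    and v: "((snd c \<circ> \<gamma>) has_vector_derivative v) (at s)"
  shows "curve_speed A g (f \<circ> \<gamma>) s = sqrt (g c (\<gamma> s) v v)"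
proof -
  define c' where "c' = (SOME c. c \<in> A \<and> (f \<circ> \<gamma>) s \<in> fst c)"
  have c': "c' \<in> A \<and> (f \<circ> \<gamma>) s \<in> fst c'"
    unfolding c'_def by (rule someI_ex) (use chart_cover in blast)
  let ?D = "frechet_derivative (coord_rep c c' f) (at (snd c (\<gamma> s)))"
  have "((snd c' \<circ> (f \<circ> \<gamma>)) has_vector_derivative ?D v) (at s)"
    using curve_transfer_derivative[OF f(1) c, of c' s UNIV \<gamma> v] \<gamma> v c' by auto
  then have "vector_derivative (snd c' \<circ> (f \<circ> \<gamma>)) (at s) = ?D v"
    by (rule vector_derivative_at)
  moreover have "g c (\<gamma> s) v v = g c' (f (\<gamma> s)) (?D v) (?D v)"
    using f(2) c c' \<gamma> unfolding preserves_metric_def Let_def by auto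
  ultimately show ?thesis
    unfolding curve_speed_def c'_def[symmetric] Let_def by simp
qed

lemma curve_speed_chart:
  assumes "c \<in> A" "isCont \<gamma> s" "\<gamma> s \<in> fst c" "((snd c \<circ> \<gamma>) has_vector_derivative v) (at s)"
  shows "curve_speed A g \<gamma> s = sqrt (g c (\<gamma> s) v v)"
  using curve_speed_transfer[OF smooth_id preserves_id assms] by simp

lemma curve_speed_nonneg: "curve_speed A g \<gamma> s \<ge> 0"
proof -
  define c where "c = (SOME c. c \<in> A \<and> \<gamma> s \<in> fst c)"
  have "c \<in> A \<and> \<gamma> s \<in> fst c"
    unfolding c_def by (rule someI_ex) (use chart_cover in blast)
  then show ?thesis
    unfolding curve_speed_def c_def[symmetric] Let_def by (simp add: metric_at(4))
qed

lemma curve_length_nonneg: "curve_length A g \<gamma> \<ge> 0"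
proof (cases "curve_speed A g \<gamma> integrable_on {0..1}")
  case True then show ?thesis unfolding curve_length_def
    by (intro integral_nonneg) (auto simp: curve_speed_nonneg)
next
  case False then show ?thesis unfolding curve_length_def by (simp add: not_integrable_integral)
qed

end


section \<open>Isometries preserve lengths and distances\<close>

context riemannian begin

text \<open>
  Continuity of the derivative of the image curve is checked at one parameter at a time, in a chart
  around the corresponding point of \<open>\<gamma>\<close>, where the chain rule gives a formula for it.
\<close>

lemma C1_curve_on_transfer:
  assumes f: "smooth_map A f" and \<gamma>: "C1_curve_on A a b \<gamma>" "continuous_on {a..b} \<gamma>" and ab: "a < b"
  shows "C1_curve_on A a b (f \<circ> \<gamma>)"
  unfolding C1_curve_on_def
proof
  fix c' assume c': "c' \<in> A"
  define T where "T = {a..b} \<inter> (f \<circ> \<gamma>) -` fst c'"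
  define D' where "D' s = vector_derivative (snd c' \<circ> (f \<circ> \<gamma>)) (at s within {a..b})" for s
  have main: "continuous (at s within T) D' \<and>
      ((snd c' \<circ> (f \<circ> \<gamma>)) has_vector_derivative D' s) (at s within {a..b})"
    if s: "s \<in> T" for s
  proof -
    obtain c where c: "c \<in> A" "\<gamma> s \<in> fst c" using chart_cover by blast
    obtain D where D: "continuous_on ({a..b} \<inter> \<gamma> -` fst c) D"
      "\<And>s. s \<in> {a..b} \<inter> \<gamma> -` fst c \<Longrightarrow> (snd c \<circ> \<gamma> has_vector_derivative D s) (at s within {a..b})"
      using \<gamma>(1) c unfolding C1_curve_on_def by blast
    define T2 where "T2 = T \<inter> \<gamma> -` fst c"
    have der: "((snd c' \<circ> (f \<circ> \<gamma>)) has_vector_derivative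
           frechet_derivative (coord_rep c c' f) (at (snd c (\<gamma> r))) (D r)) (at r within {a..b})"
      if "r \<in> T2" for r
      using that \<gamma>(2) D(2)[of r] unfolding T2_def T_def
      by (intro curve_transfer_derivative[OF f c(1) c'])
          (auto simp: continuous_on_eq_continuous_within)
    have eq: "D' r = frechet_derivative (coord_rep c c' f) (at (snd c (\<gamma> r))) (D r)" if "r \<in> T2"
        for r
      unfolding D'_def
      using that ab by (intro vector_derivative_within_cbox[unfolded cbox_interval] der)
          (auto simp: T2_def T_def)
    have sT2: "s \<in> T2" using s c by (auto simp: T2_def)
    have "continuous_on T2 (\<lambda>r. frechet_derivative (coord_rep c c' f) (at (snd c (\<gamma> r))) (D r))"
    proof (rule smooth_on_continuous_derivative)
      show "smooth_on (snd c ` (fst c \<inter> f -` fst c')) (coord_rep c c' f)"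
        using f c(1) c' unfolding smooth_map_def by blast
      show "continuous_on T2 (\<lambda>s. snd c (\<gamma> s))"
        by (rule continuous_on_compose2[OF chart_facts(3)[OF c(1)] continuous_on_subset[OF \<gamma>(2)]])
          (auto simp: T2_def T_def)
      show "continuous_on T2 D" by (rule continuous_on_subset[OF D(1)]) (auto simp: T2_def T_def)
    qed (auto simp: T2_def T_def)
    then have "continuous_on T2 D'" by (rule continuous_on_eq) (simp add: eq)
    then have cont: "continuous (at s within T2) D'"
      using sT2 by (simp add: continuous_on_eq_continuous_within)
    obtain W where W: "open W" "W \<inter> {a..b} = \<gamma> -` fst c \<inter> {a..b}"
      using \<gamma>(2) chart_facts(1)[OF c(1)] unfolding continuous_on_open_invariant by blast
    have "at s within T2 = at s within T"
      using W sT2 by (intro at_within_nhd[of s W]) (auto simp: T2_def T_def)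
    with cont show ?thesis using der[OF sT2] eq[OF sT2] by simp
  qed
  show "\<exists>D. continuous_on ({a..b} \<inter> (f \<circ> \<gamma>) -` fst c') D \<and>
             (\<forall>s\<in>{a..b} \<inter> (f \<circ> \<gamma>) -` fst c'.
                 (snd c' \<circ> (f \<circ> \<gamma>) has_vector_derivative D s) (at s within {a..b}))"
    using main unfolding T_def[symmetric] continuous_on_eq_continuous_within by blast
qed

lemma piecewise_C1_curve_transfer:
  assumes f: "smooth_map A f" and \<gamma>: "piecewise_C1_curve A \<gamma>"
  shows "piecewise_C1_curve A (f \<circ> \<gamma>)"
proof -
  have c: "continuous_on {0..1} \<gamma>" using \<gamma> unfolding piecewise_C1_curve_def by auto
  have fc: "continuous_on {0..1} (f \<circ> \<gamma>)"
    using f c unfolding smooth_map_def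
        by (intro continuous_on_compose) (auto intro: continuous_on_subset)
  obtain S where S: "finite S" "\<And>a b. 0 \<le> a \<Longrightarrow> a < b \<Longrightarrow> b \<le> 1 \<Longrightarrow> {a<..<b} \<inter> S = {} \<Longrightarrow>
      C1_curve_on A a b \<gamma>"
    using \<gamma> unfolding piecewise_C1_curve_def by blast
  have "C1_curve_on A a b (f \<circ> \<gamma>)" if "0 \<le> a" "a < b" "b \<le> 1" "{a<..<b} \<inter> S = {}" for a b
    using that by (intro C1_curve_on_transfer[OF f S(2)] continuous_on_subset[OF c]) auto
  with S(1) fc show ?thesis unfolding piecewise_C1_curve_def by blast
qed

text \<open>
  The speed refers to two-sided derivatives. They exist off a finite set, into which the end points
  of the parameter interval are put as well.
\<close>

lemma piecewise_C1_curve_derivative: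
  assumes "piecewise_C1_curve A \<gamma>"
  obtains S where "finite S" "0 \<in> S" "1 \<in> S"
    "\<And>s. s \<in> {0..1} - S \<Longrightarrow> isCont \<gamma> s"
    "\<And>s c. s \<in> {0..1} - S \<Longrightarrow> c \<in> A \<Longrightarrow> \<gamma> s \<in> fst c \<Longrightarrow> \<exists>v. ((snd c \<circ> \<gamma>) has_vector_derivative v) (at s)"
proof -
  have c: "continuous_on {0..1} \<gamma>" using assms unfolding piecewise_C1_curve_def by auto
  obtain S where S: "finite S" "\<And>a b. 0 \<le> a \<Longrightarrow> a < b \<Longrightarrow> b \<le> 1 \<Longrightarrow> {a<..<b} \<inter> S = {} \<Longrightarrow>
      C1_curve_on A a b \<gamma>"
    using assms unfolding piecewise_C1_curve_def by blast
  define S' where "S' = insert 0 (insert 1 S)"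
  have 1: "isCont \<gamma> s" if "s \<in> {0..1} - S'" for s
    using that c by (intro continuous_on_interior[OF c]) (auto simp: S'_def)
  have 2: "\<exists>v. ((snd c \<circ> \<gamma>) has_vector_derivative v) (at s)"
    if s: "s \<in> {0..1} - S'" and c: "c \<in> A" "\<gamma> s \<in> fst c" for s c
  proof -
    have "open ({0<..<1} - S)" using S(1) by (intro open_Diff finite_imp_closed) auto
    moreover have "s \<in> {0<..<1} - S" using s by (auto simp: S'_def)
    ultimately obtain e where e: "e > 0" "cball s e \<subseteq> {0<..<1} - S" using open_contains_cball
        by blast
    then have e': "{s - e..s + e} \<subseteq> {0<..<1} - S" by (simp add: cball_eq_atLeastAtMost)
    have "C1_curve_on A (s - e) (s + e) \<gamma>"
    proof (rule S(2))
      have "s - e \<in> {s - e..s + e}" "s + e \<in> {s - e..s + e}" using e(1) by auto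
      then show "0 \<le> s - e" "s + e \<le> 1" using e'
          by (meson DiffE greaterThanLessThan_iff less_imp_le subsetD)+
      have "{s - e<..<s + e} \<subseteq> {s - e..s + e}" by auto
      then show "{s - e<..<s + e} \<inter> S = {}" using e' by blast
    qed (use e in auto)
    then obtain v where "((snd c \<circ> \<gamma>) has_vector_derivative v) (at s within {s - e..s + e})"
      using c e(1) unfolding C1_curve_on_def by fastforce
    moreover have "at s within {s - e..s + e} = at s" using e(1) by (intro at_within_Icc_at) auto
    ultimately show ?thesis by auto
  qed
  show thesis by (rule that[of S']) (use S(1) 1 2 in \<open>auto simp: S'_def\<close>)
qed

text \<open>
  The speeds agree off a finite set, which does not affect the integral.
\<close>

lemma curve_length_isometry:
  assumes f: "smooth_map A f" "preserves_metric A g f" and \<gamma>: "piecewise_C1_curve A \<gamma>"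
  shows "curve_length A g (f \<circ> \<gamma>) = curve_length A g \<gamma>"
proof -
  obtain S where S: "finite S" "\<And>s. s \<in> {0..1} - S \<Longrightarrow> isCont \<gamma> s"
    "\<And>s c. s \<in> {0..1} - S \<Longrightarrow> c \<in> A \<Longrightarrow> \<gamma> s \<in> fst c \<Longrightarrow> \<exists>v. ((snd c \<circ> \<gamma>) has_vector_derivative v) (at s)"
    using piecewise_C1_curve_derivative[OF \<gamma>] by metis
  show ?thesis unfolding curve_length_def
  proof (rule integral_spike[OF negligible_finite[OF S(1)]])
    fix s :: real assume s: "s \<in> {0..1} - S"
    obtain c where c: "c \<in> A" "\<gamma> s \<in> fst c" using chart_cover by blast
    obtain v where v: "((snd c \<circ> \<gamma>) has_vector_derivative v) (at s)" using S(3)[OF s c] by blast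
    show "curve_speed A g \<gamma> s = curve_speed A g (f \<circ> \<gamma>) s"
      using curve_speed_transfer[OF f c(1) S(2)[OF s] c(2) v]
          curve_speed_chart[OF c(1) S(2)[OF s] c(2) v] by simp
  qed
qed

lemma curve_lengths_isometry_subset:
  assumes f: "smooth_map A f" "preserves_metric A g f"
  shows "{curve_length A g \<gamma> |\<gamma>. piecewise_C1_curve A \<gamma> \<and> \<gamma> 0 = x \<and> \<gamma> 1 = y} \<subseteq>
    {curve_length A g \<gamma> |\<gamma>. piecewise_C1_curve A \<gamma> \<and> \<gamma> 0 = f x \<and> \<gamma> 1 = f y}"
proof safe
  fix \<gamma> assume "piecewise_C1_curve A \<gamma>"
  then show "\<exists>\<gamma>'. curve_length A g \<gamma> = curve_length A g \<gamma>' \<and> piecewise_C1_curve A \<gamma>' \<and> \<gamma>' 0 =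
      f (\<gamma> 0) \<and> \<gamma>' 1 = f (\<gamma> 1)"
    by (intro exI[of _ "f \<circ> \<gamma>"]) (simp add: curve_length_isometry[OF f]
        piecewise_C1_curve_transfer[OF f(1)])
qed

text \<open>
  By the chain rule the differentials of \<open>f\<close> and \<open>inv f\<close> at corresponding points are inverse to each
  other, so the invariance identity of \<open>f\<close> can be read backwards.
\<close>

lemma preserves_metric_inv:
  assumes f: "riemannian_isometry A g f"
  shows "preserves_metric A g (inv f)"
  unfolding preserves_metric_def
proof (intro ballI allI)
  fix c c' p u v assume c: "c \<in> A" "c' \<in> A" and p: "p \<in> fst c \<inter> inv f -` fst c'"
  have bij: "bij f" and s: "smooth_map A f" and si: "smooth_map A (inv f)"
      and pr: "preserves_metric A g f"
    using f unfolding riemannian_isometry_def by auto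
  have ff: "f (inv f p) = p" for p using bij by (simp add: bij_is_surj surj_f_inv_f)
  let ?q = "inv f p"
  let ?F = "frechet_derivative (coord_rep c' c f) (at (snd c' ?q))"
  let ?G = "frechet_derivative (coord_rep c c' (inv f)) (at (snd c p))"
  have G: "(coord_rep c c' (inv f) has_derivative ?G) (at (snd c p))"
    using coord_rep_has_derivative[OF si c] p by auto
  have GG: "coord_rep c c' (inv f) (snd c p) = snd c' ?q"
    using p by (auto simp: coord_rep_def chart_facts(6)[OF c(1)])
  have F: "(coord_rep c' c f has_derivative ?F) (at (coord_rep c c' (inv f) (snd c p)))"
    unfolding GG using coord_rep_has_derivative[OF s c(2) c(1), of ?q] p by (auto simp: ff)
  have d: "(coord_rep c' c f \<circ> coord_rep c c' (inv f) has_derivative ?F \<circ> ?G) (at (snd c p))"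
    by (rule diff_chain_at[OF G F])
  have "open (snd c ` (fst c \<inter> inv f -` fst c'))"
  proof -
    have "openin (top_of_set (snd c ` fst c)) (snd c ` (fst c \<inter> inv f -` fst c'))"
    proof (rule homeomorphism_imp_open_map)
      show "homeomorphism (fst c) (snd c ` fst c) (snd c) (chart_inv c)"
        using chart[OF c(1)] unfolding is_chart_def by auto
      have "open (inv f -` fst c')" using si chart_facts(1)[OF c(2)] unfolding smooth_map_def
        by (intro open_vimage) auto
      then show "openin (top_of_set (fst c)) (fst c \<inter> inv f -` fst c')"
          by (simp add: openin_open_Int)
    qed
    then show ?thesis using chart_facts(2)[OF c(1)] openin_open_trans by blast
  qed
  then have "(id has_derivative ?F \<circ> ?G) (at (snd c p))"
  proof (rule has_derivative_transform_within_open[OF d])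
    fix x assume "x \<in> snd c ` (fst c \<inter> inv f -` fst c')"
    then obtain r where r: "r \<in> fst c" "inv f r \<in> fst c'" "x = snd c r" by auto
    then show "(coord_rep c' c f \<circ> coord_rep c c' (inv f)) x = id x"
      by (simp add: coord_rep_def chart_facts(6)[OF c(1)] chart_facts(6)[OF c(2)] ff)
  qed (use p in auto)
  then have id: "?F \<circ> ?G = id" using has_derivative_id has_derivative_unique
    by (metis (no_types, lifting) eq_id_iff)
  have "g c' ?q (?G u) (?G v) = g c (f ?q) (?F (?G u)) (?F (?G v))"
    using pr c p unfolding preserves_metric_def Let_def by (auto simp: ff)
  then show "g c p u v = (let D = ?G in g c' ?q (D u) (D v))"
    using fun_cong[OF id] by (simp add: ff)
qed

lemma riemannian_isometry_inv:
  assumes "riemannian_isometry A g f"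
  shows "riemannian_isometry A g (inv f)"
  using assms preserves_metric_inv[OF assms] unfolding riemannian_isometry_def
  by (auto simp: bij_imp_bij_inv inv_inv_eq)

text \<open>
  Both \<open>f\<close> and its inverse map curves to curves of the same length, so the two sets of lengths whose
  infima are compared are equal.
\<close>

lemma riemannian_dist_isometry:
  assumes f: "riemannian_isometry A g f"
  shows "riemannian_dist A g (f x) (f y) = riemannian_dist A g x y"
proof -
  have "bij f" "smooth_map A f" "preserves_metric A g f" "smooth_map A (inv f)"
      "preserves_metric A g (inv f)"
    using f riemannian_isometry_inv[OF f] unfolding riemannian_isometry_def by auto
  then show ?thesis
    using curve_lengths_isometry_subset[of f x y]
        curve_lengths_isometry_subset[of "inv f" "f x" "f y"]
    unfolding riemannian_dist_def by (simp add: bij_is_inj inv_f_f)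
qed

text \<open>
  Near a given parameter the curve stays in one chart, and on either side of the parameter the speed
  is a continuous function up to values at end points. Compactness of the interval does the rest.
  Additivity of the length under concatenation rests on this, as the integral of a function that is
  not integrable is \<open>0\<close> by convention.
\<close>

lemma curve_speed_integrable:
  assumes \<gamma>: "piecewise_C1_curve A \<gamma>"
  shows "curve_speed A g \<gamma> integrable_on {0..1}"
  unfolding cbox_interval[symmetric]
proof (rule integrable_on_little_subintervals, rule ballI)
  fix x :: real assume x: "x \<in> cbox 0 1"
  have cont: "continuous_on {0..1} \<gamma>" using \<gamma> unfolding piecewise_C1_curve_def by auto
  obtain S where S: "finite S" "\<And>a b. 0 \<le> a \<Longrightarrow> a < b \<Longrightarrow> b \<le> 1 \<Longrightarrow> {a<..<b} \<inter> S = {} \<Longrightarrow>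
      C1_curve_on A a b \<gamma>"
    using \<gamma> unfolding piecewise_C1_curve_def by blast
  obtain c where c: "c \<in> A" "\<gamma> x \<in> fst c" using chart_cover by blast
  obtain W where W: "open W" "W \<inter> {0..1} = \<gamma> -` fst c \<inter> {0..1}"
    using cont chart_facts(1)[OF c(1)] unfolding continuous_on_open_invariant by blast
  have "x \<in> W" using W x c by auto
  then obtain d1 where d1: "d1 > 0" "ball x d1 \<subseteq> W" using W(1) openE by blast
  obtain d2 where d2: "d2 > 0" "\<And>y. y \<in> S \<Longrightarrow> y \<noteq> x \<Longrightarrow> d2 \<le> dist x y"
    using finite_set_avoid[OF S(1), of x] by blast
  define d where "d = min d1 d2"
  have claim: "curve_speed A g \<gamma> integrable_on {a..b}"
    if ab: "a \<le> b" "{a..b} \<subseteq> {0..1}" "{a..b} \<subseteq> ball x d" "x \<notin> {a<..<b}" for a b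
  proof (cases "a = b")
    case True then show ?thesis using integrable_on_refl[of _ a] by simp
  next
    case False
    have "y \<notin> S" if "y \<in> {a<..<b}" for y
    proof
      assume "y \<in> S"
      moreover have "y \<noteq> x" using that ab(4) by auto
      ultimately have "d2 \<le> dist x y" using d2(2) by blast
      moreover have "y \<in> ball x d" using that ab(3)
          by (meson greaterThanLessThan_subseteq_atLeastAtMost_iff order_refl subsetD)
      ultimately show False by (auto simp: d_def)
    qed
    then have disj: "{a<..<b} \<inter> S = {}" by auto
    have cc: "{a..b} \<subseteq> \<gamma> -` fst c"
    proof
      fix y assume y: "y \<in> {a..b}"
      then have "y \<in> ball x d1" "y \<in> {0..1}" using ab(2,3) by (auto simp: d_def)
      then show "y \<in> \<gamma> -` fst c" using W(2) d1(2) by blast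
    qed
    have ab': "0 \<le> a" "a < b" "b \<le> 1" using ab(1,2) False by auto
    obtain D where D: "continuous_on {a..b} D"
      "\<And>s. s \<in> {a..b} \<Longrightarrow> (snd c \<circ> \<gamma> has_vector_derivative D s) (at s within {a..b})"
      using S(2)[OF ab' disj] c(1) cc unfolding C1_curve_on_def by (metis inf.orderE)
    have "continuous_on {a..b} (\<lambda>s. sqrt (g c (\<gamma> s) (D s) (D s)))"
      using cc by (intro continuous_intros metric_continuous[OF c(1)]
          continuous_on_subset[OF cont ab(2)] D(1)) auto
    then have "(\<lambda>s. sqrt (g c (\<gamma> s) (D s) (D s))) integrable_on {a..b}"
      by (rule integrable_continuous_real)
    then show ?thesis
    proof (rule integrable_spike_finite[of "{a, b}", rotated 2])
      fix s assume s: "s \<in> {a..b} - {a, b}"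
      then have s': "s \<in> {a<..<b}" "s \<in> {a..b}" by auto
      have "isCont \<gamma> s" using s' ab(2)
          continuous_on_interior[OF continuous_on_subset[OF cont ab(2)], of s] by auto
      moreover have "\<gamma> s \<in> fst c" using cc s'(2) by blast
      moreover have "(snd c \<circ> \<gamma> has_vector_derivative D s) (at s)"
        using D(2)[OF s'(2)] s'(1) by (simp add: at_within_Icc_at)
      ultimately show "curve_speed A g \<gamma> s = sqrt (g c (\<gamma> s) (D s) (D s))"
        using curve_speed_chart[OF c(1)] by blast
    qed auto
  qed
  show "\<exists>d>0. \<forall>u v. x \<in> cbox u v \<and> cbox u v \<subseteq> ball x d \<and> cbox u v \<subseteq> cbox 0 1 \<longrightarrow>
                 curve_speed A g \<gamma> integrable_on cbox u v"
  proof (intro exI[of _ d] conjI allI impI)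
    show "d > 0" using d1 d2 by (simp add: d_def)
    fix u v :: real assume uv: "x \<in> cbox u v \<and> cbox u v \<subseteq> ball x d \<and> cbox u v \<subseteq> cbox 0 1"
    then have x: "u \<le> x" "x \<le> v" and sub: "{u..v} \<subseteq> ball x d" "{u..v} \<subseteq> {0..1}"
      by (auto simp: cbox_interval)
    have "{u..x} \<subseteq> {u..v}" "{x..v} \<subseteq> {u..v}" using x by auto
    then have "curve_speed A g \<gamma> integrable_on {u..x}" "curve_speed A g \<gamma> integrable_on {x..v}"
      using sub x by (intro claim; auto)+
    then show "curve_speed A g \<gamma> integrable_on cbox u v"
      using Henstock_Kurzweil_Integration.integrable_combine[OF x] by (simp add: cbox_interval)
  qed
qed

end


section \<open>Symmetry and measurability of the distance\<close>

context riemannian begin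

text \<open>
  Affine changes of the parameter produce both the reversed curve and the two halves of a
  concatenation.
\<close>

lemma C1_curve_on_affine:
  assumes \<gamma>: "C1_curve_on A a' b' \<gamma>" 
    and u: "\<And>s. s \<in> {a..b} \<Longrightarrow> m * s + k \<in> {a'..b'}"
    and \<eta>: "\<And>s. s \<in> {a..b} \<Longrightarrow> \<eta> s = \<gamma> (m * s + k)"
  shows "C1_curve_on A a b \<eta>"
  unfolding C1_curve_on_def
proof
  fix c assume "c \<in> A"
  then obtain D where D: "continuous_on ({a'..b'} \<inter> \<gamma> -` fst c) D"
    "\<And>s. s \<in> {a'..b'} \<inter> \<gamma> -` fst c \<Longrightarrow> (snd c \<circ> \<gamma> has_vector_derivative D s) (at s within {a'..b'})"
    using \<gamma> unfolding C1_curve_on_def by blast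
  show "\<exists>D. continuous_on ({a..b} \<inter> \<eta> -` fst c) D \<and>
     (\<forall>s\<in>{a..b} \<inter> \<eta> -` fst c. (snd c \<circ> \<eta> has_vector_derivative D s) (at s within {a..b}))"
  proof (intro exI[of _ "\<lambda>s. m *\<^sub>R D (m * s + k)"] conjI ballI)
    show "continuous_on ({a..b} \<inter> \<eta> -` fst c) (\<lambda>s. m *\<^sub>R D (m * s + k))"
      using u \<eta> by (intro continuous_intros continuous_on_compose2[OF D(1)]) auto
    fix s assume s: "s \<in> {a..b} \<inter> \<eta> -` fst c"
    have "(snd c \<circ> \<gamma> has_vector_derivative D (m * s + k)) (at (m * s + k) within {a'..b'})"
      using s u \<eta> by (intro D(2)) auto
    then have 1: "(snd c \<circ> \<gamma> has_vector_derivative D (m * s + k))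
        (at (m * s + k) within (\<lambda>s. m * s + k) ` {a..b})"
      by (rule has_vector_derivative_within_subset) (use u in auto)
    have "((\<lambda>s. m * s + k) has_vector_derivative m) (at s within {a..b})"
      by (auto intro!: derivative_eq_intros)
    from vector_diff_chain_within[OF this 1]
    show "(snd c \<circ> \<eta> has_vector_derivative m *\<^sub>R D (m * s + k)) (at s within {a..b})"
      by (rule has_vector_derivative_transform[rotated 2]) (use s \<eta> in auto)
  qed
qed

lemma curve_speed_affine:
  assumes \<eta>: "\<forall>\<^sub>F r in nhds s. \<eta> r = \<gamma> (m * r + k)"
    and \<gamma>: "isCont \<gamma> (m * s + k)"
      "\<And>c. c \<in> A \<Longrightarrow> \<gamma> (m * s + k) \<in> fst c \<Longrightarrow>
          \<exists>v. ((snd c \<circ> \<gamma>) has_vector_derivative v) (at (m * s + k))"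
  shows "curve_speed A g \<eta> s = \<bar>m\<bar> * curve_speed A g \<gamma> (m * s + k)"
proof -
  let ?u = "\<lambda>r. m * r + k"
  obtain c where c: "c \<in> A" "\<gamma> (?u s) \<in> fst c" using chart_cover by blast
  obtain v where v: "((snd c \<circ> \<gamma>) has_vector_derivative v) (at (?u s))" using \<gamma>(2) c by blast
  have e: "\<eta> s = \<gamma> (?u s)" using \<eta> eventually_nhds_x_imp_x by blast
  have "(?u has_vector_derivative m) (at s)"
    by (auto intro!: derivative_eq_intros)
  from vector_diff_chain_at[OF this v]
  have "((snd c \<circ> \<gamma>) \<circ> ?u has_vector_derivative m *\<^sub>R v) (at s)" .
  moreover have "\<forall>\<^sub>F r in nhds s. ((snd c \<circ> \<gamma>) \<circ> ?u) r = (snd c \<circ> \<eta>) r"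
    using \<eta> by eventually_elim auto
  ultimately have d: "((snd c \<circ> \<eta>) has_vector_derivative m *\<^sub>R v) (at s)"
    by (subst (asm) has_vector_derivative_cong_ev) (auto simp: e elim: eventually_mono)
  have "isCont (\<lambda>r. \<gamma> (?u r)) s"
    using \<gamma>(1) by (intro isCont_o2[where f = ?u and g = \<gamma>]) auto
  then have i: "isCont \<eta> s" using isCont_cong[OF \<eta>] by simp
  have b: "bilinear (g c (\<gamma> (?u s)))" by (rule metric_at[OF c])
  have "curve_speed A g \<eta> s = sqrt (g c (\<eta> s) (m *\<^sub>R v) (m *\<^sub>R v))"
    using curve_speed_chart[OF c(1) i _ d] c(2) e by simp
  also have "\<dots> = sqrt (m\<^sup>2 * g c (\<gamma> (?u s)) v v)"
    by (simp add: e bilinear_lmul[OF b] bilinear_rmul[OF b] power2_eq_square mult.assoc)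
  also have "\<dots> = \<bar>m\<bar> * sqrt (g c (\<gamma> (?u s)) v v)" by (simp add: real_sqrt_mult)
  also have "\<dots> = \<bar>m\<bar> * curve_speed A g \<gamma> (?u s)"
    using curve_speed_chart[OF c(1) \<gamma>(1) c(2) v] by simp
  finally show ?thesis .
qed

lemma curve_length_affine:
  assumes \<gamma>: "piecewise_C1_curve A \<gamma>" and m: "m \<noteq> 0"
    and u: "(\<lambda>s. m * s + k) ` {a..b} = {0..1}" and \<eta>: "\<And>s. s \<in> {a<..<b} \<Longrightarrow> \<eta> s = \<gamma> (m * s + k)"
  shows "(curve_speed A g \<eta> has_integral curve_length A g \<gamma>) {a..b}"
proof -
  let ?u = "\<lambda>r. m * r + k"
  obtain S where S: "finite S" "0 \<in> S" "1 \<in> S" "\<And>s. s \<in> {0..1} - S \<Longrightarrow> isCont \<gamma> s"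
    "\<And>s c. s \<in> {0..1} - S \<Longrightarrow> c \<in> A \<Longrightarrow> \<gamma> s \<in> fst c \<Longrightarrow> \<exists>v. ((snd c \<circ> \<gamma>) has_vector_derivative v) (at s)"
    using piecewise_C1_curve_derivative[OF \<gamma>] by metis
  have inj: "inj ?u" using m by (auto intro: injI)
  have "(curve_speed A g \<gamma> has_integral curve_length A g \<gamma>) (cbox 0 1)"
    using curve_speed_integrable[OF \<gamma>] unfolding curve_length_def
        by (simp add: integrable_integral cbox_interval)
  from has_integral_affinity[OF this m, of k]
  have 1: "((\<lambda>s. curve_speed A g \<gamma> (?u s)) has_integral (1 / \<bar>m\<bar>) * curve_length A g \<gamma>)
     ((\<lambda>x. (1 / m) * x + - (k / m)) ` {0..1})"
    by (simp add: cbox_interval field_simps)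
  have 2: "(\<lambda>x. (1 / m) * x + - (k / m)) ` {0..1} = {a..b}"
    unfolding u[symmetric] image_image using m by (auto simp: field_simps image_iff)
  have "((\<lambda>s. \<bar>m\<bar> * curve_speed A g \<gamma> (?u s)) has_integral \<bar>m\<bar> * ((1 / \<bar>m\<bar>) * curve_length A g \<gamma>))
      {a..b}"
    using 1 unfolding 2 by (rule has_integral_mult_right)
  then have "((\<lambda>s. \<bar>m\<bar> * curve_speed A g \<gamma> (?u s)) has_integral curve_length A g \<gamma>) {a..b}"
    using m by simp
  then show ?thesis
  proof (rule has_integral_spike_finite[rotated 2])
    show "finite (?u -` S \<union> {a, b})" using S(1) finite_vimageI[OF _ inj] by auto
    fix s assume s: "s \<in> {a..b} - (?u -` S \<union> {a, b})"
    then have "?u s \<in> {0..1} - S" using u by blast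
    moreover have "\<forall>\<^sub>F r in nhds s. \<eta> r = \<gamma> (?u r)"
      using s by (intro eventually_nhds_in_open[of "{a<..<b}", THEN eventually_mono] \<eta>) auto
    ultimately show "curve_speed A g \<eta> s = \<bar>m\<bar> * curve_speed A g \<gamma> (?u s)"
      by (intro curve_speed_affine S(4,5)) auto
  qed
qed

lemma piecewise_C1_curve_reverse:
  assumes \<gamma>: "piecewise_C1_curve A \<gamma>"
  shows "piecewise_C1_curve A (\<lambda>s. \<gamma> (1 - s))"
      "curve_length A g (\<lambda>s. \<gamma> (1 - s)) = curve_length A g \<gamma>"
proof -
  have c: "continuous_on {0..1} \<gamma>" using \<gamma> unfolding piecewise_C1_curve_def by auto
  have "continuous_on {0..1} (\<lambda>s. \<gamma> (1 - s))"
    by (rule continuous_on_compose2[OF c]) (auto intro!: continuous_intros)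
  moreover obtain S where S: "finite S"
      "\<And>a b. 0 \<le> a \<Longrightarrow> a < b \<Longrightarrow> b \<le> 1 \<Longrightarrow> {a<..<b} \<inter> S = {} \<Longrightarrow> C1_curve_on A a b \<gamma>"
    using \<gamma> unfolding piecewise_C1_curve_def by blast
  moreover have "C1_curve_on A a b (\<lambda>s. \<gamma> (1 - s))"
    if ab: "0 \<le> a" "a < b" "b \<le> 1" "{a<..<b} \<inter> (\<lambda>s. 1 - s) ` S = {}" for a b
  proof (rule C1_curve_on_affine[where m = "-1" and k = 1])
    have "s \<notin> S" if "s \<in> {1 - b<..<1 - a}" for s
    proof
      assume "s \<in> S"
      then have "1 - s \<in> {a<..<b} \<inter> (\<lambda>s. 1 - s) ` S" using that by auto
      then show False using ab(4) by blast
    qed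
    then show "C1_curve_on A (1 - b) (1 - a) \<gamma>" using ab by (intro S(2)) auto
  qed auto
  ultimately show "piecewise_C1_curve A (\<lambda>s. \<gamma> (1 - s))"
    unfolding piecewise_C1_curve_def by (metis finite_imageI)
  have "(\<lambda>s. -1 * s + 1) ` {0..1} = {0..1::real}"
      by (auto simp: image_iff intro!: bexI[of _ "1 - _"])
  then have "(curve_speed A g (\<lambda>s. \<gamma> (1 - s)) has_integral curve_length A g \<gamma>) {0..1}"
    by (intro curve_length_affine[OF \<gamma>, of "-1" 1]) auto
  then show "curve_length A g (\<lambda>s. \<gamma> (1 - s)) = curve_length A g \<gamma>"
    unfolding curve_length_def by (rule integral_unique)
qed

lemma riemannian_dist_sym: "riemannian_dist A g x y = riemannian_dist A g y x"
proof -
  have "{curve_length A g \<gamma> |\<gamma>. piecewise_C1_curve A \<gamma> \<and> \<gamma> 0 = x \<and> \<gamma> 1 = y} \<subseteq>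
    {curve_length A g \<gamma> |\<gamma>. piecewise_C1_curve A \<gamma> \<and> \<gamma> 0 = y \<and> \<gamma> 1 = x}" for x y
  proof safe
    fix \<gamma> assume "piecewise_C1_curve A \<gamma>"
    then show "\<exists>\<gamma>'. curve_length A g \<gamma> = curve_length A g \<gamma>' \<and> piecewise_C1_curve A \<gamma>' \<and> \<gamma>' 0 =
        \<gamma> 1 \<and> \<gamma>' 1 = \<gamma> 0"
      by (intro exI[of _ "\<lambda>s. \<gamma> (1 - s)"]) (simp add: piecewise_C1_curve_reverse)
  qed
  from this[of x y] this[of y x] show ?thesis unfolding riemannian_dist_def
      by (simp add: subset_antisym)
qed

lemma piecewise_C1_curve_join:
  assumes \<gamma>: "piecewise_C1_curve A \<gamma>" and \<eta>: "piecewise_C1_curve A \<eta>" and eq: "\<gamma> 1 = \<eta> 0"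
  shows "piecewise_C1_curve A (\<gamma> +++ \<eta>)"
      "curve_length A g (\<gamma> +++ \<eta>) = curve_length A g \<gamma> + curve_length A g \<eta>"
proof -
  have "path \<gamma>" "path \<eta>" using \<gamma> \<eta> unfolding piecewise_C1_curve_def path_def by auto
  then have "continuous_on {0..1} (\<gamma> +++ \<eta>)"
    using eq path_join[of \<gamma> \<eta>] unfolding path_def pathfinish_def pathstart_def by simp
  obtain S where S: "finite S" "\<And>a b. 0 \<le> a \<Longrightarrow> a < b \<Longrightarrow> b \<le> 1 \<Longrightarrow> {a<..<b} \<inter> S = {} \<Longrightarrow>
      C1_curve_on A a b \<gamma>"
    using \<gamma> unfolding piecewise_C1_curve_def by blast
  obtain S' where S': "finite S'"
      "\<And>a b. 0 \<le> a \<Longrightarrow> a < b \<Longrightarrow> b \<le> 1 \<Longrightarrow> {a<..<b} \<inter> S' = {} \<Longrightarrow> C1_curve_on A a b \<eta>"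
    using \<eta> unfolding piecewise_C1_curve_def by blast
  define Q where "Q = insert (1/2) ((\<lambda>s. s / 2) ` S \<union> (\<lambda>s. (s + 1) / 2) ` S')"
  have "C1_curve_on A a b (\<gamma> +++ \<eta>)" if ab: "0 \<le> a" "a < b" "b \<le> 1" "{a<..<b} \<inter> Q = {}" for a b
  proof -
    have "1/2 \<notin> {a<..<b}" using ab(4) by (auto simp: Q_def)
    then consider "b \<le> 1/2" | "1/2 \<le> a" by fastforce
    then show ?thesis
    proof cases
      case 1
      show ?thesis
      proof (rule C1_curve_on_affine[where m = 2 and k = 0])
        have "s \<notin> S" if "s \<in> {2 * a<..<2 * b}" for s
        proof
          assume "s \<in> S"
          then have "s / 2 \<in> {a<..<b} \<inter> Q" using that by (auto simp: Q_def)
          then show False using ab(4) by blast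
        qed
        then show "C1_curve_on A (2 * a) (2 * b) \<gamma>" using ab 1 by (intro S(2)) auto
        show "(\<gamma> +++ \<eta>) s = \<gamma> (2 * s + 0)" if "s \<in> {a..b}" for s
          using that 1 by (auto simp: joinpaths_def)
      qed auto
    next
      case 2
      show ?thesis
      proof (rule C1_curve_on_affine[where m = 2 and k = "-1"])
        have "s \<notin> S'" if "s \<in> {2 * a - 1<..<2 * b - 1}" for s
        proof
          assume "s \<in> S'"
          then have "(s + 1) / 2 \<in> {a<..<b} \<inter> Q" using that by (auto simp: Q_def)
          then show False using ab(4) by blast
        qed
        then show "C1_curve_on A (2 * a - 1) (2 * b - 1) \<eta>" using ab 2 by (intro S'(2)) auto
        show "(\<gamma> +++ \<eta>) s = \<eta> (2 * s + - 1)" if "s \<in> {a..b}" for s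
        proof (cases "s = 1/2")
          case True then have "2 * s = 1" by simp
          then show ?thesis using eq by (simp add: joinpaths_def)
        next
          case False then show ?thesis using that 2 by (auto simp: joinpaths_def)
        qed
      qed auto
    qed
  qed
  moreover have "finite Q" using S(1) S'(1) by (simp add: Q_def)
  ultimately show "piecewise_C1_curve A (\<gamma> +++ \<eta>)"
    using \<open>continuous_on {0..1} (\<gamma> +++ \<eta>)\<close> unfolding piecewise_C1_curve_def by blast
  have "(\<lambda>s. 2 * s + 0) ` {0..1/2} = {0..1::real}" "(\<lambda>s. 2 * s + - 1) ` {1/2..1} = {0..1::real}"
    using image_affinity_atLeastAtMost[of 2 0 0 "1/2::real"]
        image_affinity_atLeastAtMost[of 2 "-1" "1/2" "1::real"] by auto
  then have "(curve_speed A g (\<gamma> +++ \<eta>) has_integral curve_length A g \<gamma>) {0..1/2}"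
    "(curve_speed A g (\<gamma> +++ \<eta>) has_integral curve_length A g \<eta>) {1/2..1}"
    by (intro curve_length_affine[OF \<gamma>, of 2 0] curve_length_affine[OF \<eta>, of 2 "-1"]; auto simp:
        joinpaths_def)+
  then have "(curve_speed A g (\<gamma> +++ \<eta>) has_integral curve_length A g \<gamma> + curve_length A g \<eta>)
      {0..1}"
    by (intro has_integral_combine[of 0 "1/2" 1]) auto
  then show "curve_length A g (\<gamma> +++ \<eta>) = curve_length A g \<gamma> + curve_length A g \<eta>"
    unfolding curve_length_def[of _ _ "\<gamma> +++ \<eta>"] by (rule integral_unique)
qed

text \<open>
  For two points that no curve joins, the infimum that defines the distance has a conventional
  value; speaking of curves avoids this case.
\<close>

definition joined_below :: "real \<Rightarrow> 'a \<Rightarrow> 'a \<Rightarrow> bool" where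
  "joined_below s x y \<longleftrightarrow> (\<exists>\<gamma>. piecewise_C1_curve A \<gamma> \<and> \<gamma> 0 = x \<and> \<gamma> 1 = y \<and> curve_length A g \<gamma> < s)"

lemma joined_below_sym: "joined_below s x y \<Longrightarrow> joined_below s y x"
proof -
  assume "joined_below s x y"
  then obtain \<gamma> where "piecewise_C1_curve A \<gamma>" "\<gamma> 0 = x" "\<gamma> 1 = y" "curve_length A g \<gamma> < s"
    unfolding joined_below_def by blast
  then show ?thesis unfolding joined_below_def
    by (intro exI[of _ "\<lambda>s. \<gamma> (1 - s)"]) (simp add: piecewise_C1_curve_reverse)
qed

lemma joined_below_trans:
  assumes "joined_below r x y" "joined_below s y z"
  shows "joined_below (r + s) x z"
proof -
  obtain \<gamma> where \<gamma>: "piecewise_C1_curve A \<gamma>" "\<gamma> 0 = x" "\<gamma> 1 = y" "curve_length A g \<gamma> < r"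
    using assms(1) unfolding joined_below_def by blast
  obtain \<eta> where \<eta>: "piecewise_C1_curve A \<eta>" "\<eta> 0 = y" "\<eta> 1 = z" "curve_length A g \<eta> < s"
    using assms(2) unfolding joined_below_def by blast
  show ?thesis unfolding joined_below_def
    using piecewise_C1_curve_join[OF \<gamma>(1) \<eta>(1)] \<gamma> \<eta>
    by (intro exI[of _ "\<gamma> +++ \<eta>"]) (simp add: joinpaths_def)
qed

text \<open>
  On a compact subset of a chart the Riemannian norm is bounded by a multiple of the Euclidean norm,
  because the finitely many coefficients of the metric are bounded there.
\<close>

lemma metric_locally_bounded:
  assumes c: "c \<in> A" and K: "compact K" "K \<subseteq> snd c ` fst c"
  obtains B where "B > 0" "\<And>x v. x \<in> K \<Longrightarrow> g c (chart_inv c x) v v \<le> B * (norm v)\<^sup>2"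
proof -
  have "\<exists>M. \<forall>x\<in>K. \<bar>g c (chart_inv c x) i j\<bar> \<le> M" for i j
  proof -
    have "continuous_on K (\<lambda>x. g c (chart_inv c x) i j)"
      by (rule continuous_on_compose2[OF metric_continuous_coeff[OF c]
          continuous_on_subset[OF chart_facts(4)[OF c] K(2)]])
        (use K(2) chart_facts(7)[OF c] in auto)
    then have "bounded ((\<lambda>x. g c (chart_inv c x) i j) ` K)"
      using K(1) compact_continuous_image compact_imp_bounded by blast
    then show ?thesis unfolding bounded_iff by auto
  qed
  then obtain M where M: "\<And>i j x. x \<in> K \<Longrightarrow> \<bar>g c (chart_inv c x) i j\<bar> \<le> M i j" by metis
  define B where "B = 1 + (\<Sum>i\<in>Basis. \<Sum>j\<in>Basis. \<bar>M i j\<bar>)"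
  have "g c (chart_inv c x) v v \<le> B * (norm v)\<^sup>2" if x: "x \<in> K" for x v
  proof -
    have p: "chart_inv c x \<in> fst c" using x K(2) chart_facts(7)[OF c] by auto
    have "g c (chart_inv c x) v v =
        (\<Sum>i\<in>Basis. \<Sum>j\<in>Basis. (v \<bullet> i) * (v \<bullet> j) * g c (chart_inv c x) i j)"
      by (rule metric_expand[OF c p])
    also have "\<dots> \<le> (\<Sum>i\<in>Basis. \<Sum>j\<in>Basis. norm v * norm v * \<bar>M i j\<bar>)"
    proof (intro sum_mono)
      fix i j :: "(real, 'n) vec" assume ij: "i \<in> Basis" "j \<in> Basis"
      have "(v \<bullet> i) * (v \<bullet> j) * g c (chart_inv c x) i j \<le> \<bar>v \<bullet> i\<bar> * \<bar>v \<bullet> j\<bar> *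
          \<bar>g c (chart_inv c x) i j\<bar>"
        by (metis abs_ge_self abs_mult)
      also have "\<dots> \<le> norm v * norm v * \<bar>M i j\<bar>"
        using M[OF x, of i j] ij by (intro mult_mono) (auto simp: Basis_le_norm)
      finally show "(v \<bullet> i) * (v \<bullet> j) * g c (chart_inv c x) i j \<le> norm v * norm v * \<bar>M i j\<bar>" .
    qed
    also have "\<dots> = (B - 1) * (norm v)\<^sup>2"
      by (simp add: B_def sum_distrib_left sum_distrib_right power2_eq_square mult_ac)
    also have "\<dots> \<le> B * (norm v)\<^sup>2" by (intro mult_right_mono) auto
    finally show ?thesis .
  qed
  moreover have "B > 0" unfolding B_def by (simp add: add_pos_nonneg sum_nonneg)
  ultimately show thesis using that by blast
qed

text \<open>
  A straight segment in a chart has Riemannian length at most a constant times its Euclidean length.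
\<close>

lemma joined_below_locally:
  assumes "s > 0"
  shows "\<exists>W. open W \<and> x \<in> W \<and> (\<forall>y\<in>W. joined_below s x y)"
proof -
  obtain c where c: "c \<in> A" "x \<in> fst c" using chart_cover by blast
  let ?U = "snd c ` fst c"
  obtain r where r: "r > 0" "cball (snd c x) r \<subseteq> ?U"
    using chart_facts(2)[OF c(1)] c(2) open_contains_cball by blast
  obtain B where B: "B > 0" "\<And>z v. z \<in> cball (snd c x) r \<Longrightarrow> g c (chart_inv c z) v v \<le> B * (norm v)\<^sup>2"
    using metric_locally_bounded[OF c(1) compact_cball r(2)] by blast
  define e where "e = min r (s / sqrt B)"
  have e: "e > 0" using r B assms by (simp add: e_def)
  define W where "W = fst c \<inter> snd c -` ball (snd c x) e"
  have "open W" unfolding W_def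
    using chart_facts(1,3)[OF c(1)] by (intro continuous_open_preimage) auto
  moreover have "x \<in> W" using c e by (simp add: W_def)
  moreover have "joined_below s x y" if y: "y \<in> W" for y
  proof -
    have yc: "y \<in> fst c" and yd: "norm (snd c y - snd c x) < e" using y
        by (auto simp: W_def dist_norm norm_minus_commute)
    define v where "v = snd c y - snd c x"
    define l where "l = (\<lambda>s::real. snd c x + s *\<^sub>R v)"
    have lK: "l s \<in> cball (snd c x) r" if "s \<in> {0..1}" for s
    proof -
      have "\<bar>s\<bar> * norm v \<le> 1 * r" using that yd by (intro mult_mono) (auto simp: v_def e_def)
      then show ?thesis by (simp add: l_def dist_norm)
    qed
    then have lU: "l s \<in> ?U" if "s \<in> {0..1}" for s using that r(2) by blast
    define \<gamma> where "\<gamma> = chart_inv c \<circ> l"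
    have cl: "continuous_on T l" for T unfolding l_def by (intro continuous_intros)
    have "continuous_on {0..1} \<gamma>" unfolding \<gamma>_def
      by (intro continuous_on_compose cl continuous_on_subset[OF chart_facts(4)[OF c(1)]])
          (use lU in auto)
    have \<gamma>c: "\<gamma> s \<in> fst c" "snd c (\<gamma> s) = l s" if "s \<in> {0..1}" for s
      using lU[OF that] chart_facts(7,8)[OF c(1)] by (auto simp: \<gamma>_def)
    have dl: "(l has_vector_derivative v) (at s within T)" for s T
      unfolding l_def by (auto intro!: derivative_eq_intros)
    have d\<gamma>: "(snd c \<circ> \<gamma> has_vector_derivative v) (at s within T)" if "T \<subseteq> {0..1}" "s \<in> T" for s T
      by (rule has_vector_derivative_transform[OF _ _ dl]) (use that \<gamma>c in auto)
    have "C1_curve_on A a b \<gamma>" if ab: "0 \<le> a" "a < b" "b \<le> 1" for a b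
      unfolding C1_curve_on_def
    proof (intro ballI exI conjI)
      fix c' assume c': "c' \<in> A"
      let ?D = "\<lambda>s. frechet_derivative (coord_rep c c' id) (at (snd c (\<gamma> s))) v"
      have ss: "{a..b} \<subseteq> {0..1}" using ab by auto
      show "continuous_on ({a..b} \<inter> \<gamma> -` fst c') ?D"
      proof (rule smooth_on_continuous_derivative)
        show "smooth_on (snd c ` (fst c \<inter> id -` fst c')) (coord_rep c c' id)"
          using smooth_id c(1) c' unfolding smooth_map_def by blast
        show "continuous_on ({a..b} \<inter> \<gamma> -` fst c') (\<lambda>s. snd c (\<gamma> s))"
          by (rule continuous_on_eq[OF cl]) (use \<gamma>c ss in auto)
      qed (use \<gamma>c ss in auto)
      fix s assume s: "s \<in> {a..b} \<inter> \<gamma> -` fst c'"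
      have "continuous (at s within {a..b}) \<gamma>"
        using s continuous_on_subset[OF \<open>continuous_on {0..1} \<gamma>\<close> ss]
            by (simp add: continuous_on_eq_continuous_within)
      then have "((snd c' \<circ> (id \<circ> \<gamma>)) has_vector_derivative ?D s) (at s within {a..b})"
        by (rule curve_transfer_derivative[OF smooth_id c(1) c'])
          (use s ss \<gamma>c in \<open>auto intro!: d\<gamma>\<close>)
      then show "((snd c' \<circ> \<gamma>) has_vector_derivative ?D s) (at s within {a..b})" by simp
    qed
    then have pw: "piecewise_C1_curve A \<gamma>"
      unfolding piecewise_C1_curve_def using \<open>continuous_on {0..1} \<gamma>\<close> by (metis finite.emptyI)
    have "curve_length A g \<gamma> \<le> sqrt B * norm v"
    proof -
      have "integral {0..1} (curve_speed A g \<gamma>) = integral {0<..<1} (curve_speed A g \<gamma>)"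
        using integral_open_interval_real[of 0 1 "curve_speed A g \<gamma>"] by simp
      also have "\<dots> \<le> integral {0<..<1::real} (\<lambda>_. sqrt B * norm v)"
      proof (rule integral_le)
        show "curve_speed A g \<gamma> integrable_on {0<..<1}"
          using curve_speed_integrable[OF pw]
              integrable_on_open_interval[of "curve_speed A g \<gamma>" 0 "1::real"]
          by (simp add: cbox_interval box_real)
        show "(\<lambda>_. sqrt B * norm v) integrable_on {0<..<1::real}"
          using integrable_on_open_interval[of "\<lambda>_. sqrt B * norm v" 0 "1::real"]
              integrable_const[of _ 0 "1::real"]
          by (simp add: cbox_interval box_real)
        fix s :: real assume s: "s \<in> {0<..<1}"
        then have s': "s \<in> {0..1}" by auto
        have i: "isCont \<gamma> s" using s continuous_on_interior[OF \<open>continuous_on {0..1} \<gamma>\<close>, of s]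
            by auto
        have "(snd c \<circ> \<gamma> has_vector_derivative v) (at s)"
          using d\<gamma>[of "{0..1}" s] s by (simp add: at_within_Icc_at)
        then have "curve_speed A g \<gamma> s = sqrt (g c (\<gamma> s) v v)"
          using curve_speed_chart[OF c(1) i] \<gamma>c(1)[OF s'] by blast
        also have "\<dots> \<le> sqrt (B * (norm v)\<^sup>2)"
          using B(2)[OF lK[OF s'], of v] by (simp add: \<gamma>_def)
        also have "\<dots> = sqrt B * norm v" by (simp add: real_sqrt_mult)
        finally show "curve_speed A g \<gamma> s \<le> sqrt B * norm v" .
      qed
      also have "\<dots> = sqrt B * norm v"
          using integral_open_interval_real[of 0 1 "\<lambda>_. sqrt B * norm v"] by auto
      finally show ?thesis unfolding curve_length_def .
    qed
    also have "\<dots> < sqrt B * e" using B(1) yd by (simp add: v_def)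
    also have "\<dots> \<le> s" using B(1) by (simp add: e_def min_def field_simps)
    finally have "curve_length A g \<gamma> < s" .
    moreover have "\<gamma> 0 = x" "\<gamma> 1 = y"
        by (auto simp: \<gamma>_def l_def v_def chart_facts(6)[OF c(1)] c(2) yc)
    ultimately show ?thesis unfolding joined_below_def using pw by blast
  qed
  ultimately show ?thesis by blast
qed

text \<open>
  The end points of a curve can be moved by attaching two short segments.
\<close>

lemma open_joined_below: "open {z. joined_below s (fst z) (snd z)}"
proof (subst open_subopen, safe)
  fix x y assume "joined_below s (fst (x, y)) (snd (x, y))"
  then obtain \<gamma> where \<gamma>: "piecewise_C1_curve A \<gamma>" "\<gamma> 0 = x" "\<gamma> 1 = y" "curve_length A g \<gamma> < s"
    unfolding joined_below_def by auto
  define e where "e = (s - curve_length A g \<gamma>) / 3"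
  have e: "e > 0" using \<gamma> by (simp add: e_def)
  have "joined_below (s - 2 * e) x y" unfolding joined_below_def
    using \<gamma> by (intro exI[of _ \<gamma>]) (simp add: e_def field_simps)
  obtain V W where V: "open V" "x \<in> V" "\<And>x'. x' \<in> V \<Longrightarrow> joined_below e x x'"
    and W: "open W" "y \<in> W" "\<And>y'. y' \<in> W \<Longrightarrow> joined_below e y y'"
    using joined_below_locally[OF e] by metis
  have "joined_below s x' y'" if "x' \<in> V" "y' \<in> W" for x' y'
    using joined_below_trans[OF joined_below_trans[OF joined_below_sym[OF V(3)[OF that(1)]]
      \<open>joined_below (s - 2 * e) x y\<close>] W(3)[OF that(2)]] by simp
  then show "\<exists>T. open T \<and> (x, y) \<in> T \<and> T \<subseteq> {z. joined_below s (fst z) (snd z)}"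
    using V W by (intro exI[of _ "V \<times> W"]) (auto intro: open_Times)
qed

text \<open>
  The second case is that of points that are not joined by any curve, at the conventional distance
  \<open>Inf {}\<close>.
\<close>

lemma riemannian_dist_le_iff:
  "riemannian_dist A g x y \<le> t \<longleftrightarrow>
     (if \<exists>n. joined_below (real n) x y then \<forall>n. joined_below (t + 1 / Suc n) x y else Inf {} \<le> t)"
proof -
  let ?S = "{curve_length A g \<gamma> |\<gamma>. piecewise_C1_curve A \<gamma> \<and> \<gamma> 0 = x \<and> \<gamma> 1 = y}"
  have ex: "(\<exists>n. joined_below (real n) x y) \<longleftrightarrow> ?S \<noteq> {}"
    unfolding joined_below_def using reals_Archimedean2 by fastforce
  have bdd: "bdd_below ?S" using curve_length_nonneg by (intro bdd_belowI[of _ 0]) auto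
  show ?thesis
  proof (cases "?S = {}")
    case True then show ?thesis unfolding ex unfolding riemannian_dist_def True by simp
  next
    case False
    have lt: "Inf ?S < r \<longleftrightarrow> joined_below r x y" for r
      using cInf_less_iff[OF False bdd] unfolding joined_below_def by auto
    have "Inf ?S \<le> t \<longleftrightarrow> (\<forall>n. Inf ?S < t + 1 / Suc n)"
    proof
      assume "Inf ?S \<le> t"
      then show "\<forall>n. Inf ?S < t + 1 / Suc n" by (auto intro: le_less_trans)
    next
      assume *: "\<forall>n. Inf ?S < t + 1 / Suc n"
      show "Inf ?S \<le> t"
      proof (rule field_le_epsilon)
        fix e :: real assume "e > 0"
        then obtain n where "1 / Suc n < e" using nat_approx_posE by blast
        then show "Inf ?S \<le> t + e" using *[rule_format, of n] by linarith
      qed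
    qed
    then show ?thesis using False unfolding ex lt unfolding riemannian_dist_def by simp
  qed
qed

lemma measurable_riemannian_dist_le:
  "{z. riemannian_dist A g (fst z) (snd z) \<le> t} \<in> sets (borel \<Otimes>\<^sub>M borel)"
proof -
  have [measurable]: "{z. joined_below s (fst z) (snd z)} \<in> sets borel" for s
    using open_joined_below by (rule borel_open)
  have "{z. riemannian_dist A g (fst z) (snd z) \<le> t} =
     {z\<in>space borel. if \<exists>n. z \<in> {z. joined_below (real n) (fst z) (snd z)}
       then \<forall>n. z \<in> {z. joined_below (t + 1 / Suc n) (fst z) (snd z)} else Inf {} \<le> t}"
    unfolding riemannian_dist_le_iff by simp
  also have "\<dots> \<in> sets borel" by measurable
  finally show ?thesis unfolding borel_prod .
qed

end


section \<open>The Riemannian volume\<close>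

text \<open>
  Real functions are regarded as functions with values in \<open>real ^ 1\<close>.
\<close>

lemma has_absolute_integral_change_of_variables_to_real:
  fixes \<rho> :: "real^'n::{finite,wellorder} \<Rightarrow> real"
      and F :: "real^'n::{finite,wellorder} \<Rightarrow> real^'n::{finite,wellorder}"
  assumes "S \<in> sets lebesgue" "\<And>x. x \<in> S \<Longrightarrow> (F has_derivative F' x) (at x within S)" "inj_on F S"
  shows "((\<lambda>x. \<bar>det (matrix (F' x))\<bar> * \<rho> (F x)) absolutely_integrable_on S \<and>
           integral S (\<lambda>x. \<bar>det (matrix (F' x))\<bar> * \<rho> (F x)) = b)
     \<longleftrightarrow> (\<rho> absolutely_integrable_on (F ` S) \<and> integral (F ` S) \<rho> = b)"
  using has_absolute_integral_change_of_variables[OF assms, of "\<lambda>x. vec (\<rho> x) :: real^1" "vec b"]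
  unfolding absolutely_integrable_on_1_iff integral_on_1_eq integrable_on_1_iff
      absolutely_integrable_on_def
  by (auto simp: has_integral_iff)

lemma absolutely_integrable_iff_nn_integral:
  fixes f :: "'e::euclidean_space \<Rightarrow> real"
  assumes "(\<lambda>x. indicator S x * f x) \<in> borel_measurable borel" "\<And>x. 0 \<le> f x"
  shows "f absolutely_integrable_on S \<longleftrightarrow> (\<integral>\<^sup>+x\<in>S. ennreal (f x) \<partial>lborel) < \<infinity>"
    "f absolutely_integrable_on S \<Longrightarrow> (\<integral>\<^sup>+x\<in>S. ennreal (f x) \<partial>lborel) = ennreal (integral S f)"
proof -
  have m: "(\<lambda>x. indicator S x * f x) \<in> borel_measurable lborel" using assms(1) by simp
  have e: "ennreal (indicator S x * f x) = ennreal (f x) * indicator S x" for x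
    by (simp split: split_indicator)
  have "f absolutely_integrable_on S \<longleftrightarrow> integrable lebesgue (\<lambda>x. indicator S x * f x)"
    by (simp add: set_integrable_def)
  also have "\<dots> \<longleftrightarrow> integrable lborel (\<lambda>x. indicator S x * f x)"
    by (rule integrable_completion[OF m])
  also have "\<dots> \<longleftrightarrow> (\<integral>\<^sup>+x. ennreal (norm (indicator S x * f x)) \<partial>lborel) < \<infinity>"
    using m by (simp add: integrable_iff_bounded)
  also have "(\<lambda>x. ennreal (norm (indicator S x * f x))) = (\<lambda>x. ennreal (f x) * indicator S x)"
    using assms(2) e by (auto simp: abs_mult)
  finally show *: "f absolutely_integrable_on S \<longleftrightarrow> (\<integral>\<^sup>+x\<in>S. ennreal (f x) \<partial>lborel) < \<infinity>" .
  assume f: "f absolutely_integrable_on S"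
  then have i: "integrable lebesgue (\<lambda>x. indicator S x * f x)" by (simp add: set_integrable_def)
  have "(\<integral>\<^sup>+x\<in>S. ennreal (f x) \<partial>lborel) = (\<integral>\<^sup>+x. ennreal (indicator S x * f x) \<partial>lebesgue)"
    by (simp add: nn_integral_completion e)
  also have "\<dots> = ennreal (integral\<^sup>L lebesgue (\<lambda>x. indicator S x * f x))"
    using i assms(2) by (intro nn_integral_eq_integral) auto
  also have "integral\<^sup>L lebesgue (\<lambda>x. indicator S x * f x) = integral S f"
    using set_lebesgue_integral_eq_integral(2)[OF f] by (simp add: set_lebesgue_integral_def)
  finally show "(\<integral>\<^sup>+x\<in>S. ennreal (f x) \<partial>lborel) = ennreal (integral S f)" .
qed

text \<open>
  The equality includes the value \<open>\<infinity>\<close>, since one side is finite if and only if the other is. The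
  coercion to \<open>ennreal\<close> cuts off negative values, so both densities can be replaced by their
  positive parts.
\<close>

lemma nn_integral_change_of_variables:
  fixes \<rho> r :: "real^'n::{finite,wellorder} \<Rightarrow> real"
      and F :: "real^'n::{finite,wellorder} \<Rightarrow> real^'n::{finite,wellorder}"
  assumes S: "S \<in> sets borel" "\<And>x. x \<in> S \<Longrightarrow> (F has_derivative F' x) (at x within S)" "inj_on F S"
    and r: "\<And>x. x \<in> S \<Longrightarrow> r x = \<bar>det (matrix (F' x))\<bar> * \<rho> (F x)"
    and m: "(\<lambda>x. indicator S x * r x) \<in> borel_measurable borel"
      "(\<lambda>x. indicator (F ` S) x * \<rho> x) \<in> borel_measurable borel"
  shows "(\<integral>\<^sup>+x\<in>S. ennreal (r x) \<partial>lborel) = (\<integral>\<^sup>+x\<in>F ` S. ennreal (\<rho> x) \<partial>lborel)"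
proof -
  define r' where "r' = (\<lambda>x. max 0 (r x))"
  define \<rho>' where "\<rho>' = (\<lambda>x. max 0 (\<rho> x))"
  have "(\<lambda>x. indicator S x * r' x) = (\<lambda>x. max 0 (indicator S x * r x))"
    "(\<lambda>x. indicator (F ` S) x * \<rho>' x) = (\<lambda>x. max 0 (indicator (F ` S) x * \<rho> x))"
    by (auto simp: r'_def \<rho>'_def split: split_indicator)
  with m have m': "(\<lambda>x. indicator S x * r' x) \<in> borel_measurable borel"
    "(\<lambda>x. indicator (F ` S) x * \<rho>' x) \<in> borel_measurable borel" by simp_all
  have r': "r' x = \<bar>det (matrix (F' x))\<bar> * \<rho>' (F x)" if "x \<in> S" for x
    using r[OF that] by (auto simp: r'_def \<rho>'_def max_def mult_le_0_iff zero_le_mult_iff)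
  have S': "S \<in> sets lebesgue" using S(1) by simp
  have cov: "(r' absolutely_integrable_on S \<and> integral S r' = b) \<longleftrightarrow>
     (\<rho>' absolutely_integrable_on (F ` S) \<and> integral (F ` S) \<rho>' = b)" for b
  proof -
    have "(r' absolutely_integrable_on S) =
        ((\<lambda>x. \<bar>det (matrix (F' x))\<bar> * \<rho>' (F x)) absolutely_integrable_on S)"
      using r' by (intro set_integrable_cong) auto
    moreover have "integral S r' = integral S (\<lambda>x. \<bar>det (matrix (F' x))\<bar> * \<rho>' (F x))"
      using r' by (intro integral_cong) auto
    ultimately show ?thesis
      using has_absolute_integral_change_of_variables_to_real[OF S' S(2,3), of \<rho>' b] by simp
  qed
  have nn: "0 \<le> r' x" "0 \<le> \<rho>' x" for x by (auto simp: r'_def \<rho>'_def)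
  have "(\<integral>\<^sup>+x\<in>S. ennreal (r' x) \<partial>lborel) = (\<integral>\<^sup>+x\<in>F ` S. ennreal (\<rho>' x) \<partial>lborel)"
  proof (cases "r' absolutely_integrable_on S")
    case True
    then show ?thesis using cov[of "integral S r'"]
        absolutely_integrable_iff_nn_integral(2)[OF m'(1) nn(1)]
      absolutely_integrable_iff_nn_integral(2)[OF m'(2) nn(2)] by simp
  next
    case False
    moreover have "\<not> \<rho>' absolutely_integrable_on (F ` S)" using False cov by blast
    ultimately show ?thesis
      using absolutely_integrable_iff_nn_integral(1)[OF m'(1) nn(1)]
      absolutely_integrable_iff_nn_integral(1)[OF m'(2) nn(2)] by (simp add: less_top[symmetric])
  qed
  then show ?thesis by (simp add: r'_def \<rho>'_def ennreal_max_0)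
qed

context riemannian begin

definition chart_density :: "('a, 'n) chart \<Rightarrow> (real, 'n) vec \<Rightarrow> real" where
  "chart_density c x = sqrt (det (gram_matrix g c (chart_inv c x)))"

definition chart_volume :: "('a, 'n) chart \<Rightarrow> 'a set \<Rightarrow> ennreal" where
  "chart_volume c B = (\<integral>\<^sup>+x\<in>snd c ` B. ennreal (chart_density c x) \<partial>lborel)"

lemma is_riemannian_volume_iff:
  "is_riemannian_volume A g \<mu> \<longleftrightarrow> sets \<mu> = sets borel \<and>
     (\<forall>c\<in>A. \<forall>B\<in>sets borel. B \<subseteq> fst c \<longrightarrow> emeasure \<mu> B = chart_volume c B)"
  unfolding is_riemannian_volume_def chart_volume_def chart_density_def ..

text \<open>
  If \<open>J\<close> is the Jacobian matrix of \<open>f\<close> in the two charts, invariance of the metric says that the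
  Gram matrices satisfy \<open>G = J\<^sup>T G' J\<close>; determinants are multiplicative.
\<close>

lemma chart_density_transfer:
  assumes f: "smooth_map A f" "preserves_metric A g f" and c: "c \<in> A" "c' \<in> A"
    and p: "p \<in> fst c" "f p \<in> fst c'"
  shows "chart_density c (snd c p) =
    \<bar>det (matrix (frechet_derivative (coord_rep c c' f) (at (snd c p))))\<bar> * chart_density c'
        (snd c' (f p))"
proof -
  let ?D = "frechet_derivative (coord_rep c c' f) (at (snd c p))"
  let ?J = "matrix ?D"
  let ?G = "gram_matrix g c' (f p)"
  have b: "bilinear (g c' (f p))" by (rule metric_at[OF c(2) p(2)])
  have "gram_matrix g c p = transpose ?J ** ?G ** ?J"
  proof (simp add: vec_eq_iff, intro allI)
    fix i j
    have e: "?D (axis i 1) = (\<Sum>k\<in>UNIV. (?J $ k $ i) *\<^sub>R axis k 1)" for i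
      using basis_expansion[of "?D (axis i 1)"] by (simp add: matrix_def scalar_mult_eq_scaleR)
    have "gram_matrix g c p $ i $ j = g c' (f p) (?D (axis i 1)) (?D (axis j 1))"
      using f(2) c p unfolding gram_matrix_def preserves_metric_def Let_def by auto
    also have "\<dots> = (\<Sum>(k,l)\<in>UNIV \<times> UNIV. g c' (f p) ((?J $ k $ i) *\<^sub>R axis k 1)
        ((?J $ l $ j) *\<^sub>R axis l 1))"
      unfolding e by (rule bilinear_sum[OF b])
    also have "\<dots> = (\<Sum>l\<in>UNIV. \<Sum>k\<in>UNIV. ?J $ k $ i * ?G $ k $ l * ?J $ l $ j)"
      by (subst sum.swap) (simp add: sum.cartesian_product bilinear_lmul[OF b] bilinear_rmul[OF b]
          gram_matrix_def mult_ac)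
    also have "\<dots> = (transpose ?J ** ?G ** ?J) $ i $ j"
      by (simp add: matrix_matrix_mult_def transpose_def sum_distrib_right)
    finally show "gram_matrix g c p $ i $ j = (transpose ?J ** ?G ** ?J) $ i $ j" .
  qed
  then have "det (gram_matrix g c p) = (det ?J)\<^sup>2 * det ?G"
    by (simp add: det_mul power2_eq_square)
  then show ?thesis
    unfolding chart_density_def by (simp add: chart_facts(6) c p real_sqrt_mult)
qed

lemma chart_image_measurable:
  assumes c: "c \<in> A" and B: "B \<in> sets borel" "B \<subseteq> fst c"
  shows "snd c ` B \<in> sets borel"
proof -
  let ?U = "snd c ` fst c"
  have U: "?U \<in> sets borel" using chart_facts(2)[OF c] by simp
  have "chart_inv c \<in> borel_measurable (restrict_space borel ?U)"
    by (intro borel_measurable_continuous_on_restrict chart_facts(4)[OF c])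
  from measurable_sets[OF this B(1)]
  have "chart_inv c -` B \<inter> ?U \<in> sets borel"
    using U by (auto simp: sets_restrict_space space_restrict_space)
  also have "chart_inv c -` B \<inter> ?U = snd c ` B"
    using B(2) chart_facts(6)[OF c] by auto
  finally show ?thesis .
qed

lemma chart_density_measurable:
  assumes c: "c \<in> A" and S: "S \<in> sets borel" "S \<subseteq> snd c ` fst c"
  shows "(\<lambda>x. indicator S x * chart_density c x) \<in> borel_measurable borel"
proof -
  have "continuous_on (snd c ` fst c) (\<lambda>x. g c (chart_inv c x) u v)" for u v
    using metric c unfolding riemannian_metric_def by (blast intro: smooth_on_continuous_on)
  then have "continuous_on (snd c ` fst c) (chart_density c)"
    unfolding chart_density_def det_def gram_matrix_def by (auto intro!: continuous_intros)
  then have "continuous_on S (chart_density c)" by (rule continuous_on_subset[OF _ S(2)])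
  from borel_measurable_continuous_on_indicator[OF S(1) this] show ?thesis by simp
qed

lemma chart_volume_suminf:
  assumes c: "c \<in> A" and B: "\<And>n. B n \<in> sets borel" "\<And>n. B n \<subseteq> fst c"
      "disjoint_family (B :: nat \<Rightarrow> 'a set)"
  shows "(\<Sum>n. chart_volume c (B n)) = chart_volume c (\<Union>n. B n)"
proof -
  have m: "(\<lambda>x. ennreal (chart_density c x) * indicator (snd c ` B n) x) \<in> borel_measurable lborel"
      for n
  proof -
    have S: "snd c ` B n \<in> sets borel" "snd c ` B n \<subseteq> snd c ` fst c"
      using chart_image_measurable[OF c B(1,2)] B(2) by auto
    have "(\<lambda>x. ennreal (chart_density c x) * indicator (snd c ` B n) x) =
       (\<lambda>x. ennreal (indicator (snd c ` B n) x * chart_density c x))"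
      by (auto split: split_indicator)
    with chart_density_measurable[OF c S] show ?thesis by simp
  qed
  have d: "disjoint_family (\<lambda>n. snd c ` B n)"
    using B(2,3) chart_facts(5)[OF c] unfolding disjoint_family_on_def
    by (metis image_empty inj_on_image_Int)
  have "(\<Sum>n. chart_volume c (B n)) =
     (\<integral>\<^sup>+x. (\<Sum>n. ennreal (chart_density c x) * indicator (snd c ` B n) x) \<partial>lborel)"
    unfolding chart_volume_def by (rule nn_integral_suminf[symmetric, OF m])
  also have "\<dots> = (\<integral>\<^sup>+x. ennreal (chart_density c x) * indicator (\<Union>n. snd c ` B n) x \<partial>lborel)"
    by (simp add: suminf_indicator[OF d])
  finally show ?thesis unfolding chart_volume_def image_UN .
qed

lemma isometry_borel:
  assumes f: "riemannian_isometry A g f" and B: "B \<in> sets borel"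
  shows "f ` B \<in> sets borel" "f -` B \<in> sets borel"
proof -
  have "bij f" and s: "continuous_on UNIV f" "continuous_on UNIV (inv f)"
    using f unfolding riemannian_isometry_def smooth_map_def by auto
  have "f \<in> borel_measurable borel" "inv f \<in> borel_measurable borel"
    using s by (auto intro: borel_measurable_continuous_onI)
  then show "f ` B \<in> sets borel" "f -` B \<in> sets borel"
    using measurable_sets[OF _ B, of "inv f" borel] measurable_sets[OF _ B, of f borel]
    by (simp_all add: bij_vimage_eq_inv_image[OF bij_imp_bij_inv[OF \<open>bij f\<close>]]
        inv_inv_eq[OF \<open>bij f\<close>])
qed

text \<open>
  The Jacobian determinant in the change of variables formula is exactly the factor between the two
  densities. For \<open>f = id\<close> this is the agreement of local volumes where two charts overlap.
\<close>

lemma chart_volume_transfer: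
  assumes f: "riemannian_isometry A g f" and c: "c \<in> A" "c' \<in> A"
    and B: "B \<in> sets borel" "B \<subseteq> fst c" "f ` B \<subseteq> fst c'"
  shows "chart_volume c B = chart_volume c' (f ` B)"
proof -
  have f': "smooth_map A f" "preserves_metric A g f" "inj f"
    using f unfolding riemannian_isometry_def by (auto simp: bij_is_inj)
  let ?F = "coord_rep c c' f"
  have F: "?F (snd c p) = snd c' (f p)" if "p \<in> B" for p
    using that B(2) by (auto simp: coord_rep_def chart_facts(6)[OF c(1)])
  then have FB: "?F ` snd c ` B = snd c' ` f ` B" by (force simp: image_iff)
  have fB: "f ` B \<in> sets borel" using isometry_borel[OF f B(1)] by simp
  have "(\<integral>\<^sup>+x\<in>snd c ` B. ennreal (chart_density c x) \<partial>lborel) =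
     (\<integral>\<^sup>+x\<in>?F ` snd c ` B. ennreal (chart_density c' x) \<partial>lborel)"
  proof (rule nn_integral_change_of_variables)
    show "snd c ` B \<in> sets borel" by (rule chart_image_measurable[OF c(1) B(1,2)])
    fix x assume "x \<in> snd c ` B"
    then obtain p where p: "p \<in> B" "x = snd c p" by auto
    then have p': "p \<in> fst c" "f p \<in> fst c'" using B by auto
    show "(?F has_derivative frechet_derivative ?F (at x)) (at x within snd c ` B)"
      unfolding p(2) using coord_rep_has_derivative[OF f'(1) c p']
          by (rule has_derivative_at_withinI)
    show "chart_density c x = \<bar>det (matrix (frechet_derivative ?F (at x)))\<bar> *
        chart_density c' (?F x)"
      unfolding p(2) F[OF p(1)] by (rule chart_density_transfer[OF f'(1,2) c p'])
  next
    show "inj_on ?F (snd c ` B)"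
    proof (rule inj_onI, safe)
      fix p q assume "p \<in> B" "q \<in> B" "?F (snd c p) = ?F (snd c q)"
      then have "f p = f q" using F chart_facts(5)[OF c(2)] B(3) by (metis image_subset_iff inj_onD)
      then show "snd c p = snd c q" using f'(3) by (metis injD)
    qed
    show "(\<lambda>x. indicator (snd c ` B) x * chart_density c x) \<in> borel_measurable borel"
      by (rule chart_density_measurable[OF c(1)])
          (use chart_image_measurable[OF c(1) B(1,2)] B in auto)
    show "(\<lambda>x. indicator (?F ` snd c ` B) x * chart_density c' x) \<in> borel_measurable borel"
      unfolding FB
      by (rule chart_density_measurable[OF c(2)])
          (use chart_image_measurable[OF c(2) fB B(3)] B in auto)
  qed
  then show ?thesis unfolding chart_volume_def FB .
qed

lemma isometry_id: "riemannian_isometry A g id"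
  unfolding riemannian_isometry_def using smooth_id preserves_id by simp

text \<open>
  A Lindelof cover by chart domains, made disjoint.
\<close>

lemma countable_chart_cover:
  obtains c :: "nat \<Rightarrow> ('a, 'n) chart" and U where "\<And>n. c n \<in> A" "\<And>n. U n \<in> sets borel"
    "\<And>n. U n \<subseteq> fst (c n)" "disjoint_family U" "(\<Union>n. U n) = UNIV"
proof -
  have "\<And>S. S \<in> fst ` A \<Longrightarrow> open S" using chart_facts(1) by auto
  then obtain F where F: "F \<subseteq> fst ` A" "countable F" "\<Union>F = \<Union>(fst ` A)"
    using Lindelof[of "fst ` A"] by metis
  have U: "\<Union>F = UNIV" using F(3) chart_cover by auto
  then have ne: "F \<noteq> {}" by auto
  have "\<exists>c. c \<in> A \<and> fst c = from_nat_into F n" for n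
    using from_nat_into[OF ne, of n] F(1) by (metis imageE subsetD)
  then obtain c where c: "\<And>n. c n \<in> A" "\<And>n. fst (c n) = from_nat_into F n" by metis
  have "(\<Union>n. fst (c n)) = UNIV" using U range_from_nat_into[OF ne F(2)] c(2) by auto
  moreover have "disjointed (\<lambda>n. fst (c n)) n \<in> sets borel" for n
    unfolding disjointed_def using chart_facts(1)[OF c(1)] by (intro sets.Diff sets.finite_UN) auto
  ultimately show thesis
    by (intro that[of c "disjointed (\<lambda>n. fst (c n))"] c(1) disjointed_subset
        disjoint_family_disjointed)
      (simp_all add: UN_disjointed_eq)
qed

text \<open>
  Cutting along a countable cover and adding up the local volumes gives the correct value on
  every Borel set inside a single chart. With \<open>f = id\<close> this yields existence of the volume
  measure, with an isometry it yields invariance.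
\<close>

lemma chart_volume_glue:
  assumes f: "riemannian_isometry A g f"
    and cover: "\<And>n. c n \<in> A" "\<And>n. U n \<in> sets borel" "\<And>n. U n \<subseteq> fst (c n)" "disjoint_family U"
      "(\<Union>n::nat. U n) = UNIV"
    and B: "c' \<in> A" "B \<in> sets borel" "B \<subseteq> fst c'"
  shows "(\<Sum>n. chart_volume (c n) (f -` B \<inter> U n)) = chart_volume c' B"
proof -
  have bij: "bij f" using f unfolding riemannian_isometry_def by auto
  have m: "f -` B \<inter> U n \<in> sets borel" for n using isometry_borel[OF f B(2)] cover(2) by auto
  have "(\<Sum>n. chart_volume (c n) (f -` B \<inter> U n)) = (\<Sum>n. chart_volume c' (f ` (f -` B \<inter> U n)))"
    using m cover(3) B(3)
    by (intro suminf_cong chart_volume_transfer[OF f cover(1) B(1)]) auto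
  also have "\<dots> = chart_volume c' (\<Union>n. f ` (f -` B \<inter> U n))"
  proof (rule chart_volume_suminf[OF B(1)])
    show "f ` (f -` B \<inter> U n) \<in> sets borel" for n using isometry_borel[OF f m] by simp
    show "disjoint_family (\<lambda>n. f ` (f -` B \<inter> U n))"
      unfolding disjoint_family_on_def
    proof (intro ballI impI)
      fix k l :: nat assume "k \<noteq> l"
      then have "(f -` B \<inter> U k) \<inter> (f -` B \<inter> U l) = {}"
        using cover(4) unfolding disjoint_family_on_def by blast
      then show "f ` (f -` B \<inter> U k) \<inter> f ` (f -` B \<inter> U l) = {}"
        by (metis image_Int[OF bij_is_inj[OF bij]] image_empty)
    qed
  qed (use B in auto)
  also have "(\<Union>n. f ` (f -` B \<inter> U n)) = B"
  proof -
    have "(\<Union>n. f ` (f -` B \<inter> U n)) = f ` (f -` B \<inter> (\<Union>n. U n))" by blast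
    also have "\<dots> = B" unfolding cover(5) using bij by (simp add: bij_is_surj surj_image_vimage_eq)
    finally show ?thesis .
  qed
  finally show ?thesis .
qed

text \<open>
  Local volumes added up over the pieces of a disjoint countable cover form a measure, and gluing
  shows that it has the prescribed density in every chart. A second measure with this property
  agrees with it on every piece.
\<close>

lemma ex1_riemannian_volume: "\<exists>!\<mu>. is_riemannian_volume A g \<mu>"
proof -
  obtain c :: "nat \<Rightarrow> ('a, 'n) chart" and U where cover: "\<And>n. c n \<in> A" "\<And>n. U n \<in> sets borel"
    "\<And>n. U n \<subseteq> fst (c n)" "disjoint_family U" "(\<Union>n. U n) = UNIV"
    by (rule countable_chart_cover; rule that)
  define m where "m B = (\<Sum>n. chart_volume (c n) (B \<inter> U n))" for B
  define \<mu> where "\<mu> = measure_of UNIV (sets borel) m"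
  have m0: "m {} = 0" by (simp add: m_def chart_volume_def)
  have "countably_additive (sets borel) m"
  proof (rule countably_additiveI)
    fix B :: "nat \<Rightarrow> 'a set" assume B: "range B \<subseteq> sets borel" "disjoint_family B"
    have "(\<Sum>i. m (B i)) = (\<Sum>i. \<integral>\<^sup>+n. chart_volume (c n) (B i \<inter> U n) \<partial>count_space UNIV)"
      by (simp add: m_def nn_integral_count_space_nat)
    also have "\<dots> = (\<integral>\<^sup>+n. (\<Sum>i. chart_volume (c n) (B i \<inter> U n)) \<partial>count_space UNIV)"
      by (rule nn_integral_suminf[symmetric]) simp
    also have "\<dots> = (\<integral>\<^sup>+n. chart_volume (c n) ((\<Union>i. B i) \<inter> U n) \<partial>count_space UNIV)"
    proof (rule nn_integral_cong)
      fix n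
      have "(\<Sum>i. chart_volume (c n) (B i \<inter> U n)) = chart_volume (c n) (\<Union>i. B i \<inter> U n)"
        using B cover(2,3)[of n]
        by (intro chart_volume_suminf[OF cover(1)] disjoint_family_on_bisimulation[OF B(2)]
            sets.Int) auto
      then show "(\<Sum>i. chart_volume (c n) (B i \<inter> U n)) = chart_volume (c n) ((\<Union>i. B i) \<inter> U n)"
        by simp
    qed
    also have "\<dots> = m (\<Union>i. B i)" by (simp add: m_def nn_integral_count_space_nat)
    finally show "(\<Sum>i. m (B i)) = m (\<Union>i. B i)" .
  qed
  moreover have sb: "sigma_sets UNIV (sets borel) = sets (borel :: 'a measure)"
    using sets.sigma_sets_eq[of "borel :: 'a measure"] by simp
  ultimately have em: "emeasure \<mu> B = m B" if "B \<in> sets borel" for B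
    using that m0 unfolding \<mu>_def by (intro emeasure_measure_of[OF refl]) (auto simp: positive_def)
  have sm: "sets \<mu> = sets borel" unfolding \<mu>_def by (simp add: sb)
  have "is_riemannian_volume A g \<mu>"
    unfolding is_riemannian_volume_iff
    using sm em chart_volume_glue[OF isometry_id cover] by (auto simp: m_def)
  moreover have "\<mu>1 = \<mu>" if 1: "is_riemannian_volume A g \<mu>1" for \<mu>1
  proof (rule measure_eqI)
    show "sets \<mu>1 = sets \<mu>" using 1 sm unfolding is_riemannian_volume_iff by simp
    fix B assume "B \<in> sets \<mu>1"
    then have B: "B \<in> sets borel" using 1 unfolding is_riemannian_volume_iff by auto
    have s1: "sets \<mu>1 = sets borel" using 1 unfolding is_riemannian_volume_iff by simp
    have "emeasure \<mu>1 B = emeasure \<mu>1 (\<Union>n. B \<inter> U n)" unfolding Int_UN_distrib[symmetric] cover(5)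
        by simp
    also have "\<dots> = (\<Sum>n. emeasure \<mu>1 (B \<inter> U n))"
      using B cover(2) s1 by (intro suminf_emeasure[symmetric]
          disjoint_family_on_bisimulation[OF cover(4)]) auto
    also have "\<dots> = m B" unfolding m_def
    proof (rule suminf_cong)
      fix n
      have "B \<inter> U n \<in> sets borel" "B \<inter> U n \<subseteq> fst (c n)" using B cover(2,3) by auto
      then show "emeasure \<mu>1 (B \<inter> U n) = chart_volume (c n) (B \<inter> U n)"
        using 1 cover(1) unfolding is_riemannian_volume_iff by blast
    qed
    finally show "emeasure \<mu>1 B = emeasure \<mu> B" using em[OF B] by simp
  qed
  ultimately show ?thesis by blast
qed

lemma riemannian_volume:
  "sets (riemannian_volume A g) = sets borel"
  "c \<in> A \<Longrightarrow> B \<in> sets borel \<Longrightarrow> B \<subseteq> fst c \<Longrightarrow> emeasure (riemannian_volume A g) B = chart_volume c B"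
  using theI'[OF ex1_riemannian_volume, folded riemannian_volume_def, unfolded
      is_riemannian_volume_iff] by blast+

text \<open>
  The image measure has the property that characterises the volume.
\<close>

lemma riemannian_volume_isometry:
  assumes f: "riemannian_isometry A g f"
  shows "distr (riemannian_volume A g) borel f = riemannian_volume A g"
proof -
  let ?\<mu> = "riemannian_volume A g"
  obtain c :: "nat \<Rightarrow> ('a, 'n) chart" and U where cover: "\<And>n. c n \<in> A" "\<And>n. U n \<in> sets borel"
    "\<And>n. U n \<subseteq> fst (c n)" "disjoint_family U" "(\<Union>n. U n) = UNIV"
    by (rule countable_chart_cover; rule that)
  have "continuous_on UNIV f" using f unfolding riemannian_isometry_def smooth_map_def by auto
  then have f': "f \<in> measurable ?\<mu> borel"
    using riemannian_volume(1) by (simp add: borel_measurable_continuous_onI cong: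
        measurable_cong_sets)
  have sp: "space ?\<mu> = UNIV" using riemannian_volume(1) sets_eq_imp_space_eq by fastforce
  have "is_riemannian_volume A g (distr ?\<mu> borel f)"
    unfolding is_riemannian_volume_iff
  proof (intro conjI ballI impI)
    fix c' B assume B: "c' \<in> A" "B \<in> sets borel" "B \<subseteq> fst c'"
    have fB: "f -` B \<in> sets borel" by (rule isometry_borel[OF f B(2)])
    have "emeasure (distr ?\<mu> borel f) B = emeasure ?\<mu> (\<Union>n. f -` B \<inter> U n)"
      unfolding Int_UN_distrib[symmetric] cover(5) using f' B(2) by (simp add: emeasure_distr sp)
    also have "\<dots> = (\<Sum>n. emeasure ?\<mu> (f -` B \<inter> U n))"
      using fB cover(2) riemannian_volume(1)
      by (intro suminf_emeasure[symmetric] disjoint_family_on_bisimulation[OF cover(4)]) auto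
    also have "\<dots> = (\<Sum>n. chart_volume (c n) (f -` B \<inter> U n))"
      using fB cover(2,3) by (intro suminf_cong riemannian_volume(2)[OF cover(1)]) auto
    also have "\<dots> = chart_volume c' B" by (rule chart_volume_glue[OF f cover B])
    finally show "emeasure (distr ?\<mu> borel f) B = chart_volume c' B" .
  qed simp
  then show ?thesis
    by (rule the1_equality[OF ex1_riemannian_volume, folded riemannian_volume_def, symmetric])
qed

lemma riemannian_volume_singleton: "emeasure (riemannian_volume A g) {p} = 0"
proof -
  obtain c where c: "c \<in> A" "p \<in> fst c" using chart_cover by blast
  have "emeasure (riemannian_volume A g) {p} = chart_volume c {p}"
    using c by (intro riemannian_volume(2)) auto
  also have "\<dots> = 0" unfolding chart_volume_def
  proof (subst nn_integral_0_iff_AE)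
    have "snd c ` {p} \<in> sets borel" by simp
    from chart_density_measurable[OF c(1) this] c(2)
    have "(\<lambda>x. ennreal (indicator (snd c ` {p}) x * chart_density c x)) \<in> borel_measurable lborel"
        by simp
    also have "(\<lambda>x. ennreal (indicator (snd c ` {p}) x * chart_density c x)) =
       (\<lambda>x. ennreal (chart_density c x) * indicator (snd c ` {p}) x)"
      by (auto split: split_indicator)
    finally show "(\<lambda>x. ennreal (chart_density c x) * indicator (snd c ` {p}) x) \<in>
        borel_measurable lborel" .
    have "AE x in lborel. x \<noteq> snd c p" by (rule AE_lborel_singleton)
    then show "AE x in lborel. ennreal (chart_density c x) * indicator (snd c ` {p}) x = 0"
      by eventually_elim simp
  qed
  finally show ?thesis .
qed

text \<open>
  A point process is finite on compact sets for every outcome, so compact sets serve as windows that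
  contain finitely many points.
\<close>

lemma countable_compact_cover:
  obtains K :: "nat \<Rightarrow> 'a set" where "\<And>n. compact (K n)" "(\<Union>n. K n) = UNIV"
proof -
  define F where "F = {W :: 'a set. open W \<and> (\<exists>K. compact K \<and> W \<subseteq> K)}"
  have "\<exists>W\<in>F. p \<in> W" for p
  proof -
    obtain c where c: "c \<in> A" "p \<in> fst c" using chart_cover by blast
    obtain r where r: "r > 0" "cball (snd c p) r \<subseteq> snd c ` fst c"
      using chart_facts(2)[OF c(1)] c(2) open_contains_cball by blast
    let ?W = "fst c \<inter> snd c -` ball (snd c p) r"
    have "open ?W"
      using chart_facts(1,3)[OF c(1)] by (intro continuous_open_preimage) auto
    moreover have "compact (chart_inv c ` cball (snd c p) r)"
      by (intro compact_continuous_image continuous_on_subset[OF chart_facts(4)[OF c(1)] r(2)]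
          compact_cball)
    moreover have "?W \<subseteq> chart_inv c ` cball (snd c p) r"
    proof
      fix q assume "q \<in> ?W"
      then have q: "chart_inv c (snd c q) = q" "snd c q \<in> ball (snd c p) r"
        using chart_facts(6)[OF c(1), of q] by blast+
      have "snd c q \<in> cball (snd c p) r" using q(2) ball_subset_cball by blast
      then show "q \<in> chart_inv c ` cball (snd c p) r" using imageI[of _ _ "chart_inv c"] q(1)
          by metis
    qed
    moreover have "p \<in> ?W" using c r by auto
    ultimately have "?W \<in> F" "p \<in> ?W" unfolding F_def by auto
    then show ?thesis ..
  qed
  then have U: "\<Union>F = UNIV" by auto
  obtain F' where F': "F' \<subseteq> F" "countable F'" "\<Union>F' = \<Union>F"
    by (rule Lindelof[of F]) (auto simp: F_def)
  have ne: "F' \<noteq> {}" using F' U by auto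
  have "\<exists>K. compact K \<and> from_nat_into F' n \<subseteq> K" for n
    using from_nat_into[OF ne, of n] F'(1) unfolding F_def by auto
  then obtain K where K: "\<And>n. compact (K n)" "\<And>n. from_nat_into F' n \<subseteq> K n" by metis
  have "(\<Union>n. K n) = UNIV"
  proof -
    have "\<exists>n\<in>UNIV. p \<in> K n" for p
    proof -
      obtain W where "W \<in> F'" "p \<in> W" using F'(3) U by blast
      then obtain n where "p \<in> from_nat_into F' n" using from_nat_into_surj[OF F'(2)] by metis
      then show ?thesis using K(2) by blast
    qed
    then show ?thesis by auto
  qed
  then show thesis using that K(1) by blast
qed

end


section \<open>Configurations of points\<close>

text \<open>
  With values in \<open>[0, \<infinity>]\<close>, sums over the points of an infinite configuration make sense.
\<close>

definition sum_over :: "'a set \<Rightarrow> ('a \<Rightarrow> ennreal) \<Rightarrow> ennreal" where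
  "sum_over X F = (\<integral>\<^sup>+x. F x \<partial>count_space X)"

lemma sum_over_finite: "finite X \<Longrightarrow> sum_over X F = (\<Sum>x\<in>X. F x)"
  unfolding sum_over_def by (rule nn_integral_count_space_finite)

lemma sum_over_add: "sum_over X (\<lambda>x. F x + G x) = sum_over X F + sum_over X G"
  unfolding sum_over_def by (rule nn_integral_add) auto

lemma sum_over_cmult: "sum_over X (\<lambda>x. c * F x) = c * sum_over X F"
  unfolding sum_over_def by (rule nn_integral_cmult) auto

lemma sum_over_multc: "sum_over X (\<lambda>x. F x * c) = sum_over X F * c"
  unfolding sum_over_def by (rule nn_integral_multc) auto

lemma sum_over_suminf: "sum_over X (\<lambda>x. \<Sum>n. F n x) = (\<Sum>n. sum_over X (F n))"
  unfolding sum_over_def by (rule nn_integral_suminf) auto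

lemma sum_over_mono: "(\<And>x. x \<in> X \<Longrightarrow> F x \<le> G x) \<Longrightarrow> sum_over X F \<le> sum_over X G"
  unfolding sum_over_def by (intro nn_integral_mono) auto

lemma sum_over_cong: "(\<And>x. x \<in> X \<Longrightarrow> F x = G x) \<Longrightarrow> sum_over X F = sum_over X G"
  unfolding sum_over_def by (intro nn_integral_cong) auto

lemma sum_over_Int: "sum_over (X \<inter> B) F = sum_over X (\<lambda>x. indicator B x * F x)"
proof -
  have "sum_over (X \<inter> B) F = (\<integral>\<^sup>+x. F x * indicator (X \<inter> B) x \<partial>count_space UNIV)"
    unfolding sum_over_def by (simp add: nn_integral_count_space_indicator)
  also have "\<dots> = (\<integral>\<^sup>+x. (indicator B x * F x) * indicator X x \<partial>count_space UNIV)"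
    by (intro nn_integral_cong) (simp split: split_indicator)
  finally show ?thesis unfolding sum_over_def by (simp add: nn_integral_count_space_indicator)
qed

lemma sum_over_remove: "x \<in> X \<Longrightarrow> sum_over X F = F x + sum_over (X - {x}) F"
proof -
  assume x: "x \<in> X"
  have "sum_over X F = sum_over X (\<lambda>y. indicator {x} y * F y + indicator (- {x}) y * F y)"
    by (intro sum_over_cong) (simp split: split_indicator)
  also have "\<dots> = sum_over (X \<inter> {x}) F + sum_over (X \<inter> - {x}) F"
    unfolding sum_over_Int by (rule sum_over_add)
  also have "X \<inter> {x} = {x}" using x by auto
  finally show ?thesis by (simp add: sum_over_finite Diff_eq)
qed

lemma sum_over_SUP: "incseq F \<Longrightarrow> sum_over X (\<lambda>x. SUP i::nat. F i x) = (SUP i. sum_over X (F i))"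
  unfolding sum_over_def by (rule nn_integral_monotone_convergence_SUP)
      (auto simp: incseq_def le_fun_def)

lemma sum_over_indicator: "finite (X \<inter> B) \<Longrightarrow> sum_over X (indicator B) = of_nat (card (X \<inter> B))"
  using sum_over_Int[of X B "\<lambda>_. 1"] by (simp add: sum_over_finite)

text \<open>
  The uniqueness theorem for measures, stated for countably additive set functions. It is applied to
  expectations of sums over random points, which are given by formulas and not as measures.
\<close>

lemma countably_additive_eqI:
  assumes G: "Int_stable G" "G \<subseteq> Pow S" "S \<in> G"
    and a: "a {} = (0::ennreal)" "countably_additive (sigma_sets S G) a"
    and b: "b {} = 0" "countably_additive (sigma_sets S G) b"
    and eq: "\<And>X. X \<in> G \<Longrightarrow> a X = b X" and fin: "a S < \<infinity>" and X: "X \<in> sigma_sets S G"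
  shows "a X = b X"
proof -
  interpret s: sigma_algebra S "sigma_sets S G" by (rule sigma_algebra_sigma_sets[OF G(2)])
  have sub: "sigma_sets S G \<subseteq> Pow S" using sigma_sets_into_sp[OF G(2)] by auto
  have ss: "sigma_sets S (sigma_sets S G) = sigma_sets S G" by (rule s.sigma_sets_eq)
  have A: "emeasure (measure_of S (sigma_sets S G) a) Y = a Y" if "Y \<in> sigma_sets S G" for Y
    by (rule emeasure_measure_of[OF refl sub]) (use a that ss in \<open>auto simp: positive_def sub\<close>)
  have B: "emeasure (measure_of S (sigma_sets S G) b) Y = b Y" if "Y \<in> sigma_sets S G" for Y
    by (rule emeasure_measure_of[OF refl sub]) (use b that ss in \<open>auto simp: positive_def sub\<close>)
  have GS: "Y \<in> sigma_sets S G" if "Y \<in> G" for Y using that by (rule sigma_sets.Basic)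
  have "measure_of S (sigma_sets S G) a = measure_of S (sigma_sets S G) b"
  proof (rule measure_eqI_generator_eq[OF G(1,2)])
    show "range (\<lambda>_::nat. S) \<subseteq> G" using G(3) by auto
    show "emeasure (measure_of S (sigma_sets S G) a) S \<noteq> \<infinity>" using A[OF GS[OF G(3)]] fin by simp
  qed (use A B GS eq ss sub in auto)
  with A[OF X] B[OF X] show ?thesis by simp
qed

text \<open>
  The windows \<open>H m\<close> exhaust the space. A configuration is a set with finitely many points in each
  window, and a Borel set is called bounded if some window contains it. The numbers of points in
  bounded Borel sets generate the \<open>\<sigma>\<close>-algebra on the configurations, which makes a point process
  without multiple points a random element of this space.
\<close>

locale config =
  fixes H :: "nat \<Rightarrow> 'a::{t2_space,second_countable_topology} set"
  assumes H_borel[measurable]: "\<And>m. H m \<in> sets borel" and H_inc: "incseq H"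
      and H_cover: "(\<Union>m. H m) = UNIV"
begin

definition configs :: "'a set set" where "configs = {X. \<forall>m. finite (X \<inter> H m)}"

definition bounded_borel :: "'a set set" where "bounded_borel = {B \<in> sets borel. \<exists>m. B \<subseteq> H m}"

definition config_space :: "'a set measure" where
  "config_space = sigma configs {{X \<in> configs. card (X \<inter> B) = k} |B k. B \<in> bounded_borel}"

lemma space_config_space[simp]: "space config_space = configs"
  unfolding config_space_def by (rule space_measure_of) auto

lemma bounded_borel_borel: "B \<in> bounded_borel \<Longrightarrow> B \<in> sets borel" by (simp add: bounded_borel_def)

lemma H_bounded_borel: "B \<in> sets borel \<Longrightarrow> H m \<inter> B \<in> bounded_borel" by (auto simp: bounded_borel_def)

lemma bounded_borel_Int: "B \<in> bounded_borel \<Longrightarrow> A \<in> sets borel \<Longrightarrow> B \<inter> A \<in> bounded_borel"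
    by (auto simp: bounded_borel_def)

lemma configs_finite: "X \<in> configs \<Longrightarrow> B \<in> bounded_borel \<Longrightarrow> finite (X \<inter> B)"
proof -
  assume X: "X \<in> configs" and "B \<in> bounded_borel"
  then obtain m where "B \<subseteq> H m" unfolding bounded_borel_def by auto
  then have "X \<inter> B \<subseteq> X \<inter> H m" by auto
  moreover have "finite (X \<inter> H m)" using X by (simp add: configs_def)
  ultimately show ?thesis by (rule finite_subset)
qed

lemma configs_mono: "X \<in> configs \<Longrightarrow> Y \<subseteq> X \<Longrightarrow> Y \<in> configs"
  unfolding configs_def using finite_subset[OF Int_mono[OF _ order_refl]] by blast

lemma configs_insert: "X \<in> configs \<Longrightarrow> insert x X \<in> configs"
  unfolding configs_def by (auto simp: Int_insert_left)

lemma incseq_H_le: "m \<le> n \<Longrightarrow> H m \<subseteq> H n" using H_inc by (simp add: incseq_def)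

lemma in_some_H: "\<exists>m. x \<in> H m" using H_cover by blast

lemma card_measurable[measurable]:
  assumes "B \<in> bounded_borel" shows
      "(\<lambda>X. card (X \<inter> B)) \<in> measurable config_space (count_space UNIV)"
proof (rule measurable_count_space_eq2_countable[THEN iffD2])
  have "{X \<in> configs. card (X \<inter> B) = k} \<in> sets config_space" for k
    unfolding config_space_def using assms by (intro in_measure_of) auto
  moreover have "(\<lambda>X. card (X \<inter> B)) -` {k} \<inter> space config_space = {X \<in> configs. card (X \<inter> B) = k}"
      for k by auto
  ultimately show "(\<lambda>X. card (X \<inter> B)) \<in> space config_space \<rightarrow> UNIV \<and>
      (\<forall>a\<in>UNIV. (\<lambda>X. card (X \<inter> B)) -` {a} \<inter> space config_space \<in> sets config_space)"
    by auto
qed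

lemma measurable_config_space:
  assumes "\<And>z. z \<in> space M \<Longrightarrow> f z \<in> configs"
    and "\<And>B. B \<in> bounded_borel \<Longrightarrow> (\<lambda>z. card (f z \<inter> B)) \<in> measurable M (count_space UNIV)"
  shows "f \<in> measurable M config_space"
  unfolding config_space_def
proof (rule measurable_measure_of)
  fix Q assume "Q \<in> {{X \<in> configs. card (X \<inter> B) = k} |B k. B \<in> bounded_borel}"
  then obtain B k where Q: "Q = {X \<in> configs. card (X \<inter> B) = k}" "B \<in> bounded_borel" by auto
  have "f -` Q \<inter> space M = (\<lambda>z. card (f z \<inter> B)) -` {k} \<inter> space M" using assms(1) Q(1) by auto
  also have "\<dots> \<in> sets M" using measurable_sets[OF assms(2)[OF Q(2)], of "{k}"] by simp
  finally show "f -` Q \<inter> space M \<in> sets M" .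
qed (use assms in auto)

text \<open>
  A sequence of open sets that separates points. The cells of level \<open>k\<close> below are the atoms of
  the algebra generated by its first \<open>k\<close> members. They form nested finite partitions that shrink
  to single points, and they turn statements about points into statements about counts.
\<close>

definition separator :: "nat \<Rightarrow> 'a set" where
  "separator = (SOME b. (\<forall>i. open (b i)) \<and> (\<forall>x y. x \<noteq> y \<longrightarrow> (\<exists>i. x \<in> b i \<and> y \<notin> b i)))"

lemma separator_separates: "open (separator i)" "x \<noteq> y \<Longrightarrow> \<exists>i. x \<in> separator i \<and> y \<notin> separator i"
proof -
  obtain B :: "'a set set" where B: "countable B" "topological_basis B" using ex_countable_basis
      by auto
  have ne: "B \<noteq> {}" using topological_basisE[OF B(2) open_UNIV UNIV_I] by blast
  have 1: "open (from_nat_into B i)" for i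
    using from_nat_into[OF ne] topological_basis_open[OF B(2)] by blast
  have 2: "\<exists>i. x \<in> from_nat_into B i \<and> y \<notin> from_nat_into B i" if xy: "x \<noteq> y" for x y
  proof -
    obtain U where U: "open U" "x \<in> U" "y \<notin> U" using t1_space[OF xy] by auto
    obtain W where "W \<in> B" "x \<in> W" "W \<subseteq> U" using topological_basisE[OF B(2) U(1,2)] by blast
    then show ?thesis using U(3) from_nat_into_surj[OF B(1)] by (metis subsetD)
  qed
  have "(\<forall>i. open (separator i)) \<and> (\<forall>x y. x \<noteq> y \<longrightarrow> (\<exists>i. x \<in> separator i \<and> y \<notin> separator i))"
    unfolding separator_def by (rule someI[of _ "from_nat_into B"]) (use 1 2 in blast)
  then show "open (separator i)" "x \<noteq> y \<Longrightarrow> \<exists>i. x \<in> separator i \<and> y \<notin> separator i" by auto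
qed

definition cell :: "nat \<Rightarrow> nat set \<Rightarrow> 'a set" where
  "cell k J = {x. {i. i < k \<and> x \<in> separator i} = J}"

lemma cell_borel[measurable]: "cell k J \<in> sets borel"
proof -
  have [measurable]: "separator i \<in> sets borel" for i using separator_separates(1) by simp
  have "{x \<in> space borel. \<forall>i\<in>{..<k}. x \<in> separator i \<longleftrightarrow> i \<in> J} \<in> sets borel" by measurable
  moreover have "cell k J = (if J \<subseteq> {..<k} then
      {x \<in> space borel. \<forall>i\<in>{..<k}. x \<in> separator i \<longleftrightarrow> i \<in> J} else {})"
    unfolding cell_def by auto
  ultimately show ?thesis by simp
qed

lemma cell_self: "x \<in> cell k {i. i < k \<and> x \<in> separator i}"
    "{i. i < k \<and> x \<in> separator i} \<in> Pow {..<k}"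
  by (auto simp: cell_def)

lemma cell_disjoint: "x \<in> cell k J \<Longrightarrow> x \<in> cell k J' \<Longrightarrow> J = J'"
  by (auto simp: cell_def)

lemma cells_separate_finite:
  assumes "finite Y"
  shows "\<exists>k. \<forall>J. \<forall>x\<in>Y. \<forall>y\<in>Y. x \<in> cell k J \<longrightarrow> y \<in> cell k J \<longrightarrow> x = y"
proof -
  have "\<exists>i. x \<noteq> y \<longrightarrow> x \<in> separator i \<and> y \<notin> separator i" for x y using separator_separates(2) by blast
  then obtain i where i: "\<And>x y. x \<noteq> y \<Longrightarrow> x \<in> separator (i x y) \<and> y \<notin> separator (i x y)" by metis
  have "finite ((\<lambda>(x, y). i x y) ` (Y \<times> Y))" using assms by auto
  then obtain k where "(\<lambda>(x, y). i x y) ` (Y \<times> Y) \<subseteq> {..<k}" using finite_nat_bounded by blast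
  then have k: "i x y < k" if "x \<in> Y" "y \<in> Y" for x y using that by blast
  have "x = y" if "x \<in> Y" "y \<in> Y" "x \<in> cell k J" "y \<in> cell k J" for x y J
  proof (rule ccontr)
    assume "x \<noteq> y"
    then show False using that i[of x y] k[of x y] by (auto simp: cell_def)
  qed
  then show ?thesis by blast
qed

text \<open>
  A point of the window belongs to the configuration if and only if all cells around it are
  occupied, since the finitely many points of the configuration in the window are eventually
  separated from any other point.
\<close>

lemma member_iff_cells:
  assumes "X \<in> configs"
  shows "x \<in> X \<longleftrightarrow> (\<exists>m. x \<in> H m \<and> (\<forall>k. \<exists>J\<in>Pow {..<k}. x \<in> cell k J \<and>
      card (X \<inter> (H m \<inter> cell k J)) \<noteq> 0))"
proof
  assume x: "x \<in> X"
  obtain m where m: "x \<in> H m" using in_some_H by blast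
  have "\<exists>J\<in>Pow {..<k}. x \<in> cell k J \<and> card (X \<inter> (H m \<inter> cell k J)) \<noteq> 0" for k
  proof (intro bexI conjI)
    let ?J = "{i. i < k \<and> x \<in> separator i}"
    have "finite (X \<inter> (H m \<inter> cell k ?J))"
        by (intro configs_finite[OF assms] H_bounded_borel) measurable
    then show "card (X \<inter> (H m \<inter> cell k ?J)) \<noteq> 0" using x m cell_self(1)[of x k] by auto
  qed (use cell_self(1)[of x k] cell_self(2)[of k x] in auto)
  then show "\<exists>m. x \<in> H m \<and> (\<forall>k. \<exists>J\<in>Pow {..<k}. x \<in> cell k J \<and> card (X \<inter> (H m \<inter> cell k J)) \<noteq> 0)"
    using m by blast
next
  assume "\<exists>m. x \<in> H m \<and> (\<forall>k. \<exists>J\<in>Pow {..<k}. x \<in> cell k J \<and> card (X \<inter> (H m \<inter> cell k J)) \<noteq> 0)"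
  then obtain m where m: "\<And>k. \<exists>J\<in>Pow {..<k}. x \<in> cell k J \<and> card (X \<inter> (H m \<inter> cell k J)) \<noteq> 0"
      by blast
  have "finite (insert x (X \<inter> H m))" using assms by (auto simp: configs_def)
  then obtain k where k: "\<And>J x' y. x' \<in> insert x (X \<inter> H m) \<Longrightarrow> y \<in> insert x (X \<inter> H m) \<Longrightarrow> x' \<in>
      cell k J \<Longrightarrow> y \<in> cell k J \<Longrightarrow> x' = y"
    using cells_separate_finite by meson
  obtain J where J: "x \<in> cell k J" "card (X \<inter> (H m \<inter> cell k J)) \<noteq> 0" using m[of k] by blast
  then have "X \<inter> (H m \<inter> cell k J) \<noteq> {}" by auto
  then obtain y where "y \<in> X" "y \<in> H m" "y \<in> cell k J" by blast
  then show "x \<in> X" using k[of x y J] J(1) by auto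
qed

lemma measurable_member[measurable]:
  "Measurable.pred (borel \<Otimes>\<^sub>M config_space) (\<lambda>z. fst z \<in> snd z)"
proof -
  have [measurable]: "H m \<inter> cell k J \<in> bounded_borel" for m k J
      by (intro H_bounded_borel) measurable
  have "Measurable.pred (borel \<Otimes>\<^sub>M config_space) (\<lambda>z. \<exists>m. fst z \<in> H m \<and>
     (\<forall>k. \<exists>J\<in>Pow {..<k}. fst z \<in> cell k J \<and> card (snd z \<inter> (H m \<inter> cell k J)) \<noteq> 0))"
    by measurable
  also have "?this \<longleftrightarrow> ?thesis"
    by (intro measurable_cong member_iff_cells[symmetric]) (auto simp: space_pair_measure)
  finally show ?thesis .
qed

lemma measurable_member'[measurable (raw)]:
  assumes [measurable]: "f \<in> measurable M borel" "X \<in> measurable M config_space"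
  shows "Measurable.pred M (\<lambda>z. f z \<in> X z)"
  using measurable_compose[OF measurable_Pair[OF assms] measurable_member] by simp

lemma measurable_config_space_space: "X \<in> measurable M config_space \<Longrightarrow> z \<in> space M \<Longrightarrow> X z \<in> configs"
  using measurable_space[of X M config_space z] by simp

lemma measurable_card'[measurable (raw)]:
  assumes "X \<in> measurable M config_space" "B \<in> bounded_borel"
  shows "(\<lambda>z. card (X z \<inter> B)) \<in> measurable M (count_space UNIV)"
  using measurable_compose[OF assms(1) card_measurable[OF assms(2)]] .

lemma measurable_delete[measurable (raw)]:
  assumes [measurable]: "f \<in> measurable M borel" "X \<in> measurable M config_space"
  shows "(\<lambda>z. X z - {f z}) \<in> measurable M config_space"
proof (rule measurable_config_space)
  fix B assume [measurable]: "B \<in> bounded_borel"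
  then have [measurable]: "B \<in> sets borel" by (rule bounded_borel_borel)
  have "(\<lambda>z. if f z \<in> X z \<and> f z \<in> B then card (X z \<inter> B) - 1 else card (X z \<inter> B)) \<in>
      measurable M (count_space UNIV)"
    by measurable
  also have "?this \<longleftrightarrow> (\<lambda>z. card ((X z - {f z}) \<inter> B)) \<in> measurable M (count_space UNIV)"
  proof (intro measurable_cong)
    fix z assume "z \<in> space M"
    then have "finite (X z \<inter> B)" by
        (intro configs_finite[OF measurable_config_space_space[OF assms(2)] \<open>B \<in> bounded_borel\<close>])
    moreover have e: "(X z - {f z}) \<inter> B = X z \<inter> B - {f z}" by auto
    ultimately show "(if f z \<in> X z \<and> f z \<in> B then card (X z \<inter> B) - 1 else card (X z \<inter> B)) =
        card ((X z - {f z}) \<inter> B)"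
      unfolding e by (simp add: card_Diff_singleton_if)
  qed
  finally show "(\<lambda>z. card ((X z - {f z}) \<inter> B)) \<in> measurable M (count_space UNIV)" .
qed (auto intro: configs_mono[OF measurable_config_space_space[OF assms(2)]])

lemma measurable_insert[measurable (raw)]:
  assumes [measurable]: "f \<in> measurable M borel" "X \<in> measurable M config_space"
  shows "(\<lambda>z. insert (f z) (X z)) \<in> measurable M config_space"
proof (rule measurable_config_space)
  fix B assume [measurable]: "B \<in> bounded_borel"
  then have [measurable]: "B \<in> sets borel" by (rule bounded_borel_borel)
  have "(\<lambda>z. if f z \<notin> X z \<and> f z \<in> B then card (X z \<inter> B) + 1 else card (X z \<inter> B)) \<in>
      measurable M (count_space UNIV)"
    by measurable
  also have "?this \<longleftrightarrow> (\<lambda>z. card (insert (f z) (X z) \<inter> B)) \<in> measurable M (count_space UNIV)"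
  proof (intro measurable_cong)
    fix z assume "z \<in> space M"
    then have "finite (X z \<inter> B)" by
        (intro configs_finite[OF measurable_config_space_space[OF assms(2)] \<open>B \<in> bounded_borel\<close>])
    then show "(if f z \<notin> X z \<and> f z \<in> B then card (X z \<inter> B) + 1 else card (X z \<inter> B)) =
        card (insert (f z) (X z) \<inter> B)"
      by (auto simp: Int_insert_left card_insert_if insert_absorb)
  qed
  finally show "(\<lambda>z. card (insert (f z) (X z) \<inter> B)) \<in> measurable M (count_space UNIV)" .
qed (auto intro: configs_insert[OF measurable_config_space_space[OF assms(2)]])

lemma measurable_restrict[measurable (raw)]:
  assumes [measurable]: "X \<in> measurable M config_space" and A: "A \<in> sets borel"
  shows "(\<lambda>z. X z \<inter> A) \<in> measurable M config_space"
proof (rule measurable_config_space)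
  fix B assume "B \<in> bounded_borel"
  then have [measurable]: "B \<inter> A \<in> bounded_borel" using A by (rule bounded_borel_Int)
  have "(\<lambda>z. card (X z \<inter> (B \<inter> A))) \<in> measurable M (count_space UNIV)" by measurable
  then show "(\<lambda>z. card (X z \<inter> A \<inter> B)) \<in> measurable M (count_space UNIV)" by (simp add: ac_simps)
qed (auto intro: configs_mono[OF measurable_config_space_space[OF assms(1)]])

lemma sum_over_eq_SUP: "sum_over X F = (SUP m. sum_over (X \<inter> H m) F)"
proof -
  have "sum_over X F = sum_over X (\<lambda>x. SUP m. indicator (H m) x * F x)"
  proof (rule sum_over_cong)
    fix x
    obtain m where m: "x \<in> H m" using in_some_H by blast
    show "F x = (SUP m. indicator (H m) x * F x)"
    proof (rule antisym)
      show "F x \<le> (SUP m. indicator (H m) x * F x)" by (rule SUP_upper2[of m]) (use m in auto)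
    qed (auto intro!: SUP_least split: split_indicator)
  qed
  also have "\<dots> = (SUP m. sum_over X (\<lambda>x. indicator (H m) x * F x))"
    by (rule sum_over_SUP) (auto simp: incseq_def le_fun_def intro!: mult_right_mono indicator_leI
        dest: incseq_H_le split: split_indicator)
  finally show ?thesis by (simp add: sum_over_Int)
qed

text \<open>
  For product sets the sum is a count. Complements in the Dynkin argument are harmless because the
  window contains finitely many points.
\<close>

lemma sum_over_measurable_set:
  assumes X[measurable]: "X \<in> measurable M config_space" and A: "A \<in> sets (M \<Otimes>\<^sub>M borel)"
  shows "(\<lambda>z. sum_over (X z \<inter> H m) (\<lambda>y. indicator A (z, y))) \<in> borel_measurable M"
proof -
  have fin: "finite (X z \<inter> H m)" if "z \<in> space M" for z
    using measurable_config_space_space[OF X that] by (auto simp: configs_def)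
  have Hbb[measurable]: "H m \<in> bounded_borel" using H_bounded_borel[of UNIV] by simp
  show ?thesis
    using Int_stable_pair_measure_generator pair_measure_closed A unfolding sets_pair_measure
  proof (induct rule: sigma_sets_induct_disjoint)
    case (basic A)
    then obtain a b where A: "A = a \<times> b" and [measurable]: "a \<in> sets M" "b \<in> sets borel" by auto
    have [measurable]: "H m \<inter> b \<in> bounded_borel" by (rule H_bounded_borel) measurable
    have "(\<lambda>z. indicator a z * (of_nat (card (X z \<inter> (H m \<inter> b))) :: ennreal)) \<in> borel_measurable M"
        by measurable
    also have "?this \<longleftrightarrow> ?case"
    proof (intro measurable_cong)
      fix z assume z: "z \<in> space M"
      have "sum_over (X z \<inter> H m) (\<lambda>y. indicator A (z, y)) =
          sum_over (X z \<inter> H m) (\<lambda>y. indicator a z * indicator b y)"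
        by (intro sum_over_cong) (simp add: A indicator_times)
      also have "\<dots> = indicator a z * of_nat (card (X z \<inter> (H m \<inter> b)))"
        using sum_over_indicator[of "X z \<inter> H m" b] finite_Int[OF disjI1[OF fin[OF z]], of b]
            by (simp add: sum_over_cmult Int_assoc)
      finally show "indicator a z * of_nat (card (X z \<inter> (H m \<inter> b))) =
          sum_over (X z \<inter> H m) (\<lambda>y. indicator A (z, y))" ..
    qed
    finally show ?case .
  next
    case empty then show ?case by (simp add: sum_over_def)
  next
    case (compl A)
    note [measurable] = compl(2)
    have "(\<lambda>z. of_nat (card (X z \<inter> H m)) - sum_over (X z \<inter> H m) (\<lambda>y. indicator A (z, y))) \<in>
        borel_measurable M"
      by measurable
    also have "?this \<longleftrightarrow> ?case"
    proof (intro measurable_cong)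
      fix z assume z: "z \<in> space M"
      let ?Y = "X z \<inter> H m"
      have "sum_over ?Y (\<lambda>y. indicator (space M \<times> space borel - A) (z, y)) +
          sum_over ?Y (\<lambda>y. indicator A (z, y)) = sum_over ?Y (\<lambda>y. 1)"
        unfolding sum_over_add[symmetric] using z
            by (intro sum_over_cong) (auto split: split_indicator)
      also have "\<dots> = of_nat (card ?Y)" using fin[OF z] by (simp add: sum_over_finite)
      finally have e: "sum_over ?Y (\<lambda>y. indicator (space M \<times> space borel - A) (z, y)) +
          sum_over ?Y (\<lambda>y. indicator A (z, y)) = of_nat (card ?Y)" .
      have "sum_over ?Y (\<lambda>y. indicator A (z, y)) \<noteq> \<top>"
        using e by (auto simp: top_add dest: sym)
      then show "of_nat (card ?Y) - sum_over ?Y (\<lambda>y. indicator A (z, y)) =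
          sum_over ?Y (\<lambda>y. indicator (space M \<times> space borel - A) (z, y))"
        unfolding e[symmetric] by (rule ennreal_add_diff_cancel_right)
    qed
    finally show ?case .
  next
    case (union A)
    note [measurable] = union(3)
    have "(\<lambda>z. \<Sum>i. sum_over (X z \<inter> H m) (\<lambda>y. indicator (A i) (z, y))) \<in> borel_measurable M"
        by measurable
    moreover have "(\<Sum>i. sum_over (X z \<inter> H m) (\<lambda>y. indicator (A i) (z, y))) =
        sum_over (X z \<inter> H m) (\<lambda>y. indicator (\<Union>i. A i) (z, y))" for z
      unfolding sum_over_suminf[symmetric] by (simp add: suminf_indicator[OF union(1)])
    ultimately show ?case by simp
  qed
qed

lemma sum_over_measurable[measurable (raw)]:
  assumes X: "X \<in> measurable M config_space"
      and F: "(\<lambda>(z, y). F z y) \<in> borel_measurable (M \<Otimes>\<^sub>M borel)"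
  shows "(\<lambda>z. sum_over (X z) (F z)) \<in> borel_measurable M"
proof -
  have "(\<lambda>z. sum_over (X z \<inter> H m) (\<lambda>y. G (z, y))) \<in> borel_measurable M"
      if "G \<in> borel_measurable (M \<Otimes>\<^sub>M borel)" for G m
    using that
  proof (induct rule: borel_measurable_induct)
    case (cong f g)
    have "(\<lambda>z. sum_over (X z \<inter> H m) (\<lambda>y. f (z, y))) \<in> borel_measurable M \<longleftrightarrow>
        (\<lambda>z. sum_over (X z \<inter> H m) (\<lambda>y. g (z, y))) \<in> borel_measurable M"
      by (intro measurable_cong sum_over_cong cong(3)) (simp add: space_pair_measure)
    with cong show ?case by simp
  next
    case (set A) then show ?case by (rule sum_over_measurable_set[OF X])
  next
    case (mult u c) then show ?case by (simp add: sum_over_cmult)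
  next
    case (add u v) then show ?case by (simp add: sum_over_add)
  next
    case (seq U)
    have "sum_over (X z \<inter> H m) (\<lambda>y. (SUP i. U i) (z, y)) =
        (SUP i. sum_over (X z \<inter> H m) (\<lambda>y. U i (z, y)))" for z
      unfolding SUP_apply using seq(4) by (intro sum_over_SUP) (auto simp: incseq_def le_fun_def)
    then show ?case using seq(3) by simp
  qed
  from this[OF F] show ?thesis unfolding sum_over_eq_SUP[of "X _"] by simp
qed

end


section \<open>Cylinder events and the Mecke equation\<close>

definition poisson_mass :: "real \<Rightarrow> nat \<Rightarrow> real" where
  "poisson_mass l k = exp (- l) * l ^ k / fact k"

lemma poisson_mass_Suc: "poisson_mass l (Suc k) * real (Suc k) = l * poisson_mass l k"
  by (simp add: poisson_mass_def fact_Suc del: of_nat_Suc)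

lemma poisson_mass_nonneg: "l \<ge> 0 \<Longrightarrow> poisson_mass l k \<ge> 0"
  by (simp add: poisson_mass_def)

definition count_vectors :: "nat \<Rightarrow> (nat \<Rightarrow> nat) set" where
  "count_vectors n = {v. \<forall>i\<ge>n. v i = 0}"

lemma countable_count_vectors: "countable (count_vectors n)"
proof (rule countable_subset)
  show "count_vectors n \<subseteq> range (\<lambda>l i. if i < length l then l ! i else 0)"
  proof
    fix v assume "v \<in> count_vectors n"
    then have "v = (\<lambda>i. if i < length (map v [0..<n]) then map v [0..<n] ! i else 0)"
      by (auto simp: count_vectors_def fun_eq_iff)
    then show "v \<in> range (\<lambda>l i. if i < length l then l ! i else 0)" by (rule range_eqI)
  qed
qed simp

text \<open>
  Counts beyond \<open>n\<close> are set to \<open>0\<close>, so that the possible vectors form the countable set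
  \<open>count_vectors n\<close>.
\<close>

definition counts_on :: "nat \<Rightarrow> (nat \<Rightarrow> 'a set) \<Rightarrow> 'a set \<Rightarrow> nat \<Rightarrow> nat" where
  "counts_on n D X = (\<lambda>i. if i < n then card (X \<inter> D i) else 0)"

lemma counts_on_count_vectors: "counts_on n D X \<in> count_vectors n"
    by (simp add: counts_on_def count_vectors_def)

context config begin

lemma empty_bounded_borel: "{} \<in> bounded_borel" by (auto simp: bounded_borel_def)

lemma counts_on_measurable[measurable]:
  assumes [measurable]: "\<And>i. D i \<in> bounded_borel"
  shows "counts_on n D \<in> measurable config_space (count_space (count_vectors n))"
proof (rule measurable_count_space_eq_countable[THEN iffD2, OF countable_count_vectors], intro conjI
    ballI)
  fix a assume a: "a \<in> count_vectors n"
  have "{X \<in> space config_space. \<forall>i\<in>{..<n}. card (X \<inter> D i) = a i} \<in> sets config_space" by measurable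
  also have "{X \<in> space config_space. \<forall>i\<in>{..<n}. card (X \<inter> D i) = a i} =
      counts_on n D -` {a} \<inter> space config_space"
    using a by (auto simp: counts_on_def count_vectors_def fun_eq_iff)
  finally show "counts_on n D -` {a} \<inter> space config_space \<in> sets config_space" .
qed (simp add: counts_on_count_vectors)

definition refines :: "nat \<Rightarrow> (nat \<Rightarrow> 'a set) \<Rightarrow> 'a set set \<Rightarrow> bool" where
  "refines n D \<B> \<longleftrightarrow> (\<forall>i. D i \<in> bounded_borel) \<and> disjoint_family D \<and> (\<forall>i. D i \<subseteq> \<Union>\<B>) \<and>
     (\<forall>B\<in>\<B>. \<exists>S\<subseteq>{..<n}. B = (\<Union>i\<in>S. D i))"

lemma refinesD:
  assumes "refines n D \<B>"
  shows "D i \<in> bounded_borel" "disjoint_family D" "D i \<subseteq> \<Union>\<B>" "B \<in> \<B> \<Longrightarrow> \<exists>S\<subseteq>{..<n}. B = (\<Union>i\<in>S. D i)"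
  using assms unfolding refines_def by auto

text \<open>
  The disjoint sets are the atoms of the algebra generated by \<open>\<B>\<close>, except the one outside
  \<open>\<Union>\<B>\<close>.
\<close>

lemma bounded_borel_common_refinement:
  assumes \<B>: "finite \<B>" "\<B> \<subseteq> bounded_borel"
  shows "\<exists>n D. refines n D \<B>"
proof -
  have "finite (Pow \<B> - {{}})" using \<B>(1) by auto
  then obtain h where h: "bij_betw h {0..<card (Pow \<B> - {{}})} (Pow \<B> - {{}})"
    using ex_bij_betw_nat_finite by blast
  define n where "n = card (Pow \<B> - {{}})"
  define D where "D i = (if i < n then {x. {B \<in> \<B>. x \<in> B} = h i} else {})" for i
  have hi: "h i \<subseteq> \<B>" "h i \<noteq> {}" if "i < n" for i
  proof -
    have "h i \<in> Pow \<B> - {{}}" using bij_betwE[OF h] that by (simp add: n_def)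
    then show "h i \<subseteq> \<B>" "h i \<noteq> {}" by auto
  qed
  have sub: "D i \<subseteq> B" if "i < n" "B \<in> h i" for i B using that by (auto simp: D_def)
  have 1: "D i \<in> bounded_borel" for i
  proof (cases "i < n")
    case True
    obtain B where B: "B \<in> h i" using hi[OF True] by auto
    then obtain m where "B \<subseteq> H m" using hi(1)[OF True] \<B>(2) by (auto simp: bounded_borel_def)
    then have "D i \<subseteq> H m" using sub[OF True B] by auto
    moreover have "{x \<in> space borel. \<forall>B\<in>\<B>. x \<in> B \<longleftrightarrow> B \<in> h i} \<in> sets borel"
    proof (rule sets.sets_Collect_finite_All[OF _ \<B>(1)])
      fix B assume "B \<in> \<B>"
      then have [measurable]: "B \<in> sets borel" using \<B>(2) bounded_borel_borel by auto
      show "{x \<in> space borel. (x \<in> B) = (B \<in> h i)} \<in> sets borel" by measurable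
    qed
    moreover have "{x \<in> space borel. \<forall>B\<in>\<B>. x \<in> B \<longleftrightarrow> B \<in> h i} = D i"
      using True hi(1)[OF True] by (auto simp: D_def)
    ultimately show ?thesis by (auto simp: bounded_borel_def)
  qed (auto simp: D_def empty_bounded_borel)
  have 2: "disjoint_family D"
    unfolding disjoint_family_on_def
  proof (intro ballI impI)
    fix i j :: nat assume "i \<noteq> j"
    then have "h i \<noteq> h j" if "i < n" "j < n"
      using that inj_on_eq_iff[OF bij_betw_imp_inj_on[OF h], of i j] by (simp add: n_def)
    then show "D i \<inter> D j = {}" by (auto simp: D_def)
  qed
  have 3: "D i \<subseteq> \<Union>\<B>" for i
    using hi[of i] sub[of i] by (cases "i < n") (auto simp: D_def)
  have 4: "\<exists>S\<subseteq>{..<n}. B = (\<Union>i\<in>S. D i)" if B: "B \<in> \<B>" for B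
  proof (intro exI[of _ "{i. i < n \<and> B \<in> h i}"] conjI)
    show "B = (\<Union>i\<in>{i. i < n \<and> B \<in> h i}. D i)"
    proof
      show "B \<subseteq> (\<Union>i\<in>{i. i < n \<and> B \<in> h i}. D i)"
      proof
        fix x assume x: "x \<in> B"
        then have "{B \<in> \<B>. x \<in> B} \<in> Pow \<B> - {{}}" using B by auto
        then have "{B \<in> \<B>. x \<in> B} \<in> h ` {0..<card (Pow \<B> - {{}})}"
          using bij_betw_imp_surj_on[OF h] by simp
        then obtain i where "{B \<in> \<B>. x \<in> B} = h i" "i \<in> {0..<card (Pow \<B> - {{}})}" by (rule imageE)
        then have i: "i < n" "h i = {B \<in> \<B>. x \<in> B}" by (simp_all add: n_def)
        then have "x \<in> D i" "B \<in> h i" using x B by (auto simp: D_def)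
        then show "x \<in> (\<Union>i\<in>{i. i < n \<and> B \<in> h i}. D i)" using i(1) by blast
      qed
      show "(\<Union>i\<in>{i. i < n \<and> B \<in> h i}. D i) \<subseteq> B" using sub by blast
    qed
  qed auto
  have "refines n D \<B>" unfolding refines_def using 1 2 3 4 by simp
  then show ?thesis by (intro exI)
qed

definition determined_by :: "'a set set \<Rightarrow> ('a set \<Rightarrow> bool) \<Rightarrow> bool" where
  "determined_by \<B> Q \<longleftrightarrow> (\<forall>X\<in>configs. \<forall>Y\<in>configs. (\<forall>B\<in>\<B>. card (X \<inter> B) = card (Y \<inter> B)) \<longrightarrow> (Q X \<longleftrightarrow> Q Y))"

lemma determined_by_mono: "determined_by \<B> Q \<Longrightarrow> \<B> \<subseteq> \<B>' \<Longrightarrow> determined_by \<B>' Q"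
  unfolding determined_by_def by (meson subsetD)

text \<open>
  The counts in the disjoint sets of a common refinement determine the counts in the given sets.
\<close>

lemma determined_by_counts_on:
  assumes \<B>: "finite \<B>" "\<B> \<subseteq> bounded_borel" and Q: "determined_by \<B> Q"
  shows "\<exists>n D W. refines n D \<B> \<and> (\<forall>X\<in>configs. Q X \<longleftrightarrow> counts_on n D X \<in> W)"
proof -
  obtain n D where ref: "refines n D \<B>" using bounded_borel_common_refinement[OF \<B>] by blast
  note D = refinesD[OF ref]
  have "Q X \<longleftrightarrow> counts_on n D X \<in> counts_on n D ` {X \<in> configs. Q X}" if X: "X \<in> configs" for X
  proof
    assume "counts_on n D X \<in> counts_on n D ` {X \<in> configs. Q X}"
    then obtain Y where Y: "Y \<in> configs" "Q Y" "counts_on n D X = counts_on n D Y" by auto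
    have "card (X \<inter> B) = card (Y \<inter> B)" if BB: "B \<in> \<B>" for B
    proof -
      obtain S where S: "S \<subseteq> {..<n}" "B = (\<Union>i\<in>S. D i)" using D(4)[OF BB] by blast
      have fS: "finite S" using S(1) finite_subset by blast
      have c: "card (Z \<inter> B) = (\<Sum>i\<in>S. card (Z \<inter> D i))" if "Z \<in> configs" for Z
        unfolding S(2) Int_UN_distrib
        by (rule card_UN_disjoint[OF fS])
            (use D(2) configs_finite[OF that D(1)] in \<open>auto simp: disjoint_family_on_def\<close>)
      have "card (X \<inter> D i) = card (Y \<inter> D i)" if "i \<in> S" for i
        using fun_cong[OF Y(3), of i] S(1) that by (auto simp: counts_on_def)
      then show ?thesis by (simp add: c X Y(1))
    qed
    then show "Q X" using Q X Y unfolding determined_by_def by blast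
  qed (use X in auto)
  then show ?thesis using ref by blast
qed

text \<open>
  Events that depend on finitely many counts. Stated in terms of determination and not by conditions
  on the counts, the class is obviously stable under intersections, and the sets can be refined.
\<close>

definition cylinders :: "'a set set set" where
  "cylinders = {G. G \<subseteq> configs \<and> (\<exists>\<B>. finite \<B> \<and> \<B> \<subseteq> bounded_borel \<and> determined_by \<B> (\<lambda>X. X \<in> G))}"

lemma cylindersI:
  "G \<subseteq> configs \<Longrightarrow> finite \<B> \<Longrightarrow> \<B> \<subseteq> bounded_borel \<Longrightarrow> determined_by \<B> (\<lambda>X. X \<in> G) \<Longrightarrow> G \<in> cylinders"
  unfolding cylinders_def by (intro CollectI conjI exI)

lemma Int_stable_cylinders: "Int_stable cylinders"
proof (rule Int_stableI)
  fix G G' assume "G \<in> cylinders" "G' \<in> cylinders"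
  then obtain \<B> \<B>' where "finite \<B>" "\<B> \<subseteq> bounded_borel" "determined_by \<B> (\<lambda>X. X \<in> G)" "G \<subseteq> configs"
    "finite \<B>'" "\<B>' \<subseteq> bounded_borel" "determined_by \<B>' (\<lambda>X. X \<in> G')" unfolding cylinders_def
        by blast
  moreover from this have "determined_by (\<B> \<union> \<B>') (\<lambda>X. X \<in> G \<inter> G')"
    unfolding determined_by_def ball_Un Int_iff by meson
  ultimately show "G \<inter> G' \<in> cylinders" by (intro cylindersI[of _ "\<B> \<union> \<B>'"]) auto
qed

lemma configs_cylinder: "configs \<in> cylinders"
  by (rule cylindersI[of _ "{}"]) (auto simp: determined_by_def)

lemma sets_config_space_cylinders: "sets config_space = sigma_sets configs cylinders"
proof
  let ?E = "{{X \<in> configs. card (X \<inter> B) = k} |B k. B \<in> bounded_borel}"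
  have "sets config_space = sigma_sets configs ?E"
    unfolding config_space_def by (rule sets_measure_of) auto
  also have "\<dots> \<subseteq> sigma_sets configs cylinders"
  proof (rule sigma_sets_mono'')
    show "?E \<subseteq> cylinders" 
    proof
      fix G assume "G \<in> ?E"
      then obtain B k where "G = {X \<in> configs. card (X \<inter> B) = k}" "B \<in> bounded_borel" by blast
      then show "G \<in> cylinders"
        by (intro cylindersI[of _ "{B}"]) (auto simp: determined_by_def)
    qed
  qed (auto simp: cylinders_def sigma_sets_top)
  finally show "sets config_space \<subseteq> sigma_sets configs cylinders" .
  have "cylinders \<subseteq> sets config_space"
  proof
    fix G assume "G \<in> cylinders"
    then obtain \<B> where *: "finite \<B>" "\<B> \<subseteq> bounded_borel" "determined_by \<B> (\<lambda>X. X \<in> G)"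
        "G \<subseteq> configs"
      unfolding cylinders_def by blast
    obtain n D W where ref: "refines n D \<B>" and W: "\<forall>X\<in>configs. X \<in> G \<longleftrightarrow> counts_on n D X \<in> W"
      using determined_by_counts_on[OF *(1-3)] by blast
    note D = refinesD(1)[OF ref]
    have "counts_on n D -` (W \<inter> count_vectors n) \<inter> space config_space \<in> sets config_space"
      by (rule measurable_sets[OF counts_on_measurable[OF D]]) auto
    also have "counts_on n D -` (W \<inter> count_vectors n) \<inter> space config_space = G"
        using W *(4) counts_on_count_vectors by auto
    finally show "G \<in> sets config_space" .
  qed
  then show "sigma_sets configs cylinders \<subseteq> sets config_space"
    using sets.sigma_sets_subset[of cylinders config_space] by simp
qed

end

text \<open>
  A random configuration with independent Poisson counts in disjoint bounded sets.
\<close>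

locale poisson_points = config H + prob_space \<Omega>
  for H :: "nat \<Rightarrow> 'a::{t2_space,second_countable_topology} set" and \<Omega> :: "'w measure" +
  fixes \<mu> :: "'a measure" and V :: "'w \<Rightarrow> 'a set"
  assumes sets_\<mu>[measurable_cong]: "sets \<mu> = sets borel"
    and H_finite: "\<And>m. emeasure \<mu> (H m) < \<infinity>"
    and V_measurable[measurable]: "V \<in> measurable \<Omega> config_space"
    and joint_counts: "\<And>(n::nat) D v. (\<And>i. D i \<in> bounded_borel) \<Longrightarrow> disjoint_family D \<Longrightarrow>
      prob {\<omega> \<in> space \<Omega>. \<forall>i<n. card (V \<omega> \<inter> D i) = v i} =
          (\<Prod>i<n. poisson_mass (measure \<mu> (D i)) (v i))"
begin

lemma V_configs: "\<omega> \<in> space \<Omega> \<Longrightarrow> V \<omega> \<in> configs"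
  by (rule measurable_config_space_space[OF V_measurable])

lemma bounded_borel_finite: "B \<in> bounded_borel \<Longrightarrow> emeasure \<mu> B < \<infinity>"
proof -
  assume "B \<in> bounded_borel"
  then obtain m where m: "B \<subseteq> H m" by (auto simp: bounded_borel_def)
  have "emeasure \<mu> B \<le> emeasure \<mu> (H m)" by (rule emeasure_mono[OF m]) (simp add: sets_\<mu>)
  then show ?thesis using H_finite[of m] by simp
qed

lemma bounded_borel_emeasure: "B \<in> bounded_borel \<Longrightarrow> emeasure \<mu> B = ennreal (measure \<mu> B)"
  using bounded_borel_finite[of B] by (simp add: emeasure_eq_ennreal_measure less_top)

lemma nn_integral_counts_on:
  assumes D: "\<And>i. D i \<in> bounded_borel" "disjoint_family D"
  shows "(\<integral>\<^sup>+\<omega>. f (counts_on n D (V \<omega>)) \<partial>\<Omega>) =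
    (\<integral>\<^sup>+v. ennreal (\<Prod>i<n. poisson_mass (measure \<mu> (D i)) (v i)) * f v \<partial>count_space
        (count_vectors n))"
proof -
  have m[measurable]: "(\<lambda>\<omega>. counts_on n D (V \<omega>)) \<in> measurable \<Omega> (count_space (count_vectors n))"
    using measurable_compose[OF V_measurable counts_on_measurable[OF D(1)]] .
  have "distr \<Omega> (count_space (count_vectors n)) (\<lambda>\<omega>. counts_on n D (V \<omega>)) =
    density (count_space (count_vectors n))
        (\<lambda>v. ennreal (\<Prod>i<n. poisson_mass (measure \<mu> (D i)) (v i)))"
  proof (rule measure_eqI_countable[of _ "count_vectors n"])
    fix a assume a: "a \<in> count_vectors n"
    have "(\<lambda>\<omega>. counts_on n D (V \<omega>)) -` {a} \<inter> space \<Omega> = {\<omega> \<in> space \<Omega>. \<forall>i<n. card (V \<omega> \<inter> D i) = a i}"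
      using a by (auto simp: counts_on_def count_vectors_def fun_eq_iff)
    then have "emeasure (distr \<Omega> (count_space (count_vectors n)) (\<lambda>\<omega>. counts_on n D (V \<omega>))) {a} =
      ennreal (\<Prod>i<n. poisson_mass (measure \<mu> (D i)) (a i))"
      using a joint_counts[of D n a] D by (simp add: emeasure_distr emeasure_eq_measure)
    also have "\<dots> = emeasure (density (count_space (count_vectors n))
        (\<lambda>v. ennreal (\<Prod>i<n. poisson_mass (measure \<mu> (D i)) (v i)))) {a}"
      using a by (simp add: emeasure_density nn_integral_indicator_singleton)
    finally show "emeasure (distr \<Omega> (count_space (count_vectors n)) (\<lambda>\<omega>. counts_on n D (V \<omega>))) {a} =
        \<dots>" .
  qed (auto simp: countable_count_vectors)
  then have "(\<integral>\<^sup>+v. f v \<partial>distr \<Omega> (count_space (count_vectors n)) (\<lambda>\<omega>. counts_on n D (V \<omega>))) = 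
     (\<integral>\<^sup>+v. f v \<partial>density (count_space (count_vectors n))
         (\<lambda>v. ennreal (\<Prod>i<n. poisson_mass (measure \<mu> (D i)) (v i))))" by simp
  then show ?thesis by (simp add: nn_integral_distr nn_integral_density)
qed

text \<open>
  The Mecke equation for count vectors is the identity \<open>(k + 1) p (k + 1) = m p k\<close> of the Poisson
  weights with mean \<open>m\<close>, applied to the \<open>j\<close>-th count.
\<close>

lemma mecke_counts_on:
  assumes D: "\<And>i. D i \<in> bounded_borel" "disjoint_family D" and j: "j < n"
  shows "(\<integral>\<^sup>+\<omega>. of_nat (counts_on n D (V \<omega>) j) *
      f ((counts_on n D (V \<omega>))(j := counts_on n D (V \<omega>) j - 1)) \<partial>\<Omega>) =
    emeasure \<mu> (D j) * (\<integral>\<^sup>+\<omega>. f (counts_on n D (V \<omega>)) \<partial>\<Omega>)"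
proof -
  let ?P = "\<lambda>v. \<Prod>i<n. poisson_mass (measure \<mu> (D i)) (v i)"
  define up where "up w = w(j := Suc (w j))" for w :: "nat \<Rightarrow> nat"
  let ?F = "\<lambda>v. ennreal (?P v) * (of_nat (v j) * f (v(j := v j - 1)))"
  have inj: "inj_on up (count_vectors n)"
  proof (rule inj_onI)
    fix v w assume *: "up v = up w"
    show "v = w"
    proof
      fix i show "v i = w i" using fun_cong[OF *, of i] by (cases "i = j") (simp_all add: up_def)
    qed
  qed
  have "(\<integral>\<^sup>+\<omega>. of_nat (counts_on n D (V \<omega>) j) *
      f ((counts_on n D (V \<omega>))(j := counts_on n D (V \<omega>) j - 1)) \<partial>\<Omega>)
      = (\<integral>\<^sup>+v. ?F v \<partial>count_space (count_vectors n))"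
    using nn_integral_counts_on[OF D, of "\<lambda>v. of_nat (v j) * f (v(j := v j - 1))" n] .
  also have "\<dots> = (\<integral>\<^sup>+v. ?F v \<partial>count_space (up ` count_vectors n))"
  proof (rule nn_integral_count_space_eq)
    fix v assume v: "v \<in> count_vectors n - up ` count_vectors n"
    have "v j = 0"
    proof (rule ccontr)
      assume "v j \<noteq> 0"
      then have "v = up (v(j := v j - 1))" by (auto simp: up_def)
      moreover have "v(j := v j - 1) \<in> count_vectors n" using v j by (auto simp: count_vectors_def)
      ultimately show False using v by blast
    qed
    then show "?F v = 0" by simp
  qed (use j in \<open>auto simp: up_def count_vectors_def\<close>)
  also have "\<dots> = (\<integral>\<^sup>+w. ?F (up w) \<partial>count_space (count_vectors n))"
    by (rule nn_integral_bij_count_space[symmetric]) (use inj in \<open>auto simp: bij_betw_def\<close>)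
  also have "\<dots> = (\<integral>\<^sup>+w. emeasure \<mu> (D j) * (ennreal (?P w) * f w) \<partial>count_space (count_vectors n))"
  proof (rule nn_integral_cong)
    fix w :: "nat \<Rightarrow> nat"
    have jn: "j \<in> {..<n}" using j by simp
    have "?P (up w) = poisson_mass (measure \<mu> (D j)) (Suc (w j)) *
        (\<Prod>i\<in>{..<n} - {j}. poisson_mass (measure \<mu> (D i)) (w i))"
      using prod.remove[OF _ jn, of "\<lambda>i. poisson_mass (measure \<mu> (D i)) (up w i)"]
          by (simp add: up_def)
    moreover have "?P w = poisson_mass (measure \<mu> (D j)) (w j) *
        (\<Prod>i\<in>{..<n} - {j}. poisson_mass (measure \<mu> (D i)) (w i))"
      using prod.remove[OF _ jn, of "\<lambda>i. poisson_mass (measure \<mu> (D i)) (w i)"] by simp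
    ultimately have "?P (up w) * real (Suc (w j)) = measure \<mu> (D j) * ?P w"
      using poisson_mass_Suc[of "measure \<mu> (D j)" "w j"] by (simp add: mult_ac)
    moreover have "?P v \<ge> 0" for v by (intro prod_nonneg poisson_mass_nonneg) auto
    ultimately have "ennreal (?P (up w)) * of_nat (Suc (w j)) = ennreal (measure \<mu> (D j)) *
        ennreal (?P w)"
      unfolding ennreal_of_nat_eq_real_of_nat by (simp add: ennreal_mult[symmetric] del: of_nat_Suc)
    moreover have "(up w)(j := up w j - 1) = w" "up w j = Suc (w j)" by (auto simp: up_def)
    ultimately show "?F (up w) = emeasure \<mu> (D j) * (ennreal (?P w) * f w)"
      unfolding bounded_borel_emeasure[OF D(1)] by (metis mult.assoc)
  qed
  also have "\<dots> = emeasure \<mu> (D j) * (\<integral>\<^sup>+w. ennreal (?P w) * f w \<partial>count_space (count_vectors n))"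
    by (rule nn_integral_cmult) simp
  finally show ?thesis unfolding nn_integral_counts_on[OF D] .
qed

text \<open>
  Deleting a point that lies in the \<open>j\<close>-th of the disjoint sets lowers the \<open>j\<close>-th count by \<open>1\<close>.
\<close>

lemma mecke_cylinder:
  assumes A: "A \<in> bounded_borel" and G: "G \<in> cylinders"
  shows "(\<integral>\<^sup>+\<omega>. sum_over (V \<omega>) (\<lambda>x. indicator A x * indicator G (V \<omega> - {x})) \<partial>\<Omega>) =
    emeasure \<mu> A * emeasure \<Omega> {\<omega> \<in> space \<Omega>. V \<omega> \<in> G}"
proof -
  obtain \<B> where \<B>: "finite \<B>" "\<B> \<subseteq> bounded_borel" "determined_by \<B> (\<lambda>X. X \<in> G)" "G \<subseteq> configs"
    using G unfolding cylinders_def by blast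
  have "finite (insert A \<B>)" "insert A \<B> \<subseteq> bounded_borel" "determined_by (insert A \<B>) (\<lambda>X. X \<in> G)"
    using \<B>(1,2) A determined_by_mono[OF \<B>(3) subset_insertI] by auto
  from determined_by_counts_on[OF this]
  obtain n D W where ref: "refines n D (insert A \<B>)"
      and W: "\<And>X. X \<in> configs \<Longrightarrow> X \<in> G \<longleftrightarrow> counts_on n D X \<in> W"
    by blast
  note D = refinesD(1,2)[OF ref]
  obtain S where S: "S \<subseteq> {..<n}" "A = (\<Union>i\<in>S. D i)" using refinesD(4)[OF ref, of A] by blast
  have fS: "finite S" using S(1) finite_subset by blast
  have m[measurable]: "(\<lambda>\<omega>. counts_on n D (V \<omega>)) \<in> measurable \<Omega> (count_space (count_vectors n))"
    using measurable_compose[OF V_measurable counts_on_measurable[OF D(1)]] .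
  let ?f = "\<lambda>v. indicator W v :: ennreal"
  let ?g = "\<lambda>j v. of_nat (v j) * ?f (v(j := v j - 1)) :: ennreal"
  have "sum_over (V \<omega>) (\<lambda>x. indicator A x * indicator G (V \<omega> - {x})) =
      (\<Sum>j\<in>S. ?g j (counts_on n D (V \<omega>)))"
    if \<omega>: "\<omega> \<in> space \<Omega>" for \<omega>
  proof -
    have X: "V \<omega> \<in> configs" by (rule V_configs[OF \<omega>])
    have fin: "finite (V \<omega> \<inter> D j)" for j by (rule configs_finite[OF X D(1)])
    have ind: "indicator G (V \<omega> - {x}) = ?f ((counts_on n D (V \<omega>))(j := counts_on n D (V \<omega>) j - 1))"
      if x: "x \<in> V \<omega>" "x \<in> D j" and j: "j \<in> S" for x j
    proof -
      have "counts_on n D (V \<omega> - {x}) = (counts_on n D (V \<omega>))(j := counts_on n D (V \<omega>) j - 1)"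
      proof
        fix i
        show "counts_on n D (V \<omega> - {x}) i =
            ((counts_on n D (V \<omega>))(j := counts_on n D (V \<omega>) j - 1)) i"
        proof (cases "i = j")
          case True
          have "(V \<omega> - {x}) \<inter> D j = V \<omega> \<inter> D j - {x}" by blast
          then show ?thesis using x fin[of j] True
              by (simp add: counts_on_def card_Diff_singleton_if)
        next
          case False
          then have "D i \<inter> D j = {}" using D(2) unfolding disjoint_family_on_def by blast
          then have "(V \<omega> - {x}) \<inter> D i = V \<omega> \<inter> D i" using x(2) by blast
          then show ?thesis using False by (simp add: counts_on_def)
        qed
      qed
      then have "V \<omega> - {x} \<in> G \<longleftrightarrow> (counts_on n D (V \<omega>))(j := counts_on n D (V \<omega>) j - 1) \<in> W"
        using W[OF configs_mono[OF X Diff_subset[of _ "{x}"]]] by simp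
      then show ?thesis by (simp add: indicator_def)
    qed
    have "sum_over (V \<omega>) (\<lambda>x. indicator A x * indicator G (V \<omega> - {x})) =
        sum_over (V \<omega> \<inter> A) (\<lambda>x. indicator G (V \<omega> - {x}))"
      by (simp add: sum_over_Int)
    also have "V \<omega> \<inter> A = (\<Union>j\<in>S. V \<omega> \<inter> D j)" using S(2) by auto
    also have "sum_over (\<Union>j\<in>S. V \<omega> \<inter> D j) (\<lambda>x. indicator G (V \<omega> - {x})) =
        (\<Sum>x\<in>(\<Union>j\<in>S. V \<omega> \<inter> D j). indicator G (V \<omega> - {x}))"
      by (rule sum_over_finite, rule finite_UN_I[OF fS fin])
    also have "\<dots> = (\<Sum>j\<in>S. \<Sum>x\<in>V \<omega> \<inter> D j. indicator G (V \<omega> - {x}))"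
      by (rule sum.UNION_disjoint) (use fS fin D(2) in \<open>auto simp: disjoint_family_on_def\<close>)
    also have "\<dots> = (\<Sum>j\<in>S. ?g j (counts_on n D (V \<omega>)))"
    proof (rule sum.cong[OF refl])
      fix j assume j: "j \<in> S"
      have "(\<Sum>x\<in>V \<omega> \<inter> D j. indicator G (V \<omega> - {x})) =
          (\<Sum>x\<in>V \<omega> \<inter> D j. ?f ((counts_on n D (V \<omega>))(j := counts_on n D (V \<omega>) j - 1)))"
        using ind j by (intro sum.cong) auto
      also have "\<dots> = ?g j (counts_on n D (V \<omega>))" using j S(1) by (auto simp: counts_on_def)
      finally show "(\<Sum>x\<in>V \<omega> \<inter> D j. indicator G (V \<omega> - {x})) = ?g j (counts_on n D (V \<omega>))" .
    qed
    finally show ?thesis .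
  qed
  then have "(\<integral>\<^sup>+\<omega>. sum_over (V \<omega>) (\<lambda>x. indicator A x * indicator G (V \<omega> - {x})) \<partial>\<Omega>) =
     (\<integral>\<^sup>+\<omega>. (\<Sum>j\<in>S. ?g j (counts_on n D (V \<omega>))) \<partial>\<Omega>)" by (rule nn_integral_cong)
  also have "\<dots> = (\<Sum>j\<in>S. \<integral>\<^sup>+\<omega>. ?g j (counts_on n D (V \<omega>)) \<partial>\<Omega>)"
  proof (rule nn_integral_sum)
    fix j
    have "?g j \<in> borel_measurable (count_space (count_vectors n))" by simp
    from measurable_compose[OF m this] show "(\<lambda>\<omega>. ?g j (counts_on n D (V \<omega>))) \<in> borel_measurable \<Omega>"
        .
  qed
  also have "\<dots> = (\<Sum>j\<in>S. emeasure \<mu> (D j) * (\<integral>\<^sup>+\<omega>. ?f (counts_on n D (V \<omega>)) \<partial>\<Omega>))"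
    using S(1) by (intro sum.cong refl mecke_counts_on[OF D]) auto
  also have "\<dots> = (\<Sum>j\<in>S. emeasure \<mu> (D j)) * (\<integral>\<^sup>+\<omega>. ?f (counts_on n D (V \<omega>)) \<partial>\<Omega>)"
    by (simp add: sum_distrib_right)
  also have "(\<Sum>j\<in>S. emeasure \<mu> (D j)) = emeasure \<mu> A"
    unfolding S(2) using D fS
    by (intro sum_emeasure) (auto simp: sets_\<mu> bounded_borel_borel intro:
        disjoint_family_on_mono[OF subset_UNIV])
  also have "(\<integral>\<^sup>+\<omega>. ?f (counts_on n D (V \<omega>)) \<partial>\<Omega>) = (\<integral>\<^sup>+\<omega>. indicator {\<omega> \<in> space \<Omega>. V \<omega> \<in> G} \<omega> \<partial>\<Omega>)"
    by (intro nn_integral_cong) (auto simp: W[OF V_configs] split: split_indicator)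
  also have "\<dots> = emeasure \<Omega> {\<omega> \<in> space \<Omega>. V \<omega> \<in> G}"
  proof (rule nn_integral_indicator)
    have "G \<in> sets config_space" unfolding sets_config_space_cylinders using G
        by (rule sigma_sets.Basic)
    then show "{\<omega> \<in> space \<Omega>. V \<omega> \<in> G} \<in> sets \<Omega>" by measurable
  qed
  finally show ?thesis .
qed

end

context poisson_points begin

lemma mecke_lhs_measurable[measurable]:
  assumes [measurable]: "F \<in> borel_measurable (borel \<Otimes>\<^sub>M config_space)"
  shows "(\<lambda>\<omega>. sum_over (V \<omega>) (\<lambda>x. F (x, V \<omega> - {x}))) \<in> borel_measurable \<Omega>"
  by measurable

lemma mecke_rhs_measurable[measurable]:
  assumes [measurable]: "F \<in> borel_measurable (borel \<Otimes>\<^sub>M config_space)"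
  shows "(\<lambda>x. \<integral>\<^sup>+\<omega>. F (x, V \<omega>) \<partial>\<Omega>) \<in> borel_measurable \<mu>"
  by measurable

lemma mecke_rectangle:
  assumes A: "A \<in> bounded_borel" and G: "G \<in> sets config_space"
  shows "(\<integral>\<^sup>+\<omega>. sum_over (V \<omega>) (\<lambda>x. indicator A x * indicator G (V \<omega> - {x})) \<partial>\<Omega>) =
    emeasure \<mu> A * emeasure \<Omega> {\<omega> \<in> space \<Omega>. V \<omega> \<in> G}"
proof -
  have [measurable]: "A \<in> sets borel" using A by (rule bounded_borel_borel)
  let ?a = "\<lambda>G. \<integral>\<^sup>+\<omega>. sum_over (V \<omega>) (\<lambda>x. indicator A x * indicator G (V \<omega> - {x})) \<partial>\<Omega>"
  let ?b = "\<lambda>G. emeasure \<mu> A * emeasure \<Omega> {\<omega> \<in> space \<Omega>. V \<omega> \<in> G}"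
  show ?thesis
  proof (rule countably_additive_eqI[of cylinders configs ?a ?b])
    show "Int_stable cylinders" by (rule Int_stable_cylinders)
    show "cylinders \<subseteq> Pow configs" by (auto simp: cylinders_def)
    show "configs \<in> cylinders" by (rule configs_cylinder)
    show "?a {} = 0" by (simp add: sum_over_def)
    show "?b {} = 0" by simp
    show "G \<in> sigma_sets configs cylinders" using G sets_config_space_cylinders by simp
    show "?a X = ?b X" if "X \<in> cylinders" for X by (rule mecke_cylinder[OF A that])
    have "?a configs = ?b configs" by (rule mecke_cylinder[OF A configs_cylinder])
    also have "\<dots> \<le> emeasure \<mu> A * 1" by (intro mult_left_mono emeasure_le_1) auto
    also have "\<dots> < \<infinity>" using bounded_borel_finite[OF A] by simp
    finally show "?a configs < \<infinity>" .
    show "countably_additive (sigma_sets configs cylinders) ?a"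
    proof (rule countably_additiveI)
      fix Gs :: "nat \<Rightarrow> 'a set set" assume Gs: "range Gs \<subseteq> sigma_sets configs cylinders"
          "disjoint_family Gs"
      then have [measurable]: "Gs i \<in> sets config_space" for i unfolding sets_config_space_cylinders
          by auto
      have "(\<Sum>i. ?a (Gs i)) = (\<integral>\<^sup>+\<omega>. (\<Sum>i. sum_over (V \<omega>)
          (\<lambda>x. indicator A x * indicator (Gs i) (V \<omega> - {x}))) \<partial>\<Omega>)"
        by (rule nn_integral_suminf[symmetric]) measurable
      also have "\<dots> = ?a (\<Union>i. Gs i)"
        by (simp add: sum_over_suminf[symmetric] suminf_indicator[OF Gs(2)])
      finally show "(\<Sum>i. ?a (Gs i)) = ?a (\<Union>i. Gs i)" .
    qed
    show "countably_additive (sigma_sets configs cylinders) ?b"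
    proof (rule countably_additiveI)
      fix Gs :: "nat \<Rightarrow> 'a set set" assume Gs: "range Gs \<subseteq> sigma_sets configs cylinders"
          "disjoint_family Gs"
      then have [measurable]: "Gs i \<in> sets config_space" for i unfolding sets_config_space_cylinders
          by auto
      have "(\<Sum>i. emeasure \<Omega> {\<omega> \<in> space \<Omega>. V \<omega> \<in> Gs i}) = emeasure \<Omega> (\<Union>i. {\<omega> \<in> space \<Omega>. V \<omega> \<in> Gs i})"
      proof (rule suminf_emeasure)
        show "disjoint_family (\<lambda>i. {\<omega> \<in> space \<Omega>. V \<omega> \<in> Gs i})"
          using Gs(2) unfolding disjoint_family_on_def by blast
      qed auto
      also have "(\<Union>i. {\<omega> \<in> space \<Omega>. V \<omega> \<in> Gs i}) = {\<omega> \<in> space \<Omega>. V \<omega> \<in> (\<Union>i. Gs i)}" by blast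
      finally show "(\<Sum>i. ?b (Gs i)) = ?b (\<Union>i. Gs i)" by simp
    qed
  qed
qed

lemma mecke_window_set:
  assumes Q: "Q \<in> sets (borel \<Otimes>\<^sub>M config_space)"
  shows "(\<integral>\<^sup>+\<omega>. sum_over (V \<omega>) (\<lambda>x. indicator (H m) x * indicator Q (x, V \<omega> - {x})) \<partial>\<Omega>) =
    (\<integral>\<^sup>+x. \<integral>\<^sup>+\<omega>. indicator (H m) x * indicator Q (x, V \<omega>) \<partial>\<Omega> \<partial>\<mu>)"
proof -
  let ?a = "\<lambda>Q. \<integral>\<^sup>+\<omega>. sum_over (V \<omega>) (\<lambda>x. indicator (H m) x * indicator Q (x, V \<omega> - {x})) \<partial>\<Omega>"
  let ?b = "\<lambda>Q. \<integral>\<^sup>+x. \<integral>\<^sup>+\<omega>. indicator (H m) x * indicator Q (x, V \<omega>) \<partial>\<Omega> \<partial>\<mu>"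
  let ?R = "{a \<times> b |a b. a \<in> sets borel \<and> b \<in> sets config_space}"
  have ss: "sets (borel \<Otimes>\<^sub>M config_space) = sigma_sets (UNIV \<times> configs) ?R"
    by (simp add: sets_pair_measure)
  have eq: "?a X = ?b X" if XR: "X \<in> ?R" for X
  proof -
    obtain a b where X: "X = a \<times> b" and [measurable]: "a \<in> sets borel" "b \<in> sets config_space"
        using XR by blast
    have "?a X = (\<integral>\<^sup>+\<omega>. sum_over (V \<omega>) (\<lambda>x. indicator (H m \<inter> a) x * indicator b (V \<omega> - {x})) \<partial>\<Omega>)"
      unfolding X by (intro nn_integral_cong sum_over_cong)
          (simp add: indicator_times indicator_inter_arith mult.assoc)
    also have "\<dots> = emeasure \<mu> (H m \<inter> a) * emeasure \<Omega> {\<omega> \<in> space \<Omega>. V \<omega> \<in> b}"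
      by (intro mecke_rectangle H_bounded_borel) measurable
    also have "\<dots> = (\<integral>\<^sup>+x. indicator (H m \<inter> a) x * emeasure \<Omega> {\<omega> \<in> space \<Omega>. V \<omega> \<in> b} \<partial>\<mu>)"
      by (simp add: nn_integral_multc sets_\<mu>)
    also have "\<dots> = ?b X"
    proof (rule nn_integral_cong)
      fix x
      have "emeasure \<Omega> {\<omega> \<in> space \<Omega>. V \<omega> \<in> b} = (\<integral>\<^sup>+\<omega>. indicator {\<omega> \<in> space \<Omega>. V \<omega> \<in> b} \<omega> \<partial>\<Omega>)"
          by simp
      also have "\<dots> = (\<integral>\<^sup>+\<omega>. indicator b (V \<omega>) \<partial>\<Omega>)"
        by (intro nn_integral_cong) (simp add: indicator_def)
      finally have "indicator (H m \<inter> a) x * emeasure \<Omega> {\<omega> \<in> space \<Omega>. V \<omega> \<in> b} =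
         (\<integral>\<^sup>+\<omega>. indicator (H m \<inter> a) x * indicator b (V \<omega>) \<partial>\<Omega>)" by (simp add: nn_integral_cmult)
      then show "indicator (H m \<inter> a) x * emeasure \<Omega> {\<omega> \<in> space \<Omega>. V \<omega> \<in> b} =
         (\<integral>\<^sup>+\<omega>. indicator (H m) x * indicator X (x, V \<omega>) \<partial>\<Omega>)"
        unfolding X by (simp add: indicator_times indicator_inter_arith mult.assoc)
    qed
    finally show ?thesis .
  qed
  show ?thesis
  proof (rule countably_additive_eqI[of ?R "UNIV \<times> configs" ?a ?b])
    show "Int_stable ?R" by (rule Int_stable_pair_measure_generator)
    show "?R \<subseteq> Pow (UNIV \<times> configs)" using sets.space_closed[of config_space] by auto
    show uR: "UNIV \<times> configs \<in> ?R" using sets.top[of config_space] by force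
    show "?a {} = 0" by (simp add: sum_over_def)
    show "?b {} = 0" by simp
    show "Q \<in> sigma_sets (UNIV \<times> configs) ?R" using Q unfolding ss .
    show "?a X = ?b X" if "X \<in> ?R" for X by (rule eq[OF that])
    have "?a (UNIV \<times> configs) = ?b (UNIV \<times> configs)" by (rule eq[OF uR])
    also have "\<dots> \<le> (\<integral>\<^sup>+x. \<integral>\<^sup>+\<omega>. indicator (H m) x \<partial>\<Omega> \<partial>\<mu>)"
      by (intro nn_integral_mono) (simp split: split_indicator)
    also have "\<dots> = emeasure \<mu> (H m)" by (simp add: emeasure_space_1 sets_\<mu>)
    also have "\<dots> < \<infinity>" using H_finite by simp
    finally show "?a (UNIV \<times> configs) < \<infinity>" .
    show "countably_additive (sigma_sets (UNIV \<times> configs) ?R) ?a"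
    proof (rule countably_additiveI)
      fix Gs :: "nat \<Rightarrow> ('a \<times> 'a set) set" assume Gs: "range Gs \<subseteq> sigma_sets (UNIV \<times> configs) ?R"
          "disjoint_family Gs"
      then have [measurable]: "Gs i \<in> sets (borel \<Otimes>\<^sub>M config_space)" for i unfolding ss by auto
      have "(\<Sum>i. ?a (Gs i)) = (\<integral>\<^sup>+\<omega>. (\<Sum>i. sum_over (V \<omega>)
          (\<lambda>x. indicator (H m) x * indicator (Gs i) (x, V \<omega> - {x}))) \<partial>\<Omega>)"
        by (rule nn_integral_suminf[symmetric]) measurable
      also have "\<dots> = ?a (\<Union>i. Gs i)"
        by (simp add: sum_over_suminf[symmetric] suminf_indicator[OF Gs(2)])
      finally show "(\<Sum>i. ?a (Gs i)) = ?a (\<Union>i. Gs i)" .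
    qed
    show "countably_additive (sigma_sets (UNIV \<times> configs) ?R) ?b"
    proof (rule countably_additiveI)
      fix Gs :: "nat \<Rightarrow> ('a \<times> 'a set) set" assume Gs: "range Gs \<subseteq> sigma_sets (UNIV \<times> configs) ?R"
          "disjoint_family Gs"
      then have [measurable]: "Gs i \<in> sets (borel \<Otimes>\<^sub>M config_space)" for i unfolding ss by auto
      have "(\<Sum>i. ?b (Gs i)) = (\<integral>\<^sup>+x. (\<Sum>i. \<integral>\<^sup>+\<omega>. indicator (H m) x * indicator (Gs i) (x, V \<omega>) \<partial>\<Omega>) \<partial>\<mu>)"
        by (rule nn_integral_suminf[symmetric]) measurable
      also have "\<dots> = (\<integral>\<^sup>+x. \<integral>\<^sup>+\<omega>. (\<Sum>i. indicator (H m) x * indicator (Gs i) (x, V \<omega>)) \<partial>\<Omega> \<partial>\<mu>)"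
        by (intro nn_integral_cong nn_integral_suminf[symmetric]) measurable
      also have "\<dots> = ?b (\<Union>i. Gs i)" by (simp add: suminf_indicator[OF Gs(2)])
      finally show "(\<Sum>i. ?b (Gs i)) = ?b (\<Union>i. Gs i)" .
    qed
  qed
qed

lemma mecke_window:
  assumes "F \<in> borel_measurable (borel \<Otimes>\<^sub>M config_space)"
  shows "(\<integral>\<^sup>+\<omega>. sum_over (V \<omega>) (\<lambda>x. indicator (H m) x * F (x, V \<omega> - {x})) \<partial>\<Omega>) =
    (\<integral>\<^sup>+x. \<integral>\<^sup>+\<omega>. indicator (H m) x * F (x, V \<omega>) \<partial>\<Omega> \<partial>\<mu>)"
  using assms
proof (induct rule: borel_measurable_induct)
  case (cong f g)
  have "x \<in> space (borel \<Otimes>\<^sub>M config_space) \<Longrightarrow> f x = g x" for x using cong(3) by simp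
  then have "f (x, X) = g (x, X)" if "X \<in> configs" for x X using that
      by (simp add: space_pair_measure)
  note fg = this[OF V_configs] this[OF configs_mono[OF V_configs Diff_subset]]
  have "(\<integral>\<^sup>+\<omega>. sum_over (V \<omega>) (\<lambda>x. indicator (H m) x * f (x, V \<omega> - {x})) \<partial>\<Omega>) =
      (\<integral>\<^sup>+\<omega>. sum_over (V \<omega>) (\<lambda>x. indicator (H m) x * g (x, V \<omega> - {x})) \<partial>\<Omega>)"
    by (intro nn_integral_cong sum_over_cong) (simp add: fg)
  moreover have "(\<integral>\<^sup>+x. \<integral>\<^sup>+\<omega>. indicator (H m) x * f (x, V \<omega>) \<partial>\<Omega> \<partial>\<mu>) =
     (\<integral>\<^sup>+x. \<integral>\<^sup>+\<omega>. indicator (H m) x * g (x, V \<omega>) \<partial>\<Omega> \<partial>\<mu>)"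
    by (intro nn_integral_cong) (simp add: fg)
  ultimately show ?case using cong(4) by simp
next
  case (set A) then show ?case by (rule mecke_window_set)
next
  case (mult u c)
  note [measurable] = mult(2)
  have "(\<integral>\<^sup>+\<omega>. sum_over (V \<omega>) (\<lambda>x. indicator (H m) x * (c * u (x, V \<omega> - {x}))) \<partial>\<Omega>) =
      c * (\<integral>\<^sup>+\<omega>. sum_over (V \<omega>) (\<lambda>x. indicator (H m) x * u (x, V \<omega> - {x})) \<partial>\<Omega>)"
    by (subst nn_integral_cmult[symmetric]) (auto simp: sum_over_cmult[symmetric] mult.left_commute)
  moreover have "(\<integral>\<^sup>+x. \<integral>\<^sup>+\<omega>. indicator (H m) x * (c * u (x, V \<omega>)) \<partial>\<Omega> \<partial>\<mu>) =
      (\<integral>\<^sup>+x. c * (\<integral>\<^sup>+\<omega>. indicator (H m) x * u (x, V \<omega>) \<partial>\<Omega>) \<partial>\<mu>)"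
    by (intro nn_integral_cong, subst nn_integral_cmult[symmetric]) (auto simp: mult.left_commute)
  moreover have "\<dots> = c * (\<integral>\<^sup>+x. \<integral>\<^sup>+\<omega>. indicator (H m) x * u (x, V \<omega>) \<partial>\<Omega> \<partial>\<mu>)"
    by (rule nn_integral_cmult) measurable
  ultimately show ?case using mult(4) by simp
next
  case (add u v)
  note [measurable] = add(1) add(4)
  have "(\<integral>\<^sup>+\<omega>. sum_over (V \<omega>) (\<lambda>x. indicator (H m) x * (u (x, V \<omega> - {x}) + v (x, V \<omega> - {x}))) \<partial>\<Omega>) =
      (\<integral>\<^sup>+\<omega>. sum_over (V \<omega>) (\<lambda>x. indicator (H m) x * u (x, V \<omega> - {x})) + sum_over (V \<omega>)
          (\<lambda>x. indicator (H m) x * v (x, V \<omega> - {x})) \<partial>\<Omega>)"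
    by (simp add: sum_over_add[symmetric] distrib_left)
  also have "\<dots> = (\<integral>\<^sup>+\<omega>. sum_over (V \<omega>) (\<lambda>x. indicator (H m) x * u (x, V \<omega> - {x})) \<partial>\<Omega>) +
      (\<integral>\<^sup>+\<omega>. sum_over (V \<omega>) (\<lambda>x. indicator (H m) x * v (x, V \<omega> - {x})) \<partial>\<Omega>)"
    by (rule nn_integral_add) measurable
  also have "\<dots> = (\<integral>\<^sup>+x. \<integral>\<^sup>+\<omega>. indicator (H m) x * u (x, V \<omega>) \<partial>\<Omega> \<partial>\<mu>) +
      (\<integral>\<^sup>+x. \<integral>\<^sup>+\<omega>. indicator (H m) x * v (x, V \<omega>) \<partial>\<Omega> \<partial>\<mu>)"
    using add(3) add(7) by simp
  also have "\<dots> = (\<integral>\<^sup>+x. (\<integral>\<^sup>+\<omega>. indicator (H m) x * u (x, V \<omega>) \<partial>\<Omega>) +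
      (\<integral>\<^sup>+\<omega>. indicator (H m) x * v (x, V \<omega>) \<partial>\<Omega>) \<partial>\<mu>)"
    by (rule nn_integral_add[symmetric]) measurable
  also have "\<dots> = (\<integral>\<^sup>+x. \<integral>\<^sup>+\<omega>. indicator (H m) x * (u (x, V \<omega>) + v (x, V \<omega>)) \<partial>\<Omega> \<partial>\<mu>)"
    by (intro nn_integral_cong, subst nn_integral_add[symmetric]) (auto simp: distrib_left)
  finally show ?case by (simp add: add.commute)
next
  case (seq U)
  note [measurable] = seq(1)
  have inc: "U i z \<le> U j z" if "i \<le> j" for i j z by (rule le_funD[OF incseqD[OF seq(4) that]])
  have supm: "indicator (H m) x * (SUP i. U i) z = (SUP i. indicator (H m) x * U i z)" for x z
    unfolding SUP_apply by (rule SUP_mult_left_ennreal)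
  have "(\<integral>\<^sup>+\<omega>. sum_over (V \<omega>) (\<lambda>x. indicator (H m) x * (SUP i. U i) (x, V \<omega> - {x})) \<partial>\<Omega>) =
     (\<integral>\<^sup>+\<omega>. (SUP i. sum_over (V \<omega>) (\<lambda>x. indicator (H m) x * U i (x, V \<omega> - {x}))) \<partial>\<Omega>)"
    unfolding supm by (intro nn_integral_cong sum_over_SUP)
        (auto simp: incseq_def le_fun_def intro!: mult_left_mono inc)
  also have "\<dots> = (SUP i. \<integral>\<^sup>+\<omega>. sum_over (V \<omega>) (\<lambda>x. indicator (H m) x * U i (x, V \<omega> - {x})) \<partial>\<Omega>)"
    by (rule nn_integral_monotone_convergence_SUP)
        (auto simp: incseq_def le_fun_def intro!: sum_over_mono mult_left_mono inc)
  also have "\<dots> = (SUP i. \<integral>\<^sup>+x. \<integral>\<^sup>+\<omega>. indicator (H m) x * U i (x, V \<omega>) \<partial>\<Omega> \<partial>\<mu>)"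
    using seq(3) by simp
  also have "\<dots> = (\<integral>\<^sup>+x. (SUP i. \<integral>\<^sup>+\<omega>. indicator (H m) x * U i (x, V \<omega>) \<partial>\<Omega>) \<partial>\<mu>)"
    by (rule nn_integral_monotone_convergence_SUP[symmetric])
      (auto simp: incseq_def le_fun_def intro!: nn_integral_mono mult_left_mono inc)
  also have "\<dots> = (\<integral>\<^sup>+x. \<integral>\<^sup>+\<omega>. (SUP i. indicator (H m) x * U i (x, V \<omega>)) \<partial>\<Omega> \<partial>\<mu>)"
    by (intro nn_integral_cong nn_integral_monotone_convergence_SUP[symmetric])
      (auto simp: incseq_def le_fun_def intro!: mult_left_mono inc)
  also have "\<dots> = (\<integral>\<^sup>+x. \<integral>\<^sup>+\<omega>. indicator (H m) x * (SUP i. U i) (x, V \<omega>) \<partial>\<Omega> \<partial>\<mu>)"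
    unfolding supm ..
  finally show ?case .
qed

text \<open>
  The Mecke equation. The point \<open>x\<close> is deleted from the configuration on the left-hand side. This
  form avoids the null event that the process has a point at a given position, and it can be
  iterated, as in \<open>mecke_two_points\<close>.
\<close>

theorem mecke:
  assumes [measurable]: "F \<in> borel_measurable (borel \<Otimes>\<^sub>M config_space)"
  shows "(\<integral>\<^sup>+\<omega>. sum_over (V \<omega>) (\<lambda>x. F (x, V \<omega> - {x})) \<partial>\<Omega>) = (\<integral>\<^sup>+x. \<integral>\<^sup>+\<omega>. F (x, V \<omega>) \<partial>\<Omega> \<partial>\<mu>)"
proof -
  have Hle: "indicator (H i) x \<le> (indicator (H j) x :: ennreal)" if "i \<le> j" for i j x
    using incseq_H_le[OF that] by (auto split: split_indicator)
  have sup: "(SUP m. indicator (H m) x * y) = (y :: ennreal)" for x y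
  proof (rule antisym)
    obtain m where "x \<in> H m" using in_some_H by blast
    then show "y \<le> (SUP m. indicator (H m) x * y)" by (intro SUP_upper2[of m]) auto
  qed (auto intro!: SUP_least split: split_indicator)
  have "(\<integral>\<^sup>+\<omega>. sum_over (V \<omega>) (\<lambda>x. F (x, V \<omega> - {x})) \<partial>\<Omega>) =
    (\<integral>\<^sup>+\<omega>. sum_over (V \<omega>) (\<lambda>x. SUP m. indicator (H m) x * F (x, V \<omega> - {x})) \<partial>\<Omega>)"
    unfolding sup ..
  also have "\<dots> = (\<integral>\<^sup>+\<omega>. (SUP m. sum_over (V \<omega>) (\<lambda>x. indicator (H m) x * F (x, V \<omega> - {x}))) \<partial>\<Omega>)"
    by (intro nn_integral_cong sum_over_SUP)
        (auto simp: incseq_def le_fun_def intro!: mult_right_mono Hle)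
  also have "\<dots> = (SUP m. \<integral>\<^sup>+\<omega>. sum_over (V \<omega>) (\<lambda>x. indicator (H m) x * F (x, V \<omega> - {x})) \<partial>\<Omega>)"
    by (rule nn_integral_monotone_convergence_SUP)
        (auto simp: incseq_def le_fun_def intro!: sum_over_mono mult_right_mono Hle)
  also have "\<dots> = (SUP m. \<integral>\<^sup>+x. \<integral>\<^sup>+\<omega>. indicator (H m) x * F (x, V \<omega>) \<partial>\<Omega> \<partial>\<mu>)"
    by (simp add: mecke_window)
  also have "\<dots> = (\<integral>\<^sup>+x. (SUP m. \<integral>\<^sup>+\<omega>. indicator (H m) x * F (x, V \<omega>) \<partial>\<Omega>) \<partial>\<mu>)"
    by (rule nn_integral_monotone_convergence_SUP[symmetric])
      (auto simp: incseq_def le_fun_def intro!: nn_integral_mono mult_right_mono Hle)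
  also have "\<dots> = (\<integral>\<^sup>+x. \<integral>\<^sup>+\<omega>. (SUP m. indicator (H m) x * F (x, V \<omega>)) \<partial>\<Omega> \<partial>\<mu>)"
    by (intro nn_integral_cong nn_integral_monotone_convergence_SUP[symmetric])
      (auto simp: incseq_def le_fun_def intro!: mult_right_mono Hle)
  finally show ?thesis unfolding sup .
qed

theorem mecke_two_points:
  assumes F[measurable]: "F \<in> borel_measurable (borel \<Otimes>\<^sub>M (borel \<Otimes>\<^sub>M config_space))"
  shows "(\<integral>\<^sup>+\<omega>. sum_over (V \<omega>) (\<lambda>x. sum_over (V \<omega> - {x}) (\<lambda>y. F (x, y, V \<omega> - {x} - {y}))) \<partial>\<Omega>) =
    (\<integral>\<^sup>+x. \<integral>\<^sup>+y. \<integral>\<^sup>+\<omega>. F (x, y, V \<omega>) \<partial>\<Omega> \<partial>\<mu> \<partial>\<mu>)"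
proof -
  have "(\<lambda>z. sum_over (snd z) (\<lambda>y. F (fst z, y, snd z - {y}))) \<in>
      borel_measurable (borel \<Otimes>\<^sub>M config_space)"
    by measurable
  from mecke[OF this]
  have "(\<integral>\<^sup>+\<omega>. sum_over (V \<omega>) (\<lambda>x. sum_over (V \<omega> - {x}) (\<lambda>y. F (x, y, V \<omega> - {x} - {y}))) \<partial>\<Omega>) =
    (\<integral>\<^sup>+x. \<integral>\<^sup>+\<omega>. sum_over (V \<omega>) (\<lambda>y. F (x, y, V \<omega> - {y})) \<partial>\<Omega> \<partial>\<mu>)" by simp
  also have "\<dots> = (\<integral>\<^sup>+x. \<integral>\<^sup>+y. \<integral>\<^sup>+\<omega>. F (x, y, V \<omega>) \<partial>\<Omega> \<partial>\<mu> \<partial>\<mu>)"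
  proof (rule nn_integral_cong)
    fix x
    have "(\<lambda>z. F (x, z)) \<in> borel_measurable (borel \<Otimes>\<^sub>M config_space)" by measurable
    from mecke[OF this] show "(\<integral>\<^sup>+\<omega>. sum_over (V \<omega>) (\<lambda>y. F (x, y, V \<omega> - {y})) \<partial>\<Omega>) =
        (\<integral>\<^sup>+y. \<integral>\<^sup>+\<omega>. F (x, y, V \<omega>) \<partial>\<Omega> \<partial>\<mu>)" .
  qed
  finally show ?thesis .
qed

end


section \<open>Independence in disjoint regions\<close>

context poisson_points begin

text \<open>
  Independence of count vectors is derived from their point probabilities by this decomposition.
\<close>

lemma emeasure_discrete_split:
  assumes [measurable]: "X \<in> measurable \<Omega> (count_space T)" "Measurable.pred \<Omega> Q"
      and T: "countable T" "W \<subseteq> T"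
  shows "emeasure \<Omega> {\<omega> \<in> space \<Omega>. X \<omega> \<in> W \<and> Q \<omega>} =
    (\<integral>\<^sup>+v. emeasure \<Omega> {\<omega> \<in> space \<Omega>. X \<omega> = v \<and> Q \<omega>} \<partial>count_space W)"
proof -
  have "emeasure \<Omega> (\<Union>v\<in>W. {\<omega> \<in> space \<Omega>. X \<omega> = v \<and> Q \<omega>}) =
      (\<integral>\<^sup>+v. emeasure \<Omega> {\<omega> \<in> space \<Omega>. X \<omega> = v \<and> Q \<omega>} \<partial>count_space W)"
  proof (rule emeasure_UN_countable)
    show "countable W" using T countable_subset by blast
    show "{\<omega> \<in> space \<Omega>. X \<omega> = v \<and> Q \<omega>} \<in> sets \<Omega>" if "v \<in> W" for v
      using T(2) that by measurable
  qed (auto simp: disjoint_family_on_def)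
  also have "(\<Union>v\<in>W. {\<omega> \<in> space \<Omega>. X \<omega> = v \<and> Q \<omega>}) = {\<omega> \<in> space \<Omega>. X \<omega> \<in> W \<and> Q \<omega>}" by blast
  finally show ?thesis .
qed

lemma prod_lessThan_add: "(\<Prod>i<m + n. f i) = (\<Prod>i<m. f i) * (\<Prod>i<n. f (m + i :: nat) :: real)"
  by (induction n) (simp_all add: mult.assoc)

lemma indep_counts_on:
  assumes D: "\<And>i. D i \<in> bounded_borel" "disjoint_family D"
      and D': "\<And>i. D' i \<in> bounded_borel" "disjoint_family D'"
    and disj: "\<And>i j. D i \<inter> D' j = {}"
  shows "emeasure \<Omega> {\<omega> \<in> space \<Omega>. counts_on n D (V \<omega>) \<in> W \<and> counts_on n' D' (V \<omega>) \<in> W'} =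
    emeasure \<Omega> {\<omega> \<in> space \<Omega>. counts_on n D (V \<omega>) \<in> W} * emeasure \<Omega>
        {\<omega> \<in> space \<Omega>. counts_on n' D' (V \<omega>) \<in> W'}"
proof -
  have m[measurable]: "(\<lambda>\<omega>. counts_on n D (V \<omega>)) \<in> measurable \<Omega> (count_space (count_vectors n))"
    using measurable_compose[OF V_measurable counts_on_measurable[OF D(1)]] .
  have m'[measurable]: "(\<lambda>\<omega>. counts_on n' D' (V \<omega>)) \<in> measurable \<Omega> (count_space (count_vectors n'))"
    using measurable_compose[OF V_measurable counts_on_measurable[OF D'(1)]] .
  let ?p = "\<lambda>v. \<Prod>i<n. poisson_mass (measure \<mu> (D i)) (v i)"
  let ?p' = "\<lambda>v. \<Prod>i<n'. poisson_mass (measure \<mu> (D' i)) (v i)"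
  have nn: "0 \<le> ?p v" "0 \<le> ?p' v" for v by (auto intro!: prod_nonneg poisson_mass_nonneg)
  have counts_on_eq: "counts_on n D X = v \<longleftrightarrow> (\<forall>i<n. card (X \<inter> D i) = v i)" if "v \<in> count_vectors n"
      for n D and X :: "'a set" and v
    using that by (auto simp: counts_on_def count_vectors_def fun_eq_iff)
  have 1: "emeasure \<Omega> {\<omega> \<in> space \<Omega>. counts_on n D (V \<omega>) = v} = ennreal (?p v)"
      if "v \<in> count_vectors n" for v
    using joint_counts[OF D, of n v] by (simp add: counts_on_eq[OF that] emeasure_eq_measure)
  have 2: "emeasure \<Omega> {\<omega> \<in> space \<Omega>. counts_on n' D' (V \<omega>) = v} = ennreal (?p' v)"
      if "v \<in> count_vectors n'" for v
    using joint_counts[OF D', of n' v] by (simp add: counts_on_eq[OF that] emeasure_eq_measure)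
  have 3: "emeasure \<Omega> {\<omega> \<in> space \<Omega>. counts_on n' D' (V \<omega>) = v' \<and> counts_on n D (V \<omega>) = v} =
      ennreal (?p v) * ennreal (?p' v')"
    if v: "v \<in> count_vectors n" "v' \<in> count_vectors n'" for v v'
  proof -
    define E where "E i = (if i < n then D i else D' (i - n))" for i
    have "E i \<in> bounded_borel" for i using D(1) D'(1) by (simp add: E_def)
    moreover have "disjoint_family E"
      unfolding disjoint_family_on_def
    proof (intro ballI impI)
      fix i j :: nat assume ij: "i \<noteq> j"
      have a: "D i \<inter> D j = {}" using D(2) ij unfolding disjoint_family_on_def by blast
      have b: "D' (i - n) \<inter> D' (j - n) = {}" if "\<not> i < n" "\<not> j < n"
      proof -
        have "i - n \<noteq> j - n" using that ij by linarith
        then show ?thesis using D'(2) unfolding disjoint_family_on_def by blast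
      qed
      show "E i \<inter> E j = {}"
        using a b disj disj[of j "i - n"] by (auto simp: E_def Int_commute)
    qed
    ultimately have c: "prob {\<omega> \<in> space \<Omega>. \<forall>i<n + n'. card (V \<omega> \<inter> E i) =
        (if i < n then v i else v' (i - n))}
       = (\<Prod>i<n + n'. poisson_mass (measure \<mu> (E i)) (if i < n then v i else v' (i - n)))" by
           (rule joint_counts)
    have d: "(\<Prod>i<n + n'. poisson_mass (measure \<mu> (E i)) (if i < n then v i else v' (i - n))) =
        ?p v * ?p' v'"
      unfolding prod_lessThan_add by (simp add: E_def)
    have e: "(\<forall>i<n + n'. card (X \<inter> E i) = (if i < n then v i else v' (i - n))) \<longleftrightarrow>
       counts_on n' D' X = v' \<and> counts_on n D X = v" for X
    proof -
      have "(\<forall>i<n + n'. card (X \<inter> E i) = (if i < n then v i else v' (i - n))) \<longleftrightarrow>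
         (\<forall>i<n. card (X \<inter> D i) = v i) \<and> (\<forall>i<n'. card (X \<inter> D' i) = v' i)" (is "?L \<longleftrightarrow> ?R")
      proof
        assume L: ?L
        show ?R
        proof (intro conjI allI impI)
          fix i assume "i < n" then show "card (X \<inter> D i) = v i" using L[rule_format, of i]
              by (simp add: E_def)
        next
          fix i assume "i < n'" then show "card (X \<inter> D' i) = v' i" using L[rule_format, of "n + i"]
              by (simp add: E_def)
        qed
      qed (simp add: E_def)
      then show ?thesis unfolding counts_on_eq[OF v(1)] counts_on_eq[OF v(2)] by blast
    qed
    show ?thesis using c unfolding d e by (simp add: emeasure_eq_measure ennreal_mult nn)
  qed
  define U where "U = W \<inter> count_vectors n"
  define U' where "U' = W' \<inter> count_vectors n'"
  have U: "U \<subseteq> count_vectors n" "U' \<subseteq> count_vectors n'" by (auto simp: U_def U'_def)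
  have "emeasure \<Omega> {\<omega> \<in> space \<Omega>. counts_on n D (V \<omega>) \<in> U \<and> counts_on n' D' (V \<omega>) \<in> U'} =
    (\<integral>\<^sup>+v. emeasure \<Omega> {\<omega> \<in> space \<Omega>. counts_on n D (V \<omega>) = v \<and> counts_on n' D' (V \<omega>) \<in> U'}
        \<partial>count_space U)"
    using measurable_compose[OF m', of "\<lambda>v. v \<in> U'" "count_space UNIV"]
    by (intro emeasure_discrete_split[OF m _ countable_count_vectors U(1)]) simp
  also have "\<dots> = (\<integral>\<^sup>+v. \<integral>\<^sup>+v'. ennreal (?p v) * ennreal (?p' v') \<partial>count_space U' \<partial>count_space U)"
  proof (rule nn_integral_cong)
    fix v assume "v \<in> space (count_space U)"
    then have v: "v \<in> count_vectors n" using U by auto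
    have "emeasure \<Omega> {\<omega> \<in> space \<Omega>. counts_on n' D' (V \<omega>) \<in> U' \<and> counts_on n D (V \<omega>) = v} =
       (\<integral>\<^sup>+v'. emeasure \<Omega> {\<omega> \<in> space \<Omega>. counts_on n' D' (V \<omega>) = v' \<and> counts_on n D (V \<omega>) = v}
           \<partial>count_space U')"
      using v by (intro emeasure_discrete_split[OF m' _ countable_count_vectors U(2)]) measurable
    also have "\<dots> = (\<integral>\<^sup>+v'. ennreal (?p v) * ennreal (?p' v') \<partial>count_space U')"
      using U v by (intro nn_integral_cong 3) auto
    finally show "emeasure \<Omega> {\<omega> \<in> space \<Omega>. counts_on n D (V \<omega>) = v \<and> counts_on n' D' (V \<omega>) \<in> U'} =
       (\<integral>\<^sup>+v'. ennreal (?p v) * ennreal (?p' v') \<partial>count_space U')" by (simp add: conj_commute)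
  qed
  also have "\<dots> = (\<integral>\<^sup>+v. ennreal (?p v) \<partial>count_space U) * (\<integral>\<^sup>+v'. ennreal (?p' v') \<partial>count_space U')"
    by (simp add: nn_integral_cmult nn_integral_multc)
  also have "(\<integral>\<^sup>+v. ennreal (?p v) \<partial>count_space U) =
      emeasure \<Omega> {\<omega> \<in> space \<Omega>. counts_on n D (V \<omega>) \<in> U}"
    using emeasure_discrete_split[OF m, of "\<lambda>_. True", OF _ countable_count_vectors U(1)] U(1)
    by (simp add: 1 subset_iff cong: nn_integral_cong_simp)
  also have "(\<integral>\<^sup>+v. ennreal (?p' v) \<partial>count_space U') =
      emeasure \<Omega> {\<omega> \<in> space \<Omega>. counts_on n' D' (V \<omega>) \<in> U'}"
    using emeasure_discrete_split[OF m', of "\<lambda>_. True", OF _ countable_count_vectors U(2)] U(2)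
    by (simp add: 2 subset_iff cong: nn_integral_cong_simp)
  finally show ?thesis by (simp add: U_def U'_def counts_on_count_vectors)
qed

lemma restrict_cylinder_counts_on:
  assumes A: "A \<in> sets borel" and G: "G \<in> cylinders"
  shows "\<exists>n D W. (\<forall>i. D i \<in> bounded_borel) \<and> disjoint_family D \<and> (\<forall>i. D i \<subseteq> A) \<and>
      (\<forall>X\<in>configs. X \<inter> A \<in> G \<longleftrightarrow> counts_on n D X \<in> W)"
proof -
  obtain \<B> where \<B>: "finite \<B>" "\<B> \<subseteq> bounded_borel" "determined_by \<B> (\<lambda>X. X \<in> G)"
    using G unfolding cylinders_def by blast
  have det: "determined_by ((\<lambda>B. B \<inter> A) ` \<B>) (\<lambda>X. X \<inter> A \<in> G)"
    unfolding determined_by_def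
  proof (intro ballI impI)
    fix X Y assume XY: "X \<in> configs" "Y \<in> configs"
        and *: "\<forall>B\<in>(\<lambda>B. B \<inter> A) ` \<B>. card (X \<inter> B) = card (Y \<inter> B)"
    have "card (X \<inter> A \<inter> B) = card (Y \<inter> A \<inter> B)" if "B \<in> \<B>" for B
      using * that by (simp add: Int_assoc Int_commute[of A])
    moreover have "X \<inter> A \<in> configs" "Y \<inter> A \<in> configs" using XY by (auto intro: configs_mono)
    ultimately show "(X \<inter> A \<in> G) = (Y \<inter> A \<in> G)" using \<B>(3) unfolding determined_by_def by blast
  qed
  have "finite ((\<lambda>B. B \<inter> A) ` \<B>)" "(\<lambda>B. B \<inter> A) ` \<B> \<subseteq> bounded_borel"
    using \<B>(1,2) bounded_borel_Int[OF _ A] by auto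
  from determined_by_counts_on[OF this det] obtain n D W where ref: "refines n D ((\<lambda>B. B \<inter> A) ` \<B>)"
      and W: "\<forall>X\<in>configs. X \<inter> A \<in> G \<longleftrightarrow> counts_on n D X \<in> W"
    by (elim exE conjE)
  have "D i \<subseteq> A" for i using refinesD(3)[OF ref, of i] by blast
  then show ?thesis using refinesD(1,2)[OF ref] W
    by (intro exI[of _ n] exI[of _ D] exI[of _ W]) simp
qed

text \<open>
  On cylinder events both restrictions depend on counts in disjoint sets; cylinder events generate.
\<close>

lemma indep_restrict:
  assumes [measurable]: "A \<in> sets borel" "A' \<in> sets borel" and disj: "A \<inter> A' = {}"
  shows "indep_var config_space (\<lambda>\<omega>. V \<omega> \<inter> A) config_space (\<lambda>\<omega>. V \<omega> \<inter> A')"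
proof -
  let ?E = "\<lambda>A. {(\<lambda>\<omega>. V \<omega> \<inter> A) -` G \<inter> space \<Omega> |G. G \<in> cylinders}"
  have cyl: "G \<in> sets config_space" if "G \<in> cylinders" for G
    unfolding sets_config_space_cylinders using that by (rule sigma_sets.Basic)
  have stable: "Int_stable (?E A)" for A
  proof (rule Int_stableI)
    fix a b assume "a \<in> ?E A" "b \<in> ?E A"
    then obtain G G' where "G \<in> cylinders" "G' \<in> cylinders" "a = (\<lambda>\<omega>. V \<omega> \<inter> A) -` G \<inter> space \<Omega>"
      "b = (\<lambda>\<omega>. V \<omega> \<inter> A) -` G' \<inter> space \<Omega>" by blast
    then show "a \<inter> b \<in> ?E A"
      using Int_stableD[OF Int_stable_cylinders, of G G']
          by (intro CollectI exI[of _ "G \<inter> G'"]) auto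
  qed
  have gen: "sigma_sets (space \<Omega>) {(\<lambda>\<omega>. V \<omega> \<inter> A) -` G \<inter> space \<Omega> |G. G \<in> sets config_space} =
      sigma_sets (space \<Omega>) (?E A)"
    if "A \<in> sets borel" for A
  proof -
    have "(\<lambda>\<omega>. V \<omega> \<inter> A) \<in> space \<Omega> \<rightarrow> configs" using V_configs by (auto intro: configs_mono)
    from sigma_sets_vimage_commute[OF this, of cylinders]
    have "{(\<lambda>\<omega>. V \<omega> \<inter> A) -` G \<inter> space \<Omega> |G. G \<in> sets config_space} = sigma_sets (space \<Omega>) (?E A)"
      unfolding sets_config_space_cylinders .
    moreover have "?E A \<subseteq> Pow (space \<Omega>)" by blast
    ultimately show ?thesis using sigma_sets_sigma_sets_eq by simp
  qed
  have ev: "?E A \<subseteq> events" if [measurable]: "A \<in> sets borel" for A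
    using cyl by (auto intro!: measurable_sets[of "\<lambda>\<omega>. V \<omega> \<inter> A" \<Omega> config_space])
  have "indep_set (?E A) (?E A')"
  proof (rule indep_setI[OF ev ev])
    fix a b assume "a \<in> ?E A" "b \<in> ?E A'"
    then obtain G G' where G: "G \<in> cylinders" "G' \<in> cylinders" "a = (\<lambda>\<omega>. V \<omega> \<inter> A) -` G \<inter> space \<Omega>"
      "b = (\<lambda>\<omega>. V \<omega> \<inter> A') -` G' \<inter> space \<Omega>" by blast
    obtain n D W where D: "\<forall>i. D i \<in> bounded_borel" "disjoint_family D" "\<forall>i. D i \<subseteq> A"
        "\<forall>X\<in>configs. X \<inter> A \<in> G \<longleftrightarrow> counts_on n D X \<in> W"
      using restrict_cylinder_counts_on[OF assms(1) G(1)] by blast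
    obtain n' D' W' where D': "\<forall>i. D' i \<in> bounded_borel" "disjoint_family D'" "\<forall>i. D' i \<subseteq> A'"
        "\<forall>X\<in>configs. X \<inter> A' \<in> G' \<longleftrightarrow> counts_on n' D' X \<in> W'"
      using restrict_cylinder_counts_on[OF assms(2) G(2)] by blast
    have a: "a = {\<omega> \<in> space \<Omega>. counts_on n D (V \<omega>) \<in> W}"
        and b: "b = {\<omega> \<in> space \<Omega>. counts_on n' D' (V \<omega>) \<in> W'}"
      unfolding G(3,4) using D(4) D'(4) V_configs by auto
    have ab: "a \<inter> b = {\<omega> \<in> space \<Omega>. counts_on n D (V \<omega>) \<in> W \<and> counts_on n' D' (V \<omega>) \<in> W'}" unfolding
        a b by blast
    have "D i \<inter> D' j = {}" for i j using D(3) D'(3) disj by blast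
    then have "emeasure \<Omega> (a \<inter> b) = emeasure \<Omega> a * emeasure \<Omega> b"
      unfolding ab unfolding a b by (intro indep_counts_on) (use D D' in auto)
    then show "prob (a \<inter> b) = prob a * prob b"
      by (simp add: emeasure_eq_measure ennreal_mult[symmetric])
  qed measurable
  from indep_set_sigma_sets[OF this stable stable]
  show ?thesis unfolding indep_var_eq using gen assms by simp
qed

lemma nn_integral_restrict_indep:
  assumes A[measurable]: "A \<in> sets borel" "A' \<in> sets borel" and disj: "A \<inter> A' = {}"
    and [measurable]: "f \<in> borel_measurable config_space" "g \<in> borel_measurable config_space"
  shows "(\<integral>\<^sup>+\<omega>. f (V \<omega> \<inter> A) * g (V \<omega> \<inter> A') \<partial>\<Omega>) = (\<integral>\<^sup>+\<omega>. f (V \<omega> \<inter> A) \<partial>\<Omega>) * (\<integral>\<^sup>+\<omega>. g (V \<omega> \<inter> A') \<partial>\<Omega>)"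
proof -
  have m: "(\<lambda>\<omega>. V \<omega> \<inter> A) \<in> measurable \<Omega> config_space" "(\<lambda>\<omega>. V \<omega> \<inter> A') \<in> measurable \<Omega> config_space"
      by measurable
  interpret X: prob_space "distr \<Omega> config_space (\<lambda>\<omega>. V \<omega> \<inter> A)" by (rule prob_space_distr[OF m(1)])
  interpret Y: prob_space "distr \<Omega> config_space (\<lambda>\<omega>. V \<omega> \<inter> A')" by (rule prob_space_distr[OF m(2)])
  have "distr \<Omega> config_space (\<lambda>\<omega>. V \<omega> \<inter> A) \<Otimes>\<^sub>M distr \<Omega> config_space (\<lambda>\<omega>. V \<omega> \<inter> A') =
      distr \<Omega> (config_space \<Otimes>\<^sub>M config_space) (\<lambda>\<omega>. (V \<omega> \<inter> A, V \<omega> \<inter> A'))"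
    using indep_restrict[OF A disj] unfolding indep_var_distribution_eq by simp
  then have "(\<integral>\<^sup>+z. f (fst z) * g (snd z) \<partial>distr \<Omega> (config_space \<Otimes>\<^sub>M config_space)
      (\<lambda>\<omega>. (V \<omega> \<inter> A, V \<omega> \<inter> A'))) =
     (\<integral>\<^sup>+z. f (fst z) * g (snd z) \<partial>(distr \<Omega> config_space (\<lambda>\<omega>. V \<omega> \<inter> A) \<Otimes>\<^sub>M distr \<Omega> config_space
         (\<lambda>\<omega>. V \<omega> \<inter> A')))" by simp
  also have "\<dots> = (\<integral>\<^sup>+x. \<integral>\<^sup>+y. f x *
      g y \<partial>distr \<Omega> config_space (\<lambda>\<omega>. V \<omega> \<inter> A') \<partial>distr \<Omega> config_space (\<lambda>\<omega>. V \<omega> \<inter> A))"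
    by (subst Y.nn_integral_fst[symmetric]) auto
  also have "\<dots> = (\<integral>\<^sup>+x. f x \<partial>distr \<Omega> config_space (\<lambda>\<omega>. V \<omega> \<inter> A)) *
      (\<integral>\<^sup>+y. g y \<partial>distr \<Omega> config_space (\<lambda>\<omega>. V \<omega> \<inter> A'))"
    by (simp add: nn_integral_cmult nn_integral_multc)
  also have "\<dots> = (\<integral>\<^sup>+\<omega>. f (V \<omega> \<inter> A) \<partial>\<Omega>) * (\<integral>\<^sup>+\<omega>. g (V \<omega> \<inter> A') \<partial>\<Omega>)"
    by (simp add: nn_integral_distr m)
  finally show ?thesis by (simp add: nn_integral_distr)
qed

end


section \<open>Second moments of sums of local functionals\<close>

lemma sum_over_infinite: "infinite (X \<inter> B) \<Longrightarrow> sum_over X (indicator B) = \<top>"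
  using sum_over_Int[of X B "\<lambda>_. 1"] by (simp add: sum_over_def)

lemma sum_over_zero: "sum_over X (\<lambda>x. 0) = 0" by (simp add: sum_over_def)

lemma sum_over_square:
  "sum_over X f * sum_over X f = sum_over X (\<lambda>x. f x * f x) +
      sum_over X (\<lambda>x. sum_over (X - {x}) (\<lambda>y. f x * f y))"
proof -
  have "sum_over X f * sum_over X f = sum_over X (\<lambda>x. f x * sum_over X f)"
      by (simp add: sum_over_multc)
  also have "\<dots> = sum_over X (\<lambda>x. f x * f x + sum_over (X - {x}) (\<lambda>y. f x * f y))"
    by (intro sum_over_cong) (simp add: sum_over_remove[of _ X f] sum_over_cmult distrib_left)
  finally show ?thesis by (simp add: sum_over_add)
qed

context poisson_points begin

sublocale sigma_finite_measure \<mu>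
proof
  show "\<exists>A. countable A \<and> A \<subseteq> sets \<mu> \<and> \<Union> A = space \<mu> \<and> (\<forall>a\<in>A. emeasure \<mu> a \<noteq> \<infinity>)"
    using H_finite H_cover sets_eq_imp_space_eq[OF sets_\<mu>]
    by (intro exI[of _ "range H"]) (auto simp: sets_\<mu> less_top)
qed

lemma expectation_count:
  assumes [measurable]: "D \<in> sets borel"
  shows "(\<integral>\<^sup>+\<omega>. sum_over (V \<omega>) (indicator D) \<partial>\<Omega>) = emeasure \<mu> D"
proof -
  have "(\<lambda>z. indicator D (fst z)) \<in> borel_measurable (borel \<Otimes>\<^sub>M config_space)" by measurable
  from mecke[OF this] show ?thesis by (simp add: emeasure_space_1 sets_\<mu>)
qed

lemma sum_over_indicator_ge_1: "x \<in> X \<Longrightarrow> x \<in> B \<Longrightarrow> sum_over X (indicator B) \<ge> 1"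
  by (subst sum_over_remove) auto

text \<open>
  Suppose that \<open>x\<close> and \<open>y\<close> are not neighbours. Then the two functionals depend on the
  configuration in \<open>B x\<close> and in \<open>B y\<close>, and they become independent when the overlap \<open>D\<close> of these
  sets is cut out. Cutting it out matters only if \<open>D\<close> contains a point, and the expected number
  of points in \<open>D\<close> is \<open>\<mu> D\<close>. This change is made in the expectation of the product and in the
  expectations of the two factors, hence the constant \<open>3\<close>.
\<close>

lemma local_covariance:
  fixes c :: "'a \<times> 'a set \<Rightarrow> ennreal"
  assumes c[measurable]: "c \<in> borel_measurable (borel \<Otimes>\<^sub>M config_space)" and c1: "\<And>z. c z \<le> 1"
    and B[measurable]: "\<And>x. B x \<in> sets borel" and sym: "\<And>x y. y \<in> B x \<longleftrightarrow> x \<in> B y"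
    and loc: "\<And>x X. X \<in> configs \<Longrightarrow> c (x, X) = c (x, X \<inter> B x)"
    and mean: "\<And>x. (\<integral>\<^sup>+\<omega>. c (x, V \<omega>) \<partial>\<Omega>) = L"
  shows "(\<integral>\<^sup>+\<omega>. c (x, insert y (V \<omega>)) * c (y, insert x (V \<omega>)) \<partial>\<Omega>) \<le>
    L * L + indicator (B x) y + 3 * emeasure \<mu> (B x \<inter> B y)"
proof (cases "y \<in> B x")
  case True
  have "(\<integral>\<^sup>+\<omega>. c (x, insert y (V \<omega>)) * c (y, insert x (V \<omega>)) \<partial>\<Omega>) \<le> (\<integral>\<^sup>+\<omega>. 1 * 1 \<partial>\<Omega>)"
    by (intro nn_integral_mono mult_mono c1) auto
  also have "\<dots> = indicator (B x) y" using True by (simp add: emeasure_space_1)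
  also have "\<dots> \<le> L * L + indicator (B x) y + 3 * emeasure \<mu> (B x \<inter> B y)"
    by (simp add: add_increasing add_increasing2)
  finally show ?thesis .
next
  case False
  then have nx: "x \<notin> B y" using sym by blast
  define D where "D = B x \<inter> B y"
  have [measurable]: "D \<in> sets borel" unfolding D_def by measurable
  define m where "m = emeasure \<mu> D"
  have ins: "c (x, insert y X) = c (x, X)" if "X \<in> configs" "y \<notin> B x" for x y X
  proof -
    have "insert y X \<inter> B x = X \<inter> B x" using that(2) by blast
    then show ?thesis using loc[OF that(1), of x] loc[OF configs_insert[OF that(1)], of x y] by simp
  qed
  have off: "c (x, X) = c (x, X \<inter> (B x - D))" if "X \<in> configs" "X \<inter> D = {}" for x X
  proof -
    have "X \<inter> B x = X \<inter> (B x - D)" using that(2) by blast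
    then show ?thesis using loc[OF that(1), of x] by simp
  qed
  have hit: "1 \<le> sum_over X (indicator D)" if XD: "X \<inter> D \<noteq> {}" for X
  proof -
    obtain z where "z \<in> X" "z \<in> D" using XD by auto
    then show ?thesis by (rule sum_over_indicator_ge_1)
  qed
  have le1: "c (x, X) \<le> sum_over X (indicator D) + c (x, X \<inter> (B x - D))"
    "c (x, X \<inter> (B x - D)) \<le> sum_over X (indicator D) + c (x, X)" if "X \<in> configs" for x X
  proof -
    have "c (x, X) \<le> sum_over X (indicator D) + c (x, X \<inter> (B x - D)) \<and>
      c (x, X \<inter> (B x - D)) \<le> sum_over X (indicator D) + c (x, X)"
    proof (cases "X \<inter> D = {}")
      case True
      then show ?thesis using off[OF that True, of x] by (simp add: add_increasing)
    next
      case False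
      then show ?thesis using order_trans[OF c1 hit[OF False]] by (simp add: add_increasing2)
    qed
    then show "c (x, X) \<le> sum_over X (indicator D) + c (x, X \<inter> (B x - D))"
      "c (x, X \<inter> (B x - D)) \<le> sum_over X (indicator D) + c (x, X)" by auto
  qed
  have le2: "c (x, X) * c (y, X) \<le> sum_over X (indicator D) + c (x, X \<inter> (B x - D)) *
      c (y, X \<inter> (B y - D))"
    if "X \<in> configs" for X
  proof (cases "X \<inter> D = {}")
    case True then show ?thesis using off[OF that True, of x] off[OF that True, of y]
        by (simp add: add_increasing)
  next
    case False
    have "c (x, X) * c (y, X) \<le> 1 * 1" by (intro mult_mono c1) auto
    also have "\<dots> \<le> sum_over X (indicator D)" using hit[OF False] by simp
    finally show ?thesis by (simp add: add_increasing2)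
  qed
  have cx[measurable]: "(\<lambda>X. c (x, X)) \<in> borel_measurable config_space" for x by measurable
  have p: "(\<integral>\<^sup>+\<omega>. c (x, V \<omega> \<inter> (B x - D)) \<partial>\<Omega>) \<le> m + L" for x
  proof -
    have "(\<integral>\<^sup>+\<omega>. c (x, V \<omega> \<inter> (B x - D)) \<partial>\<Omega>) \<le> (\<integral>\<^sup>+\<omega>. sum_over (V \<omega>) (indicator D) + c (x, V \<omega>) \<partial>\<Omega>)"
      by (intro nn_integral_mono le1 V_configs)
    also have "\<dots> = m + L" by (subst nn_integral_add) (auto simp: expectation_count mean m_def)
    finally show ?thesis .
  qed
  have p1: "(\<integral>\<^sup>+\<omega>. c (x, V \<omega> \<inter> (B x - D)) \<partial>\<Omega>) \<le> 1" for x
  proof -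
    have "(\<integral>\<^sup>+\<omega>. c (x, V \<omega> \<inter> (B x - D)) \<partial>\<Omega>) \<le> (\<integral>\<^sup>+\<omega>. 1 \<partial>\<Omega>)" by (intro nn_integral_mono c1)
    then show ?thesis by (simp add: emeasure_space_1)
  qed
  have L1: "L \<le> 1"
  proof -
    have "L \<le> (\<integral>\<^sup>+\<omega>. 1 \<partial>\<Omega>)" unfolding mean[of x, symmetric] by (intro nn_integral_mono c1)
    then show ?thesis by (simp add: emeasure_space_1)
  qed
  let ?px = "\<integral>\<^sup>+\<omega>. c (x, V \<omega> \<inter> (B x - D)) \<partial>\<Omega>" and ?py = "\<integral>\<^sup>+\<omega>. c (y, V \<omega> \<inter> (B y - D)) \<partial>\<Omega>"
  have "(\<integral>\<^sup>+\<omega>. c (x, insert y (V \<omega>)) * c (y, insert x (V \<omega>)) \<partial>\<Omega>) = (\<integral>\<^sup>+\<omega>. c (x, V \<omega>) * c (y, V \<omega>) \<partial>\<Omega>)"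
    by (intro nn_integral_cong) (simp add: ins[OF V_configs] False nx)
  also have "\<dots> \<le> (\<integral>\<^sup>+\<omega>. sum_over (V \<omega>) (indicator D) + c (x, V \<omega> \<inter> (B x - D)) *
      c (y, V \<omega> \<inter> (B y - D)) \<partial>\<Omega>)"
    by (intro nn_integral_mono le2 V_configs)
  also have "\<dots> = m + (\<integral>\<^sup>+\<omega>. c (x, V \<omega> \<inter> (B x - D)) * c (y, V \<omega> \<inter> (B y - D)) \<partial>\<Omega>)"
    by (subst nn_integral_add) (auto simp: expectation_count m_def)
  also have "(\<integral>\<^sup>+\<omega>. c (x, V \<omega> \<inter> (B x - D)) * c (y, V \<omega> \<inter> (B y - D)) \<partial>\<Omega>) = ?px * ?py"
  proof (rule nn_integral_restrict_indep[of "B x - D" "B y - D" "\<lambda>X. c (x, X)" "\<lambda>X. c (y, X)"])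
    show "(B x - D) \<inter> (B y - D) = {}" by (auto simp: D_def)
  qed measurable
  also have "m + ?px * ?py \<le> m + (m * 1 + L * (m + L))"
  proof (rule add_left_mono)
    have "?px * ?py \<le> (m + L) * ?py" by (intro mult_right_mono p) auto
    also have "\<dots> = m * ?py + L * ?py" by (simp add: distrib_right)
    also have "\<dots> \<le> m * 1 + L * (m + L)" by (intro add_mono mult_left_mono p p1) auto
    finally show "?px * ?py \<le> m * 1 + L * (m + L)" .
  qed
  also have "\<dots> \<le> m + (m + (1 * m + L * L))"
    unfolding mult_1_right distrib_left[of L]
        by (intro add_left_mono add_right_mono mult_right_mono L1) auto
  also have "\<dots> = L * L + 3 * m"
  proof -
    have "(3::ennreal) = 1 + 1 + 1" by simp
    then have "3 * m = m + m + m" by (simp only: distrib_right mult_1_left)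
    then show ?thesis by (simp add: ac_simps)
  qed
  finally show ?thesis using False by (simp add: m_def D_def)
qed

text \<open>
  The Mecke equation for one and for two points computes both moments. The covariance bound is
  integrable in \<open>y\<close>: as the neighbourhood relation is symmetric, exchanging the order of integration
  gives \<open>v * v\<close> for the integral of \<open>\<mu> (B x \<inter> B y)\<close>. So the variance is at most a constant
  times \<open>\<mu> E\<close>.
\<close>

lemma second_moment:
  fixes c :: "'a \<times> 'a set \<Rightarrow> ennreal"
  assumes c[measurable]: "c \<in> borel_measurable (borel \<Otimes>\<^sub>M config_space)" and c1: "\<And>z. c z \<le> 1"
    and Bm[measurable]: "Measurable.pred (borel \<Otimes>\<^sub>M borel) (\<lambda>z. snd z \<in> B (fst z))"
    and sym: "\<And>x y. y \<in> B x \<longleftrightarrow> x \<in> B y"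
    and loc: "\<And>x X. X \<in> configs \<Longrightarrow> c (x, X) = c (x, X \<inter> B x)"
    and mean: "\<And>x. (\<integral>\<^sup>+\<omega>. c (x, V \<omega>) \<partial>\<Omega>) = L" and v: "\<And>x. emeasure \<mu> (B x) = v"
    and E[measurable]: "E \<in> sets borel"
  defines "S \<equiv> \<lambda>\<omega>. sum_over (V \<omega>) (\<lambda>x. indicator E x * c (x, V \<omega> - {x}))"
  shows "(\<integral>\<^sup>+\<omega>. S \<omega> \<partial>\<Omega>) = L * emeasure \<mu> E"
    and "(\<integral>\<^sup>+\<omega>. S \<omega> * S \<omega> \<partial>\<Omega>) \<le> (L * emeasure \<mu> E) * (L * emeasure \<mu> E) + (1 + v + 3 * v * v) *
        emeasure \<mu> E"
proof -
  let ?a = "emeasure \<mu> E"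
  have B[measurable]: "B x \<in> sets borel" for x
  proof -
    have "(\<lambda>y. (x, y)) \<in> measurable borel (borel \<Otimes>\<^sub>M borel)" by measurable
    moreover have "{z \<in> space (borel \<Otimes>\<^sub>M borel). snd z \<in> B (fst z)} \<in> sets (borel \<Otimes>\<^sub>M borel)"
        by measurable
    ultimately have "(\<lambda>y. (x, y)) -` {z \<in> space (borel \<Otimes>\<^sub>M borel). snd z \<in> B (fst z)} \<inter> space borel \<in>
        sets borel"
      by (rule measurable_sets)
    then show ?thesis by (simp add: space_pair_measure)
  qed
  have "(\<lambda>z. indicator E (fst z) * c z) \<in> borel_measurable (borel \<Otimes>\<^sub>M config_space)" by measurable
  from mecke[OF this] have "(\<integral>\<^sup>+\<omega>. S \<omega> \<partial>\<Omega>) = (\<integral>\<^sup>+x. \<integral>\<^sup>+\<omega>. indicator E x * c (x, V \<omega>) \<partial>\<Omega> \<partial>\<mu>)"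
    unfolding S_def by simp
  also have "\<dots> = (\<integral>\<^sup>+x. indicator E x * L \<partial>\<mu>)"
    by (intro nn_integral_cong) (simp add: nn_integral_cmult mean)
  finally show "(\<integral>\<^sup>+\<omega>. S \<omega> \<partial>\<Omega>) = L * ?a"
    using nn_integral_cmult_indicator[of E \<mu> L] by (simp add: sets_\<mu> mult.commute)
  let ?f = "\<lambda>\<omega> x. indicator E x * c (x, V \<omega> - {x})"
  let ?F = "\<lambda>(x, y, X). indicator E x * indicator E y * (c (x, insert y X) * c (y, insert x X))"
  have diag: "(\<integral>\<^sup>+\<omega>. sum_over (V \<omega>) (\<lambda>x. ?f \<omega> x * ?f \<omega> x) \<partial>\<Omega>) \<le> ?a"
  proof -
    have "(\<integral>\<^sup>+\<omega>. sum_over (V \<omega>) (\<lambda>x. ?f \<omega> x * ?f \<omega> x) \<partial>\<Omega>) \<le>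
        (\<integral>\<^sup>+\<omega>. sum_over (V \<omega>) (\<lambda>x. (indicator E x * 1) * (1 * 1)) \<partial>\<Omega>)"
      by (intro nn_integral_mono sum_over_mono mult_mono c1) (simp_all add: indicator_def)
    then show ?thesis by (simp add: expectation_count)
  qed
  have off: "(\<integral>\<^sup>+\<omega>. sum_over (V \<omega>) (\<lambda>x. sum_over (V \<omega> - {x}) (\<lambda>y. ?f \<omega> x * ?f \<omega> y)) \<partial>\<Omega>) =
    (\<integral>\<^sup>+x. \<integral>\<^sup>+y. indicator E x * indicator E y *
        (\<integral>\<^sup>+\<omega>. c (x, insert y (V \<omega>)) * c (y, insert x (V \<omega>)) \<partial>\<Omega>) \<partial>\<mu> \<partial>\<mu>)"
  proof -
    have "(\<integral>\<^sup>+\<omega>. sum_over (V \<omega>) (\<lambda>x. sum_over (V \<omega> - {x}) (\<lambda>y. ?f \<omega> x * ?f \<omega> y)) \<partial>\<Omega>) =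
      (\<integral>\<^sup>+\<omega>. sum_over (V \<omega>) (\<lambda>x. sum_over (V \<omega> - {x}) (\<lambda>y. ?F (x, y, V \<omega> - {x} - {y}))) \<partial>\<Omega>)"
    proof (intro nn_integral_cong sum_over_cong)
      fix \<omega> x y assume "x \<in> V \<omega>" "y \<in> V \<omega> - {x}"
      then have "insert y (V \<omega> - {x} - {y}) = V \<omega> - {x}" "insert x (V \<omega> - {x} - {y}) = V \<omega> - {y}"
          by auto
      then show "?f \<omega> x * ?f \<omega> y = ?F (x, y, V \<omega> - {x} - {y})" by (simp add: mult_ac)
    qed
    also have "\<dots> = (\<integral>\<^sup>+x. \<integral>\<^sup>+y. \<integral>\<^sup>+\<omega>. ?F (x, y, V \<omega>) \<partial>\<Omega> \<partial>\<mu> \<partial>\<mu>)"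
      by (rule mecke_two_points) measurable
    finally show ?thesis by (simp add: nn_integral_cmult)
  qed
  have Bm2[measurable]: "Measurable.pred (\<mu> \<Otimes>\<^sub>M \<mu>) (\<lambda>z. snd z \<in> B (fst z))" by measurable
  have DD: "(\<integral>\<^sup>+y. emeasure \<mu> (B x \<inter> B y) \<partial>\<mu>) = v * v" for x
  proof -
    interpret P: pair_sigma_finite \<mu> \<mu> by unfold_locales
    have "(\<integral>\<^sup>+y. emeasure \<mu> (B x \<inter> B y) \<partial>\<mu>) =
        (\<integral>\<^sup>+y. \<integral>\<^sup>+z. indicator (B x) z * indicator (B y) z \<partial>\<mu> \<partial>\<mu>)"
      by (intro nn_integral_cong) (simp add: indicator_inter_arith[symmetric] sets_\<mu>)
    also have "\<dots> = (\<integral>\<^sup>+z. \<integral>\<^sup>+y. indicator (B x) z * indicator (B y) z \<partial>\<mu> \<partial>\<mu>)"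
    proof (rule P.Fubini'[symmetric])
      have "(\<lambda>z. indicator (B x) (snd z) * (if snd z \<in> B (fst z) then 1 else 0) :: ennreal) \<in>
          borel_measurable (\<mu> \<Otimes>\<^sub>M \<mu>)"
        by measurable
      then show "(\<lambda>(y, z). indicator (B x) z * indicator (B y) z :: ennreal) \<in>
          borel_measurable (\<mu> \<Otimes>\<^sub>M \<mu>)"
        by (simp add: indicator_def case_prod_beta)
    qed
    also have "\<dots> = (\<integral>\<^sup>+z. \<integral>\<^sup>+y. indicator (B x) z * indicator (B z) y \<partial>\<mu> \<partial>\<mu>)"
      using sym by (intro nn_integral_cong) (simp add: indicator_def)
    also have "\<dots> = (\<integral>\<^sup>+z. indicator (B x) z * v \<partial>\<mu>)"
      by (intro nn_integral_cong) (simp add: nn_integral_cmult sets_\<mu> v)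
    finally show ?thesis by (simp add: nn_integral_multc sets_\<mu> v)
  qed
  have Dm[measurable]: "(\<lambda>z. emeasure \<mu> (B (fst z) \<inter> B (snd z))) \<in> borel_measurable (\<mu> \<Otimes>\<^sub>M \<mu>)"
  proof -
    have pm: "Measurable.pred M (\<lambda>w. g w \<in> B (f w))"
        if "f \<in> measurable M borel" "g \<in> measurable M borel"
      for M :: "(('a \<times> 'a) \<times> 'a) measure" and f g
      using measurable_compose[OF measurable_Pair[OF that] Bm] by simp
    have [measurable]: "Measurable.pred ((\<mu> \<Otimes>\<^sub>M \<mu>) \<Otimes>\<^sub>M \<mu>) (\<lambda>w. snd w \<in> B (fst (fst w)))"
      "Measurable.pred ((\<mu> \<Otimes>\<^sub>M \<mu>) \<Otimes>\<^sub>M \<mu>) (\<lambda>w. snd w \<in> B (snd (fst w)))"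
      by (rule pm; measurable)+
    have "(\<lambda>z. \<integral>\<^sup>+w. (if w \<in> B (fst z) \<and> w \<in> B (snd z) then 1 else 0) \<partial>\<mu>) \<in>
        borel_measurable (\<mu> \<Otimes>\<^sub>M \<mu>)"
      by measurable
    also have "(\<lambda>z. \<integral>\<^sup>+w. (if w \<in> B (fst z) \<and> w \<in> B (snd z) then 1 else 0) \<partial>\<mu>) =
        (\<lambda>z. emeasure \<mu> (B (fst z) \<inter> B (snd z)))"
    proof
      fix z
      have "(\<integral>\<^sup>+w. (if w \<in> B (fst z) \<and> w \<in> B (snd z) then 1 else 0) \<partial>\<mu>) =
          (\<integral>\<^sup>+w. indicator (B (fst z) \<inter> B (snd z)) w \<partial>\<mu>)"
        by (intro nn_integral_cong) (simp add: indicator_def)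
      then show "(\<integral>\<^sup>+w. (if w \<in> B (fst z) \<and> w \<in> B (snd z) then 1 else 0) \<partial>\<mu>) =
          emeasure \<mu> (B (fst z) \<inter> B (snd z))"
        by (simp add: sets_\<mu>)
    qed
    finally show ?thesis .
  qed
  have "(\<integral>\<^sup>+x. \<integral>\<^sup>+y. indicator E x * indicator E y *
      (\<integral>\<^sup>+\<omega>. c (x, insert y (V \<omega>)) * c (y, insert x (V \<omega>)) \<partial>\<Omega>) \<partial>\<mu> \<partial>\<mu>) \<le>
     (\<integral>\<^sup>+x. \<integral>\<^sup>+y. indicator E x * (L * L * indicator E y + indicator (B x) y + 3 * emeasure \<mu>
         (B x \<inter> B y)) \<partial>\<mu> \<partial>\<mu>)"
  proof (intro nn_integral_mono)
    fix x y
    have "indicator E x * indicator E y * (\<integral>\<^sup>+\<omega>. c (x, insert y (V \<omega>)) * c (y, insert x (V \<omega>)) \<partial>\<Omega>) \<le>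
      indicator E x * indicator E y * (L * L + indicator (B x) y + 3 * emeasure \<mu> (B x \<inter> B y))"
      by (intro mult_left_mono local_covariance c c1 B sym loc mean) auto
    also have "\<dots> \<le> indicator E x * (L * L * indicator E y + indicator (B x) y + 3 *
        emeasure \<mu> (B x \<inter> B y))"
      by (auto split: split_indicator)
    finally show "indicator E x * indicator E y *
        (\<integral>\<^sup>+\<omega>. c (x, insert y (V \<omega>)) * c (y, insert x (V \<omega>)) \<partial>\<Omega>) \<le>
      indicator E x * (L * L * indicator E y + indicator (B x) y + 3 * emeasure \<mu> (B x \<inter> B y))" .
  qed
  also have "\<dots> = (\<integral>\<^sup>+x. indicator E x * (L * L * ?a + v + 3 * (v * v)) \<partial>\<mu>)"
  proof (rule nn_integral_cong)
    fix x
    have [measurable]: "(\<lambda>y. emeasure \<mu> (B x \<inter> B y)) \<in> borel_measurable \<mu>"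
    proof -
      have "(\<lambda>y. (x, y)) \<in> measurable \<mu> (\<mu> \<Otimes>\<^sub>M \<mu>)"
        by (rule measurable_Pair1') (simp add: sets_eq_imp_space_eq[OF sets_\<mu>])
      from measurable_compose[OF this Dm] show ?thesis by simp
    qed
    show "(\<integral>\<^sup>+y. indicator E x * (L * L * indicator E y + indicator (B x) y + 3 *
        emeasure \<mu> (B x \<inter> B y)) \<partial>\<mu>) =
      indicator E x * (L * L * ?a + v + 3 * (v * v))"
      by (simp add: nn_integral_cmult nn_integral_add sets_\<mu> v DD)
  qed
  also have "\<dots> = ?a * (L * L * ?a + v + 3 * (v * v))"
    by (simp add: nn_integral_multc sets_\<mu>)
  finally have off': "(\<integral>\<^sup>+\<omega>. sum_over (V \<omega>) (\<lambda>x. sum_over (V \<omega> - {x}) (\<lambda>y. ?f \<omega> x * ?f \<omega> y)) \<partial>\<Omega>) \<le>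
      ?a * (L * L * ?a + v + 3 * (v * v))"
    unfolding off .
  have "(\<integral>\<^sup>+\<omega>. S \<omega> * S \<omega> \<partial>\<Omega>) = (\<integral>\<^sup>+\<omega>. sum_over (V \<omega>) (\<lambda>x. ?f \<omega> x * ?f \<omega> x) +
      sum_over (V \<omega>) (\<lambda>x. sum_over (V \<omega> - {x}) (\<lambda>y. ?f \<omega> x * ?f \<omega> y)) \<partial>\<Omega>)"
    unfolding S_def sum_over_square ..
  also have "\<dots> = (\<integral>\<^sup>+\<omega>. sum_over (V \<omega>) (\<lambda>x. ?f \<omega> x * ?f \<omega> x) \<partial>\<Omega>) +
      (\<integral>\<^sup>+\<omega>. sum_over (V \<omega>) (\<lambda>x. sum_over (V \<omega> - {x}) (\<lambda>y. ?f \<omega> x * ?f \<omega> y)) \<partial>\<Omega>)"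
    by (rule nn_integral_add) measurable
  also have "\<dots> \<le> ?a + ?a * (L * L * ?a + v + 3 * (v * v))"
    by (intro add_mono diag off')
  also have "\<dots> = (L * ?a) * (L * ?a) + (1 + v + 3 * v * v) * ?a"
    by (simp add: distrib_left distrib_right mult_ac add_ac)
  finally show "(\<integral>\<^sup>+\<omega>. S \<omega> * S \<omega> \<partial>\<Omega>) \<le> (L * ?a) * (L * ?a) + (1 + v + 3 * v * v) * ?a" .
qed

end


section \<open>The mean clustering coefficient\<close>

text \<open>
  The reciprocal of the number of ordered pairs in a set of \<open>n + 2\<close> points. It is \<open>0\<close> for
  \<open>n = \<infinity>\<close>.
\<close>

definition inv_pairs :: "ennreal \<Rightarrow> ennreal" where
  "inv_pairs n = 1 / ((n + 2) * (n + 1))"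

text \<open>
  The fraction of the ordered pairs of distinct points of \<open>X \<inter> B\<close> that belong to \<open>R\<close>. The
  weight of a pair \<open>y, z\<close> is expressed by the number of points that remain when \<open>y\<close> and \<open>z\<close> are
  deleted, in order to fit the Mecke equation for two points. If \<open>X \<inter> B\<close> is infinite, all weights
  vanish.
\<close>

definition linked_fraction :: "'a set \<Rightarrow> ('a \<times> 'a) set \<Rightarrow> 'a set \<Rightarrow> ennreal" where
  "linked_fraction B R X = sum_over X (\<lambda>y. sum_over (X - {y}) (\<lambda>z.
     indicator B y * (indicator B z *
         (indicator R (y, z) * inv_pairs (sum_over (X - {y} - {z}) (indicator B))))))"

definition linked_pairs :: "('a \<times> 'a) set \<Rightarrow> 'a set \<Rightarrow> ('a \<times> 'a) set" where
  "linked_pairs R Y = {(y, z). y \<in> Y \<and> z \<in> Y \<and> y \<noteq> z \<and> (y, z) \<in> R}"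

lemma inv_pairs_top: "inv_pairs \<top> = 0"
  by (simp add: inv_pairs_def ennreal_mult_eq_top_iff top_add ennreal_top_mult)

lemma inv_pairs_of_nat: "k \<ge> 2 \<Longrightarrow> inv_pairs (of_nat (k - 2)) = ennreal (1 / (real k * (real k - 1)))"
proof -
  assume k: "k \<ge> 2"
  have "of_nat (k - 2) + 2 = ennreal (real k)"
    using k by (simp add: ennreal_of_nat_eq_real_of_nat of_nat_diff flip: ennreal_numeral
        ennreal_plus)
  moreover have "of_nat (k - 2) + 1 = ennreal (real k - 1)"
    using k by (simp add: ennreal_of_nat_eq_real_of_nat of_nat_diff flip: ennreal_1 ennreal_plus)
  ultimately show ?thesis
    using k by (simp add: inv_pairs_def divide_ennreal flip: ennreal_mult ennreal_1)
qed

lemma linked_fraction_eq_sum_over: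
  "linked_fraction B R X = sum_over (X \<inter> B)
      (\<lambda>y. sum_over (X \<inter> B - {y}) (\<lambda>z. indicator R (y, z) * inv_pairs
      (sum_over (X - {y} - {z}) (indicator B))))"
proof -
  have "linked_fraction B R X = sum_over X (\<lambda>y. indicator B y * sum_over (X - {y}) (\<lambda>z.
     indicator B z * (indicator R (y, z) * inv_pairs (sum_over (X - {y} - {z}) (indicator B)))))"
    unfolding linked_fraction_def sum_over_cmult ..
  also have "\<dots> = sum_over (X \<inter> B)
      (\<lambda>y. sum_over ((X - {y}) \<inter> B) (\<lambda>z. indicator R (y, z) * inv_pairs
      (sum_over (X - {y} - {z}) (indicator B))))"
    unfolding sum_over_Int[symmetric] ..
  finally show ?thesis by (simp add: Int_Diff Int_commute Diff_Int_distrib2)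
qed

lemma linked_fraction_infinite:
  assumes "infinite (X \<inter> B)"
  shows "linked_fraction B R X = 0"
proof -
  have "sum_over (X - {y} - {z}) (indicator B) = \<top>" for y z
  proof (rule sum_over_infinite)
    have sub: "X \<inter> B \<subseteq> (X - {y} - {z}) \<inter> B \<union> {y, z}" by blast
    show "infinite ((X - {y} - {z}) \<inter> B)"
    proof
      assume "finite ((X - {y} - {z}) \<inter> B)"
      then have "finite ((X - {y} - {z}) \<inter> B \<union> {y, z})" by simp
      from finite_subset[OF sub this] assms show False by simp
    qed
  qed
  then show ?thesis unfolding linked_fraction_def by (simp add: inv_pairs_top sum_over_zero)
qed

lemma finite_linked_pairs: "finite Y \<Longrightarrow> finite (linked_pairs R Y)"
  by (rule finite_subset[of _ "Y \<times> Y"]) (auto simp: linked_pairs_def)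

lemma linked_fraction_finite:
  assumes fin: "finite (X \<inter> B)"
  shows "linked_fraction B R X = of_nat (card (linked_pairs R (X \<inter> B))) *
      inv_pairs (of_nat (card (X \<inter> B) - 2))"
proof -
  let ?Y = "X \<inter> B"
  let ?k = "inv_pairs (of_nat (card ?Y - 2))"
  have *: "sum_over (X - {y} - {z}) (indicator B) = of_nat (card ?Y - 2)" if "y \<in> ?Y" "z \<in> ?Y - {y}"
      for y z
  proof -
    have e: "(X - {y} - {z}) \<inter> B = ?Y - {y, z}" by blast
    have "card (?Y - {y, z}) = card ?Y - 2"
      using that fin by (subst card_Diff_subset) auto
    then show ?thesis using sum_over_indicator[of "X - {y} - {z}" B] fin unfolding e by simp
  qed
  have "linked_fraction B R X = sum_over ?Y (\<lambda>y. sum_over (?Y - {y}) (\<lambda>z. indicator R (y, z) * ?k))"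
    unfolding linked_fraction_eq_sum_over by (intro sum_over_cong) (simp add: *)
  also have "\<dots> = (\<Sum>y\<in>?Y. \<Sum>z\<in>?Y - {y}. indicator R (y, z)) * ?k"
    using fin by (simp add: sum_over_multc sum_over_finite)
  also have "(\<Sum>y\<in>?Y. \<Sum>z\<in>?Y - {y}. indicator R (y, z)) =
      (\<Sum>p\<in>Sigma ?Y (\<lambda>y. ?Y - {y}). indicator R p :: ennreal)"
    using fin by (subst sum.Sigma) auto
  also have "\<dots> = (\<Sum>p\<in>linked_pairs R ?Y. 1)"
    using fin by (intro sum.mono_neutral_cong_right) (auto simp: linked_pairs_def indicator_def)
  finally show ?thesis by simp
qed

lemma linked_pairs_UNIV_card: "finite Y \<Longrightarrow> card (linked_pairs UNIV Y) = card Y * (card Y - 1)"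
proof -
  assume fin: "finite Y"
  have "linked_pairs UNIV Y = Sigma Y (\<lambda>y. Y - {y})" by (auto simp: linked_pairs_def)
  then show ?thesis using fin by (simp add: card_SigmaI)
qed

lemma linked_fraction_UNIV: "linked_fraction B UNIV X =
    (if finite (X \<inter> B) \<and> card (X \<inter> B) \<ge> 2 then 1 else 0)"
proof (cases "finite (X \<inter> B)")
  case True
  let ?k = "card (X \<inter> B)"
  show ?thesis
  proof (cases "?k \<ge> 2")
    case k: True
    have "linked_fraction B UNIV X = ennreal (real (?k * (?k - 1))) *
        ennreal (1 / (real ?k * (real ?k - 1)))"
      unfolding linked_fraction_finite[OF True] linked_pairs_UNIV_card[OF True]
          inv_pairs_of_nat[OF k]
      unfolding ennreal_of_nat_eq_real_of_nat ..
    also have "\<dots> = ennreal (real (?k * (?k - 1)) * (1 / (real ?k * (real ?k - 1))))"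
      using k by (intro ennreal_mult[symmetric]) auto
    also have "real (?k * (?k - 1)) * (1 / (real ?k * (real ?k - 1))) = 1"
      using k by (simp add: of_nat_diff)
    finally show ?thesis using True k by simp
  next
    case False
    then have "?k * (?k - 1) = 0" by (cases ?k) auto
    then show ?thesis unfolding linked_fraction_finite[OF True] linked_pairs_UNIV_card[OF True]
        using False by simp
  qed
qed (simp add: linked_fraction_infinite)

lemma linked_fraction_mono: "R \<subseteq> R' \<Longrightarrow> linked_fraction B R X \<le> linked_fraction B R' X"
  unfolding linked_fraction_def by (intro sum_over_mono mult_left_mono mult_right_mono)
      (auto simp: indicator_def)

lemma linked_fraction_le_1: "linked_fraction B R X \<le> 1"
  using linked_fraction_mono[of R UNIV B X] linked_fraction_UNIV[of B X] by (auto split: if_splits)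

lemma linked_fraction_local: "linked_fraction B R X = linked_fraction B R (X \<inter> B)"
proof (cases "finite (X \<inter> B)")
  case True
  then show ?thesis using linked_fraction_finite[of "X \<inter> B" B]
      by (simp add: linked_fraction_finite Int_assoc)
next
  case False
  then show ?thesis using linked_fraction_infinite[of "X \<inter> B" B]
      by (simp add: linked_fraction_infinite Int_assoc)
qed

text \<open>
  A triangle at \<open>x\<close> arises from its two other vertices in either order.
\<close>

lemma card_linked_pairs_triangles:
  assumes Y: "finite Y" "x \<notin> Y" and R: "sym R"
  shows "card (linked_pairs R Y) = 2 * card ((\<lambda>(y, z). {x, y, z}) ` linked_pairs R Y)"
proof -
  let ?P = "linked_pairs R Y" and ?f = "\<lambda>(y, z). {x, y, z}"
  have fin: "finite ?P" by (rule finite_linked_pairs[OF Y(1)])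
  have "card ?P = (\<Sum>T\<in>?f ` ?P. \<Sum>p\<in>{p \<in> ?P. ?f p = T}. 1)"
    using sum.image_gen[OF fin, of "\<lambda>_. 1::nat" ?f] by simp
  also have "\<dots> = (\<Sum>T\<in>?f ` ?P. 2)"
  proof (rule sum.cong[OF refl])
    fix T assume "T \<in> ?f ` ?P"
    then obtain y z where p: "(y, z) \<in> ?P" "T = {x, y, z}" by auto
    then have yz: "y \<noteq> z" "(z, y) \<in> ?P" "y \<noteq> x" "z \<noteq> x" using R Y(2)
        by (auto simp: linked_pairs_def sym_def)
    have "q \<in> {(y, z), (z, y)}" if "q \<in> ?P" "?f q = T" for q
    proof -
      obtain a b where q: "q = (a, b)" by (cases q)
      have ab: "a \<noteq> b" "a \<noteq> x" "b \<noteq> x" using that(1) Y(2) by (auto simp: q linked_pairs_def)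
      have "{x, a, b} = {x, y, z}" using that(2) p(2) by (simp add: q)
      then have "{a, b} = {y, z}" using ab yz by (auto simp: set_eq_iff)
      then show ?thesis by (auto simp: q doubleton_eq_iff)
    qed
    then have "{p \<in> ?P. ?f p = T} = {(y, z), (z, y)}" using p yz(2) by auto
    then show "(\<Sum>p\<in>{p \<in> ?P. ?f p = T}. 1) = (2::nat)" using yz(1) by simp
  qed
  finally show ?thesis by simp
qed

lemma threshold_edge_iff:
  assumes "\<And>x y. d x y = d y x"
  shows "{x, y} \<in> threshold_edges d t V \<longleftrightarrow> x \<in> V \<and> y \<in> V \<and> x \<noteq> y \<and> d x y \<le> t"
proof
  assume "{x, y} \<in> threshold_edges d t V"
  then obtain a b where "{x, y} = {a, b}" "a \<in> V" "b \<in> V" "a \<noteq> b" "d a b \<le> t"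
    unfolding threshold_edges_def by blast
  then show "x \<in> V \<and> y \<in> V \<and> x \<noteq> y \<and> d x y \<le> t"
    using assms[of x y] by (auto simp: doubleton_eq_iff)
qed (auto simp: threshold_edges_def)

text \<open>
  The vertex \<open>x\<close> is deleted from the configuration, as the Mecke equation requires. A vertex with
  infinitely many neighbours has degree \<open>0\<close> by the convention on \<open>card\<close>, which agrees with the value
  \<open>0\<close> of \<open>linked_fraction\<close>.
\<close>

lemma local_clustering_eq_linked_fraction:
  assumes d: "\<And>x y. d x y = d y x" and x: "x \<in> V"
  shows "ennreal (local_clustering (threshold_edges d t V) x) =
    linked_fraction {y. y \<noteq> x \<and> d x y \<le> t} {z. d (fst z) (snd z) \<le> t} (V - {x})"
proof -
  let ?E = "threshold_edges d t V" and ?B = "{y. y \<noteq> x \<and> d x y \<le> t}"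
      and ?R = "{z. d (fst z) (snd z) \<le> t}"
  let ?Y = "(V - {x}) \<inter> ?B"
  let ?P = "linked_pairs ?R ?Y"
  have edge: "{y, z} \<in> ?E \<longleftrightarrow> y \<in> V \<and> z \<in> V \<and> y \<noteq> z \<and> d y z \<le> t" for y z
    by (rule threshold_edge_iff[OF d])
  have deg: "degree ?E x = card ?Y"
    unfolding degree_def edge using x by (intro arg_cong[where f = card]) auto
  have tri: "{T. x \<in> T \<and> card T = 3 \<and> (\<forall>y\<in>T. \<forall>z\<in>T. y \<noteq> z \<longrightarrow> {y, z} \<in> ?E)} =
      (\<lambda>(y, z). {x, y, z}) ` ?P"
  proof (intro set_eqI iffI)
    fix T assume T: "T \<in> {T. x \<in> T \<and> card T = 3 \<and> (\<forall>y\<in>T. \<forall>z\<in>T. y \<noteq> z \<longrightarrow> {y, z} \<in> ?E)}"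
    then have "card (T - {x}) = 2" by (simp add: card_Diff_singleton_if)
    then obtain y z where yz: "T - {x} = {y, z}" "y \<noteq> z" by (auto simp: card_2_iff)
    then have T': "T = {x, y, z}" "y \<noteq> x" "z \<noteq> x" using T by auto
    then have "{x, y} \<in> ?E" "{x, z} \<in> ?E" "{y, z} \<in> ?E" using T yz(2) by auto
    then have "(y, z) \<in> ?P" using yz(2) T' unfolding edge by (auto simp: linked_pairs_def)
    then show "T \<in> (\<lambda>(y, z). {x, y, z}) ` ?P" using T'(1) by (intro image_eqI[of _ _ "(y, z)"]) auto
  next
    fix T assume "T \<in> (\<lambda>(y, z). {x, y, z}) ` ?P"
    then obtain y z where p: "(y, z) \<in> ?P" "T = {x, y, z}" by auto
    then have "y \<in> V" "z \<in> V" "y \<noteq> x" "z \<noteq> x" "y \<noteq> z" "d x y \<le> t" "d x z \<le> t" "d y z \<le> t"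
        "d y x \<le> t" "d z x \<le> t" "d z y \<le> t"
      using d[of y x] d[of z x] d[of z y] by (auto simp: linked_pairs_def)
    then show "T \<in> {T. x \<in> T \<and> card T = 3 \<and> (\<forall>y\<in>T. \<forall>z\<in>T. y \<noteq> z \<longrightarrow> {y, z} \<in> ?E)}"
      unfolding edge p(2) using x by auto
  qed
  show ?thesis
  proof (cases "finite ?Y")
    case False
    then show ?thesis using deg by (simp add: local_clustering_def linked_fraction_infinite)
  next
    case fin: True
    show ?thesis
    proof (cases "card ?Y \<ge> 2")
      case True
      let ?k = "card ?Y"
      have "sym ?R" using d by (auto simp: sym_def)
      then have two: "card ?P = 2 * triangle_count ?E x"
        unfolding triangle_count_def tri by (intro card_linked_pairs_triangles[OF fin]) auto
      have "linked_fraction ?B ?R (V - {x}) = ennreal (real (card ?P)) *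
          ennreal (1 / (real ?k * (real ?k - 1)))"
        unfolding linked_fraction_finite[OF fin] inv_pairs_of_nat[OF True] unfolding
            ennreal_of_nat_eq_real_of_nat ..
      also have "\<dots> = ennreal (real (card ?P) * (1 / (real ?k * (real ?k - 1))))"
        using True by (intro ennreal_mult[symmetric]) auto
      also have "real (card ?P) * (1 / (real ?k * (real ?k - 1))) = local_clustering ?E x"
        unfolding local_clustering_def deg two using True by simp
      finally show ?thesis ..
    next
      case False
      then have "card (linked_pairs UNIV ?Y) = 0" unfolding linked_pairs_UNIV_card[OF fin]
          by (cases "card ?Y") auto
      then have "linked_pairs UNIV ?Y = {}" using finite_linked_pairs[OF fin] by auto
      then have "?P = {}" by (auto simp: linked_pairs_def)
      then show ?thesis unfolding linked_fraction_finite[OF fin] using False deg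
          by (simp add: local_clustering_def)
    qed
  qed
qed

lemma local_clustering_nonneg: "0 \<le> local_clustering E x"
  unfolding local_clustering_def by auto

context config begin

lemma inv_pairs_measurable[measurable]: "inv_pairs \<in> borel_measurable borel"
  unfolding inv_pairs_def by measurable

lemma linked_fraction_measurable:
  assumes B: "Measurable.pred (M \<Otimes>\<^sub>M borel) (\<lambda>z. snd z \<in> B (fst z))"
      and R[measurable]: "R \<in> sets (borel \<Otimes>\<^sub>M borel)"
    and X[measurable]: "X \<in> measurable M config_space"
  shows "(\<lambda>w. linked_fraction (B w) R (X w)) \<in> borel_measurable M"
proof -
  have Bi: "(\<lambda>z. indicator (B (fst z)) (snd z) :: ennreal) \<in> borel_measurable (M \<Otimes>\<^sub>M borel)"
    using B unfolding indicator_def by measurable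
  have BI[measurable (raw)]: "(\<lambda>w. indicator (B (f w)) (g w) :: ennreal) \<in> borel_measurable N"
    if "f \<in> measurable N M" "g \<in> measurable N borel" for f g and N :: "'c measure"
    using measurable_compose[OF measurable_Pair[OF that] Bi] by simp
  show ?thesis unfolding linked_fraction_def by measurable
qed

end

context poisson_points begin

text \<open>
  Once two points \<open>y\<close> and \<open>z\<close> are added to the process, the weight depends on the process alone and
  the indicators depend on \<open>y\<close> and \<open>z\<close> alone.
\<close>

lemma linked_fraction_mean_factor:
  assumes [measurable]: "B \<in> sets borel" "R \<in> sets (borel \<Otimes>\<^sub>M borel)"
  shows "(\<integral>\<^sup>+\<omega>. linked_fraction B R (V \<omega>) \<partial>\<Omega>) =
    (\<integral>\<^sup>+y. \<integral>\<^sup>+z. indicator B y * (indicator B z * indicator R (y, z)) \<partial>\<mu> \<partial>\<mu>) *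
    (\<integral>\<^sup>+\<omega>. inv_pairs (sum_over (V \<omega>) (indicator B)) \<partial>\<Omega>)"
proof -
  let ?F = "\<lambda>(y, z, X). indicator B y *
      (indicator B z * (indicator R (y, z) * inv_pairs (sum_over X (indicator B))))"
  let ?h = "\<integral>\<^sup>+\<omega>. inv_pairs (sum_over (V \<omega>) (indicator B)) \<partial>\<Omega>"
  have [measurable]: "(\<lambda>w. indicator R (fst w, fst (snd w)) :: ennreal) \<in>
      borel_measurable (borel \<Otimes>\<^sub>M (borel \<Otimes>\<^sub>M config_space))"
    by measurable
  have F: "?F \<in> borel_measurable (borel \<Otimes>\<^sub>M (borel \<Otimes>\<^sub>M config_space))" unfolding case_prod_beta
      by measurable
  have Rm[measurable]: "(\<lambda>w. indicator R w :: ennreal) \<in> borel_measurable (\<mu> \<Otimes>\<^sub>M \<mu>)" by measurable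
  have "(\<integral>\<^sup>+\<omega>. linked_fraction B R (V \<omega>) \<partial>\<Omega>) = (\<integral>\<^sup>+y. \<integral>\<^sup>+z. \<integral>\<^sup>+\<omega>. ?F (y, z, V \<omega>) \<partial>\<Omega> \<partial>\<mu> \<partial>\<mu>)"
    using mecke_two_points[OF F] unfolding linked_fraction_def by simp
  also have "\<dots> = (\<integral>\<^sup>+y. \<integral>\<^sup>+z. indicator B y * (indicator B z * indicator R (y, z)) * ?h \<partial>\<mu> \<partial>\<mu>)"
    by (simp add: nn_integral_cmult mult.assoc)
  also have "\<dots> = (\<integral>\<^sup>+y. (\<integral>\<^sup>+z. indicator B y * (indicator B z * indicator R (y, z)) \<partial>\<mu>) * ?h \<partial>\<mu>)"
    by (intro nn_integral_cong nn_integral_multc) measurable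
  also have "\<dots> = (\<integral>\<^sup>+y. \<integral>\<^sup>+z. indicator B y * (indicator B z * indicator R (y, z)) \<partial>\<mu> \<partial>\<mu>) * ?h"
    by (intro nn_integral_multc) measurable
  finally show ?thesis .
qed

text \<open>
  The bounded sets \<open>H m \<inter> B\<close> increase to \<open>B\<close>.
\<close>

lemma prob_empty:
  assumes B[measurable]: "B \<in> sets borel" and fin: "emeasure \<mu> B < \<infinity>"
  shows "prob {\<omega> \<in> space \<Omega>. V \<omega> \<inter> B = {}} = exp (- measure \<mu> B)"
proof -
  let ?A = "\<lambda>m. {\<omega> \<in> space \<Omega>. card (V \<omega> \<inter> (H m \<inter> B)) = 0}"
  have [measurable]: "H m \<inter> B \<in> bounded_borel" for m by (rule H_bounded_borel[OF B])
  have "prob (?A m) = exp (- measure \<mu> (H m \<inter> B))" for m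
  proof -
    have bounded_borel: "(if i = 0 then H m \<inter> B else {}) \<in> bounded_borel" for i :: nat
        by (simp add: H_bounded_borel[OF B] empty_bounded_borel)
    have "disjoint_family (\<lambda>i::nat. if i = 0 then H m \<inter> B else {})"
        by (auto simp: disjoint_family_on_def)
    from joint_counts[OF bounded_borel this, of 1 "\<lambda>_. 0"] show ?thesis
        by (simp add: poisson_mass_def)
  qed
  moreover have "(\<lambda>m. prob (?A m)) \<longlonglongrightarrow> prob (\<Inter>m. ?A m)"
  proof (rule finite_Lim_measure_decseq)
    show "decseq ?A"
    proof (intro decseq_SucI subsetI)
      fix m \<omega> assume w: "\<omega> \<in> ?A (Suc m)"
      then have "finite (V \<omega> \<inter> (H (Suc m) \<inter> B))"
          by (intro configs_finite V_configs H_bounded_borel B) auto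
      then have "V \<omega> \<inter> (H (Suc m) \<inter> B) = {}" using w by simp
      then have "V \<omega> \<inter> (H m \<inter> B) = {}" using incseq_H_le[of m "Suc m"] by auto
      then show "\<omega> \<in> ?A m" using w by simp
    qed
    have "?A m \<in> events" for m by measurable
    then show "range ?A \<subseteq> events" by blast
  qed
  moreover have "(\<Inter>m. ?A m) = {\<omega> \<in> space \<Omega>. V \<omega> \<inter> B = {}}"
  proof (intro set_eqI iffI)
    fix \<omega> assume w: "\<omega> \<in> (\<Inter>m. ?A m)"
    then have w': "\<omega> \<in> space \<Omega>" by auto
    have "V \<omega> \<inter> (H m \<inter> B) = {}" for m
    proof -
      have "card (V \<omega> \<inter> (H m \<inter> B)) = 0" using w by simp
      then show ?thesis using card_0_eq[OF
          configs_finite[OF V_configs[OF w'] H_bounded_borel[OF B]]] by blast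
    qed
    then have "V \<omega> \<inter> B = {}" using in_some_H by blast
    then show "\<omega> \<in> {\<omega> \<in> space \<Omega>. V \<omega> \<inter> B = {}}" using w' by simp
  next
    fix \<omega> assume w: "\<omega> \<in> {\<omega> \<in> space \<Omega>. V \<omega> \<inter> B = {}}"
    then have "V \<omega> \<inter> (H m \<inter> B) = {}" for m by blast
    then show "\<omega> \<in> (\<Inter>m. ?A m)" using w by simp
  qed
  moreover have "(\<lambda>m. exp (- measure \<mu> (H m \<inter> B))) \<longlonglongrightarrow> exp (- measure \<mu> B)"
  proof (intro tendsto_exp tendsto_minus)
    have "(\<lambda>m. measure \<mu> (H m \<inter> B)) \<longlonglongrightarrow> measure \<mu> (\<Union>m. H m \<inter> B)"
    proof (rule Lim_measure_incseq)
      show "incseq (\<lambda>m. H m \<inter> B)" using incseq_H_le by (fastforce simp: incseq_def)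
      show "emeasure \<mu> (\<Union>m. H m \<inter> B) \<noteq> \<infinity>" using fin H_cover
          by (simp add: Int_commute flip: Int_UN_distrib)
    qed (auto simp: sets_\<mu>)
    then show "(\<lambda>m. measure \<mu> (H m \<inter> B)) \<longlonglongrightarrow> measure \<mu> B"
      using H_cover by (simp add: Int_commute flip: Int_UN_distrib)
  qed
  ultimately show ?thesis using LIMSEQ_unique by simp
qed

lemma sum_over_one_point:
  "sum_over X (\<lambda>x. indicator B x * indicator {0} (sum_over (X - {x}) (indicator B))) =
      indicator {1} (sum_over X (indicator B))"
proof -
  have s: "indicator {0} (sum_over (X - {x}) (indicator B)) =
      (indicator {1} (sum_over X (indicator B)) :: ennreal)"
    if "x \<in> X \<inter> B" for x
  proof -
    have "sum_over X (indicator B) = 1 + sum_over (X - {x}) (indicator B)"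
      using that sum_over_remove[of x X "indicator B"] by simp
    then show ?thesis by (auto simp: indicator_def)
  qed
  have "sum_over X (\<lambda>x. indicator B x * indicator {0} (sum_over (X - {x}) (indicator B))) =
      sum_over (X \<inter> B) (\<lambda>x. indicator {1} (sum_over X (indicator B)))"
    unfolding sum_over_Int[symmetric] by (rule sum_over_cong[OF s])
  also have "\<dots> = sum_over X (\<lambda>x. indicator B x * indicator {1} (sum_over X (indicator B)))"
      by (rule sum_over_Int)
  also have "\<dots> = sum_over X (indicator B) * indicator {1} (sum_over X (indicator B))"
      by (rule sum_over_multc)
  also have "\<dots> = indicator {1} (sum_over X (indicator B))" by (auto simp: indicator_def)
  finally show ?thesis .
qed

lemma sum_over_indicator_cases:
  "(infinite (X \<inter> B) \<and> sum_over X (indicator B) = \<top>) \<or>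
      (finite (X \<inter> B) \<and> sum_over X (indicator B) = of_nat (card (X \<inter> B)))"
  using sum_over_infinite sum_over_indicator by blast

text \<open>
  The case of the complete graph, where the fraction is \<open>1\<close> as soon as there are two points. It
  determines the expected weight without the summation of a series, also if \<open>\<mu> B = \<infinity>\<close>.
\<close>

lemma expectation_inv_pairs:
  assumes B[measurable]: "B \<in> sets borel"
  shows "emeasure \<mu> B * emeasure \<mu> B * (\<integral>\<^sup>+\<omega>. inv_pairs (sum_over (V \<omega>) (indicator B)) \<partial>\<Omega>) =
    (\<integral>\<^sup>+\<omega>. linked_fraction B UNIV (V \<omega>) \<partial>\<Omega>)"
proof -
  have U: "UNIV \<in> sets (borel \<Otimes>\<^sub>M borel :: ('a \<times> 'a) measure)"
    using sets.top[of "borel \<Otimes>\<^sub>M borel :: ('a \<times> 'a) measure"] by (simp add: space_pair_measure)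
  have "(\<integral>\<^sup>+y. \<integral>\<^sup>+z. indicator B y * (indicator B z * indicator UNIV (y, z)) \<partial>\<mu> \<partial>\<mu>) =
     (\<integral>\<^sup>+y. indicator B y * emeasure \<mu> B \<partial>\<mu>)"
    by (intro nn_integral_cong) (simp add: nn_integral_cmult sets_\<mu>)
  also have "\<dots> = emeasure \<mu> B * emeasure \<mu> B"
    using nn_integral_cmult_indicator[of B \<mu> "emeasure \<mu> B"] by (simp add: sets_\<mu> mult.commute)
  finally show ?thesis unfolding linked_fraction_mean_factor[OF B U] by simp
qed

text \<open>
  The probability of exactly one point is \<open>\<mu> B\<close> times the probability of no point, by the Mecke
  equation for the indicator of the event that the deletion of a point of \<open>B\<close> leaves none.
\<close>

lemma prob_at_least_two:
  assumes B[measurable]: "B \<in> sets borel" and fin: "emeasure \<mu> B < \<infinity>"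
  shows "(\<integral>\<^sup>+\<omega>. linked_fraction B UNIV (V \<omega>) \<partial>\<Omega>) =
      ennreal (1 - exp (- measure \<mu> B) * (1 + measure \<mu> B))"
proof -
  let ?N = "\<lambda>\<omega>. sum_over (V \<omega>) (indicator B)"
  let ?v = "measure \<mu> B"
  have [measurable]: "?N \<in> borel_measurable \<Omega>" by measurable
  have clm[measurable]: "(\<lambda>\<omega>. linked_fraction B UNIV (V \<omega>)) \<in> borel_measurable \<Omega>"
    unfolding linked_fraction_def by measurable
  have v: "emeasure \<mu> B = ennreal ?v" using fin by (simp add: emeasure_eq_ennreal_measure less_top)
  have p0: "(\<integral>\<^sup>+\<omega>. indicator {0} (?N \<omega>) \<partial>\<Omega>) = ennreal (exp (- ?v))"
  proof -
    have "(\<integral>\<^sup>+\<omega>. indicator {0} (?N \<omega>) \<partial>\<Omega>) = (\<integral>\<^sup>+\<omega>. indicator {\<omega> \<in> space \<Omega>. ?N \<omega> = 0} \<omega> \<partial>\<Omega>)"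
      by (intro nn_integral_cong) (simp add: indicator_def)
    also have "\<dots> = emeasure \<Omega> {\<omega> \<in> space \<Omega>. ?N \<omega> = 0}" by (rule nn_integral_indicator) measurable
    also have "{\<omega> \<in> space \<Omega>. ?N \<omega> = 0} = {\<omega> \<in> space \<Omega>. V \<omega> \<inter> B = {}}"
    proof (intro Collect_cong conj_cong refl)
      fix \<omega> show "(?N \<omega> = 0) = (V \<omega> \<inter> B = {})"
        using sum_over_indicator_cases[of "V \<omega>" B] by auto
    qed
    finally show ?thesis using prob_empty[OF B fin] by (simp add: emeasure_eq_measure)
  qed
  have p1: "(\<integral>\<^sup>+\<omega>. indicator {1} (?N \<omega>) \<partial>\<Omega>) = ennreal (?v * exp (- ?v))"
  proof -
    have "(\<lambda>z. indicator B (fst z) * indicator {0} (sum_over (snd z) (indicator B)) :: ennreal) \<in>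
        borel_measurable (borel \<Otimes>\<^sub>M config_space)"
      by measurable
    from mecke[OF this]
    have "(\<integral>\<^sup>+\<omega>. indicator {1} (?N \<omega>) \<partial>\<Omega>) = (\<integral>\<^sup>+x. \<integral>\<^sup>+\<omega>. indicator B x * indicator {0} (?N \<omega>) \<partial>\<Omega> \<partial>\<mu>)"
      by (simp add: sum_over_one_point)
    also have "\<dots> = (\<integral>\<^sup>+x. indicator B x * ennreal (exp (- ?v)) \<partial>\<mu>)"
      by (intro nn_integral_cong) (simp add: nn_integral_cmult p0)
    also have "\<dots> = ennreal ?v * ennreal (exp (- ?v))"
      using nn_integral_cmult_indicator[of B \<mu> "ennreal (exp (- ?v))"]
          by (simp add: sets_\<mu> v mult.commute)
    finally show ?thesis by (simp add: ennreal_mult)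
  qed
  have "AE \<omega> in \<Omega>. ?N \<omega> \<noteq> \<infinity>"
    by (rule nn_integral_noteq_infinite) (use fin in \<open>auto simp: expectation_count\<close>)
  then have "AE \<omega> in \<Omega>. linked_fraction B UNIV (V \<omega>) +
      (indicator {0} (?N \<omega>) + indicator {1} (?N \<omega>)) = 1"
  proof eventually_elim
    case (elim \<omega>)
    then have f: "finite (V \<omega> \<inter> B)" "?N \<omega> = of_nat (card (V \<omega> \<inter> B))"
        using sum_over_indicator_cases[of "V \<omega>" B] by auto
    consider "card (V \<omega> \<inter> B) = 0" | "card (V \<omega> \<inter> B) = 1" | "card (V \<omega> \<inter> B) \<ge> 2" by linarith
    then show ?case
      by cases (auto simp: linked_fraction_UNIV f indicator_def)
  qed
  then have "(\<integral>\<^sup>+\<omega>. linked_fraction B UNIV (V \<omega>) + (indicator {0} (?N \<omega>) + indicator {1} (?N \<omega>)) \<partial>\<Omega>)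
      = (\<integral>\<^sup>+\<omega>. 1 \<partial>\<Omega>)"
    by (rule nn_integral_cong_AE)
  then have "(\<integral>\<^sup>+\<omega>. linked_fraction B UNIV (V \<omega>) \<partial>\<Omega>) +
      (ennreal (exp (- ?v)) + ennreal (?v * exp (- ?v))) = 1"
    by (simp add: nn_integral_add p0 p1 emeasure_space_1)
  then have e: "(\<integral>\<^sup>+\<omega>. linked_fraction B UNIV (V \<omega>) \<partial>\<Omega>) + ennreal (exp (- ?v) * (1 + ?v)) = 1"
    by (simp add: ennreal_plus[symmetric] algebra_simps del: ennreal_plus)
  have "(\<integral>\<^sup>+\<omega>. linked_fraction B UNIV (V \<omega>) \<partial>\<Omega>) = 1 - ennreal (exp (- ?v) * (1 + ?v))"
    unfolding e[symmetric] by (rule ennreal_add_diff_cancel_right[symmetric]) simp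
  then show ?thesis by (simp add: ennreal_minus flip: ennreal_1)
qed

theorem linked_fraction_mean:
  assumes B[measurable]: "B \<in> sets borel" and R[measurable]: "R \<in> sets (borel \<Otimes>\<^sub>M borel)"
  defines "Q \<equiv> \<integral>\<^sup>+y. \<integral>\<^sup>+z. indicator B y * (indicator B z * indicator R (y, z)) \<partial>\<mu> \<partial>\<mu>"
  shows "(\<integral>\<^sup>+\<omega>. linked_fraction B R (V \<omega>) \<partial>\<Omega>) =
    (if emeasure \<mu> B = 0 \<or> emeasure \<mu> B = \<infinity> then 0
     else Q / (emeasure \<mu> B * emeasure \<mu> B) * ennreal
         (1 - exp (- measure \<mu> B) * (1 + measure \<mu> B)))"
proof -
  let ?h = "\<integral>\<^sup>+\<omega>. inv_pairs (sum_over (V \<omega>) (indicator B)) \<partial>\<Omega>"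
  have f: "(\<integral>\<^sup>+\<omega>. linked_fraction B R (V \<omega>) \<partial>\<Omega>) = Q * ?h" unfolding Q_def
      by (rule linked_fraction_mean_factor) measurable
  have h: "emeasure \<mu> B * emeasure \<mu> B * ?h = (\<integral>\<^sup>+\<omega>. linked_fraction B UNIV (V \<omega>) \<partial>\<Omega>)"
      by (rule expectation_inv_pairs[OF B])
  consider "emeasure \<mu> B = 0" | "emeasure \<mu> B = \<infinity>" | "emeasure \<mu> B \<noteq> 0" "emeasure \<mu> B < \<infinity>"
    using less_top[of "emeasure \<mu> B"] by auto
  then show ?thesis
  proof cases
    case 1
    have "Q \<le> (\<integral>\<^sup>+y. indicator B y * emeasure \<mu> B \<partial>\<mu>)"
      unfolding Q_def
    proof (rule nn_integral_mono)
      fix y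
      have "(\<integral>\<^sup>+z. indicator B y * (indicator B z * indicator R (y, z)) \<partial>\<mu>) \<le>
          (\<integral>\<^sup>+z. indicator B y * indicator B z \<partial>\<mu>)"
        by (intro nn_integral_mono) (simp add: indicator_def)
      then show "(\<integral>\<^sup>+z. indicator B y * (indicator B z * indicator R (y, z)) \<partial>\<mu>) \<le> indicator B y *
          emeasure \<mu> B"
        by (simp add: nn_integral_cmult sets_\<mu>)
    qed
    then have "Q = 0" using 1 by simp
    then show ?thesis using 1 f by simp
  next
    case 2
    have "(\<integral>\<^sup>+\<omega>. linked_fraction B UNIV (V \<omega>) \<partial>\<Omega>) \<le> (\<integral>\<^sup>+\<omega>. 1 \<partial>\<Omega>)"
        by (intro nn_integral_mono linked_fraction_le_1)
    then have "\<infinity> * ?h \<le> 1" using h 2 by (simp add: emeasure_space_1 ennreal_top_mult)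
    then have "?h = 0" by (cases "?h = 0") (auto simp: ennreal_top_mult top_unique)
    then show ?thesis using 2 f by simp
  next
    case 3
    let ?w = "emeasure \<mu> B * emeasure \<mu> B"
    have w: "?w \<noteq> 0" "?w \<noteq> \<top>" using 3 by (auto simp: ennreal_mult_eq_top_iff)
    have "Q * ?h = Q / ?w * (?w * ?h)"
    proof -
      have "?h = (?h * ?w) / ?w" using w by (simp add: ennreal_mult_divide_eq)
      then show ?thesis by (simp add: ennreal_divide_times mult.commute)
    qed
    then show ?thesis using 3 f unfolding h prob_at_least_two[OF B 3(2)] by simp
  qed
qed

end


section \<open>The atoms of a Poisson process\<close>

lemma measurable_nat_of_ennreal:
  fixes f :: "'a \<Rightarrow> nat"
  assumes "(\<lambda>z. of_nat (f z) :: ennreal) \<in> borel_measurable M"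
  shows "f \<in> measurable M (count_space UNIV)"
proof (rule measurable_count_space_eq2_countable[THEN iffD2])
  have "f -` {k} \<inter> space M = (\<lambda>z. of_nat (f z) :: ennreal) -` {of_nat k} \<inter> space M" for k by auto
  then have "f -` {k} \<inter> space M \<in> sets M" for k using measurable_sets[OF assms, of "{of_nat k}"]
      by simp
  then show "f \<in> space M \<rightarrow> UNIV \<and> (\<forall>a\<in>UNIV. f -` {a} \<inter> space M \<in> sets M)" by auto
qed

lemma poisson_mass_at_least_two: "l \<ge> 0 \<Longrightarrow> 1 - poisson_mass l 0 - poisson_mass l 1 \<le> l\<^sup>2"
proof -
  assume l: "l \<ge> 0"
  have "1 - l\<^sup>2 \<le> (1 + l) * (1 - l)" by (simp add: algebra_simps power2_eq_square)
  also have "\<dots> \<le> (1 + l) * exp (- l)" using l exp_ge_add_one_self[of "- l"]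
      by (intro mult_left_mono) auto
  finally show ?thesis by (simp add: poisson_mass_def algebra_simps)
qed

text \<open>
  A Poisson process as a random measure, with finite mass in every window and a diffuse intensity
  measure. Its set of atoms turns out to be a configuration as in \<open>poisson_points\<close>.
\<close>

locale atomic_poisson_process = config H + prob_space \<Omega>
  for H :: "nat \<Rightarrow> 'a::{t2_space,second_countable_topology} set" and \<Omega> :: "'w measure" +
  fixes \<mu> :: "'a measure" and \<nu> :: "'w \<Rightarrow> 'a measure"
  assumes sets_\<mu>: "sets \<mu> = sets borel"
    and H_finite: "\<And>m. emeasure \<mu> (H m) < \<infinity>"
    and diffuse: "\<And>x. emeasure \<mu> {x} = 0"
    and poisson: "poisson_process \<Omega> \<mu> \<nu>"
    and \<nu>_finite: "\<And>\<omega> m. \<omega> \<in> space \<Omega> \<Longrightarrow> emeasure (\<nu> \<omega>) (H m) < \<infinity>"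
begin

definition V :: "'w \<Rightarrow> 'a set" where "V \<omega> = atoms (\<nu> \<omega>)"

lemmas poisson_process_facts = poisson[unfolded poisson_process_def point_process_def]

lemma sets_\<nu>: "\<omega> \<in> space \<Omega> \<Longrightarrow> sets (\<nu> \<omega>) = sets borel"
  using bspec[OF conjunct1[OF conjunct1[OF poisson_process_facts]]] by simp

lemma count_measurable[measurable]: "B \<in> sets borel \<Longrightarrow> (\<lambda>\<omega>. emeasure (\<nu> \<omega>) B) \<in> borel_measurable \<Omega>"
  using bspec[OF conjunct2[OF conjunct1[OF poisson_process_facts]]] by simp

lemma count_cases:
  assumes "\<omega> \<in> space \<Omega>" "B \<in> sets borel"
  shows "emeasure (\<nu> \<omega>) B = \<top> \<or> (\<exists>k::nat. emeasure (\<nu> \<omega>) B = of_nat k)"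
proof -
  have "emeasure (\<nu> \<omega>) B \<in> range ennreal_of_enat"
    using bspec[OF conjunct1[OF conjunct1[OF poisson_process_facts]] assms(1)] assms(2) by simp
  then obtain e where "emeasure (\<nu> \<omega>) B = ennreal_of_enat e" by blast
  then show ?thesis by (cases e) auto
qed

lemma count_ge_1:
  assumes "\<omega> \<in> space \<Omega>" "B \<in> sets borel" "emeasure (\<nu> \<omega>) B > 0"
  shows "emeasure (\<nu> \<omega>) B \<ge> 1"
proof -
  consider "emeasure (\<nu> \<omega>) B = \<top>" | k :: nat where "emeasure (\<nu> \<omega>) B = of_nat k"
    using count_cases[OF assms(1,2)] by blast
  then show ?thesis
  proof cases
    case (2 k)
    then have "k \<ge> 1" using assms(3) by (cases k) auto
    then have "(of_nat 1 :: ennreal) \<le> of_nat k" by (rule of_nat_mono)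
    then show ?thesis using 2 by simp
  qed simp
qed

lemma bounded_borel_count_finite: "\<omega> \<in> space \<Omega> \<Longrightarrow> B \<in> bounded_borel \<Longrightarrow> emeasure (\<nu> \<omega>) B < \<infinity>"
proof -
  assume w: "\<omega> \<in> space \<Omega>" and "B \<in> bounded_borel"
  then obtain m where m: "B \<subseteq> H m" by (auto simp: bounded_borel_def)
  have "emeasure (\<nu> \<omega>) B \<le> emeasure (\<nu> \<omega>) (H m)" using m
      by (rule emeasure_mono) (simp add: sets_\<nu>[OF w])
  then show ?thesis using \<nu>_finite[OF w, of m] by simp
qed

text \<open>
  Split the set by the separating sets one after the other and always keep a part with positive
  mass. Masses are integers, so they stay at least \<open>1\<close>, and so does the mass of the intersection
  of all parts kept, which contains at most one point.
\<close>

lemma exists_atom: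
  assumes w: "\<omega> \<in> space \<Omega>" and B: "B \<in> bounded_borel" and pos: "emeasure (\<nu> \<omega>) B > 0"
  shows "\<exists>x\<in>B. x \<in> V \<omega>"
proof -
  let ?N = "\<nu> \<omega>"
  note sN = sets_\<nu>[OF w]
  define C where "C = rec_nat B (\<lambda>k C. if emeasure ?N (C \<inter> separator k) > 0 then C \<inter> separator k
      else C - separator k)"
  have C0: "C 0 = B" by (simp add: C_def)
  have CS: "C (Suc k) = (if emeasure ?N (C k \<inter> separator k) > 0 then C k \<inter> separator k else C k -
      separator k)" for k
    by (simp add: C_def)
  have inv: "C k \<in> sets borel \<and> C k \<subseteq> B \<and> emeasure ?N (C k) > 0" for k
  proof (induction k)
    case 0 then show ?case using pos bounded_borel_borel[OF B] by (simp add: C0)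
  next
    case (Suc k)
    have s: "separator k \<in> sets borel" using separator_separates(1)[of k] by simp
    then have m: "C k \<inter> separator k \<in> sets ?N" "C k - separator k \<in> sets ?N" using Suc sN by auto
    have "emeasure ?N (C k) = emeasure ?N (C k \<inter> separator k) + emeasure ?N (C k - separator k)"
      using m by (subst plus_emeasure) (auto intro: arg_cong[of _ _ "emeasure ?N"])
    then have "emeasure ?N (C (Suc k)) > 0" using Suc unfolding CS
        by (auto simp: zero_less_iff_neq_zero)
    moreover have "C (Suc k) \<in> sets borel" "C (Suc k) \<subseteq> B" using Suc m sN unfolding CS by auto
    ultimately show ?case by simp
  qed
  have dec: "decseq C" by (rule decseq_SucI) (auto simp: CS)
  have "(INF k. emeasure ?N (C k)) = emeasure ?N (\<Inter>k. C k)"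
  proof (rule INF_emeasure_decseq[OF _ dec])
    show "range C \<subseteq> sets ?N" using inv sN by auto
    have "emeasure ?N (C k) \<le> emeasure ?N B" for k using inv[of k] bounded_borel_borel[OF B] sN
        by (intro emeasure_mono) auto
    then show "emeasure ?N (C k) \<noteq> \<infinity>" for k
      using bounded_borel_count_finite[OF w B]
          by (metis infinity_ennreal_def le_less_trans less_irrefl)
  qed
  moreover have "1 \<le> (INF k. emeasure ?N (C k))"
    using inv by (intro INF_greatest count_ge_1[OF w]) auto
  ultimately have ge: "1 \<le> emeasure ?N (\<Inter>k. C k)" by simp
  then have "(\<Inter>k. C k) \<noteq> {}" by auto
  then obtain x where x: "x \<in> (\<Inter>k. C k)" by blast
  have "y = x" if y: "y \<in> (\<Inter>k. C k)" for y
  proof (rule ccontr)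
    assume "y \<noteq> x"
    then obtain i where i: "y \<in> separator i" "x \<notin> separator i" using separator_separates(2) by blast
    have "y \<in> C (Suc i)" "x \<in> C (Suc i)" using x y by auto
    then show False using i unfolding CS by (auto split: if_splits)
  qed
  then have eq: "(\<Inter>k. C k) = {x}" using x by blast
  have "emeasure ?N {x} > 0" using ge unfolding eq by (rule less_le_trans[OF zero_less_one])
  then have "x \<in> V \<omega>" unfolding V_def atoms_def by (rule CollectI)
  moreover have "x \<in> C 0" using x by (rule INT_D) simp
  ultimately show ?thesis unfolding C0 by (rule bexI)
qed

lemma finite_atoms:
  assumes w: "\<omega> \<in> space \<Omega>"
  shows "finite (V \<omega> \<inter> H m)"
proof (rule ccontr)
  assume inf: "infinite (V \<omega> \<inter> H m)"
  let ?N = "\<nu> \<omega>"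
  note sN = sets_\<nu>[OF w]
  have le: "of_nat n \<le> emeasure ?N (H m)" for n
  proof -
    obtain F where F: "F \<subseteq> V \<omega> \<inter> H m" "finite F" "card F = n"
      using infinite_arbitrarily_large[OF inf] by blast
    have "of_nat n = (\<Sum>x\<in>F. 1 :: ennreal)" using F by simp
    also have "\<dots> \<le> (\<Sum>x\<in>F. emeasure ?N {x})"
      using F(1) by (intro sum_mono count_ge_1[OF w]) (auto simp: V_def atoms_def)
    also have "\<dots> = emeasure ?N F"
      using F(2) by (intro emeasure_eq_sum_singleton[symmetric]) (auto simp: sN)
    also have "\<dots> \<le> emeasure ?N (H m)" using F(1) sN by (intro emeasure_mono) auto
    finally show ?thesis .
  qed
  obtain k :: nat where "emeasure ?N (H m) = of_nat k"
    using count_cases[OF w, of "H m"] \<nu>_finite[OF w, of m] by auto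
  then have "(of_nat (Suc k) :: ennreal) \<le> of_nat k" using le[of "Suc k"] by simp
  then show False by (simp only: of_nat_le_iff)
qed

lemma V_in_configs: "\<omega> \<in> space \<Omega> \<Longrightarrow> V \<omega> \<in> configs"
  using finite_atoms unfolding configs_def by simp

lemma count_eq_sum_atoms:
  assumes w: "\<omega> \<in> space \<Omega>" and B: "B \<in> bounded_borel"
  shows "emeasure (\<nu> \<omega>) B = (\<Sum>x\<in>V \<omega> \<inter> B. emeasure (\<nu> \<omega>) {x})"
proof -
  let ?N = "\<nu> \<omega>"
  note sN = sets_\<nu>[OF w]
  have fin: "finite (V \<omega> \<inter> B)" by (rule configs_finite[OF V_in_configs[OF w] B])
  have fs: "V \<omega> \<inter> B \<in> sets borel" using fin by (intro borel_closed finite_imp_closed)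
  have "B - V \<omega> \<inter> B \<in> bounded_borel" using B fs by (auto simp: bounded_borel_def)
  then have "\<not> emeasure ?N (B - V \<omega> \<inter> B) > 0" using exists_atom[OF w, of "B - V \<omega> \<inter> B"] by blast
  then have "emeasure ?N (B - V \<omega> \<inter> B) = 0" by (simp add: zero_less_iff_neq_zero)
  moreover have "emeasure ?N B = emeasure ?N (V \<omega> \<inter> B) + emeasure ?N (B - V \<omega> \<inter> B)"
    using fs bounded_borel_borel[OF B] sN
        by (subst plus_emeasure) (auto intro: arg_cong[of _ _ "emeasure ?N"])
  moreover have "emeasure ?N (V \<omega> \<inter> B) = (\<Sum>x\<in>V \<omega> \<inter> B. emeasure ?N {x})"
    using fin by (intro emeasure_eq_sum_singleton) (auto simp: sN)
  ultimately show ?thesis by simp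
qed

text \<open>
  For each level, the number of cells with positive mass is at most the number of atoms, with
  equality once the cells separate the atoms. So the number of atoms is a measurable function of
  countably many masses.
\<close>

lemma card_atoms_eq_SUP:
  assumes w: "\<omega> \<in> space \<Omega>" and B: "B \<in> bounded_borel"
  shows "(of_nat (card (V \<omega> \<inter> B)) :: ennreal) =
    (SUP k. \<Sum>J\<in>Pow {..<k}. if emeasure (\<nu> \<omega>) (B \<inter> cell k J) > 0 then 1 else 0)"
proof (rule antisym)
  let ?Y = "V \<omega> \<inter> B"
  let ?J = "\<lambda>k. {J \<in> Pow {..<k}. emeasure (\<nu> \<omega>) (B \<inter> cell k J) > 0}"
  have fin: "finite ?Y" by (rule configs_finite[OF V_in_configs[OF w] B])
  have finJ: "finite (?J k)" for k by simp
  have sumJ: "(\<Sum>J\<in>Pow {..<k}. if emeasure (\<nu> \<omega>) (B \<inter> cell k J) > 0 then 1 else 0) =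
      (of_nat (card (?J k)) :: ennreal)" for k
    by (simp add: sum.If_cases Int_def)
  have le: "card (?J k) \<le> card ?Y" for k
  proof -
    have "\<exists>x. x \<in> ?Y \<and> x \<in> cell k J" if J: "J \<in> ?J k" for J
    proof -
      have "B \<inter> cell k J \<in> bounded_borel" by (rule bounded_borel_Int[OF B]) measurable
      from exists_atom[OF w this] J show ?thesis by blast
    qed
    then obtain f where f: "\<And>J. J \<in> ?J k \<Longrightarrow> f J \<in> ?Y \<and> f J \<in> cell k J" by metis
    have "inj_on f (?J k)"
    proof (rule inj_onI)
      fix J J' assume "J \<in> ?J k" "J' \<in> ?J k" "f J = f J'"
      then show "J = J'" using f[of J] f[of J'] cell_disjoint by metis
    qed
    moreover have "f ` ?J k \<subseteq> ?Y" using f by blast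
    ultimately show ?thesis using card_inj_on_le fin by blast
  qed
  show "(SUP k. \<Sum>J\<in>Pow {..<k}. if emeasure (\<nu> \<omega>) (B \<inter> cell k J) > 0 then 1 else 0) \<le>
      (of_nat (card ?Y) :: ennreal)"
    unfolding sumJ by (intro SUP_least of_nat_mono le)
  obtain k where k: "\<And>J x y. x \<in> ?Y \<Longrightarrow> y \<in> ?Y \<Longrightarrow> x \<in> cell k J \<Longrightarrow> y \<in> cell k J \<Longrightarrow> x = y"
    using cells_separate_finite[OF fin] by meson
  define code where "code x = {i. i < k \<and> x \<in> separator i}" for x
  have code: "x \<in> cell k (code x)" "code x \<in> Pow {..<k}" for x
    using cell_self(1)[of x k] cell_self(2)[of k x] by (auto simp: code_def)
  have "card ?Y \<le> card (?J k)"
  proof (rule card_inj_on_le[of code])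
    show "inj_on code ?Y"
    proof (rule inj_onI)
      fix x y assume xy: "x \<in> ?Y" "y \<in> ?Y" "code x = code y"
      show "x = y" by (rule k[OF xy(1,2) code(1)[of x]]) (use code(1)[of y] xy(3) in simp)
    qed
    show "code ` ?Y \<subseteq> ?J k"
    proof
      fix J assume "J \<in> code ` ?Y"
      then obtain x where x: "x \<in> V \<omega>" "x \<in> B" "J = code x" by blast
      have "0 < emeasure (\<nu> \<omega>) {x}" using x(1) by (simp add: V_def atoms_def)
      also have "\<dots> \<le> emeasure (\<nu> \<omega>) (B \<inter> cell k (code x))"
        using x(2) code(1)[of x] bounded_borel_borel[OF B] cell_borel
            by (intro emeasure_mono) (auto simp: sets_\<nu>[OF w])
      finally show "J \<in> ?J k" using x(3) code(2)[of x] by simp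
    qed
  qed simp
  then have "(of_nat (card ?Y) :: ennreal) \<le> of_nat (card (?J k))" by (rule of_nat_mono)
  also have "\<dots> \<le> (SUP k. of_nat (card (?J k)))" by (rule SUP_upper) simp
  finally show "(of_nat (card ?Y) :: ennreal) \<le>
      (SUP k. \<Sum>J\<in>Pow {..<k}. if emeasure (\<nu> \<omega>) (B \<inter> cell k J) > 0 then 1 else 0)"
    unfolding sumJ .
qed

lemma V_measurable: "V \<in> measurable \<Omega> config_space"
proof (rule measurable_config_space[OF V_in_configs])
  fix B assume B: "B \<in> bounded_borel"
  have [measurable]: "B \<inter> cell k J \<in> sets borel" for k J using bounded_borel_borel[OF B]
      by measurable
  have "(\<lambda>\<omega>. SUP k. \<Sum>J\<in>Pow {..<k}. if emeasure (\<nu> \<omega>) (B \<inter> cell k J) > 0 then 1 else 0 :: ennreal) \<in>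
      borel_measurable \<Omega>"
    by measurable
  also have "?this \<longleftrightarrow> (\<lambda>\<omega>. of_nat (card (V \<omega> \<inter> B)) :: ennreal) \<in> borel_measurable \<Omega>"
    by (intro measurable_cong card_atoms_eq_SUP[OF _ B, symmetric])
  finally show "(\<lambda>\<omega>. card (V \<omega> \<inter> B)) \<in> measurable \<Omega> (count_space UNIV)"
      by (rule measurable_nat_of_ennreal)
qed

lemma bounded_borel_emeasure_\<mu>: "B \<in> bounded_borel \<Longrightarrow> emeasure \<mu> B = ennreal (measure \<mu> B)"
proof -
  assume "B \<in> bounded_borel"
  then obtain m where m: "B \<subseteq> H m" by (auto simp: bounded_borel_def)
  have "emeasure \<mu> B \<le> emeasure \<mu> (H m)" by (rule emeasure_mono[OF m]) (simp add: sets_\<mu>)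
  then have "emeasure \<mu> B < \<infinity>" using H_finite[of m] by (rule le_less_trans)
  then show ?thesis by (simp add: emeasure_eq_ennreal_measure less_top)
qed

lemma prob_count:
  assumes "B \<in> bounded_borel"
  shows "prob {\<omega> \<in> space \<Omega>. emeasure (\<nu> \<omega>) B = of_nat k} = poisson_mass (measure \<mu> B) k"
  using bspec[OF conjunct1[OF conjunct2[OF poisson_process_facts]] bounded_borel_borel[OF assms]]
      bounded_borel_emeasure_\<mu>[OF assms]
  unfolding poisson_mass_def by simp

lemma prob_multiple_points:
  assumes B: "B \<in> bounded_borel"
  shows "emeasure \<Omega> {\<omega> \<in> space \<Omega>. emeasure (\<nu> \<omega>) B \<ge> 2} \<le> emeasure \<mu> B * emeasure \<mu> B"
proof -
  have [measurable]: "B \<in> sets borel" by (rule bounded_borel_borel[OF B])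
  let ?A = "\<lambda>k::nat. {\<omega> \<in> space \<Omega>. emeasure (\<nu> \<omega>) B = of_nat k}"
  have A[measurable]: "?A k \<in> events" for k by measurable
  have "{\<omega> \<in> space \<Omega>. emeasure (\<nu> \<omega>) B \<ge> 2} = space \<Omega> - (?A 0 \<union> ?A 1)"
  proof (intro set_eqI iffI)
    fix \<omega> assume "\<omega> \<in> space \<Omega> - (?A 0 \<union> ?A 1)"
    then have w: "\<omega> \<in> space \<Omega>" "emeasure (\<nu> \<omega>) B \<noteq> 0" "emeasure (\<nu> \<omega>) B \<noteq> 1" by auto
    obtain k :: nat where k: "emeasure (\<nu> \<omega>) B = of_nat k"
      using count_cases[OF w(1), of B] bounded_borel_count_finite[OF w(1) B] by auto
    then have "k \<noteq> 0" "k \<noteq> 1" using w by auto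
    then have "2 \<le> k" by simp
    then have "(of_nat 2 :: ennreal) \<le> of_nat k" by (rule of_nat_mono)
    then show "\<omega> \<in> {\<omega> \<in> space \<Omega>. emeasure (\<nu> \<omega>) B \<ge> 2}" using w k by simp
  qed auto
  also have "emeasure \<Omega> \<dots> = ennreal (1 - prob (?A 0 \<union> ?A 1))"
    unfolding emeasure_eq_measure prob_compl[OF sets.Un[OF A A]] ..
  also have "prob (?A 0 \<union> ?A 1) = prob (?A 0) + prob (?A 1)"
    by (intro finite_measure_Union A) auto
  also have "ennreal (1 - (prob (?A 0) + prob (?A 1))) \<le> ennreal ((measure \<mu> B)\<^sup>2)"
    using poisson_mass_at_least_two[of "measure \<mu> B"] unfolding prob_count[OF B]
        by (intro ennreal_leI) simp
  also have "\<dots> = emeasure \<mu> B * emeasure \<mu> B"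
    unfolding bounded_borel_emeasure_\<mu>[OF B] by (simp add: ennreal_mult power2_eq_square)
  finally show ?thesis .
qed

text \<open>
  The sum is the integral over \<open>x\<close> in the window of the measure of the cell around \<open>x\<close>, and the
  cells shrink to \<open>{x}\<close>, which is a null set.
\<close>

lemma sum_cells_square_tendsto:
  "(\<lambda>k. \<Sum>J\<in>Pow {..<k}. emeasure \<mu> (H m \<inter> cell k J) * emeasure \<mu> (H m \<inter> cell k J)) \<longlonglongrightarrow> 0"
proof -
  let ?C = "\<lambda>k J. H m \<inter> cell k J"
  let ?code = "\<lambda>k x. {i. i < k \<and> x \<in> separator i}"
  let ?f = "\<lambda>k x. \<Sum>J\<in>Pow {..<k}. emeasure \<mu> (?C k J) * indicator (?C k J) x"
  note [measurable_cong] = sets_\<mu>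
  have f_eq: "?f k x = indicator (H m) x * emeasure \<mu> (?C k (?code k x))" for k x
  proof -
    have "x \<in> cell k J \<longleftrightarrow> J = ?code k x" for J unfolding cell_def by blast
    then have "indicator (?C k J) x = (if J = ?code k x then indicator (H m) x else 0 :: ennreal)"
        for J
      by (simp add: indicator_def)
    then have "?f k x = (\<Sum>J\<in>Pow {..<k}. if J = ?code k x then emeasure \<mu> (?C k J) *
        indicator (H m) x else 0)"
      by (intro sum.cong) auto
    also have "\<dots> = emeasure \<mu> (?C k (?code k x)) * indicator (H m) x"
      using cell_self(2)[of k x] by (subst sum.delta) auto
    finally show ?thesis by (simp add: mult.commute)
  qed
  have "(\<lambda>k. \<integral>\<^sup>+x. ?f k x \<partial>\<mu>) \<longlonglongrightarrow> (\<integral>\<^sup>+x. 0 \<partial>\<mu>)"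
  proof (rule nn_integral_dominated_convergence[where w =
      "\<lambda>x. indicator (H m) x * emeasure \<mu> (H m)"])
    show "?f k \<in> borel_measurable \<mu>" for k by measurable
    show "(\<lambda>x. indicator (H m) x * emeasure \<mu> (H m)) \<in> borel_measurable \<mu>" by measurable
    show "AE x in \<mu>. ?f k x \<le> indicator (H m) x * emeasure \<mu> (H m)" for k
      unfolding f_eq by (intro AE_I2 mult_left_mono emeasure_mono) (auto simp: sets_\<mu>)
    have "(\<integral>\<^sup>+x. indicator (H m) x * emeasure \<mu> (H m) \<partial>\<mu>) = emeasure \<mu> (H m) * emeasure \<mu> (H m)"
      using nn_integral_cmult_indicator[of "H m" \<mu> "emeasure \<mu> (H m)"]
          by (simp add: sets_\<mu> mult.commute)
    also have "\<dots> < \<infinity>" using H_finite[of m] by (simp add: ennreal_mult_less_top)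
    finally show "(\<integral>\<^sup>+x. indicator (H m) x * emeasure \<mu> (H m) \<partial>\<mu>) < \<infinity>" .
    show "AE x in \<mu>. (\<lambda>k. ?f k x) \<longlonglongrightarrow> 0"
    proof (rule AE_I2)
      fix x
      have "(\<lambda>k. emeasure \<mu> (?C k (?code k x))) \<longlonglongrightarrow> emeasure \<mu> (\<Inter>k. ?C k (?code k x))"
      proof (rule Lim_emeasure_decseq)
        show "range (\<lambda>k. ?C k (?code k x)) \<subseteq> sets \<mu>" by (auto simp: sets_\<mu>)
        show "decseq (\<lambda>k. ?C k (?code k x))"
        proof (rule decseq_SucI, rule subsetI)
          fix k y assume "y \<in> ?C (Suc k) (?code (Suc k) x)"
          then have y: "y \<in> H m" "?code (Suc k) y = ?code (Suc k) x" by (auto simp: cell_def)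
          have "y \<in> separator i \<longleftrightarrow> x \<in> separator i" if "i < k" for i
          proof -
            have "i \<in> ?code (Suc k) y \<longleftrightarrow> i \<in> ?code (Suc k) x" unfolding y(2) ..
            then show ?thesis using that by simp
          qed
          then show "y \<in> ?C k (?code k x)" using y(1) by (auto simp: cell_def)
        qed
        have "emeasure \<mu> (?C k (?code k x)) \<le> emeasure \<mu> (H m)" for k
            by (rule emeasure_mono) (auto simp: sets_\<mu>)
        then show "emeasure \<mu> (?C k (?code k x)) \<noteq> \<infinity>" for k
          using H_finite[of m] by (metis infinity_ennreal_def le_less_trans less_irrefl)
      qed
      moreover have "emeasure \<mu> (\<Inter>k. ?C k (?code k x)) = 0"
      proof -
        have "(\<Inter>k. ?C k (?code k x)) \<subseteq> {x}"
        proof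
          fix y assume y: "y \<in> (\<Inter>k. ?C k (?code k x))"
          have "y = x"
          proof (rule ccontr)
            assume "y \<noteq> x"
            then obtain i where i: "y \<in> separator i" "x \<notin> separator i" using separator_separates(2)
                by blast
            have "y \<in> cell (Suc i) (?code (Suc i) x)" using y by blast
            then have "?code (Suc i) y = ?code (Suc i) x" by (simp add: cell_def)
            moreover have "i \<in> ?code (Suc i) y" using i by simp
            ultimately show False using i by simp
          qed
          then show "y \<in> {x}" by simp
        qed
        then have "emeasure \<mu> (\<Inter>k. ?C k (?code k x)) \<le> emeasure \<mu> {x}"
            by (rule emeasure_mono) (simp add: sets_\<mu>)
        then show ?thesis by (simp add: diffuse)
      qed
      ultimately have "(\<lambda>k. emeasure \<mu> (?C k (?code k x))) \<longlonglongrightarrow> 0" by simp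
      then show "(\<lambda>k. ?f k x) \<longlonglongrightarrow> 0" unfolding f_eq by (cases "x \<in> H m") auto
    qed
  qed auto
  moreover have "(\<integral>\<^sup>+x. ?f k x \<partial>\<mu>) = (\<Sum>J\<in>Pow {..<k}. emeasure \<mu> (?C k J) * emeasure \<mu> (?C k J))"
      for k
    by (subst nn_integral_sum) (auto simp: nn_integral_cmult_indicator sets_\<mu>)
  ultimately show ?thesis by simp
qed

text \<open>
  If there were an atom of mass at least \<open>2\<close> in a window, then on every level some cell would have
  mass at least \<open>2\<close>. The probability of the latter is at most the sum of the squared measures of the
  cells.
\<close>

lemma AE_simple: "AE \<omega> in \<Omega>. \<forall>x\<in>V \<omega>. emeasure (\<nu> \<omega>) {x} = 1"
proof -
  let ?D = "\<lambda>m k. \<Union>J\<in>Pow {..<k}. {\<omega> \<in> space \<Omega>. emeasure (\<nu> \<omega>) (H m \<inter> cell k J) \<ge> 2}"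
  have [measurable]: "?D m k \<in> events" for m k
  proof (rule sets.finite_UN)
    show "{\<omega> \<in> space \<Omega>. emeasure (\<nu> \<omega>) (H m \<inter> cell k J) \<ge> 2} \<in> events" for J by measurable
  qed simp
  have null: "(\<Inter>k. ?D m k) \<in> null_sets \<Omega>" for m
  proof (rule null_setsI)
    have "emeasure \<Omega> (\<Inter>k. ?D m k) \<le>
        (\<Sum>J\<in>Pow {..<k}. emeasure \<mu> (H m \<inter> cell k J) * emeasure \<mu> (H m \<inter> cell k J))" for k
    proof -
      have "emeasure \<Omega> (\<Inter>k. ?D m k) \<le> emeasure \<Omega> (?D m k)" by (rule emeasure_mono) auto
      also have "\<dots> \<le> (\<Sum>J\<in>Pow {..<k}. emeasure \<Omega> {\<omega> \<in> space \<Omega>. emeasure (\<nu> \<omega>) (H m \<inter> cell k J) \<ge> 2})"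
        by (rule emeasure_subadditive_finite) auto
      also have "\<dots> \<le> (\<Sum>J\<in>Pow {..<k}. emeasure \<mu> (H m \<inter> cell k J) * emeasure \<mu> (H m \<inter> cell k J))"
        by (intro sum_mono prob_multiple_points H_bounded_borel) measurable
      finally show ?thesis .
    qed
    then have "emeasure \<Omega> (\<Inter>k. ?D m k) \<le> 0"
      by (intro LIMSEQ_le_const[OF sum_cells_square_tendsto[of m]]) auto
    then show "emeasure \<Omega> (\<Inter>k. ?D m k) = 0" by simp
  qed measurable
  have "AE \<omega> in \<Omega>. \<forall>m. \<omega> \<notin> (\<Inter>k. ?D m k)"
    unfolding AE_all_countable using null by (intro allI AE_not_in)
  moreover have "AE \<omega> in \<Omega>. \<omega> \<in> space \<Omega>" by simp
  ultimately show ?thesis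
  proof eventually_elim
    case (elim \<omega>)
    note w = elim(2)
    show ?case
    proof (rule ballI, rule ccontr)
      fix x assume x: "x \<in> V \<omega>" and ne: "emeasure (\<nu> \<omega>) {x} \<noteq> 1"
      obtain m where m: "x \<in> H m" using in_some_H by blast
      have pos: "emeasure (\<nu> \<omega>) {x} > 0" using x by (simp add: V_def atoms_def)
      have "emeasure (\<nu> \<omega>) {x} \<le> emeasure (\<nu> \<omega>) (H m)" using m
          by (intro emeasure_mono) (auto simp: sets_\<nu>[OF w])
      then have "emeasure (\<nu> \<omega>) {x} < \<infinity>" using \<nu>_finite[OF w, of m] by (rule le_less_trans)
      then obtain j :: nat where j: "emeasure (\<nu> \<omega>) {x} = of_nat j"
          using count_cases[OF w, of "{x}"] by auto
      have "j \<noteq> 0" "j \<noteq> 1" using pos ne j by auto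
      then have "2 \<le> j" by simp
      then have "(of_nat 2 :: ennreal) \<le> of_nat j" by (rule of_nat_mono)
      then have two: "2 \<le> emeasure (\<nu> \<omega>) {x}" using j by simp
      have "\<omega> \<in> ?D m k" for k
      proof -
        have "emeasure (\<nu> \<omega>) {x} \<le> emeasure (\<nu> \<omega>) (H m \<inter> cell k {i. i < k \<and> x \<in> separator i})"
          using m cell_self(1)[of x k] by (intro emeasure_mono) (auto simp: sets_\<nu>[OF w])
        then have "2 \<le> emeasure (\<nu> \<omega>) (H m \<inter> cell k {i. i < k \<and> x \<in> separator i})" using two
            by (rule order_trans[rotated])
        then show ?thesis using w cell_self(2)[of k x] by blast
      qed
      then show False using elim(1) by blast
    qed
  qed
qed

lemma count_eq_sum_over:
  assumes w: "\<omega> \<in> space \<Omega>" and simple: "\<forall>x\<in>V \<omega>. emeasure (\<nu> \<omega>) {x} = 1" and B: "B \<in> sets borel"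
  shows "emeasure (\<nu> \<omega>) B = sum_over (V \<omega>) (indicator B)"
proof -
  have bounded_borel: "emeasure (\<nu> \<omega>) (H m \<inter> B) = of_nat (card (V \<omega> \<inter> (H m \<inter> B)))" for m
  proof -
    have "emeasure (\<nu> \<omega>) (H m \<inter> B) = (\<Sum>x\<in>V \<omega> \<inter> (H m \<inter> B). 1)"
      unfolding count_eq_sum_atoms[OF w H_bounded_borel[OF B]] using simple by (intro sum.cong) auto
    then show ?thesis by simp
  qed
  have "emeasure (\<nu> \<omega>) B = emeasure (\<nu> \<omega>) (\<Union>m. H m \<inter> B)" using H_cover
      by (simp add: Int_commute flip: Int_UN_distrib)
  also have "\<dots> = (SUP m. emeasure (\<nu> \<omega>) (H m \<inter> B))"
  proof (rule SUP_emeasure_incseq[symmetric])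
    show "incseq (\<lambda>m. H m \<inter> B)" using incseq_H_le by (fastforce simp: incseq_def)
  qed (use B in \<open>auto simp: sets_\<nu>[OF w]\<close>)
  also have "\<dots> = (SUP m. sum_over (V \<omega> \<inter> H m) (indicator B))"
  proof -
    have "sum_over (V \<omega> \<inter> H m) (indicator B) = of_nat (card (V \<omega> \<inter> (H m \<inter> B)))" for m
      using sum_over_indicator[of "V \<omega> \<inter> H m" B]
          finite_Int[OF disjI1[OF finite_atoms[OF w, of m]], of B] by (simp add: Int_assoc)
    then show ?thesis by (simp add: bounded_borel)
  qed
  finally show ?thesis unfolding sum_over_eq_SUP[of "V \<omega>"] .
qed

sublocale points: poisson_points H \<Omega> \<mu> V
proof unfold_locales
  show "sets \<mu> = sets borel" by (rule sets_\<mu>)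
  show "emeasure \<mu> (H m) < \<infinity>" for m by (rule H_finite)
  show "V \<in> measurable \<Omega> config_space" by (rule V_measurable)
  fix n :: nat and D :: "nat \<Rightarrow> 'a set"
      and v :: "nat \<Rightarrow> nat" assume D: "\<And>i. D i \<in> bounded_borel" "disjoint_family D"
  have [measurable]: "D i \<in> sets borel" for i using D(1) bounded_borel_borel by blast
  have "AE \<omega> in \<Omega>. \<omega> \<in> {\<omega> \<in> space \<Omega>. \<forall>i<n. card (V \<omega> \<inter> D i) = v i} \<longleftrightarrow>
     \<omega> \<in> {\<omega> \<in> space \<Omega>. \<forall>i<n. emeasure (\<nu> \<omega>) (D i) = of_nat (v i)}"
    using AE_simple AE_space
  proof eventually_elim
    case (elim \<omega>)
    have "emeasure (\<nu> \<omega>) (D i) = of_nat (card (V \<omega> \<inter> D i))" for i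
      using count_eq_sum_over[OF elim(2,1), of "D i"] sum_over_indicator[of "V \<omega>" "D i"]
          configs_finite[OF V_in_configs[OF elim(2)] D(1)]
      by simp
    then show ?case by simp
  qed
  then have "prob {\<omega> \<in> space \<Omega>. \<forall>i<n. card (V \<omega> \<inter> D i) = v i} =
      prob {\<omega> \<in> space \<Omega>. \<forall>i<n. emeasure (\<nu> \<omega>) (D i) = of_nat (v i)}"
  proof (rule measure_eq_AE)
    have [measurable]: "V \<in> measurable \<Omega> config_space" "\<And>i. D i \<in> bounded_borel"
        using V_measurable D(1) by auto
    have "{\<omega> \<in> space \<Omega>. \<forall>i\<in>{..<n}. card (V \<omega> \<inter> D i) = v i} \<in> events" by measurable
    then show "{\<omega> \<in> space \<Omega>. \<forall>i<n. card (V \<omega> \<inter> D i) = v i} \<in> events" by (simp add: Ball_def)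
    have "{\<omega> \<in> space \<Omega>. \<forall>i\<in>{..<n}. emeasure (\<nu> \<omega>) (D i) = of_nat (v i)} \<in> events" by measurable
    then show "{\<omega> \<in> space \<Omega>. \<forall>i<n. emeasure (\<nu> \<omega>) (D i) = of_nat (v i)} \<in> events"
        by (simp add: Ball_def)
  qed
  also have "\<dots> = (\<Prod>i<n. poisson_mass (measure \<mu> (D i)) (v i))"
  proof (cases "n = 0")
    case True then show ?thesis by (simp add: prob_space)
  next
    case False
    have "indep_vars (\<lambda>_. borel) (\<lambda>i \<omega>. emeasure (\<nu> \<omega>) (D i)) {..<n}"
    proof -
      have "disjoint_family_on D {..<n}" using D(2) by (auto simp: disjoint_family_on_def)
      then show ?thesis using bounded_borel_borel[OF D(1)]
        by (intro conjunct2[OF conjunct2[OF poisson_process_facts], rule_format]) auto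
    qed
    from indep_varsD_finite[OF this, of "\<lambda>i. {of_nat (v i)}"] False
    have "prob (\<Inter>i\<in>{..<n}. (\<lambda>\<omega>. emeasure (\<nu> \<omega>) (D i)) -` {of_nat (v i)} \<inter> space \<Omega>) =
       (\<Prod>i<n. prob ((\<lambda>\<omega>. emeasure (\<nu> \<omega>) (D i)) -` {of_nat (v i)} \<inter> space \<Omega>))" by auto
    also have "(\<Inter>i\<in>{..<n}. (\<lambda>\<omega>. emeasure (\<nu> \<omega>) (D i)) -` {of_nat (v i)} \<inter> space \<Omega>) =
      {\<omega> \<in> space \<Omega>. \<forall>i<n. emeasure (\<nu> \<omega>) (D i) = of_nat (v i)}" using False by auto
    also have "(\<Prod>i<n. prob ((\<lambda>\<omega>. emeasure (\<nu> \<omega>) (D i)) -` {of_nat (v i)} \<inter> space \<Omega>)) =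
      (\<Prod>i<n. poisson_mass (measure \<mu> (D i)) (v i))"
    proof (rule prod.cong[OF refl])
      fix i
      have "(\<lambda>\<omega>. emeasure (\<nu> \<omega>) (D i)) -` {of_nat (v i)} \<inter> space \<Omega> =
          {\<omega> \<in> space \<Omega>. emeasure (\<nu> \<omega>) (D i) = of_nat (v i)}"
        by auto
      then show "prob ((\<lambda>\<omega>. emeasure (\<nu> \<omega>) (D i)) -` {of_nat (v i)} \<inter> space \<Omega>) =
          poisson_mass (measure \<mu> (D i)) (v i)"
        using prob_count[OF D(1)] by simp
    qed
    finally show ?thesis .
  qed
  finally show "prob {\<omega> \<in> space \<Omega>. \<forall>i<n. card (V \<omega> \<inter> D i) = v i} =
      (\<Prod>i<n. poisson_mass (measure \<mu> (D i)) (v i))" .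
qed

end


section \<open>Quotients of sums with linearly growing variance\<close>

context prob_space begin

lemma second_moment_centered:
  assumes X[measurable]: "X \<in> borel_measurable M" and m: "0 \<le> m" and k: "0 \<le> k"
    and mean: "(\<integral>\<^sup>+\<omega>. X \<omega> \<partial>M) = ennreal m"
    and square: "(\<integral>\<^sup>+\<omega>. X \<omega> * X \<omega> \<partial>M) \<le> ennreal (m\<^sup>2 + k)"
  shows "(\<integral>\<^sup>+\<omega>. ennreal ((enn2real (X \<omega>) - m)\<^sup>2) \<partial>M) \<le> ennreal k"
proof -
  have "AE \<omega> in M. X \<omega> \<noteq> \<infinity>" by (rule nn_integral_noteq_infinite) (use mean in auto)
  then have "AE \<omega> in M. ennreal ((enn2real (X \<omega>) - m)\<^sup>2) + ennreal (2 * m) * X \<omega> = X \<omega> * X \<omega> +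
      ennreal (m\<^sup>2)"
  proof eventually_elim
    case (elim \<omega>)
    then have "X \<omega> \<noteq> \<top>" by simp
    then obtain r where r: "r \<ge> 0" "X \<omega> = ennreal r" by (cases "X \<omega>" rule: ennreal_cases) auto
    have "ennreal ((r - m)\<^sup>2) + ennreal (2 * m) * ennreal r = ennreal ((r - m)\<^sup>2 + 2 * m * r)"
      using r m by (simp add: ennreal_mult ennreal_plus)
    also have "(r - m)\<^sup>2 + 2 * m * r = r * r + m\<^sup>2" by (simp add: power2_eq_square algebra_simps)
    also have "ennreal (r * r + m\<^sup>2) = ennreal r * ennreal r + ennreal (m\<^sup>2)"
      using r by (simp add: ennreal_mult ennreal_plus)
    finally show ?case using r by simp
  qed
  then have "(\<integral>\<^sup>+\<omega>. ennreal ((enn2real (X \<omega>) - m)\<^sup>2) + ennreal (2 * m) * X \<omega> \<partial>M) =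
      (\<integral>\<^sup>+\<omega>. X \<omega> * X \<omega> + ennreal (m\<^sup>2) \<partial>M)"
    by (rule nn_integral_cong_AE)
  then have "(\<integral>\<^sup>+\<omega>. ennreal ((enn2real (X \<omega>) - m)\<^sup>2) \<partial>M) + ennreal (2 * m) * ennreal m =
      (\<integral>\<^sup>+\<omega>. X \<omega> * X \<omega> \<partial>M) + ennreal (m\<^sup>2)"
    by (simp add: nn_integral_add nn_integral_cmult mean emeasure_space_1)
  also have "\<dots> \<le> ennreal (m\<^sup>2 + k) + ennreal (m\<^sup>2)" by (intro add_right_mono square)
  also have "\<dots> = ennreal k + ennreal (2 * m) * ennreal m"
    using m k by (simp add: ennreal_mult[symmetric] ennreal_plus[symmetric] power2_eq_square del:
        ennreal_plus)
  finally have "ennreal (2 * m) * ennreal m + (\<integral>\<^sup>+\<omega>. ennreal ((enn2real (X \<omega>) - m)\<^sup>2) \<partial>M) \<le>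
      ennreal (2 * m) * ennreal m + ennreal k" by (simp only: add.commute)
  then show ?thesis by (simp add: ennreal_add_left_cancel_le ennreal_mult_eq_top_iff)
qed

lemma markov_deviation:
  assumes S[measurable]: "S \<in> borel_measurable M" and a: "a > 0" and \<eta>: "\<eta> > 0" and K: "K \<ge> 0"
    and var: "(\<integral>\<^sup>+\<omega>. ennreal ((S \<omega> - l * a)\<^sup>2) \<partial>M) \<le> ennreal (K * a)"
  shows "prob {\<omega> \<in> space M. \<bar>S \<omega> - l * a\<bar> > \<eta> * a} \<le> K / (\<eta>\<^sup>2 * a)"
proof -
  let ?c = "1 / (\<eta> * a)\<^sup>2"
  have c: "?c > 0" using a \<eta> by simp
  have "emeasure M {\<omega> \<in> space M. \<bar>S \<omega> - l * a\<bar> > \<eta> * a} \<le>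
      emeasure M {\<omega> \<in> space M. 1 \<le> ennreal ?c * ennreal ((S \<omega> - l * a)\<^sup>2)}"
  proof (rule emeasure_mono)
    show "{\<omega> \<in> space M. \<bar>S \<omega> - l * a\<bar> > \<eta> * a} \<subseteq>
        {\<omega> \<in> space M. 1 \<le> ennreal ?c * ennreal ((S \<omega> - l * a)\<^sup>2)}"
    proof safe
      fix \<omega> assume "\<eta> * a < \<bar>S \<omega> - l * a\<bar>"
      then have "(\<eta> * a)\<^sup>2 \<le> \<bar>S \<omega> - l * a\<bar>\<^sup>2" using a \<eta> by (intro power_mono) auto
      then have "1 \<le> ?c * (S \<omega> - l * a)\<^sup>2" using a \<eta> by (simp add: field_simps)
      then have "ennreal 1 \<le> ennreal (?c * (S \<omega> - l * a)\<^sup>2)" by (rule ennreal_leI)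
      also have "ennreal (?c * (S \<omega> - l * a)\<^sup>2) = ennreal ?c * ennreal ((S \<omega> - l * a)\<^sup>2)"
        by (rule ennreal_mult) auto
      finally show "1 \<le> ennreal ?c * ennreal ((S \<omega> - l * a)\<^sup>2)" by simp
    qed
  qed measurable
  also have "\<dots> \<le> ennreal ?c * (\<integral>\<^sup>+\<omega>. ennreal ((S \<omega> - l * a)\<^sup>2) * indicator (space M) \<omega> \<partial>M)"
    by (rule nn_integral_Markov_inequality) measurable
  also have "(\<integral>\<^sup>+\<omega>. ennreal ((S \<omega> - l * a)\<^sup>2) * indicator (space M) \<omega> \<partial>M) =
      (\<integral>\<^sup>+\<omega>. ennreal ((S \<omega> - l * a)\<^sup>2) \<partial>M)"
    by (intro nn_integral_cong) simp
  also have "ennreal ?c * (\<integral>\<^sup>+\<omega>. ennreal ((S \<omega> - l * a)\<^sup>2) \<partial>M) \<le> ennreal ?c * ennreal (K * a)"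
    by (intro mult_left_mono var) auto
  also have "\<dots> = ennreal (K / (\<eta>\<^sup>2 * a))"
    using a K \<eta> by (simp add: ennreal_mult[symmetric] power2_eq_square)
  finally show ?thesis using a K \<eta> by (simp add: emeasure_eq_measure)
qed

text \<open>
  If numerator and denominator deviate from \<open>l * a\<close> and \<open>a\<close> by at most \<open>\<eta> * a\<close>, where
  \<open>\<eta> \<le> 1/2\<close>, the quotient deviates from \<open>l\<close> by at most \<open>2 * \<eta> * (1 + \<bar>l\<bar>)\<close>. The
  probabilities of larger deviations are bounded by the variances.
\<close>

lemma ratio_converges_in_probability:
  assumes S[measurable]: "\<And>n. S n \<in> borel_measurable M"
      and N[measurable]: "\<And>n. N n \<in> borel_measurable M"
    and a: "filterlim a at_top sequentially" and K: "K \<ge> 0"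
    and varS: "\<And>n. (\<integral>\<^sup>+\<omega>. ennreal ((S n \<omega> - l * a n)\<^sup>2) \<partial>M) \<le> ennreal (K * a n)"
    and varN: "\<And>n. (\<integral>\<^sup>+\<omega>. ennreal ((N n \<omega> - 1 * a n)\<^sup>2) \<partial>M) \<le> ennreal (K * a n)"
    and \<epsilon>: "\<epsilon> > 0"
  shows "(\<lambda>n. prob {\<omega> \<in> space M. \<bar>S n \<omega> / N n \<omega> - l\<bar> > \<epsilon>}) \<longlonglongrightarrow> 0"
proof -
  \<comment> \<open>The bound \<open>1/2\<close> keeps the denominator above \<open>a n / 2\<close>.\<close>
  define \<eta> where "\<eta> = min (1/2) (\<epsilon> / (2 * (1 + \<bar>l\<bar>)))"
  have \<eta>: "\<eta> > 0" "\<eta> \<le> 1/2" "2 * \<eta> * (1 + \<bar>l\<bar>) \<le> \<epsilon>"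
  proof -
    have "\<eta> \<le> \<epsilon> / (2 * (1 + \<bar>l\<bar>))" by (simp add: \<eta>_def)
    then have "\<eta> * (2 * (1 + \<bar>l\<bar>)) \<le> \<epsilon>" by (subst (asm) pos_le_divide_eq) auto
    then show "2 * \<eta> * (1 + \<bar>l\<bar>) \<le> \<epsilon>" by (simp add: mult_ac)
    show "\<eta> \<le> 1/2" unfolding \<eta>_def by (rule min.cobounded1)
    show "\<eta> > 0" using \<epsilon> by (simp add: \<eta>_def)
  qed
  have close: "\<bar>s / n - l\<bar> \<le> \<epsilon>" if "b > 0" "\<bar>s - l * b\<bar> \<le> \<eta> * b" "\<bar>n - 1 * b\<bar> \<le> \<eta> * b"
      for s n b :: real
  proof -
    have "\<eta> * b \<le> 1/2 * b" using \<eta>(2) that(1) by (intro mult_right_mono) auto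
    then have n: "n \<ge> b / 2" "n > 0" using that(1) that(3)[unfolded abs_le_iff] by linarith+
    have "\<bar>s - l * n\<bar> = \<bar>(s - l * b) + l * (b - n)\<bar>" by (simp add: algebra_simps)
    also have "\<dots> \<le> \<bar>s - l * b\<bar> + \<bar>l\<bar> * \<bar>b - n\<bar>" by (metis abs_mult abs_triangle_ineq)
    also have "\<dots> \<le> \<eta> * b + \<bar>l\<bar> * (\<eta> * b)" using that by (intro add_mono mult_left_mono) auto
    also have "\<dots> = (2 * \<eta> * (1 + \<bar>l\<bar>)) * (b / 2)" by (simp add: algebra_simps)
    also have "\<dots> \<le> \<epsilon> * n" using n that(1) \<epsilon> by (intro mult_mono \<eta>(3)) auto
    finally have "\<bar>s - l * n\<bar> \<le> \<epsilon> * n" .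
    moreover have "\<bar>s / n - l\<bar> = \<bar>s - l * n\<bar> / n" using n
        by (simp add: field_simps flip: abs_div_pos)
    ultimately show ?thesis using n by (simp add: field_simps)
  qed
  have ev: "\<forall>\<^sub>F n in sequentially. a n > 0"
    using a filterlim_at_top_dense by blast
  have bound: "\<forall>\<^sub>F n in sequentially. prob {\<omega> \<in> space M. \<bar>S n \<omega> / N n \<omega> - l\<bar> > \<epsilon>} \<le> 2 * K / \<eta>\<^sup>2 *
      inverse (a n)"
    using ev
  proof eventually_elim
    case (elim n)
    let ?A = "{\<omega> \<in> space M. \<bar>S n \<omega> - l * a n\<bar> > \<eta> * a n}"
        and ?B = "{\<omega> \<in> space M. \<bar>N n \<omega> - 1 * a n\<bar> > \<eta> * a n}"
    have m: "?A \<in> events" "?B \<in> events" by measurable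
    have "{\<omega> \<in> space M. \<bar>S n \<omega> / N n \<omega> - l\<bar> > \<epsilon>} \<subseteq> ?A \<union> ?B"
    proof
      fix \<omega> assume w: "\<omega> \<in> {\<omega> \<in> space M. \<bar>S n \<omega> / N n \<omega> - l\<bar> > \<epsilon>}"
      show "\<omega> \<in> ?A \<union> ?B"
      proof (rule ccontr)
        assume "\<omega> \<notin> ?A \<union> ?B"
        then have "\<bar>S n \<omega> - l * a n\<bar> \<le> \<eta> * a n" "\<bar>N n \<omega> - 1 * a n\<bar> \<le> \<eta> * a n" using w by auto
        from close[OF elim this] w show False by simp
      qed
    qed
    then have "prob {\<omega> \<in> space M. \<bar>S n \<omega> / N n \<omega> - l\<bar> > \<epsilon>} \<le> prob (?A \<union> ?B)"
      using m by (intro finite_measure_mono) auto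
    also have "\<dots> \<le> prob ?A + prob ?B" by (rule measure_Un_le[OF m])
    also have "\<dots> \<le> K / (\<eta>\<^sup>2 * a n) + K / (\<eta>\<^sup>2 * a n)"
      by (intro add_mono markov_deviation elim \<eta> K varS varN) measurable
    also have "\<dots> = 2 * K / \<eta>\<^sup>2 * inverse (a n)" using elim \<eta>(1) by (simp add: field_simps)
    finally show ?case .
  qed
  have lim: "(\<lambda>n. 2 * K / \<eta>\<^sup>2 * inverse (a n)) \<longlonglongrightarrow> 0"
    using tendsto_mult_right_zero[OF tendsto_inverse_0_at_top[OF a]] .
  show ?thesis
    by (rule tendsto_sandwich[OF _ bound tendsto_const lim]) simp
qed

text \<open>
  The sum over \<open>n\<close> of the squared relative errors has finite expectation, so it is almost surely
  finite and its terms tend to \<open>0\<close>.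
\<close>

lemma AE_square_error_tendsto:
  assumes S[measurable]: "\<And>n. S n \<in> borel_measurable M" and a: "\<And>n. a n > 0" and K: "K \<ge> 0"
    and sum: "(\<Sum>n. ennreal (1 / a n)) < \<infinity>"
    and varS: "\<And>n. (\<integral>\<^sup>+\<omega>. ennreal ((S n \<omega> - l * a n)\<^sup>2) \<partial>M) \<le> ennreal (K * a n)"
  shows "AE \<omega> in M. (\<lambda>n. S n \<omega> / a n) \<longlonglongrightarrow> l"
proof -
  let ?X = "\<lambda>n \<omega>. (S n \<omega> / a n - l)\<^sup>2"
  have "(\<integral>\<^sup>+\<omega>. ennreal (?X n \<omega>) \<partial>M) \<le> ennreal K * ennreal (1 / a n)" for n
  proof -
    have X: "?X n \<omega> = (1 / (a n)\<^sup>2) * (S n \<omega> - l * a n)\<^sup>2" for \<omega>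
    proof -
      have "S n \<omega> / a n - l = (S n \<omega> - l * a n) / a n" using a[of n] by (simp add: field_simps)
      then show ?thesis by (simp add: power_divide)
    qed
    have "(\<integral>\<^sup>+\<omega>. ennreal (?X n \<omega>) \<partial>M) =
        (\<integral>\<^sup>+\<omega>. ennreal (1 / (a n)\<^sup>2) * ennreal ((S n \<omega> - l * a n)\<^sup>2) \<partial>M)"
      unfolding X by (intro nn_integral_cong ennreal_mult) auto
    also have "\<dots> = ennreal (1 / (a n)\<^sup>2) * (\<integral>\<^sup>+\<omega>. ennreal ((S n \<omega> - l * a n)\<^sup>2) \<partial>M)"
      by (rule nn_integral_cmult) measurable
    also have "\<dots> \<le> ennreal (1 / (a n)\<^sup>2) * ennreal (K * a n)" by (intro mult_left_mono varS) auto
    also have "\<dots> = ennreal K * ennreal (1 / a n)"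
      using a[of n] K by (simp add: ennreal_mult[symmetric] power2_eq_square)
    finally show ?thesis .
  qed
  then have "(\<Sum>n. \<integral>\<^sup>+\<omega>. ennreal (?X n \<omega>) \<partial>M) \<le> (\<Sum>n. ennreal K * ennreal (1 / a n))"
    by (intro suminf_le) auto
  also have "\<dots> = ennreal K * (\<Sum>n. ennreal (1 / a n))" by (rule ennreal_suminf_cmult)
  also have "\<dots> < \<infinity>" using sum by (simp add: ennreal_mult_less_top)
  finally have "(\<integral>\<^sup>+\<omega>. (\<Sum>n. ennreal (?X n \<omega>)) \<partial>M) < \<infinity>"
    by (subst nn_integral_suminf) auto
  then have "AE \<omega> in M. (\<Sum>n. ennreal (?X n \<omega>)) \<noteq> \<infinity>"
    by (intro nn_integral_noteq_infinite) auto
  then show ?thesis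
  proof eventually_elim
    case (elim \<omega>)
    then have "summable (\<lambda>n. ?X n \<omega>)" by (intro summable_suminf_not_top) auto
    then have "(\<lambda>n. ?X n \<omega>) \<longlonglongrightarrow> 0" by (rule summable_LIMSEQ_zero)
    then have "(\<lambda>n. sqrt (?X n \<omega>)) \<longlonglongrightarrow> sqrt 0" by (rule tendsto_real_sqrt)
    then have "(\<lambda>n. \<bar>S n \<omega> / a n - l\<bar>) \<longlonglongrightarrow> 0" by simp
    then have "(\<lambda>n. S n \<omega> / a n - l) \<longlonglongrightarrow> 0" by (rule tendsto_rabs_zero_cancel)
    then show ?case by (rule LIM_zero_cancel)
  qed
qed

lemma ratio_converges_AE:
  assumes S: "\<And>n. S n \<in> borel_measurable M" and N: "\<And>n. N n \<in> borel_measurable M"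
    and a: "\<And>n. a n > 0" and K: "K \<ge> 0" and sum: "(\<Sum>n. ennreal (1 / a n)) < \<infinity>"
    and varS: "\<And>n. (\<integral>\<^sup>+\<omega>. ennreal ((S n \<omega> - l * a n)\<^sup>2) \<partial>M) \<le> ennreal (K * a n)"
    and varN: "\<And>n. (\<integral>\<^sup>+\<omega>. ennreal ((N n \<omega> - 1 * a n)\<^sup>2) \<partial>M) \<le> ennreal (K * a n)"
  shows "AE \<omega> in M. (\<lambda>n. S n \<omega> / N n \<omega>) \<longlonglongrightarrow> l"
  using AE_square_error_tendsto[OF S a K sum varS] AE_square_error_tendsto[OF N a K sum varN]
proof eventually_elim
  case (elim \<omega>)
  then have "(\<lambda>n. (S n \<omega> / a n) / (N n \<omega> / a n)) \<longlonglongrightarrow> l / 1" by (intro tendsto_divide) auto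
  moreover have "(\<lambda>n. (S n \<omega> / a n) / (N n \<omega> / a n)) = (\<lambda>n. S n \<omega> / N n \<omega>)"
  proof
    fix n show "(S n \<omega> / a n) / (N n \<omega> / a n) = S n \<omega> / N n \<omega>" using a[of n] by simp
  qed
  ultimately show ?case by simp
qed

end


section \<open>The limit for a Poisson process with homogeneous neighbourhoods\<close>

context atomic_poisson_process begin

text \<open>
  An identity for every outcome, not just almost every one: as the probability space need not be
  complete, measurability of the average requires it.
\<close>

lemma average_clustering_eq:
  assumes \<omega>: "\<omega> \<in> space \<Omega>" and d: "\<And>x y. d x y = d y x"
  shows "average_clustering d t (\<nu> \<omega>) W =
    (if emeasure (\<nu> \<omega>) W > 0 \<and> sum_over (V \<omega>) (indicator W) \<noteq> \<top>
     then enn2real (sum_over (V \<omega>) (\<lambda>x. indicator W x *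
         linked_fraction {y. y \<noteq> x \<and> d x y \<le> t} {z. d (fst z) (snd z) \<le> t} (V \<omega> - {x}))) / enn2real
             (emeasure (\<nu> \<omega>) W)
     else 0)"
proof (cases "finite (V \<omega> \<inter> W)")
  case False
  then show ?thesis by (simp add: average_clustering_def sum_over_infinite V_def)
next
  case fin: True
  let ?lc = "local_clustering (threshold_edges d t (V \<omega>))"
  have "sum_over (V \<omega>) (\<lambda>x. indicator W x *
      linked_fraction {y. y \<noteq> x \<and> d x y \<le> t} {z. d (fst z) (snd z) \<le> t} (V \<omega> - {x})) =
     sum_over (V \<omega> \<inter> W) (\<lambda>x. ennreal (?lc x))"
    unfolding sum_over_Int[symmetric]
        by (rule sum_over_cong) (simp add: local_clustering_eq_linked_fraction[OF d])
  also have "\<dots> = (\<Sum>x\<in>V \<omega> \<inter> W. ennreal (?lc x))" by (rule sum_over_finite[OF fin])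
  also have "\<dots> = ennreal (\<Sum>x\<in>V \<omega> \<inter> W. ?lc x)" by (rule sum_ennreal) (rule local_clustering_nonneg)
  finally have "enn2real (sum_over (V \<omega>)
      (\<lambda>x. indicator W x * linked_fraction {y. y \<noteq> x \<and> d x y \<le> t} {z. d (fst z) (snd z) \<le> t}
      (V \<omega> - {x}))) =
     (\<Sum>x\<in>V \<omega> \<inter> W. ?lc x)" by (simp add: sum_nonneg local_clustering_nonneg)
  moreover have "sum_over (V \<omega>) (indicator W) \<noteq> \<top>" using sum_over_indicator[OF fin] by simp
  ultimately show ?thesis by (simp add: average_clustering_def V_def measure_def)
qed

text \<open>
  The numerator is the sum of \<open>linked_fraction\<close> over the points in \<open>E n\<close>, the denominator the sum
  of the constant \<open>1\<close>, which is local with respect to empty neighbourhoods. A point is excluded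
  from its own neighbourhood \<open>B x\<close>; as \<open>\<mu>\<close> is diffuse, this leaves all integrals unchanged.
\<close>

theorem clustering_limit:
  fixes d :: "'a \<Rightarrow> 'a \<Rightarrow> real" and E :: "nat \<Rightarrow> 'a set" and t :: real
  defines "R \<equiv> {z. d (fst z) (snd z) \<le> t}"
  defines "nbhd x \<equiv> {y. d x y \<le> t}"
  defines "Q x \<equiv> \<integral>\<^sup>+y. \<integral>\<^sup>+z. indicator (nbhd x) y * (indicator (nbhd x) z * indicator R (y, z)) \<partial>\<mu> \<partial>\<mu>"
  assumes d: "\<And>x y. d x y = d y x" and Rm: "R \<in> sets (borel \<Otimes>\<^sub>M borel)"
    and v: "\<And>x. emeasure \<mu> (nbhd x) = v" and q: "\<And>x. Q x = q"
    and E[measurable]: "\<And>n. E n \<in> sets borel" and Efin: "\<And>n. emeasure \<mu> (E n) < \<infinity>"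
    and Einf: "filterlim (\<lambda>n. measure \<mu> (E n)) at_top sequentially"
    and l: "0 \<le> l" "ennreal l = (if v = 0 \<or> v = \<infinity> then 0 else q / (v * v) *
        ennreal (1 - exp (- enn2real v) * (1 + enn2real v)))"
  shows "converges_in_probability \<Omega> (\<lambda>n \<omega>. average_clustering d t (\<nu> \<omega>) (E n)) l"
    and "(\<And>n. measure \<mu> (E n) > 0) \<Longrightarrow> (\<Sum>n. ennreal (1 / measure \<mu> (E n))) < \<infinity> \<Longrightarrow>
      (AE \<omega> in \<Omega>. (\<lambda>n. average_clustering d t (\<nu> \<omega>) (E n)) \<longlonglongrightarrow> l)"
proof -
  note [measurable] = V_measurable Rm
  note [measurable_cong] = sets_\<mu>
  define B where "B x = {y. y \<noteq> x \<and> d x y \<le> t}" for x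
  define c where "c z = linked_fraction (B (fst z)) R (snd z)" for z
  have Bm: "Measurable.pred (borel \<Otimes>\<^sub>M borel) (\<lambda>z. snd z \<in> B (fst z))"
  proof -
    have "Measurable.pred (borel \<Otimes>\<^sub>M borel) (\<lambda>z. snd z \<noteq> fst z \<and> z \<in> R)" by measurable
    then show ?thesis by (simp add: B_def R_def)
  qed
  have ballm: "nbhd x \<in> sets borel" for x
  proof -
    have "(\<lambda>y. (x, y)) \<in> measurable borel (borel \<Otimes>\<^sub>M borel)" by measurable
    from measurable_sets[OF this Rm] show ?thesis by (simp add: R_def nbhd_def vimage_def)
  qed
  have Bball: "B x = nbhd x - {x}" for x by (auto simp: B_def nbhd_def)
  have Bborel: "B x \<in> sets borel" for x unfolding Bball using ballm by auto
  have AEne: "AE y in \<mu>. y \<noteq> x" for x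
    using AE_not_in[of "{x}" \<mu>] diffuse[of x] by (simp add: null_sets_def sets_\<mu>)
  have AEind: "AE y in \<mu>. indicator (B x) y = (indicator (nbhd x) y :: ennreal)" for x
    using AEne[of x] by eventually_elim (simp add: Bball indicator_def)
  have vB: "emeasure \<mu> (B x) = v" for x
  proof -
    have "emeasure \<mu> (B x) = emeasure \<mu> (nbhd x)"
      by (rule emeasure_eq_AE) (use AEne[of x] ballm Bborel in \<open>auto simp: Bball sets_\<mu>\<close>)
    then show ?thesis using v by simp
  qed
  have qB: "(\<integral>\<^sup>+y. \<integral>\<^sup>+z. indicator (B x) y * (indicator (B x) z * indicator R (y, z)) \<partial>\<mu> \<partial>\<mu>) = q"
      for x
    unfolding q[of x, symmetric] Q_def
  proof (rule nn_integral_cong_AE, use AEind[of x] in eventually_elim)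
    case (elim y)
    show ?case unfolding elim
      by (rule nn_integral_cong_AE, use AEind[of x] in eventually_elim) simp
  qed
  have cm: "c \<in> borel_measurable (borel \<Otimes>\<^sub>M config_space)"
    unfolding c_def
  proof (rule linked_fraction_measurable[OF _ Rm])
    have "(\<lambda>z. (fst (fst z), snd z)) \<in>
        measurable ((borel \<Otimes>\<^sub>M config_space) \<Otimes>\<^sub>M borel) (borel \<Otimes>\<^sub>M borel)" by measurable
    from measurable_compose[OF this Bm]
    show "Measurable.pred ((borel \<Otimes>\<^sub>M config_space) \<Otimes>\<^sub>M borel) (\<lambda>z. snd z \<in> B (fst (fst z)))" by simp
  qed measurable
  have c1: "c z \<le> 1" for z unfolding c_def by (rule linked_fraction_le_1)
  have symB: "y \<in> B x \<longleftrightarrow> x \<in> B y" for x y using d[of x y] by (auto simp: B_def)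
  have loc: "c (x, X) = c (x, X \<inter> B x)" for x X unfolding c_def
      using linked_fraction_local[of "B x" R X] by simp
  have mean: "(\<integral>\<^sup>+\<omega>. c (x, V \<omega>) \<partial>\<Omega>) = ennreal l" for x
    using points.linked_fraction_mean[OF Bborel[of x] Rm] unfolding vB qB l(2) c_def
    by (simp add: measure_def vB)
  define a where "a n = measure \<mu> (E n)" for n
  have ea: "emeasure \<mu> (E n) = ennreal (a n)" for n
    using Efin[of n] by (simp add: a_def emeasure_eq_ennreal_measure less_top)
  have a0: "a n \<ge> 0" for n by (simp add: a_def)
  let ?S = "\<lambda>n \<omega>. sum_over (V \<omega>) (\<lambda>x. indicator (E n) x * c (x, V \<omega> - {x}))"
  let ?N = "\<lambda>n \<omega>. sum_over (V \<omega>) (indicator (E n))"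
  have Sm[measurable]: "?S n \<in> borel_measurable \<Omega>" for n
  proof -
    note [measurable] = cm
    have "(\<lambda>z. indicator (E n) (fst z) * c z) \<in> borel_measurable (borel \<Otimes>\<^sub>M config_space)"
        by measurable
    from points.mecke_lhs_measurable[OF this] show ?thesis by simp
  qed
  have Nm[measurable]: "?N n \<in> borel_measurable \<Omega>" for n by measurable
  have ES: "(\<integral>\<^sup>+\<omega>. ?S n \<omega> \<partial>\<Omega>) = ennreal l * emeasure \<mu> (E n)" for n
    by (rule points.second_moment(1)[OF cm c1 Bm symB loc mean vB E])
  have ES2: "(\<integral>\<^sup>+\<omega>. ?S n \<omega> * ?S n \<omega> \<partial>\<Omega>) \<le>
     (ennreal l * emeasure \<mu> (E n)) * (ennreal l * emeasure \<mu> (E n)) + (1 + v + 3 * v * v) *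
         emeasure \<mu> (E n)" for n
    by (rule points.second_moment(2)[OF cm c1 Bm symB loc mean vB E])
  have EN: "(\<integral>\<^sup>+\<omega>. ?N n \<omega> \<partial>\<Omega>) = emeasure \<mu> (E n)" for n
    by (rule points.expectation_count) (rule E)
  have EN2: "(\<integral>\<^sup>+\<omega>. ?N n \<omega> * ?N n \<omega> \<partial>\<Omega>) \<le> emeasure \<mu> (E n) * emeasure \<mu> (E n) + emeasure \<mu> (E n)"
      for n
    using points.second_moment(2)[of "\<lambda>_. 1" "\<lambda>_. {}" 1 0 "E n"] emeasure_space_1 by simp
  obtain K where K: "K \<ge> 1" "\<And>n. (\<integral>\<^sup>+\<omega>. ?S n \<omega> * ?S n \<omega> \<partial>\<Omega>) \<le> ennreal ((l * a n)\<^sup>2 + K * a n)"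
  proof (cases "v = \<infinity>")
    case False
    then obtain r where r: "r \<ge> 0" "v = ennreal r" by (cases v rule: ennreal_cases) auto
    let ?K = "1 + r + 3 * r * r"
    have "(\<integral>\<^sup>+\<omega>. ?S n \<omega> * ?S n \<omega> \<partial>\<Omega>) \<le> ennreal ((l * a n)\<^sup>2 + ?K * a n)" for n
    proof -
      have "(1 + v + 3 * v * v) = ennreal ?K"
        using r by (simp add: ennreal_mult ennreal_plus flip: ennreal_1 ennreal_numeral)
      then have "(ennreal l * emeasure \<mu> (E n)) * (ennreal l * emeasure \<mu> (E n)) +
          (1 + v + 3 * v * v) * emeasure \<mu> (E n)
         = ennreal ((l * a n)\<^sup>2 + ?K * a n)"
        unfolding ea using r l(1) a0[of n] by (simp add: power2_eq_square ennreal_mult ennreal_plus)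
      then show ?thesis using ES2[of n] by simp
    qed
    then show thesis using r by (intro that[of ?K]) auto
  next
    case True
    then have "ennreal l = 0" using l(2) by simp
    have "(\<integral>\<^sup>+\<omega>. ?S n \<omega> * ?S n \<omega> \<partial>\<Omega>) = 0" for n
    proof -
      have "AE \<omega> in \<Omega>. ?S n \<omega> = 0"
        using ES[of n] \<open>ennreal l = 0\<close> nn_integral_0_iff_AE[OF Sm[of n]] by simp
      then have "AE \<omega> in \<Omega>. ?S n \<omega> * ?S n \<omega> = 0" by eventually_elim simp
      then show ?thesis by (subst nn_integral_0_iff_AE) auto
    qed
    then show thesis using a0 by (intro that[of 1]) auto
  qed
  let ?Sr = "\<lambda>n \<omega>. enn2real (?S n \<omega>)" and ?Nr = "\<lambda>n \<omega>. enn2real (?N n \<omega>)"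
  have varS: "(\<integral>\<^sup>+\<omega>. ennreal ((?Sr n \<omega> - l * a n)\<^sup>2) \<partial>\<Omega>) \<le> ennreal (K * a n)" for n
    by (rule second_moment_centered[OF Sm _ _ _ K(2)])
      (use l(1) a0[of n] K(1) ES[of n] in \<open>auto simp: ea ennreal_mult\<close>)
  have varN: "(\<integral>\<^sup>+\<omega>. ennreal ((?Nr n \<omega> - 1 * a n)\<^sup>2) \<partial>\<Omega>) \<le> ennreal (K * a n)" for n
  proof (rule second_moment_centered[OF Nm])
    have "ennreal (a n) * ennreal (a n) + ennreal (a n) = ennreal ((1 * a n)\<^sup>2 + 1 * a n)"
      using a0[of n] by (simp add: power2_eq_square ennreal_mult ennreal_plus)
    also have "\<dots> \<le> ennreal ((1 * a n)\<^sup>2 + K * a n)"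
      using K(1) a0[of n] by (intro ennreal_leI add_left_mono mult_right_mono) auto
    finally show "(\<integral>\<^sup>+\<omega>. ?N n \<omega> * ?N n \<omega> \<partial>\<Omega>) \<le> ennreal ((1 * a n)\<^sup>2 + K * a n)"
      using EN2[of n] unfolding ea by (rule order_trans[rotated])
  qed (use a0[of n] K(1) EN[of n] in \<open>auto simp: ea\<close>)
  have avg: "average_clustering d t (\<nu> \<omega>) (E n) =
    (if emeasure (\<nu> \<omega>) (E n) > 0 \<and> ?N n \<omega> \<noteq> \<top> then ?Sr n \<omega> / enn2real (emeasure (\<nu> \<omega>) (E n)) else
        0)"
    if "\<omega> \<in> space \<Omega>" for n \<omega>
    using average_clustering_eq[OF that, of d t "E n", OF d] unfolding c_def B_def R_def by simp
  have avgm[measurable]: "(\<lambda>\<omega>. average_clustering d t (\<nu> \<omega>) (E n)) \<in> borel_measurable \<Omega>" for n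
  proof -
    have "(\<lambda>\<omega>. if emeasure (\<nu> \<omega>) (E n) > 0 \<and>
        ?N n \<omega> \<noteq> \<top> then ?Sr n \<omega> / enn2real (emeasure (\<nu> \<omega>) (E n)) else 0) \<in> borel_measurable \<Omega>"
      by measurable
    then show ?thesis by (subst measurable_cong[OF avg]) auto
  qed
  have "AE \<omega> in \<Omega>. ?N n \<omega> \<noteq> \<infinity>" for n
    by (rule nn_integral_noteq_infinite) (use EN[of n] in \<open>auto simp: ea\<close>)
  then have "AE \<omega> in \<Omega>. \<forall>n. ?N n \<omega> \<noteq> \<infinity>" unfolding AE_all_countable by blast
  with AE_simple AE_space
  have AEavg: "AE \<omega> in \<Omega>. \<forall>n. average_clustering d t (\<nu> \<omega>) (E n) = ?Sr n \<omega> / ?Nr n \<omega>"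
  proof eventually_elim
    case (elim \<omega>)
    have "emeasure (\<nu> \<omega>) (E n) = ?N n \<omega>" for n by (rule count_eq_sum_over[OF elim(2,1) E])
    then show ?case using elim(3) avg[OF elim(2)] by (auto simp: zero_less_iff_neq_zero)
  qed
  have Srm: "?Sr n \<in> borel_measurable \<Omega>" and Nrm: "?Nr n \<in> borel_measurable \<Omega>" for n by measurable
  have K0: "K \<ge> 0" using K(1) by simp
  show "converges_in_probability \<Omega> (\<lambda>n \<omega>. average_clustering d t (\<nu> \<omega>) (E n)) l"
    unfolding converges_in_probability_def
  proof (intro conjI allI impI)
    show "(\<lambda>\<omega>. average_clustering d t (\<nu> \<omega>) (E n)) \<in> borel_measurable \<Omega>" for n by (rule avgm)
    fix \<epsilon> :: real assume \<epsilon>: "\<epsilon> > 0"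
    have "prob {\<omega> \<in> space \<Omega>. \<bar>average_clustering d t (\<nu> \<omega>) (E n) - l\<bar> > \<epsilon>} =
        prob {\<omega> \<in> space \<Omega>. \<bar>?Sr n \<omega> / ?Nr n \<omega> - l\<bar> > \<epsilon>}" for n
    proof (rule measure_eq_AE)
      show "AE \<omega> in \<Omega>. \<omega> \<in> {\<omega> \<in> space \<Omega>. \<bar>average_clustering d t (\<nu> \<omega>) (E n) - l\<bar> > \<epsilon>} \<longleftrightarrow>
         \<omega> \<in> {\<omega> \<in> space \<Omega>. \<bar>?Sr n \<omega> / ?Nr n \<omega> - l\<bar> > \<epsilon>}"
        using AEavg by eventually_elim simp
    qed measurable
    moreover have "(\<lambda>n. prob {\<omega> \<in> space \<Omega>. \<bar>?Sr n \<omega> / ?Nr n \<omega> - l\<bar> > \<epsilon>}) \<longlonglongrightarrow> 0"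
      by (rule ratio_converges_in_probability[OF Srm Nrm Einf[folded a_def] K0 varS varN \<epsilon>])
    ultimately show "(\<lambda>n. prob {\<omega> \<in> space \<Omega>. \<bar>average_clustering d t (\<nu> \<omega>) (E n) - l\<bar> > \<epsilon>}) \<longlonglongrightarrow> 0"
      by simp
  qed
  assume "\<And>n. measure \<mu> (E n) > 0" "(\<Sum>n. ennreal (1 / measure \<mu> (E n))) < \<infinity>"
  from ratio_converges_AE[OF Srm Nrm this(1) K0 this(2), folded a_def, OF varS varN]
  show "AE \<omega> in \<Omega>. (\<lambda>n. average_clustering d t (\<nu> \<omega>) (E n)) \<longlonglongrightarrow> l"
    using AEavg by eventually_elim simp
qed

end


section \<open>Homogeneous manifolds\<close>

lemma clustering_tendency_integral:
  fixes lam :: "'a::second_countable_topology measure"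
  assumes sf: "sigma_finite_measure lam" and sets[measurable_cong]: "sets lam = sets borel"
    and B[measurable]: "B \<in> sets borel" and R[measurable]: "R \<in> sets (borel \<Otimes>\<^sub>M borel)"
    and b: "emeasure lam B \<noteq> 0" "emeasure lam B \<noteq> \<infinity>"
  shows "ennreal (measure (uniform_measure lam B \<Otimes>\<^sub>M uniform_measure lam B) R) =
    (\<integral>\<^sup>+y. \<integral>\<^sup>+z. indicator B y * (indicator B z * indicator R (y, z)) \<partial>lam \<partial>lam) /
        (emeasure lam B * emeasure lam B)"
proof -
  interpret sigma_finite_measure lam by (rule sf)
  let ?U = "uniform_measure lam B" and ?b = "emeasure lam B"
  have B': "B \<in> sets lam" by (simp add: sets)
  interpret U: prob_space ?U by (rule prob_space_uniform_measure) (use b in auto)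
  interpret UU: pair_prob_space ?U ?U ..
  have sU[measurable_cong]: "sets ?U = sets borel" by (simp add: sets)
  have RU: "R \<in> sets (?U \<Otimes>\<^sub>M ?U)" using R by (simp cong: sets_pair_measure_cong add: sU)
  have Rm[measurable]: "R \<in> sets (lam \<Otimes>\<^sub>M lam)" using R
      by (simp cong: sets_pair_measure_cong add: sets)
  have Rm2: "R \<in> sets (borel \<Otimes>\<^sub>M lam)" using R by (simp cong: sets_pair_measure_cong add: sets)
  let ?h = "\<lambda>y. \<integral>\<^sup>+z. indicator R (y, z) * indicator B z \<partial>lam"
  have hm[measurable]: "?h \<in> borel_measurable lam" by measurable
  have "emeasure (?U \<Otimes>\<^sub>M ?U) R = (\<integral>\<^sup>+y. emeasure ?U (Pair y -` R) \<partial>?U)"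
    by (rule U.emeasure_pair_measure_alt[OF RU])
  also have "\<dots> = (\<integral>\<^sup>+y. ?h y / ?b \<partial>?U)"
  proof (rule nn_integral_cong)
    fix y
    have Ry: "Pair y -` R \<in> sets borel" using sets_Pair1[OF R, of y] .
    have "emeasure ?U (Pair y -` R) = (\<integral>\<^sup>+z. indicator (Pair y -` R) z \<partial>?U)" using Ry
        by (simp add: sU)
    also have "\<dots> = (\<integral>\<^sup>+z. indicator (Pair y -` R) z * indicator B z \<partial>lam) / ?b"
      by (rule nn_integral_uniform_measure) (use Ry B' in \<open>auto simp: sets\<close>)
    finally show "emeasure ?U (Pair y -` R) = ?h y / ?b" by (simp add: indicator_def)
  qed
  also have "\<dots> = (\<integral>\<^sup>+y. ?h y / ?b * indicator B y \<partial>lam) / ?b"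
    by (rule nn_integral_uniform_measure[OF _ B']) measurable
  also have "(\<integral>\<^sup>+y. ?h y / ?b * indicator B y \<partial>lam) =
      (\<integral>\<^sup>+y. (\<integral>\<^sup>+z. indicator B y * (indicator B z * indicator R (y, z)) \<partial>lam) / ?b \<partial>lam)"
  proof (rule nn_integral_cong)
    fix y
    show "?h y / ?b * indicator B y =
        (\<integral>\<^sup>+z. indicator B y * (indicator B z * indicator R (y, z)) \<partial>lam) / ?b"
      by (simp add: indicator_def mult.commute)
  qed
  also have "\<dots> = (\<integral>\<^sup>+y. \<integral>\<^sup>+z. indicator B y * (indicator B z * indicator R (y, z)) \<partial>lam \<partial>lam) / ?b"
    by (rule nn_integral_divide) measurable
  finally show ?thesis
    using b unfolding UU.P.emeasure_eq_measure
    by (simp add: divide_ennreal_def mult.assoc ennreal_inverse_mult less_top)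
qed

context riemannian begin

lemma riemannian_cball_isometry:
  assumes f: "riemannian_isometry A g f"
  shows "f -` riemannian_cball A g (f x) r = riemannian_cball A g x r"
  unfolding riemannian_cball_def using riemannian_dist_isometry[OF f] by auto

lemma riemannian_cball_borel: "riemannian_cball A g x r \<in> sets borel"
proof -
  have "(\<lambda>y. (x, y)) \<in> measurable borel (borel \<Otimes>\<^sub>M borel)" by measurable
  from measurable_sets[OF this measurable_riemannian_dist_le[of r]]
  show ?thesis by (simp add: riemannian_cball_def vimage_def)
qed

lemma isometry_measurable:
  assumes f: "riemannian_isometry A g f"
  shows "f \<in> measurable (riemannian_volume A g) borel"
proof -
  have "continuous_on UNIV f" using f unfolding riemannian_isometry_def smooth_map_def by auto
  then show ?thesis
    using riemannian_volume(1) by (simp add: borel_measurable_continuous_onI cong: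
        measurable_cong_sets)
qed

lemma riemannian_cball_volume_homogeneous:
  assumes "homogeneous A g"
  shows "emeasure (riemannian_volume A g) (riemannian_cball A g x r) =
      emeasure (riemannian_volume A g) (riemannian_cball A g y r)"
proof -
  let ?vol = "riemannian_volume A g"
  obtain f where f: "riemannian_isometry A g f" "f x = y" using assms unfolding homogeneous_def
      by blast
  have sp: "space ?vol = UNIV" using sets_eq_imp_space_eq[OF riemannian_volume(1)] by simp
  have "emeasure ?vol (riemannian_cball A g y r) =
      emeasure (distr ?vol borel f) (riemannian_cball A g y r)"
    unfolding riemannian_volume_isometry[OF f(1)] ..
  also have "\<dots> = emeasure ?vol (f -` riemannian_cball A g (f x) r)"
    using emeasure_distr[OF isometry_measurable[OF f(1)] riemannian_cball_borel] f(2) sp by simp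
  finally show ?thesis unfolding riemannian_cball_isometry[OF f(1)] ..
qed

text \<open>
  Transform both variables by an isometry that maps \<open>x\<close> to \<open>y\<close>.
\<close>

lemma linked_pairs_volume_homogeneous:
  fixes r :: real
  assumes "homogeneous A g" and sf: "sigma_finite_measure (riemannian_volume A g)"
  defines "R \<equiv> {z :: 'a \<times> 'a. riemannian_dist A g (fst z) (snd z) \<le> r}"
  defines "Q x \<equiv> \<integral>\<^sup>+y. \<integral>\<^sup>+z. indicator (riemannian_cball A g x r) y *
      (indicator (riemannian_cball A g x r) z * indicator R (y, z))
     \<partial>riemannian_volume A g \<partial>riemannian_volume A g"
  shows "Q x = (Q y :: ennreal)"
proof -
  let ?vol = "riemannian_volume A g"
  interpret sigma_finite_measure ?vol by (rule sf)
  note [measurable_cong] = riemannian_volume(1)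
  note [measurable] = riemannian_cball_borel
  have R[measurable]: "R \<in> sets (borel \<Otimes>\<^sub>M borel)" unfolding R_def
      by (rule measurable_riemannian_dist_le)
  obtain f where f: "riemannian_isometry A g f" "f x = y" using assms(1) unfolding homogeneous_def
      by blast
  note fm[measurable] = isometry_measurable[OF f(1)]
  let ?B = "riemannian_cball A g"
  let ?F = "\<lambda>u w. indicator (?B y r) u * (indicator (?B y r) w * indicator R (u, w)) :: ennreal"
  have Rm[measurable]: "(\<lambda>w. indicator R (u, w) :: ennreal) \<in> borel_measurable borel" for u
  proof -
    have "Pair u -` R \<in> sets borel" using sets_Pair1[OF R, of u] .
    moreover have "(\<lambda>w. indicator R (u, w) :: ennreal) = indicator (Pair u -` R)"
        by (auto simp: indicator_def)
    ultimately show ?thesis by simp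
  qed
  have inner: "(\<integral>\<^sup>+w. ?F u w \<partial>?vol) = (\<integral>\<^sup>+w. ?F u (f w) \<partial>?vol)" for u
  proof -
    have "(\<integral>\<^sup>+w. ?F u w \<partial>?vol) = (\<integral>\<^sup>+w. ?F u w \<partial>distr ?vol borel f)" unfolding
        riemannian_volume_isometry[OF f(1)] ..
    also have "\<dots> = (\<integral>\<^sup>+w. ?F u (f w) \<partial>?vol)" by (rule nn_integral_distr[OF fm]) measurable
    finally show ?thesis .
  qed
  have m: "(\<lambda>u. \<integral>\<^sup>+w. ?F u w \<partial>?vol) \<in> borel_measurable borel"
  proof -
    have "R \<in> sets (borel \<Otimes>\<^sub>M ?vol)" using R
        by (simp cong: sets_pair_measure_cong add: riemannian_volume(1))
    then have [measurable]: "(\<lambda>z. indicator R (fst z, snd z) :: ennreal) \<in>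
        borel_measurable (borel \<Otimes>\<^sub>M ?vol)" by simp
    show ?thesis by measurable
  qed
  have "Q y = (\<integral>\<^sup>+u. (\<integral>\<^sup>+w. ?F u w \<partial>?vol) \<partial>distr ?vol borel f)"
    unfolding Q_def riemannian_volume_isometry[OF f(1)] ..
  also have "\<dots> = (\<integral>\<^sup>+u. (\<integral>\<^sup>+w. ?F (f u) w \<partial>?vol) \<partial>?vol)"
      by (rule nn_integral_distr[OF fm]) (use m in simp)
  also have "\<dots> = (\<integral>\<^sup>+u. \<integral>\<^sup>+w. ?F (f u) (f w) \<partial>?vol \<partial>?vol)" unfolding inner ..
  also have "\<dots> = Q x" unfolding Q_def
  proof (intro nn_integral_cong)
    fix u w
    have "f u \<in> ?B y r \<longleftrightarrow> u \<in> ?B x r" for u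
      using riemannian_cball_isometry[OF f(1), of x r] f(2) by (auto simp: vimage_def)
    moreover have "(f u, f w) \<in> R \<longleftrightarrow> (u, w) \<in> R" unfolding R_def
        using riemannian_dist_isometry[OF f(1)] by simp
    ultimately show "?F (f u) (f w) = indicator (?B x r) u *
        (indicator (?B x r) w * indicator R (u, w))"
      by (simp add: indicator_def)
  qed
  finally show ?thesis ..
qed

end

theorem proposition34:
  fixes A :: "('a::{t2_space,second_countable_topology}, 'n::{finite,wellorder}) chart set"
    and g :: "('a, 'n) metric_tensor"
    and \<Omega> :: "'w measure"
    and \<nu> :: "'w \<Rightarrow> 'a measure"
    and E :: "nat \<Rightarrow> 'a set"
    and \<delta> t :: real
    and x\<^sub>0 :: 'a
  defines "C \<equiv> \<lambda>n \<omega>. average_clustering (riemannian_dist A g) t (\<nu> \<omega>) (E n)"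
    and "L \<equiv> (1 - exp (- \<delta> * ball_volume A g x\<^sub>0 t) * (1 + \<delta> * ball_volume A g x\<^sub>0 t))
              * clustering_tendency A g x\<^sub>0 t"
  assumes "riemannian_manifold A g"
    and "connected (UNIV :: 'a set)"
    and "homogeneous A g"
    and "emeasure (riemannian_volume A g) UNIV = \<infinity>"
    and "\<delta> > 0" and "t > 0"
    and "prob_space \<Omega>"
    and "poisson_process \<Omega> (scale_measure (ennreal \<delta>) (riemannian_volume A g)) \<nu>"
    and "\<And>n. E n \<in> sets borel"
    and "\<And>n. emeasure (riemannian_volume A g) (E n) < \<infinity>"
    and "incseq E" and "(\<Union>n. E n) = UNIV"
  shows "converges_in_probability \<Omega> C L \<and>
         ((\<Sum>n. 1 / emeasure (riemannian_volume A g) (E n)) < \<infinity> \<longrightarrow>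
            (AE \<omega> in \<Omega>. (\<lambda>n. C n \<omega>) \<longlonglongrightarrow> L))"
proof -
  note hom = assms(5) and inf = assms(6) and \<delta> = assms(7) and prob = assms(9) and pois = assms(10)
    and Eb = assms(11) and Ef = assms(12) and Einc = assms(13) and Ecov = assms(14)
  interpret riemannian A g by unfold_locales (rule assms(3))
  let ?vol = "riemannian_volume A g"
  let ?d = "riemannian_dist A g" and ?B = "\<lambda>x. riemannian_cball A g x t"
  let ?R = "{z. ?d (fst z) (snd z) \<le> t}"
  define \<mu> where "\<mu> = scale_measure (ennreal \<delta>) ?vol"
  have s_vol: "sets ?vol = sets borel" by (rule riemannian_volume(1))
  have s\<mu>: "sets \<mu> = sets borel" by (simp add: \<mu>_def s_vol)
  have \<mu>: "emeasure \<mu> B = ennreal \<delta> * emeasure ?vol B" for B by (simp add: \<mu>_def)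
  have m\<mu>: "measure \<mu> B = \<delta> * measure ?vol B" for B using \<delta> by (simp add: \<mu>_def)
  have \<delta>0: "ennreal \<delta> \<noteq> 0" "ennreal \<delta> \<noteq> \<top>" using \<delta> by auto
  have sf: "sigma_finite_measure ?vol"
  proof
    show "\<exists>A. countable A \<and> A \<subseteq> sets ?vol \<and> \<Union> A = space ?vol \<and> (\<forall>a\<in>A. emeasure ?vol a \<noteq> \<infinity>)"
      using Ef Eb Ecov sets_eq_imp_space_eq[OF s_vol]
          by (intro exI[of _ "range E"]) (auto simp: s_vol less_top)
  qed
  obtain K :: "nat \<Rightarrow> 'a set" where K: "\<And>n. compact (K n)" "(\<Union>n. K n) = UNIV"
    using countable_compact_cover by metis
  define KK where "KK m = (\<Union>i\<le>m. K i)" for m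
  have KK: "compact (KK m)" for m unfolding KK_def by (intro compact_UN) (use K in auto)
  \<comment> \<open>The process has finite mass in a window for every outcome because of \<open>KK m\<close>, and the
    volume of a window is finite because of \<open>E m\<close>.\<close>
  define H where "H m = E m \<inter> KK m" for m
  have KKborel: "KK m \<in> sets borel" for m using KK compact_imp_closed by (intro borel_closed) blast
  have E_mono: "E m \<subseteq> E n" if "m \<le> n" for m n using Einc that by (simp add: incseq_def)
  have KK_mono: "KK m \<subseteq> KK n" if "m \<le> n" for m n unfolding KK_def using that by (intro UN_mono) auto
  have Hcov: "(\<Union>m. H m) = UNIV"
  proof -
    have "x \<in> (\<Union>m. H m)" for x
    proof -
      have "x \<in> (\<Union>n. E n)" "x \<in> (\<Union>n. K n)" using Ecov K(2) by auto
      then obtain i j where "x \<in> E i" "x \<in> K j" by blast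
      then have "x \<in> E (max i j)" "x \<in> KK (max i j)" using E_mono[of i "max i j"]
          by (auto simp: KK_def)
      then have "x \<in> H (max i j)" by (simp add: H_def)
      then show ?thesis by (rule UN_I[OF UNIV_I])
    qed
    then show ?thesis by (auto simp only:)
  qed
  interpret prob_space \<Omega> by (rule prob)
  interpret P: atomic_poisson_process H \<Omega> \<mu> \<nu>
  proof unfold_locales
    show "H m \<in> sets borel" for m unfolding H_def using Eb KKborel by auto
    show "incseq H" unfolding incseq_def H_def using E_mono KK_mono by blast
    show "(\<Union>m. H m) = UNIV" by (rule Hcov)
    show "sets \<mu> = sets borel" by (rule s\<mu>)
    show "emeasure \<mu> (H m) < \<infinity>" for m
    proof -
      have "emeasure ?vol (H m) \<le> emeasure ?vol (E m)"
          by (rule emeasure_mono) (auto simp: H_def s_vol Eb)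
      then have "emeasure ?vol (H m) < \<infinity>" using Ef[of m] by (rule le_less_trans)
      then show ?thesis unfolding \<mu> by (simp add: ennreal_mult_less_top)
    qed
    show "emeasure \<mu> {x} = 0" for x unfolding \<mu> by (simp add: riemannian_volume_singleton)
    show "poisson_process \<Omega> \<mu> \<nu>" unfolding \<mu>_def by (rule pois)
    fix \<omega> m assume w: "\<omega> \<in> space \<Omega>"
    have pp: "sets (\<nu> \<omega>) = sets borel" "emeasure (\<nu> \<omega>) (KK m) < \<infinity>"
      using bspec[OF conjunct1[OF conjunct1[OF
          pois[unfolded poisson_process_def point_process_def]]] w] KK[of m] by auto
    have "emeasure (\<nu> \<omega>) (H m) \<le> emeasure (\<nu> \<omega>) (KK m)"
        by (rule emeasure_mono) (auto simp: H_def pp(1) KKborel)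
    then show "emeasure (\<nu> \<omega>) (H m) < \<infinity>" using pp(2) by (rule le_less_trans)
  qed
  have Rm: "?R \<in> sets (borel \<Otimes>\<^sub>M borel)" by (rule measurable_riemannian_dist_le)
  let ?q = "\<lambda>M x. \<integral>\<^sup>+y. \<integral>\<^sup>+z. indicator (?B x) y * (indicator (?B x) z * indicator ?R (y, z)) \<partial>M \<partial>M"
  have qm: "(\<lambda>z. indicator (?B x) y * (indicator (?B x) z * indicator ?R (y, z)) :: ennreal) \<in>
      borel_measurable ?vol" for x y
  proof -
    note [measurable_cong] = s_vol
    note [measurable] = riemannian_cball_borel
    have [measurable]: "Pair y -` ?R \<in> sets borel" using sets_Pair1[OF Rm, of y] .
    have "(\<lambda>z. indicator (?B x) y * (indicator (?B x) z * indicator (Pair y -` ?R) z) :: ennreal) \<in>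
        borel_measurable ?vol"
      by measurable
    then show ?thesis by (simp add: indicator_def)
  qed
  have qm2: "(\<lambda>y. \<integral>\<^sup>+z. indicator (?B x) y *
      (indicator (?B x) z * indicator ?R (y, z)) \<partial>?vol :: ennreal) \<in> borel_measurable ?vol" for x
  proof -
    interpret S: sigma_finite_measure ?vol by (rule sf)
    note [measurable_cong] = s_vol
    note [measurable] = riemannian_cball_borel Rm
    have "?R \<in> sets (?vol \<Otimes>\<^sub>M ?vol)" using Rm by (simp cong: sets_pair_measure_cong add: s_vol)
    then have [measurable]: "(\<lambda>z. indicator ?R (fst z, snd z) :: ennreal) \<in>
        borel_measurable (?vol \<Otimes>\<^sub>M ?vol)" by simp
    show ?thesis by measurable
  qed
  have q\<mu>: "?q \<mu> x = (ennreal \<delta> * ennreal \<delta>) * ?q ?vol x" for x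
  proof -
    let ?I = "\<lambda>y. \<integral>\<^sup>+z. indicator (?B x) y *
        (indicator (?B x) z * indicator ?R (y, z)) \<partial>?vol :: ennreal"
    have "?q \<mu> x = (\<integral>\<^sup>+y. ennreal \<delta> * ?I y \<partial>\<mu>)"
      unfolding \<mu>_def by (intro nn_integral_cong nn_integral_scale_measure qm)
    also have "\<dots> = ennreal \<delta> * (\<integral>\<^sup>+y. ennreal \<delta> * ?I y \<partial>?vol)"
      unfolding \<mu>_def using qm2[of x] by (intro nn_integral_scale_measure) measurable
    also have "\<dots> = ennreal \<delta> * (ennreal \<delta> * ?q ?vol x)" unfolding nn_integral_cmult[OF qm2] ..
    finally show ?thesis by (simp only: mult.assoc)
  qed
  have vol: "emeasure ?vol (?B x) = emeasure ?vol (?B x\<^sub>0)" for x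
      by (rule riemannian_cball_volume_homogeneous[OF hom])
  have q_vol: "?q ?vol x = ?q ?vol x\<^sub>0" for x by (rule linked_pairs_volume_homogeneous[OF hom sf])
  let ?b = "emeasure ?vol (?B x\<^sub>0)"
  define v where "v = ennreal \<delta> * ?b"
  have Einf: "filterlim (\<lambda>n. measure \<mu> (E n)) at_top sequentially"
  proof -
    have "(\<lambda>n. emeasure \<mu> (E n)) \<longlonglongrightarrow> emeasure \<mu> (\<Union>n. E n)"
      by (rule Lim_emeasure_incseq[OF _ Einc]) (auto simp: s\<mu> Eb)
    then have "(\<lambda>n. emeasure \<mu> (E n)) \<longlonglongrightarrow> \<top>" unfolding Ecov \<mu> inf using \<delta>0
        by (simp add: ennreal_mult_top)
    then have *: "\<forall>l\<ge>0. \<forall>\<^sub>F n in sequentially. ennreal l < emeasure \<mu> (E n)"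
      unfolding tendsto_top_iff_ennreal .
    have ev: "\<forall>\<^sub>F n in sequentially. ennreal (max Z 0) < emeasure \<mu> (E n)" for Z
      by (rule *[rule_format]) simp
    show ?thesis
      unfolding filterlim_at_top_dense
    proof
      fix Z
      show "\<forall>\<^sub>F n in sequentially. Z < measure \<mu> (E n)"
        using ev[of Z]
      proof eventually_elim
        case (elim n)
        have "emeasure \<mu> (E n) = ennreal (measure \<mu> (E n))"
          using Ef[of n] by (intro emeasure_eq_ennreal_measure)
              (simp add: \<mu> ennreal_mult_eq_top_iff less_top)
        then have "ennreal (max Z 0) < ennreal (measure \<mu> (E n))" using elim by simp
        then have "max Z 0 < measure \<mu> (E n)" by (subst (asm) ennreal_less_iff) simp_all
        then show ?case by simp
      qed
    qed
  qed
  have bv: "ball_volume A g x\<^sub>0 t = enn2real ?b" by (simp add: ball_volume_def measure_def)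
  have ge: "0 \<le> 1 - exp (- w) * (1 + w)" if "w \<ge> 0" for w :: real
  proof -
    have "exp (- w) * (1 + w) \<le> exp (- w) * exp w"
        by (intro mult_left_mono exp_ge_add_one_self) auto
    then show ?thesis by (simp flip: exp_add)
  qed
  have L0: "0 \<le> L"
    unfolding L_def clustering_tendency_def Let_def using ge[of "\<delta> * ball_volume A g x\<^sub>0 t"] \<delta>
    by (intro mult_nonneg_nonneg) (auto simp: ball_volume_def)
  have Lv: "ennreal L = (if v = 0 \<or> v = \<infinity> then 0 else ?q \<mu> x\<^sub>0 / (v * v) *
      ennreal (1 - exp (- enn2real v) * (1 + enn2real v)))"
  proof (cases "?b = 0 \<or> ?b = \<infinity>")
    case True
    \<comment> \<open>A ball of infinite volume has \<open>ball_volume\<close> zero, as \<open>measure\<close> is real-valued.\<close>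
    then have "ball_volume A g x\<^sub>0 t = 0" unfolding bv by auto
    then have "L = 0" by (simp add: L_def)
    moreover have "v = 0 \<or> v = \<infinity>" using True \<delta>0 by (auto simp: v_def ennreal_mult_top)
    ultimately show ?thesis by auto
  next
    case False
    then have b: "?b \<noteq> 0" "?b \<noteq> \<infinity>" by auto
    have v: "v \<noteq> 0" "v \<noteq> \<infinity>" using b \<delta>0 by (auto simp: v_def ennreal_mult_eq_top_iff)
    have ev: "enn2real v = \<delta> * ball_volume A g x\<^sub>0 t" using \<delta> by (simp add: v_def bv enn2real_mult)
    have "?q \<mu> x\<^sub>0 / (v * v) = (?q ?vol x\<^sub>0 * (ennreal \<delta> * ennreal \<delta>)) /
        ((?b * ?b) * (ennreal \<delta> * ennreal \<delta>))"
      unfolding q\<mu> v_def by (simp add: mult_ac)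
    also have "\<dots> = ?q ?vol x\<^sub>0 / (?b * ?b)"
      using \<delta>0 by (intro divide_mult_eq) (auto simp: ennreal_mult_eq_top_iff)
    also have "\<dots> = ennreal (clustering_tendency A g x\<^sub>0 t)"
      unfolding clustering_tendency_def Let_def
      by (rule clustering_tendency_integral[OF sf s_vol riemannian_cball_borel Rm b, symmetric])
    finally have p: "?q \<mu> x\<^sub>0 / (v * v) = ennreal (clustering_tendency A g x\<^sub>0 t)" .
    have "ennreal L = ennreal (clustering_tendency A g x\<^sub>0 t) *
        ennreal (1 - exp (- enn2real v) * (1 + enn2real v))"
      unfolding L_def ev using ge[of "\<delta> * ball_volume A g x\<^sub>0 t"] \<delta>
      by (subst ennreal_mult[symmetric])
          (auto simp: clustering_tendency_def Let_def ball_volume_def mult.commute)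
    then show ?thesis using v p by simp
  qed
  have Ef\<mu>: "emeasure \<mu> (E n) < \<infinity>" for n unfolding \<mu> using Ef[of n]
      by (simp add: ennreal_mult_less_top)
  have v\<mu>: "emeasure \<mu> {y. ?d x y \<le> t} = v" for x
    using vol[of x] unfolding \<mu> v_def riemannian_cball_def by simp
  have qx: "?q \<mu> x = ?q \<mu> x\<^sub>0" for x unfolding q\<mu> q_vol[of x] ..
  note lim = P.clustering_limit[OF riemannian_dist_sym Rm v\<mu> qx[unfolded riemannian_cball_def] Eb
      Ef\<mu> Einf L0
      Lv[unfolded riemannian_cball_def]]
  show ?thesis
  proof (intro conjI impI)
    show "converges_in_probability \<Omega> C L" unfolding C_def by (rule lim(1))
    assume sum: "(\<Sum>n. 1 / emeasure ?vol (E n)) < \<infinity>"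
    \<comment> \<open>In \<open>ennreal\<close>, \<open>1 / 0 = \<infinity>\<close>.\<close>
    have "emeasure ?vol (E n) \<noteq> 0" for n
    proof
      assume "emeasure ?vol (E n) = 0"
      then have "1 / emeasure ?vol (E n) = \<top>" by simp
      moreover have "1 / emeasure ?vol (E n) \<le> (\<Sum>n. 1 / emeasure ?vol (E n))"
        using sum_le_suminf[of "\<lambda>n. 1 / emeasure ?vol (E n)" "{n}"] by simp
      ultimately show False using sum by simp
    qed
    then have pos: "measure ?vol (E n) > 0" for n
      using Ef[of n] by (simp add: measure_def enn2real_positive_iff zero_less_iff_neq_zero)
    then have pos\<mu>: "measure \<mu> (E n) > 0" for n using \<delta> by (simp add: m\<mu>)
    have recip: "ennreal (1 / measure \<mu> (E n)) = ennreal (1 / \<delta>) * (1 / emeasure ?vol (E n))" for n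
    proof -
      have "emeasure ?vol (E n) = ennreal (measure ?vol (E n))"
        using Ef[of n] by (simp add: emeasure_eq_ennreal_measure less_top)
      then have "1 / emeasure ?vol (E n) = ennreal (1 / measure ?vol (E n))"
        using pos[of n] divide_ennreal[of 1 "measure ?vol (E n)"] by simp
      then show ?thesis using \<delta> pos[of n] by (simp add: m\<mu> ennreal_mult[symmetric])
    qed
    have "(\<Sum>n. ennreal (1 / measure \<mu> (E n))) = ennreal (1 / \<delta>) * (\<Sum>n. 1 / emeasure ?vol (E n))"
      unfolding recip by (rule ennreal_suminf_cmult)
    also have "\<dots> < \<infinity>" using sum by (simp add: ennreal_mult_less_top)
    finally have sum\<mu>: "(\<Sum>n. ennreal (1 / measure \<mu> (E n))) < \<infinity>" .
    show "AE \<omega> in \<Omega>. (\<lambda>n. C n \<omega>) \<longlonglongrightarrow> L" unfolding C_def by (rule lim(2)[OF pos\<mu> sum\<mu>])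
  qed
qed

end
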